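(* Let $Y$ be a special numerical space and $X$ a numerical space (both with base points). Then the forgetful functor $F$ induces a bijection $$\mathrm{Hom}(X,Y)/(\text{numerical homotopy})\;\longrightarrow\;\mathrm{Hom}(F(X),F(Y))/(\text{homotopy}),$$ where $\mathrm{Hom}(-,-)$ means based maps (in $s(\mathrm{Num})$ on the left, of simplicial sets on the right) and homotopies are based.
   Context: **Numerical functions.** A function $\mathbb Z^m\to\mathbb Z^n$ is numerical if it can be expressed by polynomials with rational coefficients; a function $M\to N$ between free abelian groups of finite rank is numerical if it becomes so after one (hence any) choice of bases. $\mathrm{Num}$ is the category of finitely generated free abelian groups with numerical functions as morphisms; it has finite products and final object $*=0$. $s(\mathrm{Num})$ is the category of simplicial objects in $\mathrm{Num}$, and $F$ denotes the forgetful functor $\mathrm{Num}\to\mathrm{Sets}$ and the induced functor from $s(\mathrm{Num})$ to simplicial sets. A base point of $X\in s(\mathrm{Num})$ is a morphism $*\to X$. **Numerical cohomology.** For $X\in s(\mathrm{Num})$, $H^*_{\mathrm{Num}}(X,\mathbb Z)$ is the cohomology of the normalised cochain complex of the cosimplicial abelian group $n\mapsto \mathrm{Hom}_{\mathrm{Num}}(X_n,\mathbb Z)$. A numerical space is an $X\in s(\mathrm{Num})$ with $F(X)$ connected such that the natural map $H^*_{\mathrm{Num}}(X,\mathbb Z)\to H^*(F(X),\mathbb Z)$ is an isomorphism and the groups $H_*(F(X),\mathbb Z)$ are finitely generated in each degree. **Numerical homotopy.** A numerical homotopy between $f,g\colon X\to Y$ in $s(\mathrm{Num})$ is a family of numerical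 functions $h_i\colon X_q\to Y_{q+1}$ ($0\le i\le q$) satisfying the standard identities of a simplicial homotopy from $f$ to $g$ (based: constant on the base point). **PTCP.** If $B\in s(\mathrm{Num})$ and $G$ is a group object of $s(\mathrm{Num})$, a principal twisted cartesian product (PTCP) over $B$ with fibre (structure group) $G$ is an $E\in s(\mathrm{Num})$ with $E_n=G_n\times B_n$, $\partial_i(g,b)=(\partial_i g,\partial_i b)$ for $i>0$, $\partial_0(g,b)=(\tau(b)\cdot\partial_0 g,\partial_0 b)$, $s_i(g,b)=(s_ig,s_ib)$, where $\tau\colon B_q\to G_{q-1}$ are morphisms in $\mathrm{Num}$ satisfying the usual twisting function identities: $\partial_i\tau(b)=\tau(\partial_{i+1}b)$ for $i>0$, $\partial_0\tau(b)=\tau(\partial_0b)^{-1}\tau(\partial_1b)$, $s_i\tau(b)=\tau(s_{i+1}b)$, $\tau(s_0b)=e$. **Special numerical spaces.** For a non-negatively graded chain complex $M$ of finitely generated free abelian groups, $\Gamma(M)$ is the simplicial abelian group associated to it by the Dold–Kan correspondence, viewed as a group object of $s(\mathrm{Num})$. A fibred numerical space is a connected $X\in s(\mathrm{Num})$ which is the inverse limit of a tower $\cdots\to X^{n+1}\to X^n\to\cdots\to X^0=*$ in $s(\mathrm{Num})$ such that $X^n_0$ is a point for all $n$; for every $j$ there is $N$ with $X^{n+1}_j\to X^n_j$ an isomorphism for all $n\ge N$; and each $X^{n+1}\to X^n$ is a PTCP in $\mathrm{Num}$ with fibre $\Gamma(M^n)$ for some non-negatively graded chain complex $M^n$ of finitely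 generated free abelian groups. Write $\pi_k(X)=\pi_k(F(X))$, $\pi_k^0(X)=\pi_k(X)$ and $\pi_k^{i+1}(X)=\langle \gamma(x)x^{-1}: x\in\pi_k^i(X),\gamma\in\pi_1(X)\rangle$. The fibred numerical space is special if for each $n$ there are integers $h_n,i_n$ with $H_i(M^n)=0$ for $i\neq h_n$ and $H_{h_n}(M^n)=\pi^{i_n}_{h_n}(X)/\pi^{i_n+1}_{h_n}(X)$. *)

theory Defs
  imports "HOL-Algebra.Free_Abelian_Groups" "HOL-Algebra.Generated_Groups"
begin

section \<open>The category Num\<close>

definition fg_free_abelian :: "('a, 'x) monoid_scheme \<Rightarrow> bool" where
  "fg_free_abelian A \<longleftrightarrow>
     comm_group A \<and> (\<exists>m. A \<cong> free_Abelian_group {..<m::nat})"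

text \<open>
  A polynomial with rational coefficients in variables indexed by the naturals is an element of
  \<^typ>\<open>(nat \<Rightarrow>\<^sub>0 nat) \<Rightarrow>\<^sub>0 rat\<close>, a finite rational combination of monomials.
\<close>

definition poly_vars :: "((nat \<Rightarrow>\<^sub>0 nat) \<Rightarrow>\<^sub>0 rat) \<Rightarrow> nat set" where
  "poly_vars p = (\<Union>t\<in>Poly_Mapping.keys p. Poly_Mapping.keys t)"

definition poly_eval :: "((nat \<Rightarrow>\<^sub>0 nat) \<Rightarrow>\<^sub>0 rat) \<Rightarrow> (nat \<Rightarrow> rat) \<Rightarrow> rat" where
  "poly_eval p v =
     (\<Sum>t\<in>Poly_Mapping.keys p. Poly_Mapping.lookup p t *
        (\<Prod>i\<in>Poly_Mapping.keys t. v i ^ Poly_Mapping.lookup t i))"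

text \<open>
  Bases are given by isomorphisms \<open>\<phi>\<close>, \<open>\<psi>\<close> with standard free abelian groups.  Values outside
  the carrier of the source are unconstrained.
\<close>

definition numerical ::
    "('a, 'x) monoid_scheme \<Rightarrow> ('b, 'y) monoid_scheme \<Rightarrow> ('a \<Rightarrow> 'b) \<Rightarrow> bool" where
  "numerical A B f \<longleftrightarrow> f \<in> carrier A \<rightarrow> carrier B \<and>
     (\<exists>m n \<phi> \<psi>. \<phi> \<in> iso A (free_Abelian_group {..<m::nat}) \<and>
        \<psi> \<in> iso B (free_Abelian_group {..<n::nat}) \<and>
        (\<forall>j<n. \<exists>p. poly_vars p \<subseteq> {..<m} \<and>
           (\<forall>x\<in>carrier A. of_int (Poly_Mapping.lookup (\<psi> (f x)) j) =
              poly_eval p (\<lambda>i. of_int (Poly_Mapping.lookup (\<phi> x) i)))))"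

definition num_iso ::
    "('a, 'x) monoid_scheme \<Rightarrow> ('b, 'y) monoid_scheme \<Rightarrow> ('a \<Rightarrow> 'b) \<Rightarrow> bool" where
  "num_iso A B f \<longleftrightarrow> numerical A B f \<and>
     (\<exists>g. numerical B A g \<and> (\<forall>x\<in>carrier A. g (f x) = x) \<and> (\<forall>y\<in>carrier B. f (g y) = y))"


section \<open>Simplicial sets and simplicial objects in Num\<close>

text \<open>
  \<open>face K n i\<close> and \<open>degen K n i\<close> are the operators with source \<open>simp K n\<close>.
\<close>

record 'a sset =
  simp :: "nat \<Rightarrow> 'a set"
  face :: "nat \<Rightarrow> nat \<Rightarrow> 'a \<Rightarrow> 'a"
  degen :: "nat \<Rightarrow> nat \<Rightarrow> 'a \<Rightarrow> 'a"

definition is_sset :: "'a sset \<Rightarrow> bool" where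
  "is_sset K \<longleftrightarrow>
     (\<forall>n. \<forall>i\<le>Suc n. face K (Suc n) i \<in> simp K (Suc n) \<rightarrow> simp K n) \<and>
     (\<forall>n. \<forall>i\<le>n. degen K n i \<in> simp K n \<rightarrow> simp K (Suc n)) \<and>
     (\<forall>n. \<forall>x\<in>simp K (Suc (Suc n)). \<forall>i j. i < j \<and> j \<le> Suc (Suc n) \<longrightarrow>
        face K (Suc n) i (face K (Suc (Suc n)) j x) =
        face K (Suc n) (j - 1) (face K (Suc (Suc n)) i x)) \<and>
     (\<forall>n. \<forall>x\<in>simp K n. \<forall>i j. i \<le> j \<and> j \<le> n \<longrightarrow>
        degen K (Suc n) i (degen K n j x) = degen K (Suc n) (Suc j) (degen K n i x)) \<and>
     (\<forall>n. \<forall>x\<in>simp K n. \<forall>i j. i \<le> Suc n \<and> j \<le> n \<longrightarrow>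
        face K (Suc n) i (degen K n j x) =
          (if i < j then degen K (n - 1) (j - 1) (face K n i x)
           else if i = j \<or> i = Suc j then x
           else degen K (n - 1) j (face K n (i - 1) x)))"

record 'a snum =
  obj :: "nat \<Rightarrow> 'a monoid"
  nface :: "nat \<Rightarrow> nat \<Rightarrow> 'a \<Rightarrow> 'a"
  ndegen :: "nat \<Rightarrow> nat \<Rightarrow> 'a \<Rightarrow> 'a"

definition forget :: "'a snum \<Rightarrow> 'a sset" where
  "forget X = \<lparr>simp = (\<lambda>n. carrier (obj X n)), face = nface X, degen = ndegen X\<rparr>"

definition is_snum :: "'a snum \<Rightarrow> bool" where
  "is_snum X \<longleftrightarrow> is_sset (forget X) \<and> (\<forall>n. fg_free_abelian (obj X n)) \<and>
     (\<forall>n. \<forall>i\<le>Suc n. numerical (obj X (Suc n)) (obj X n) (nface X (Suc n) i)) \<and>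
     (\<forall>n. \<forall>i\<le>n. numerical (obj X n) (obj X (Suc n)) (ndegen X n i))"

text \<open>Maps are extensional, so that equality of maps is equality in the logic.\<close>

definition smaps :: "'a sset \<Rightarrow> 'b sset \<Rightarrow> (nat \<Rightarrow> 'a \<Rightarrow> 'b) set" where
  "smaps K L = {f. (\<forall>n. f n \<in> simp K n \<rightarrow>\<^sub>E simp L n) \<and>
     (\<forall>n. \<forall>i\<le>Suc n. \<forall>x\<in>simp K (Suc n). f n (face K (Suc n) i x) = face L (Suc n) i (f (Suc n) x)) \<and>
     (\<forall>n. \<forall>i\<le>n. \<forall>x\<in>simp K n. f (Suc n) (degen K n i x) = degen L n i (f n x))}"

definition nmaps :: "'a snum \<Rightarrow> 'b snum \<Rightarrow> (nat \<Rightarrow> 'a \<Rightarrow> 'b) set" where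
  "nmaps X Y = {f \<in> smaps (forget X) (forget Y). \<forall>n. numerical (obj X n) (obj Y n) (f n)}"

definition nmap_id :: "'a snum \<Rightarrow> nat \<Rightarrow> 'a \<Rightarrow> 'a" where
  "nmap_id X n = (\<lambda>x\<in>carrier (obj X n). x)"

definition nmap_comp ::
    "'a snum \<Rightarrow> (nat \<Rightarrow> 'b \<Rightarrow> 'c) \<Rightarrow> (nat \<Rightarrow> 'a \<Rightarrow> 'b) \<Rightarrow> nat \<Rightarrow> 'a \<Rightarrow> 'c" where
  "nmap_comp X g f n = compose (carrier (obj X n)) (g n) (f n)"

definition snum_iso :: "'a snum \<Rightarrow> 'b snum \<Rightarrow> (nat \<Rightarrow> 'a \<Rightarrow> 'b) \<Rightarrow> bool" where
  "snum_iso X Y f \<longleftrightarrow> f \<in> nmaps X Y \<and>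
     (\<exists>g\<in>nmaps Y X. nmap_comp X g f = nmap_id X \<and> nmap_comp Y f g = nmap_id Y)"

text \<open>
  A simplicial map from the point, given by the image \<open>b n\<close> of its unique \<open>n\<close>-simplex.  All maps
  from a one-point group are numerical, so base points of \<open>X\<close> and of \<open>forget X\<close> agree.
\<close>

definition base_point :: "'a sset \<Rightarrow> (nat \<Rightarrow> 'a) \<Rightarrow> bool" where
  "base_point K b \<longleftrightarrow> (\<forall>n. b n \<in> simp K n) \<and>
     (\<forall>n. \<forall>i\<le>Suc n. face K (Suc n) i (b (Suc n)) = b n) \<and>
     (\<forall>n. \<forall>i\<le>n. degen K n i (b n) = b (Suc n))"

definition based_smaps ::
    "'a sset \<Rightarrow> (nat \<Rightarrow> 'a) \<Rightarrow> 'b sset \<Rightarrow> (nat \<Rightarrow> 'b) \<Rightarrow> (nat \<Rightarrow> 'a \<Rightarrow> 'b) set" where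
  "based_smaps K b L c = {f \<in> smaps K L. \<forall>n. f n (b n) = c n}"

definition based_nmaps ::
    "'a snum \<Rightarrow> (nat \<Rightarrow> 'a) \<Rightarrow> 'b snum \<Rightarrow> (nat \<Rightarrow> 'b) \<Rightarrow> (nat \<Rightarrow> 'a \<Rightarrow> 'b) set" where
  "based_nmaps X b Y c = {f \<in> nmaps X Y. \<forall>n. f n (b n) = c n}"

text \<open>The action of \<open>forget\<close> on morphisms: the same functions, no longer known to be numerical.\<close>

definition forget_map :: "(nat \<Rightarrow> 'a \<Rightarrow> 'b) \<Rightarrow> (nat \<Rightarrow> 'a \<Rightarrow> 'b)" where
  "forget_map f = f"


section \<open>Homotopies\<close>

text \<open>\<open>h q i\<close> is the function \<open>h\<^sub>i\<close> from \<open>q\<close>-simplices to \<open>(q+1)\<close>-simplices.\<close>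

definition simplicial_homotopy ::
    "'a sset \<Rightarrow> 'b sset \<Rightarrow> (nat \<Rightarrow> 'a \<Rightarrow> 'b) \<Rightarrow> (nat \<Rightarrow> 'a \<Rightarrow> 'b) \<Rightarrow>
     (nat \<Rightarrow> nat \<Rightarrow> 'a \<Rightarrow> 'b) \<Rightarrow> bool" where
  "simplicial_homotopy K L f g h \<longleftrightarrow>
     (\<forall>q. \<forall>i\<le>q. h q i \<in> simp K q \<rightarrow> simp L (Suc q)) \<and>
     (\<forall>q. \<forall>x\<in>simp K q.
        face L (Suc q) 0 (h q 0 x) = f q x \<and>
        face L (Suc q) (Suc q) (h q q x) = g q x \<and>
        (\<forall>i j. i < j \<and> j \<le> q \<longrightarrow>
           face L (Suc q) i (h q j x) = h (q - 1) (j - 1) (face K q i x)) \<and>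
        (\<forall>j<q. face L (Suc q) (Suc j) (h q (Suc j) x) = face L (Suc q) (Suc j) (h q j x)) \<and>
        (\<forall>i j. Suc j < i \<and> i \<le> Suc q \<longrightarrow>
           face L (Suc q) i (h q j x) = h (q - 1) j (face K q (i - 1) x)) \<and>
        (\<forall>i j. i \<le> j \<and> j \<le> q \<longrightarrow>
           degen L (Suc q) i (h q j x) = h (Suc q) (Suc j) (degen K q i x)) \<and>
        (\<forall>i j. j < i \<and> i \<le> Suc q \<longrightarrow>
           degen L (Suc q) i (h q j x) = h (Suc q) j (degen K q (i - 1) x)))"

definition based_homotopic ::
    "'a sset \<Rightarrow> (nat \<Rightarrow> 'a) \<Rightarrow> 'b sset \<Rightarrow> (nat \<Rightarrow> 'b) \<Rightarrow>
     (nat \<Rightarrow> 'a \<Rightarrow> 'b) \<Rightarrow> (nat \<Rightarrow> 'a \<Rightarrow> 'b) \<Rightarrow> bool" where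
  "based_homotopic K b L c f g \<longleftrightarrow>
     f \<in> based_smaps K b L c \<and> g \<in> based_smaps K b L c \<and>
     (\<exists>h. simplicial_homotopy K L f g h \<and> (\<forall>q. \<forall>i\<le>q. h q i (b q) = c (Suc q)))"

definition based_num_homotopic ::
    "'a snum \<Rightarrow> (nat \<Rightarrow> 'a) \<Rightarrow> 'b snum \<Rightarrow> (nat \<Rightarrow> 'b) \<Rightarrow>
     (nat \<Rightarrow> 'a \<Rightarrow> 'b) \<Rightarrow> (nat \<Rightarrow> 'a \<Rightarrow> 'b) \<Rightarrow> bool" where
  "based_num_homotopic X b Y c f g \<longleftrightarrow>
     f \<in> based_nmaps X b Y c \<and> g \<in> based_nmaps X b Y c \<and>
     (\<exists>h. simplicial_homotopy (forget X) (forget Y) f g h \<and>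
        (\<forall>q. \<forall>i\<le>q. numerical (obj X q) (obj Y (Suc q)) (h q i)) \<and>
        (\<forall>q. \<forall>i\<le>q. h q i (b q) = c (Suc q)))"

text \<open>
  Simplicial homotopy is not an equivalence relation for arbitrary source and target; as usual
  the quotient by homotopy is the quotient by the equivalence relation it generates.
\<close>

definition htpy_rel ::
    "'a sset \<Rightarrow> (nat \<Rightarrow> 'a) \<Rightarrow> 'b sset \<Rightarrow> (nat \<Rightarrow> 'b) \<Rightarrow>
     ((nat \<Rightarrow> 'a \<Rightarrow> 'b) \<times> (nat \<Rightarrow> 'a \<Rightarrow> 'b)) set" where
  "htpy_rel K b L c = {(f, g). f \<in> based_smaps K b L c \<and> g \<in> based_smaps K b L c \<and>
     equivclp (based_homotopic K b L c) f g}"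

definition num_htpy_rel ::
    "'a snum \<Rightarrow> (nat \<Rightarrow> 'a) \<Rightarrow> 'b snum \<Rightarrow> (nat \<Rightarrow> 'b) \<Rightarrow>
     ((nat \<Rightarrow> 'a \<Rightarrow> 'b) \<times> (nat \<Rightarrow> 'a \<Rightarrow> 'b)) set" where
  "num_htpy_rel X b Y c = {(f, g). f \<in> based_nmaps X b Y c \<and> g \<in> based_nmaps X b Y c \<and>
     equivclp (based_num_homotopic X b Y c) f g}"


section \<open>Homology and cohomology\<close>

definition fin_gen_group :: "('a, 'x) monoid_scheme \<Rightarrow> bool" where
  "fin_gen_group A \<longleftrightarrow> (\<exists>S. finite S \<and> S \<subseteq> carrier A \<and> generate A S = carrier A)"

text \<open>
  In a chain complex \<open>(C, d)\<close> the differential \<open>d n\<close> goes from \<open>C (n+1)\<close> to \<open>C n\<close>; in a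
  cochain complex it goes from \<open>C n\<close> to \<open>C (n+1)\<close>.
\<close>

definition chain_cycles ::
    "(nat \<Rightarrow> 'a monoid) \<Rightarrow> (nat \<Rightarrow> 'a \<Rightarrow> 'a) \<Rightarrow> nat \<Rightarrow> 'a set" where
  "chain_cycles C d n =
     (case n of 0 \<Rightarrow> carrier (C 0) | Suc k \<Rightarrow> kernel (C (Suc k)) (C k) (d k))"

definition chain_homology ::
    "(nat \<Rightarrow> 'a monoid) \<Rightarrow> (nat \<Rightarrow> 'a \<Rightarrow> 'a) \<Rightarrow> nat \<Rightarrow> 'a set monoid" where
  "chain_homology C d n =
     (C n)\<lparr>carrier := chain_cycles C d n\<rparr> Mod (d n ` carrier (C (Suc n)))"

definition coboundaries ::
    "(nat \<Rightarrow> 'a monoid) \<Rightarrow> (nat \<Rightarrow> 'a \<Rightarrow> 'a) \<Rightarrow> nat \<Rightarrow> 'a set" where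
  "coboundaries C d n =
     (case n of 0 \<Rightarrow> {\<one>\<^bsub>C 0\<^esub>} | Suc k \<Rightarrow> d k ` carrier (C k))"

definition cochain_cohomology ::
    "(nat \<Rightarrow> 'a monoid) \<Rightarrow> (nat \<Rightarrow> 'a \<Rightarrow> 'a) \<Rightarrow> nat \<Rightarrow> 'a set monoid" where
  "cochain_cohomology C d n =
     (C n)\<lparr>carrier := kernel (C n) (C (Suc n)) (d n)\<rparr> Mod coboundaries C d n"

definition sset_boundary :: "'a sset \<Rightarrow> nat \<Rightarrow> ('a \<Rightarrow>\<^sub>0 int) \<Rightarrow> ('a \<Rightarrow>\<^sub>0 int)" where
  "sset_boundary K n =
     frag_extend (\<lambda>x. \<Sum>i\<le>Suc n. frag_cmul ((-1) ^ i) (frag_of (face K (Suc n) i x)))"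

definition sset_homology :: "'a sset \<Rightarrow> nat \<Rightarrow> ('a \<Rightarrow>\<^sub>0 int) set monoid" where
  "sset_homology K =
     chain_homology (\<lambda>n. free_Abelian_group (simp K n)) (sset_boundary K)"

text \<open>
  \<open>norm_cochains K P n\<close> is the group of those \<open>c\<close> from \<open>n\<close>-simplices to the integers satisfying
  \<open>P n c\<close> that are killed by all codegeneracies \<open>c \<mapsto> c \<circ> s\<^sub>i\<close>; that is, the normalised cochains of
  the cosimplicial abelian group cut out by \<open>P\<close>.
\<close>

definition norm_cochains ::
    "'a sset \<Rightarrow> (nat \<Rightarrow> ('a \<Rightarrow> int) \<Rightarrow> bool) \<Rightarrow> nat \<Rightarrow> ('a \<Rightarrow> int) monoid" where
  "norm_cochains K P n = (product_group (simp K n) (\<lambda>_. integer_group))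
     \<lparr>carrier := {c \<in> simp K n \<rightarrow>\<^sub>E UNIV. P n c \<and>
        (\<forall>m i. n = Suc m \<and> i \<le> m \<longrightarrow> (\<forall>x\<in>simp K m. c (degen K m i x) = 0))}\<rparr>"

definition sset_coboundary :: "'a sset \<Rightarrow> nat \<Rightarrow> ('a \<Rightarrow> int) \<Rightarrow> ('a \<Rightarrow> int)" where
  "sset_coboundary K n c =
     (\<lambda>x\<in>simp K (Suc n). \<Sum>i\<le>Suc n. (-1) ^ i * c (face K (Suc n) i x))"

definition set_cochains :: "'a sset \<Rightarrow> nat \<Rightarrow> ('a \<Rightarrow> int) monoid" where
  "set_cochains K = norm_cochains K (\<lambda>_ _. True)"

definition num_cochains :: "'a snum \<Rightarrow> nat \<Rightarrow> ('a \<Rightarrow> int) monoid" where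
  "num_cochains X = norm_cochains (forget X) (\<lambda>n. numerical (obj X n) integer_group)"

definition sset_cohomology :: "'a sset \<Rightarrow> nat \<Rightarrow> ('a \<Rightarrow> int) set monoid" where
  "sset_cohomology K = cochain_cohomology (set_cochains K) (sset_coboundary K)"

definition num_cohomology :: "'a snum \<Rightarrow> nat \<Rightarrow> ('a \<Rightarrow> int) set monoid" where
  "num_cohomology X = cochain_cohomology (num_cochains X) (sset_coboundary (forget X))"

text \<open>
  Adding all coboundaries to the class of a numerical cocycle gives its class among all cocycles.
\<close>

definition cohomology_comparison ::
    "'a snum \<Rightarrow> nat \<Rightarrow> ('a \<Rightarrow> int) set \<Rightarrow> ('a \<Rightarrow> int) set" where
  "cohomology_comparison X n u =
     coboundaries (set_cochains (forget X)) (sset_coboundary (forget X)) n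
       <#>\<^bsub>set_cochains (forget X) n\<^esub> u"

definition sset_connected :: "'a sset \<Rightarrow> bool" where
  "sset_connected K \<longleftrightarrow> simp K 0 \<noteq> {} \<and>
     (\<forall>x\<in>simp K 0. \<forall>y\<in>simp K 0.
        equivclp (\<lambda>u v. \<exists>e\<in>simp K 1. u = face K 1 1 e \<and> v = face K 1 0 e) x y)"

definition numerical_space :: "'a snum \<Rightarrow> bool" where
  "numerical_space X \<longleftrightarrow> is_snum X \<and> sset_connected (forget X) \<and>
     (\<forall>n. cohomology_comparison X n \<in> iso (num_cohomology X n) (sset_cohomology (forget X) n)) \<and>
     (\<forall>n. fin_gen_group (sset_homology (forget X) n))"


section \<open>Homotopy groups and the action of the fundamental group\<close>

text \<open>
  The combinatorial homotopy groups in degrees \<open>n \<ge> 1\<close>.  They are meaningful for Kan complexes;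
  this is the case for the underlying simplicial sets of fibred numerical spaces, to which they
  are applied.
\<close>

definition spheres :: "'a sset \<Rightarrow> (nat \<Rightarrow> 'a) \<Rightarrow> nat \<Rightarrow> 'a set" where
  "spheres K b n = {x \<in> simp K n. \<forall>i\<le>n. face K n i x = b (n - 1)}"

definition sphere_rel :: "'a sset \<Rightarrow> (nat \<Rightarrow> 'a) \<Rightarrow> nat \<Rightarrow> ('a \<times> 'a) set" where
  "sphere_rel K b n = {(x, y). x \<in> spheres K b n \<and> y \<in> spheres K b n \<and>
     (\<exists>w\<in>simp K (Suc n). face K (Suc n) n w = x \<and> face K (Suc n) (Suc n) w = y \<and>
        (\<forall>i<n. face K (Suc n) i w = b n))}"

definition homotopy_group :: "'a sset \<Rightarrow> (nat \<Rightarrow> 'a) \<Rightarrow> nat \<Rightarrow> 'a set monoid" where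
  "homotopy_group K b n =
     \<lparr>carrier = spheres K b n // sphere_rel K b n,
      mult = (\<lambda>A B. sphere_rel K b n `` {face K (Suc n) n z | z.
        z \<in> simp K (Suc n) \<and> face K (Suc n) (n - 1) z \<in> A \<and> face K (Suc n) (Suc n) z \<in> B \<and>
        (\<forall>i<n - 1. face K (Suc n) i z = b n)}),
      one = sphere_rel K b n `` {b n}\<rparr>"

primrec degen_iter :: "'a sset \<Rightarrow> nat \<Rightarrow> nat \<Rightarrow> nat \<Rightarrow> 'a \<Rightarrow> 'a" where
  "degen_iter K m i 0 x = x"
| "degen_iter K m i (Suc k) x = degen K (m + k) i (degen_iter K m i k x)"

text \<open>
  The pull-back of the 1-simplex \<open>g\<close> along the monotone map \<open>[n] \<rightarrow> [1]\<close> sending \<open>0,\<dots>,j\<close> to 0 and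
  \<open>j+1,\<dots>,n\<close> to 1.  For fixed \<open>n\<close> and \<open>j < n\<close> these are the simplices of the homotopy on an
  \<open>(n-1)\<close>-simplex that moves all its points along \<open>g\<close>.
\<close>

definition path_prism :: "'a sset \<Rightarrow> nat \<Rightarrow> nat \<Rightarrow> 'a \<Rightarrow> 'a" where
  "path_prism K n j g = degen_iter K (n - j) 0 j (degen_iter K 1 1 (n - 1 - j) g)"

text \<open>
  \<open>y\<close> is a result of letting the loop \<open>g\<close> act on \<open>x\<close>: there is a homotopy from \<open>y\<close> to \<open>x\<close>
  (simplices \<open>h 0,\<dots>,h n\<close> of a prism) which on the boundary moves along \<open>g\<close>.  For \<open>n = 1\<close> this is
  \<open>y g = g x\<close>, so that the action is by conjugation.
\<close>

definition loop_acts :: "'a sset \<Rightarrow> (nat \<Rightarrow> 'a) \<Rightarrow> nat \<Rightarrow> 'a \<Rightarrow> 'a \<Rightarrow> 'a \<Rightarrow> bool" where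
  "loop_acts K b n g x y \<longleftrightarrow> g \<in> spheres K b 1 \<and> x \<in> spheres K b n \<and> y \<in> spheres K b n \<and>
     (\<exists>h. (\<forall>j\<le>n. h j \<in> simp K (Suc n)) \<and>
        face K (Suc n) 0 (h 0) = y \<and> face K (Suc n) (Suc n) (h n) = x \<and>
        (\<forall>j<n. face K (Suc n) (Suc j) (h (Suc j)) = face K (Suc n) (Suc j) (h j)) \<and>
        (\<forall>i j. i < j \<and> j \<le> n \<longrightarrow> face K (Suc n) i (h j) = path_prism K n (j - 1) g) \<and>
        (\<forall>i j. Suc j < i \<and> i \<le> Suc n \<longrightarrow> face K (Suc n) i (h j) = path_prism K n j g))"

definition pi1_action ::
    "'a sset \<Rightarrow> (nat \<Rightarrow> 'a) \<Rightarrow> nat \<Rightarrow> 'a set \<Rightarrow> 'a set \<Rightarrow> 'a set" where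
  "pi1_action K b n \<gamma> A =
     sphere_rel K b n `` {y. \<exists>g\<in>\<gamma>. \<exists>x\<in>A. loop_acts K b n g x y}"

primrec pi_filtration :: "'a sset \<Rightarrow> (nat \<Rightarrow> 'a) \<Rightarrow> nat \<Rightarrow> nat \<Rightarrow> 'a set set" where
  "pi_filtration K b k 0 = carrier (homotopy_group K b k)"
| "pi_filtration K b k (Suc i) = generate (homotopy_group K b k)
     {pi1_action K b k \<gamma> x \<otimes>\<^bsub>homotopy_group K b k\<^esub> inv\<^bsub>homotopy_group K b k\<^esub> x | \<gamma> x.
        \<gamma> \<in> carrier (homotopy_group K b 1) \<and> x \<in> pi_filtration K b k i}"

definition pi_quotient ::
    "'a sset \<Rightarrow> (nat \<Rightarrow> 'a) \<Rightarrow> nat \<Rightarrow> nat \<Rightarrow> 'a set set monoid" where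
  "pi_quotient K b k i =
     (homotopy_group K b k)\<lparr>carrier := pi_filtration K b k i\<rparr> Mod pi_filtration K b k (Suc i)"


section \<open>The Dold--Kan construction\<close>

definition fg_chain_complex ::
    "(nat \<Rightarrow> 'c monoid) \<Rightarrow> (nat \<Rightarrow> 'c \<Rightarrow> 'c) \<Rightarrow> bool" where
  "fg_chain_complex C d \<longleftrightarrow> (\<forall>n. fg_free_abelian (C n)) \<and>
     (\<forall>n. d n \<in> hom (C (Suc n)) (C n)) \<and>
     (\<forall>n. \<forall>x\<in>carrier (C (Suc (Suc n))). d n (d (Suc n) x) = \<one>\<^bsub>C n\<^esub>)"

text \<open>
  \<open>\<Gamma>(M)\<^sub>n\<close> is the group of chain maps from the normalised chain complex of the standard
  \<open>n\<close>-simplex to \<open>M\<close>.  That complex is free on the nonempty subsets \<open>S\<close> of \<open>{0..n}\<close> (the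
  nondegenerate simplices, in degree \<open>card S - 1\<close>), with differential the alternating sum of the
  \<open>S - {s}\<close>, the sign being given by the position of \<open>s\<close> in \<open>S\<close>.
\<close>

definition std_faces :: "nat \<Rightarrow> nat set set" where
  "std_faces n = {S. S \<subseteq> {..n} \<and> S \<noteq> {}}"

definition Gamma_obj ::
    "(nat \<Rightarrow> 'c monoid) \<Rightarrow> (nat \<Rightarrow> 'c \<Rightarrow> 'c) \<Rightarrow> nat \<Rightarrow> (nat set \<Rightarrow> 'c) monoid" where
  "Gamma_obj C d n = (product_group (std_faces n) (\<lambda>S. C (card S - 1)))
     \<lparr>carrier := {x \<in> \<Pi>\<^sub>E S\<in>std_faces n. carrier (C (card S - 1)).
        \<forall>k. \<forall>S\<in>std_faces n. card S = k + 2 \<longrightarrow>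
          d k (x S) = finprod (C k) (\<lambda>s. x (S - {s}) [^]\<^bsub>C k\<^esub> ((-1::int) ^ card {t\<in>S. t < s})) S}\<rparr>"

definition coface :: "nat \<Rightarrow> nat \<Rightarrow> nat" where
  "coface i j = (if j < i then j else Suc j)"

definition codegen :: "nat \<Rightarrow> nat \<Rightarrow> nat" where
  "codegen i j = (if j \<le> i then j else j - 1)"

definition Gamma ::
    "(nat \<Rightarrow> 'c monoid) \<Rightarrow> (nat \<Rightarrow> 'c \<Rightarrow> 'c) \<Rightarrow> (nat set \<Rightarrow> 'c) snum" where
  "Gamma C d =
     \<lparr>obj = Gamma_obj C d,
      nface = (\<lambda>n i x. \<lambda>S\<in>std_faces (n - 1). x (coface i ` S)),
      ndegen = (\<lambda>n i x. \<lambda>S\<in>std_faces (Suc n).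
        if inj_on (codegen i) S then x (codegen i ` S) else \<one>\<^bsub>C (card S - 1)\<^esub>)\<rparr>"


section \<open>Principal twisted cartesian products\<close>

text \<open>
  Only structure groups \<open>G\<close> of the form \<open>\<Gamma>(M)\<close> occur, so the multiplication of the group object
  \<open>G\<close> is taken to be the group structure of the \<open>obj G n\<close>.
\<close>

definition twisting_function ::
    "'b snum \<Rightarrow> 'g snum \<Rightarrow> (nat \<Rightarrow> 'b \<Rightarrow> 'g) \<Rightarrow> bool" where
  "twisting_function B G \<tau> \<longleftrightarrow>
     (\<forall>q. numerical (obj B (Suc q)) (obj G q) (\<tau> (Suc q))) \<and>
     (\<forall>q. \<forall>b\<in>carrier (obj B (Suc (Suc q))).
        (\<forall>i. 0 < i \<and> i \<le> Suc q \<longrightarrow>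
           nface G (Suc q) i (\<tau> (Suc (Suc q)) b) = \<tau> (Suc q) (nface B (Suc (Suc q)) (Suc i) b)) \<and>
        nface G (Suc q) 0 (\<tau> (Suc (Suc q)) b) =
          inv\<^bsub>obj G q\<^esub> (\<tau> (Suc q) (nface B (Suc (Suc q)) 0 b))
            \<otimes>\<^bsub>obj G q\<^esub> \<tau> (Suc q) (nface B (Suc (Suc q)) 1 b)) \<and>
     (\<forall>q. \<forall>b\<in>carrier (obj B (Suc q)). \<forall>i\<le>q.
        ndegen G q i (\<tau> (Suc q) b) = \<tau> (Suc (Suc q)) (ndegen B (Suc q) (Suc i) b)) \<and>
     (\<forall>q. \<forall>b\<in>carrier (obj B q). \<tau> (Suc q) (ndegen B q 0 b) = \<one>\<^bsub>obj G q\<^esub>)"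

definition twisted_product ::
    "'b snum \<Rightarrow> 'g snum \<Rightarrow> (nat \<Rightarrow> 'b \<Rightarrow> 'g) \<Rightarrow> ('g \<times> 'b) snum" where
  "twisted_product B G \<tau> =
     \<lparr>obj = (\<lambda>n. obj G n \<times>\<times> obj B n),
      nface = (\<lambda>n i (g, b).
        (if i = 0 then \<tau> n b \<otimes>\<^bsub>obj G (n - 1)\<^esub> nface G n 0 g else nface G n i g, nface B n i b)),
      ndegen = (\<lambda>n i (g, b). (ndegen G n i g, ndegen B n i b))\<rparr>"

definition is_ptcp :: "'e snum \<Rightarrow> 'b snum \<Rightarrow> (nat \<Rightarrow> 'e \<Rightarrow> 'b) \<Rightarrow> 'g snum \<Rightarrow> bool" where
  "is_ptcp E B p G \<longleftrightarrow>
     (\<exists>\<tau> \<phi>. twisting_function B G \<tau> \<and> snum_iso E (twisted_product B G \<tau>) \<phi> \<and>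
        (\<forall>q. \<forall>x\<in>carrier (obj E q). snd (\<phi> q x) = p q x))"


section \<open>Special numerical spaces\<close>

text \<open>
  Every finitely generated free abelian group is isomorphic to one with elements in the following
  type.  Hence the objects that are quantified in the definitions below (the towers, the chain
  complexes and the test objects of the universal property) may be taken in this type, all
  conditions being invariant under isomorphism.
\<close>

type_synonym zvec = "nat \<Rightarrow>\<^sub>0 int"

definition tower_cone ::
    "'a snum \<Rightarrow> (nat \<Rightarrow> 'b snum) \<Rightarrow> (nat \<Rightarrow> nat \<Rightarrow> 'b \<Rightarrow> 'b) \<Rightarrow>
     (nat \<Rightarrow> nat \<Rightarrow> 'a \<Rightarrow> 'b) \<Rightarrow> bool" where
  "tower_cone Z T p r \<longleftrightarrow> (\<forall>n. r n \<in> nmaps Z (T n)) \<and>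
     (\<forall>n. nmap_comp Z (p n) (r (Suc n)) = r n)"

definition is_inverse_limit ::
    "'a snum \<Rightarrow> (nat \<Rightarrow> zvec snum) \<Rightarrow> (nat \<Rightarrow> nat \<Rightarrow> zvec \<Rightarrow> zvec) \<Rightarrow> bool" where
  "is_inverse_limit X T p \<longleftrightarrow>
     (\<exists>r. tower_cone X T p r \<and>
        (\<forall>(Z :: zvec snum) r'. is_snum Z \<and> tower_cone Z T p r' \<longrightarrow>
           (\<exists>!u. u \<in> nmaps Z X \<and> (\<forall>n. nmap_comp Z (r n) u = r' n))))"

text \<open>
  \<open>T n\<close>, \<open>p n\<close> and \<open>(C n, d n)\<close> are \<open>X\<^sup>n\<close>, the map from \<open>X\<^sup>n\<^sup>+\<^sup>1\<close> to \<open>X\<^sup>n\<close> and the complex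
  \<open>M\<^sup>n\<close>.
\<close>

definition fibred_structure ::
    "'a snum \<Rightarrow> (nat \<Rightarrow> zvec snum) \<Rightarrow> (nat \<Rightarrow> nat \<Rightarrow> zvec \<Rightarrow> zvec) \<Rightarrow>
     (nat \<Rightarrow> nat \<Rightarrow> zvec monoid) \<Rightarrow> (nat \<Rightarrow> nat \<Rightarrow> zvec \<Rightarrow> zvec) \<Rightarrow> bool" where
  "fibred_structure X T p C d \<longleftrightarrow>
     (\<forall>n. is_snum (T n)) \<and> (\<forall>n. p n \<in> nmaps (T (Suc n)) (T n)) \<and>
     (\<forall>j. \<exists>x. carrier (obj (T 0) j) = {x}) \<and>
     is_inverse_limit X T p \<and>
     (\<forall>n. \<exists>x. carrier (obj (T n) 0) = {x}) \<and>
     (\<forall>j. \<exists>N. \<forall>n\<ge>N. num_iso (obj (T (Suc n)) j) (obj (T n) j) (p n j)) \<and>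
     (\<forall>n. fg_chain_complex (C n) (d n)) \<and>
     (\<forall>n. is_ptcp (T (Suc n)) (T n) (p n) (Gamma (C n) (d n)))"

definition fibred_numerical_space :: "'a snum \<Rightarrow> bool" where
  "fibred_numerical_space X \<longleftrightarrow> is_snum X \<and> sset_connected (forget X) \<and>
     (\<exists>T p C d. fibred_structure X T p C d)"

text \<open>
  The homotopy groups are taken at \<open>b\<close>; a fibred numerical space has only one base point.
\<close>

definition special_numerical_space :: "'a snum \<Rightarrow> (nat \<Rightarrow> 'a) \<Rightarrow> bool" where
  "special_numerical_space X b \<longleftrightarrow> fibred_numerical_space X \<and>
     (\<exists>T p C d. fibred_structure X T p C d \<and>
        (\<forall>n. \<exists>h i. 1 \<le> h \<and>
           (\<forall>k. k \<noteq> h \<longrightarrow> trivial_group (chain_homology (C n) (d n) k)) \<and>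
           chain_homology (C n) (d n) h \<cong> pi_quotient (forget X) b h i))"

end

theory Submission
  imports Defs
begin

text \<open>
  The proof is obstruction theory for two kinds of cochains at once.  For a simplicial set \<open>K\<close>, fix
  in each degree a ring of rational functions on the simplices, stable under the simplicial
  operators (\<open>function_system\<close>).  Cochains, and maps to an object of \<open>Num\<close>, are called regular if
  their coordinates lie in this ring.  If the ring consists of all functions, then every map is
  regular; if it consists of the polynomial functions on some \<open>X\<close> in \<open>s(Num)\<close>, the regular maps
  are the numerical ones.  On a cylinder one can also demand regularity at one end only.
  
  The central result is \<open>fibred_extension\<close>.  Suppose that the normalised regular cochains of \<open>K\<close>
  that vanish on a subcomplex \<open>L\<close> form an acyclic complex.  Then a map from \<open>L\<close> to a fibred
  numerical space \<open>Y\<close> extends to a regular map on \<open>K\<close>, provided that the numerical cochains of \<open>Y\<close>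
  that vanish at the base point remain regular when they are pulled back to \<open>L\<close> and extended by
  zero.  Both halves of the theorem are instances of this.  For surjectivity (\<open>numerical_approximation\<close>)
  the complex is \<open>X \<times> I\<close>, regular at the far end; an extension of a map given on the near end and
  constant at the base point is a homotopy to a numerical map.  For injectivity (\<open>numerical_square\<close>)
  it is \<open>(X \<times> I) \<times> I\<close>; on three sides of the square one prescribes a homotopy between two maps
  and homotopies from these to numerical maps, and regularity makes the fourth side a numerical
  homotopy.  A chain of homotopies is treated link by link.
  
  The acyclicity comes from the definition of a numerical space.  Contracting the cylinder gives a
  primitive of a cocycle; at the far end this is a primitive of a numerical cocycle, hence numerical
  up to an arbitrary coboundary, which can be subtracted (\<open>cylinder_acyclic\<close>).  The same contraction
  shows that the comparison isomorphism passes from \<open>X\<close> to the pair of \<open>X \<times> I\<close> and its ends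
  (\<open>cylinder_comparable\<close>).
  
  The extension is made stage by stage.  A simplex of \<open>\<Gamma>(M)\<close> is determined by its boundary and its
  value on the top cell (\<open>Gamma_fill\<close>, \<open>Gamma_eqI\<close>).  Hence a lift to a principal twisted cartesian
  product with fibre \<open>\<Gamma>(M)\<close> is the same as a normalised cochain \<open>s\<close> with values in \<open>M\<close> that satisfies
  \<open>d s = \<delta> s - t\<close>, where \<open>t\<close> is the top component of the twisting function (\<open>stage_extension\<close>).
  This linear equation has a regular solution (\<open>twisted_cochain_equation\<close>): in degrees above the
  homology of \<open>M\<close> linear sections of \<open>d\<close> give one, since the groups \<open>M\<^sub>q\<close> are free and subgroups
  cut out by homomorphisms to the integers split off; below, acyclicity gives one.  This is where the
  homology of the complexes in a special space is required to be concentrated in one degree.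
  
  Finally, the inverse limit agrees in each degree with some term of the tower
  (\<open>inverse_limit_degreewise\<close>), so that the lifts assemble to a map into \<open>Y\<close>.
\<close>

section \<open>Polynomial functions without coordinates\<close>

definition rat_algebra :: "'a set \<Rightarrow> ('a \<Rightarrow> rat) set \<Rightarrow> bool" where
  "rat_algebra S R \<longleftrightarrow> (\<forall>c. (\<lambda>_. c) \<in> R) \<and>
     (\<forall>F\<in>R. \<forall>G\<in>R. (\<lambda>x. F x + G x) \<in> R \<and> (\<lambda>x. F x * G x) \<in> R) \<and>
     (\<forall>F\<in>R. \<forall>G. (\<forall>x\<in>S. F x = G x) \<longrightarrow> G \<in> R)"

lemma rat_algebra_const: "rat_algebra S R \<Longrightarrow> (\<lambda>_. c) \<in> R"
  and rat_algebra_add: "rat_algebra S R \<Longrightarrow> F \<in> R \<Longrightarrow> G \<in> R \<Longrightarrow> (\<lambda>x. F x + G x) \<in> R"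
  and rat_algebra_mult: "rat_algebra S R \<Longrightarrow> F \<in> R \<Longrightarrow> G \<in> R \<Longrightarrow> (\<lambda>x. F x * G x) \<in> R"
  and rat_algebra_cong: "rat_algebra S R \<Longrightarrow> F \<in> R \<Longrightarrow> (\<And>x. x \<in> S \<Longrightarrow> F x = G x) \<Longrightarrow> G \<in> R"
  unfolding rat_algebra_def by blast+

lemma rat_algebra_cmul: "rat_algebra S R \<Longrightarrow> F \<in> R \<Longrightarrow> (\<lambda>x. c * F x) \<in> R"
  using rat_algebra_mult[OF _ rat_algebra_const] by blast

lemma rat_algebra_uminus: "rat_algebra S R \<Longrightarrow> F \<in> R \<Longrightarrow> (\<lambda>x. - F x) \<in> R"
  using rat_algebra_cmul[of S R F "-1"] by simp

lemma rat_algebra_diff: "rat_algebra S R \<Longrightarrow> F \<in> R \<Longrightarrow> G \<in> R \<Longrightarrow> (\<lambda>x. F x - G x) \<in> R"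
  using rat_algebra_add[OF _ _ rat_algebra_uminus, of S R F _ G] by simp

lemma rat_algebra_sum:
  assumes "rat_algebra S R" "\<And>i. i \<in> I \<Longrightarrow> F i \<in> R"
  shows "(\<lambda>x. \<Sum>i\<in>I. F i x) \<in> R"
  using assms(2)
  by (induction I rule: infinite_finite_induct)
    (auto simp: rat_algebra_const[OF assms(1)] rat_algebra_add[OF assms(1)])

lemma rat_algebra_prod:
  assumes "rat_algebra S R" "\<And>i. i \<in> I \<Longrightarrow> F i \<in> R"
  shows "(\<lambda>x. \<Prod>i\<in>I. F i x) \<in> R"
  using assms(2)
  by (induction I rule: infinite_finite_induct)
    (auto simp: rat_algebra_const[OF assms(1)] rat_algebra_mult[OF assms(1)])

lemma rat_algebra_power:
  assumes "rat_algebra S R" "F \<in> R"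
  shows "(\<lambda>x. F x ^ (k::nat)) \<in> R"
  by (induction k) (auto simp: rat_algebra_const[OF assms(1)] rat_algebra_mult[OF assms(1)] assms)

lemma rat_algebra_UNIV: "rat_algebra S UNIV"
  by (simp add: rat_algebra_def)

text \<open>
  A map into a finitely generated free abelian group is regular with respect to an algebra \<open>R\<close> of
  rational functions if all its coordinates are in \<open>R\<close>.  Quantifying over all homomorphisms to the
  integers instead of over the coordinates of a basis makes the independence of bases automatic.
\<close>

definition regular :: "'s set \<Rightarrow> ('s \<Rightarrow> rat) set \<Rightarrow> ('a, 'x) monoid_scheme \<Rightarrow> ('s \<Rightarrow> 'a) \<Rightarrow> bool" where
  "regular S R A u \<longleftrightarrow> u \<in> S \<rightarrow> carrier A \<and>
     (\<forall>l\<in>hom A integer_group. (\<lambda>x. of_int (l (u x))) \<in> R)"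

text \<open>
  The functions on the carrier of \<open>A\<close> that are polynomial in one, hence in any, basis.  The last rule
  makes the values outside the carrier irrelevant, in accordance with \<open>numerical\<close>.
\<close>

inductive_set polyfuns :: "('a, 'x) monoid_scheme \<Rightarrow> ('a \<Rightarrow> rat) set" for A where
  const: "(\<lambda>_. c) \<in> polyfuns A"
| linear: "l \<in> hom A integer_group \<Longrightarrow> (\<lambda>x. of_int (l x)) \<in> polyfuns A"
| add: "F \<in> polyfuns A \<Longrightarrow> G \<in> polyfuns A \<Longrightarrow> (\<lambda>x. F x + G x) \<in> polyfuns A"
| mult: "F \<in> polyfuns A \<Longrightarrow> G \<in> polyfuns A \<Longrightarrow> (\<lambda>x. F x * G x) \<in> polyfuns A"
| cong: "F \<in> polyfuns A \<Longrightarrow> (\<And>x. x \<in> carrier A \<Longrightarrow> F x = G x) \<Longrightarrow> G \<in> polyfuns A"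

lemma rat_algebra_polyfuns: "rat_algebra (carrier A) (polyfuns A)"
  unfolding rat_algebra_def
  by (intro conjI allI ballI impI) (auto intro: polyfuns.intros polyfuns.cong)

lemma regular_polyfuns: "regular (carrier A) (polyfuns A) A (\<lambda>x. x)"
  by (auto simp: regular_def intro: polyfuns.linear)

lemma regularD: "regular S R A u \<Longrightarrow> x \<in> S \<Longrightarrow> u x \<in> carrier A"
  by (auto simp: regular_def)

lemma regular_functional:
  "regular S R A u \<Longrightarrow> l \<in> hom A integer_group \<Longrightarrow> (\<lambda>x. of_int (l (u x))) \<in> R"
  by (auto simp: regular_def)

lemma regular_cong:
  assumes "rat_algebra S R" "regular S R A u" "\<And>x. x \<in> S \<Longrightarrow> u x = v x"
  shows "regular S R A v"
  unfolding regular_def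
proof (intro conjI ballI)
  show "v \<in> S \<rightarrow> carrier A"
    using assms(2,3) by (auto simp: regular_def Pi_iff)
  show "(\<lambda>x. of_int (l (v x))) \<in> R" if "l \<in> hom A integer_group" for l
    by (rule rat_algebra_cong[OF assms(1) regular_functional[OF assms(2) that]]) (simp add: assms(3))
qed

lemma regular_hom:
  assumes "regular S R A u" "f \<in> hom A B"
  shows "regular S R B (\<lambda>x. f (u x))"
  unfolding regular_def
proof (intro conjI ballI)
  show "(\<lambda>x. f (u x)) \<in> S \<rightarrow> carrier B" using assms by (auto simp: regular_def hom_def)
  fix l assume "l \<in> hom B integer_group"
  then have "l \<circ> f \<in> hom A integer_group" using assms(2) by (rule hom_compose[rotated])
  from regular_functional[OF assms(1) this] show "(\<lambda>x. of_int (l (f (u x)))) \<in> R" by simp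
qed

lemma regular_const:
  assumes "rat_algebra S R" "c \<in> carrier A"
  shows "regular S R A (\<lambda>_. c)"
  using assms by (auto simp: regular_def rat_algebra_const)

lemma functional_mult:
  "l \<in> hom A integer_group \<Longrightarrow> a \<in> carrier A \<Longrightarrow> b \<in> carrier A \<Longrightarrow>
    l (a \<otimes>\<^bsub>A\<^esub> b) = l a + l b"
  by (simp add: hom_def)

lemma functional_one:
  assumes "l \<in> hom A integer_group" "group A"
  shows "l \<one>\<^bsub>A\<^esub> = 0"
  using hom_one[OF assms(1,2)] by simp

lemma functional_inv:
  assumes "l \<in> hom A integer_group" "group A" "a \<in> carrier A"
  shows "l (inv\<^bsub>A\<^esub> a) = - l a"
proof -
  interpret group_hom A integer_group l
    using assms by (simp add: group_hom_def group_hom_axioms_def)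
  show ?thesis using hom_inv[OF assms(3)] by simp
qed

lemma regular_mult:
  assumes "rat_algebra S R" "group A" "regular S R A u" "regular S R A v"
  shows "regular S R A (\<lambda>x. u x \<otimes>\<^bsub>A\<^esub> v x)"
  unfolding regular_def
proof (intro conjI ballI)
  show "(\<lambda>x. u x \<otimes>\<^bsub>A\<^esub> v x) \<in> S \<rightarrow> carrier A"
    using assms(2-4) by (auto simp: regular_def Pi_def group.is_monoid monoid.m_closed)
  fix l assume l: "l \<in> hom A integer_group"
  show "(\<lambda>x. of_int (l (u x \<otimes>\<^bsub>A\<^esub> v x))) \<in> R"
    by (rule rat_algebra_cong[OF assms(1) rat_algebra_add[OF assms(1) regular_functional[OF assms(3) l]
          regular_functional[OF assms(4) l]]])
      (use l regularD[OF assms(3)] regularD[OF assms(4)] in \<open>simp add: functional_mult\<close>)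
qed

lemma regular_inv:
  assumes "rat_algebra S R" "group A" "regular S R A u"
  shows "regular S R A (\<lambda>x. inv\<^bsub>A\<^esub> u x)"
  unfolding regular_def
proof (intro conjI ballI)
  show "(\<lambda>x. inv\<^bsub>A\<^esub> u x) \<in> S \<rightarrow> carrier A"
    using assms(2,3) by (auto simp: regular_def Pi_def)
  fix l assume l: "l \<in> hom A integer_group"
  show "(\<lambda>x. of_int (l (inv\<^bsub>A\<^esub> u x))) \<in> R"
    by (rule rat_algebra_cong[OF assms(1) rat_algebra_uminus[OF assms(1) regular_functional[OF assms(3) l]]])
      (use l assms(2) regularD[OF assms(3)] in \<open>simp add: functional_inv\<close>)
qed

lemma regular_pullback:
  assumes "regular S R A u" "p \<in> S' \<rightarrow> S" "\<And>F. F \<in> R \<Longrightarrow> (\<lambda>x. F (p x)) \<in> R'"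
  shows "regular S' R' A (\<lambda>x. u (p x))"
  using assms by (auto simp: regular_def Pi_def)

subsection \<open>Coordinates\<close>

lemma zvec_expand:
  assumes "Poly_Mapping.keys z \<subseteq> {..<n::nat}"
  shows "z = (\<Sum>j<n. frag_cmul (Poly_Mapping.lookup z j) (frag_of j))"
proof (rule poly_mapping_eqI)
  fix k
  have "Poly_Mapping.lookup z k = 0" if "k \<ge> n"
    using assms that by (auto simp: in_keys_iff subset_iff)
  then show "Poly_Mapping.lookup z k =
      Poly_Mapping.lookup (\<Sum>j<n. frag_cmul (Poly_Mapping.lookup z j) (frag_of j)) k"
    by (cases "k < n") (auto simp: lookup_sum if_distrib cong: if_cong)
qed

lemma functional_sum:
  assumes "l \<in> hom (free_Abelian_group S) integer_group" "finite I"
    "\<And>i. i \<in> I \<Longrightarrow> Poly_Mapping.keys (z i) \<subseteq> S"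
  shows "l (\<Sum>i\<in>I. z i) = (\<Sum>i\<in>I. l (z i))"
  using assms(2,3)
proof (induction I)
  case empty
  then show ?case using functional_one[OF assms(1)] by simp
next
  case (insert i I)
  have "Poly_Mapping.keys (\<Sum>i\<in>I. z i) \<subseteq> S"
    using sum_closed_free_Abelian_group[of I z S] insert by simp
  then show ?case using insert functional_mult[OF assms(1), of "z i" "\<Sum>i\<in>I. z i"] by simp
qed

lemma functional_cmul:
  assumes "l \<in> hom (free_Abelian_group S) integer_group" "Poly_Mapping.keys z \<subseteq> S"
  shows "l (frag_cmul c z) = c * l z"
proof -
  interpret group_hom "free_Abelian_group S" integer_group l
    using assms by (simp add: group_hom_def group_hom_axioms_def)
  have "l (z [^]\<^bsub>free_Abelian_group S\<^esub> c) = l z [^]\<^bsub>integer_group\<^esub> c"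
    using int_pow_closed assms(2) by (intro hom_int_pow) auto
  then show ?thesis using assms(2) by (simp add: mult.commute)
qed

lemma functional_expand:
  assumes "l \<in> hom (free_Abelian_group {..<n::nat}) integer_group" "Poly_Mapping.keys z \<subseteq> {..<n}"
  shows "l z = (\<Sum>j<n. Poly_Mapping.lookup z j * l (frag_of j))"
proof -
  have "l z = l (\<Sum>j<n. frag_cmul (Poly_Mapping.lookup z j) (frag_of j))"
    using zvec_expand[OF assms(2)] by simp
  also have "\<dots> = (\<Sum>j<n. l (frag_cmul (Poly_Mapping.lookup z j) (frag_of j)))"
    by (rule functional_sum[OF assms(1)]) (auto simp: keys_frag_of)
  also have "\<dots> = (\<Sum>j<n. Poly_Mapping.lookup z j * l (frag_of j))"
    by (intro sum.cong refl functional_cmul[OF assms(1)]) (auto simp: keys_frag_of)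
  finally show ?thesis .
qed

lemma lookup_hom: "(\<lambda>z. Poly_Mapping.lookup z j) \<in> hom (free_Abelian_group S) integer_group"
  by (auto simp: hom_def lookup_add)

lemma regular_free:
  assumes "rat_algebra S R" "\<And>x. x \<in> S \<Longrightarrow> Poly_Mapping.keys (u x) \<subseteq> {..<n::nat}"
    and "\<And>j. j < n \<Longrightarrow> (\<lambda>x. of_int (Poly_Mapping.lookup (u x) j)) \<in> R"
  shows "regular S R (free_Abelian_group {..<n}) u"
  unfolding regular_def
proof (intro conjI ballI)
  show "u \<in> S \<rightarrow> carrier (free_Abelian_group {..<n})" using assms(2) by auto
  fix l assume l: "l \<in> hom (free_Abelian_group {..<n}) integer_group"
  have "(\<lambda>x. \<Sum>j<n. of_int (l (frag_of j)) * of_int (Poly_Mapping.lookup (u x) j)) \<in> R"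
    by (intro rat_algebra_sum[OF assms(1)] rat_algebra_cmul[OF assms(1)] assms(3)) auto
  then show "(\<lambda>x. of_int (l (u x))) \<in> R"
    by (rule rat_algebra_cong[OF assms(1)])
      (simp add: functional_expand[OF l assms(2)] mult.commute)
qed

lemma iso_inv_into:
  assumes "\<phi> \<in> iso A B" "group A"
  shows "inv_into (carrier A) \<phi> \<in> iso B A"
  using group.iso_set_sym[OF assms(2,1)] .

lemma iso_inv_cancel:
  assumes "\<phi> \<in> iso A B"
  shows "a \<in> carrier A \<Longrightarrow> inv_into (carrier A) \<phi> (\<phi> a) = a"
    and "b \<in> carrier B \<Longrightarrow> \<phi> (inv_into (carrier A) \<phi> b) = b"
    and "a \<in> carrier A \<Longrightarrow> \<phi> a \<in> carrier B"
    and "b \<in> carrier B \<Longrightarrow> inv_into (carrier A) \<phi> b \<in> carrier A"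
  using assms unfolding iso_def bij_betw_def
  by (auto simp: f_inv_into_f inv_into_f_f inv_into_into)

lemma regular_via_iso:
  assumes "group A" "\<psi> \<in> iso A B" "u \<in> S \<rightarrow> carrier A" "rat_algebra S R" "regular S R B (\<lambda>x. \<psi> (u x))"
  shows "regular S R A u"
  by (rule regular_cong[OF assms(4) regular_hom[OF assms(5)]])
    (use iso_inv_into[OF assms(2,1)] iso_inv_cancel[OF assms(2)] assms(3) in \<open>auto simp: iso_def Pi_iff\<close>)

lemma poly_eval_regular:
  assumes "rat_algebra S R" "\<And>i. i \<in> poly_vars p \<Longrightarrow> v i \<in> R"
  shows "(\<lambda>x. poly_eval p (\<lambda>i. v i x)) \<in> R"
  unfolding poly_eval_def
  by (intro rat_algebra_sum[OF assms(1)] rat_algebra_cmul[OF assms(1)] rat_algebra_prod[OF assms(1)]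
      rat_algebra_power[OF assms(1)] assms(2)) (auto simp: poly_vars_def)

text \<open>
  The coordinates of \<open>f \<circ> u\<close> are polynomials in those of \<open>u\<close>, and an algebra is closed under
  polynomials.  Taking for \<open>u\<close> the identity of \<open>A\<close> shows that numerical functions are regular for
  the algebra \<open>polyfuns A\<close>; for general \<open>u\<close> the lemma contains their closure under composition.
\<close>

lemma numerical_regular:
  assumes f: "numerical A B f" and R: "rat_algebra S R" and u: "regular S R A u" and B: "group B"
  shows "regular S R B (\<lambda>x. f (u x))"
proof -
  obtain m n \<phi> \<psi> where \<phi>: "\<phi> \<in> iso A (free_Abelian_group {..<m::nat})"
    and \<psi>: "\<psi> \<in> iso B (free_Abelian_group {..<n::nat})"
    and p: "\<And>j. j < n \<Longrightarrow> \<exists>p. poly_vars p \<subseteq> {..<m} \<and>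
           (\<forall>x\<in>carrier A. of_int (Poly_Mapping.lookup (\<psi> (f x)) j) =
              poly_eval p (\<lambda>i. of_int (Poly_Mapping.lookup (\<phi> x) i)))"
    and fc: "f \<in> carrier A \<rightarrow> carrier B"
    using f unfolding numerical_def by blast
  have uc: "u x \<in> carrier A" if "x \<in> S" for x using regularD[OF u that] .
  have "regular S R (free_Abelian_group {..<n}) (\<lambda>x. \<psi> (f (u x)))"
  proof (rule regular_free[OF R])
    show "Poly_Mapping.keys (\<psi> (f (u x))) \<subseteq> {..<n}" if "x \<in> S" for x
      using iso_inv_cancel(3)[OF \<psi>] fc uc[OF that] by auto
    fix j assume "j < n"
    then obtain p where pv: "poly_vars p \<subseteq> {..<m}"
      and pe: "\<And>x. x\<in>carrier A \<Longrightarrow> of_int (Poly_Mapping.lookup (\<psi> (f x)) j) =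
              poly_eval p (\<lambda>i. of_int (Poly_Mapping.lookup (\<phi> x) i))" using p by blast
    have "(\<lambda>x. of_int (Poly_Mapping.lookup (\<phi> (u x)) i)) \<in> R" for i
      using regular_functional[OF regular_hom[OF u] lookup_hom] \<phi> by (auto simp: iso_def)
    then have "(\<lambda>x. poly_eval p (\<lambda>i. of_int (Poly_Mapping.lookup (\<phi> (u x)) i))) \<in> R"
      by (intro poly_eval_regular[OF R, of p "\<lambda>i x. of_int (Poly_Mapping.lookup (\<phi> (u x)) i)"])
    then show "(\<lambda>x. of_int (Poly_Mapping.lookup (\<psi> (f (u x))) j)) \<in> R"
      by (rule rat_algebra_cong[OF R]) (simp add: pe uc)
  qed
  moreover have "(\<lambda>x. f (u x)) \<in> S \<rightarrow> carrier B" using fc uc by auto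
  ultimately show ?thesis
    using regular_via_iso[OF B \<psi> _ R] by blast
qed

lemma numerical_regularD:
  "numerical A B f \<Longrightarrow> group B \<Longrightarrow> regular (carrier A) (polyfuns A) B f"
  using numerical_regular[OF _ rat_algebra_polyfuns regular_polyfuns] .

subsection \<open>Polynomials as elements of a monoid ring\<close>

lemma poly_eval_superset:
  assumes "finite T" "Poly_Mapping.keys p \<subseteq> T"
  shows "poly_eval p v = (\<Sum>t\<in>T. Poly_Mapping.lookup p t *
        (\<Prod>i\<in>Poly_Mapping.keys t. v i ^ Poly_Mapping.lookup t i))"
  unfolding poly_eval_def
  by (rule sum.mono_neutral_left) (use assms in \<open>auto simp: in_keys_iff\<close>)

lemma poly_eval_add: "poly_eval (p + q) v = poly_eval p v + poly_eval q v"
proof -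
  let ?T = "Poly_Mapping.keys p \<union> Poly_Mapping.keys q"
  have T: "finite ?T" by simp
  show ?thesis
    using poly_eval_superset[OF T, of "p + q" v] poly_eval_superset[OF T, of p v]
      poly_eval_superset[OF T, of q v] keys_add[of p q]
    by (simp add: lookup_add distrib_right sum.distrib)
qed

lemma poly_eval_zero: "poly_eval 0 v = 0"
  by (simp add: poly_eval_def)

lemma monom_eval_superset:
  fixes v :: "nat \<Rightarrow> rat"
  assumes "finite T" "Poly_Mapping.keys t \<subseteq> T"
  shows "(\<Prod>i\<in>Poly_Mapping.keys t. v i ^ Poly_Mapping.lookup t i) = (\<Prod>i\<in>T. v i ^ Poly_Mapping.lookup t i)"
  by (rule prod.mono_neutral_left) (use assms in \<open>auto simp: in_keys_iff\<close>)

lemma poly_eval_single: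
  "poly_eval (Poly_Mapping.single t c) v =
     c * (\<Prod>i\<in>Poly_Mapping.keys t. v i ^ Poly_Mapping.lookup t i)"
  by (simp add: poly_eval_def)

lemma poly_eval_mult_single:
  "poly_eval (Poly_Mapping.single s c * Poly_Mapping.single t d) v =
     poly_eval (Poly_Mapping.single s c) v * poly_eval (Poly_Mapping.single t d) v"
proof -
  let ?T = "Poly_Mapping.keys s \<union> Poly_Mapping.keys t"
  have T: "finite ?T" by simp
  show ?thesis
    using monom_eval_superset[OF T, of "s + t" v] monom_eval_superset[OF T, of s v]
      monom_eval_superset[OF T, of t v] keys_add[of s t]
    by (simp add: mult_single poly_eval_single lookup_add power_add prod.distrib)
qed

lemma poly_expand: "p = (\<Sum>t\<in>Poly_Mapping.keys p. Poly_Mapping.single t (Poly_Mapping.lookup p t))"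
  by (rule poly_mapping_eqI) (simp add: lookup_sum lookup_single when_def in_keys_iff)

lemma poly_eval_sum: "poly_eval (\<Sum>i\<in>I. p i) v = (\<Sum>i\<in>I. poly_eval (p i) v)"
  by (induction I rule: infinite_finite_induct) (auto simp: poly_eval_add poly_eval_zero)

lemma poly_eval_mult: "poly_eval (p * q) v = poly_eval p v * poly_eval q v"
proof -
  let ?s = "\<lambda>p t. Poly_Mapping.single t (Poly_Mapping.lookup p t)"
  have "p * q = (\<Sum>s\<in>Poly_Mapping.keys p. \<Sum>t\<in>Poly_Mapping.keys q. ?s p s * ?s q t)"
    by (subst poly_expand[of p], subst poly_expand[of q]) (simp add: sum_product)
  then have "poly_eval (p * q) v =
      (\<Sum>s\<in>Poly_Mapping.keys p. poly_eval (?s p s) v) * (\<Sum>t\<in>Poly_Mapping.keys q. poly_eval (?s q t) v)"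
    by (simp add: poly_eval_sum poly_eval_mult_single sum_product)
  then show ?thesis by (simp flip: poly_eval_sum poly_expand)
qed

lemma poly_vars_add: "poly_vars (p + q) \<subseteq> poly_vars p \<union> poly_vars q"
  using keys_add[of p q] by (auto simp: poly_vars_def)

lemma poly_vars_mult: "poly_vars (p * q) \<subseteq> poly_vars p \<union> poly_vars q"
proof
  fix i assume "i \<in> poly_vars (p * q)"
  then obtain t where "t \<in> Poly_Mapping.keys (p * q)" "i \<in> Poly_Mapping.keys t"
    by (auto simp: poly_vars_def)
  moreover from this obtain a b where "t = a + b" "a \<in> Poly_Mapping.keys p" "b \<in> Poly_Mapping.keys q"
    using keys_mult[of p q] by auto
  ultimately show "i \<in> poly_vars p \<union> poly_vars q"
    using keys_add[of a b] by (auto simp: poly_vars_def)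
qed

text \<open>
  The converse passage to coordinates: the functions with a polynomial expression in a fixed basis
  contain the linear ones and are closed under the ring operations.
\<close>

lemma polyfuns_polynomial:
  assumes "F \<in> polyfuns A" and A: "group A" and \<phi>: "\<phi> \<in> iso A (free_Abelian_group {..<m::nat})"
  shows "\<exists>p. poly_vars p \<subseteq> {..<m} \<and>
    (\<forall>x\<in>carrier A. F x = poly_eval p (\<lambda>i. of_int (Poly_Mapping.lookup (\<phi> x) i)))"
  using assms(1)
proof (induction)
  case (const c)
  show ?case
    by (rule exI[of _ "Poly_Mapping.single 0 c"]) (auto simp: poly_vars_def poly_eval_single split: if_splits)
next
  case (linear l)
  let ?inv = "inv_into (carrier A) \<phi>"
  have l: "l \<circ> ?inv \<in> hom (free_Abelian_group {..<m}) integer_group"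
    by (rule hom_compose[OF _ linear]) (use iso_inv_into[OF \<phi> A] in \<open>auto simp: iso_def\<close>)
  let ?p = "\<Sum>j<m. Poly_Mapping.single (Poly_Mapping.single j (1::nat)) (of_int (l (?inv (frag_of j))) :: rat)"
  have "poly_vars ?p \<subseteq> {..<m}"
  proof -
    have "Poly_Mapping.keys ?p \<subseteq> (\<Union>j<m. {Poly_Mapping.single j 1})"
      by (rule order.trans[OF keys_sum]) (auto split: if_splits)
    then show ?thesis by (auto simp: poly_vars_def dest!: subsetD)
  qed
  moreover have "of_int (l x) = poly_eval ?p (\<lambda>i. of_int (Poly_Mapping.lookup (\<phi> x) i))"
    if "x \<in> carrier A" for x
  proof -
    have "l x = (l \<circ> ?inv) (\<phi> x)" using iso_inv_cancel(1)[OF \<phi> that] by simp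
    also have "\<dots> = (\<Sum>j<m. Poly_Mapping.lookup (\<phi> x) j * (l \<circ> ?inv) (frag_of j))"
      by (rule functional_expand[OF l]) (use iso_inv_cancel(3)[OF \<phi> that] in auto)
    finally show ?thesis
      by (simp add: poly_eval_sum poly_eval_single mult.commute)
  qed
  ultimately show ?case by blast
next
  case (add F G)
  then obtain p q where "poly_vars p \<subseteq> {..<m}" "poly_vars q \<subseteq> {..<m}"
    "\<forall>x\<in>carrier A. F x = poly_eval p (\<lambda>i. of_int (Poly_Mapping.lookup (\<phi> x) i))"
    "\<forall>x\<in>carrier A. G x = poly_eval q (\<lambda>i. of_int (Poly_Mapping.lookup (\<phi> x) i))" by blast
  then show ?case
    by (intro exI[of _ "p + q"]) (use poly_vars_add[of p q] in \<open>auto simp: poly_eval_add\<close>)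
next
  case (mult F G)
  then obtain p q where "poly_vars p \<subseteq> {..<m}" "poly_vars q \<subseteq> {..<m}"
    "\<forall>x\<in>carrier A. F x = poly_eval p (\<lambda>i. of_int (Poly_Mapping.lookup (\<phi> x) i))"
    "\<forall>x\<in>carrier A. G x = poly_eval q (\<lambda>i. of_int (Poly_Mapping.lookup (\<phi> x) i))" by blast
  then show ?case
    by (intro exI[of _ "p * q"]) (use poly_vars_mult[of p q] in \<open>auto simp: poly_eval_mult\<close>)
next
  case (cong F G)
  then show ?case by auto
qed

lemma fg_free_iso:
  assumes "fg_free_abelian A"
  obtains m \<phi> where "\<phi> \<in> iso A (free_Abelian_group {..<m::nat})"
  using assms by (auto simp: fg_free_abelian_def is_iso_def)

lemma fg_free_group: "fg_free_abelian A \<Longrightarrow> comm_group A" "fg_free_abelian A \<Longrightarrow> group A"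
  by (auto simp: fg_free_abelian_def comm_group_def)

text \<open>
  Together with \<open>numerical_regularD\<close> this characterises numerical functions by their composites with
  homomorphisms to the integers; from here on polynomials no longer appear explicitly.
\<close>

lemma regular_numerical:
  assumes A: "fg_free_abelian A" and B: "fg_free_abelian B"
    and f: "regular (carrier A) (polyfuns A) B f"
  shows "numerical A B f"
proof -
  obtain m \<phi> where \<phi>: "\<phi> \<in> iso A (free_Abelian_group {..<m::nat})" using fg_free_iso[OF A] .
  obtain n \<psi> where \<psi>: "\<psi> \<in> iso B (free_Abelian_group {..<n::nat})" using fg_free_iso[OF B] .
  have "\<exists>p. poly_vars p \<subseteq> {..<m} \<and> (\<forall>x\<in>carrier A. of_int (Poly_Mapping.lookup (\<psi> (f x)) j) =
              poly_eval p (\<lambda>i. of_int (Poly_Mapping.lookup (\<phi> x) i)))" for j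
  proof -
    have "(\<lambda>x. of_int (Poly_Mapping.lookup (\<psi> (f x)) j)) \<in> polyfuns A"
      using regular_functional[OF regular_hom[OF f] lookup_hom] \<psi> by (auto simp: iso_def)
    from polyfuns_polynomial[OF this fg_free_group(2)[OF A] \<phi>] show ?thesis .
  qed
  moreover have "f \<in> carrier A \<rightarrow> carrier B" using f by (simp add: regular_def)
  ultimately show ?thesis unfolding numerical_def using \<phi> \<psi> by blast
qed

lemma fg_free_integer_group: "fg_free_abelian integer_group"
proof -
  have "integer_group \<cong> free_Abelian_group {..<1::nat}"
    using isomorphic_group_integer_free_Abelian_group_singleton[of "0::nat"] by (simp add: lessThan_Suc)
  then show ?thesis by (auto simp: fg_free_abelian_def abelian_integer_group)
qed

lemma regular_integer:
  assumes "rat_algebra S R"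
  shows "regular S R integer_group u \<longleftrightarrow> (\<lambda>x. of_int (u x)) \<in> R"
proof
  assume "regular S R integer_group u"
  moreover have "(\<lambda>x. x) \<in> hom integer_group integer_group" by (simp add: hom_def)
  ultimately show "(\<lambda>x. of_int (u x)) \<in> R" using regular_functional by blast
next
  assume u: "(\<lambda>x. of_int (u x)) \<in> R"
  have "(\<lambda>x. of_int (l (u x))) \<in> R" if l: "l \<in> hom integer_group integer_group" for l
  proof -
    interpret group_hom integer_group integer_group l
      using l by (simp add: group_hom_def group_hom_axioms_def)
    have "l k = k * l 1" for k :: int
      using hom_int_pow[of 1 k] by simp
    then have "(\<lambda>x. of_int (l (u x))) = (\<lambda>x. of_int (l 1) * (of_int (u x) :: rat))"
      by (metis mult.commute of_int_mult)
    then show ?thesis using rat_algebra_cmul[OF assms u] by simp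
  qed
  then show "regular S R integer_group u" by (simp add: regular_def)
qed

section \<open>Splitting kernels of homomorphisms to the integers\<close>

text \<open>
  The image of \<open>\<phi>\<close> is generated by some \<open>g = \<phi> a0\<close>, so \<open>a \<mapsto> a - (\<phi> a / g) a0\<close> is a retraction of the
  group onto the kernel of \<open>\<phi>\<close>, with which \<open>f\<close> can be composed.
\<close>

lemma (in comm_group) hom_extends_from_functional_kernel:
  assumes G: "comm_group G'" and \<phi>: "\<phi> \<in> hom G integer_group"
    and f: "f \<in> hom (G\<lparr>carrier := {a \<in> carrier G. \<phi> a = 0}\<rparr>) G'"
  shows "\<exists>F\<in>hom G G'. \<forall>a\<in>carrier G. \<phi> a = 0 \<longrightarrow> F a = f a"
proof (cases "\<forall>a\<in>carrier G. \<phi> a = 0")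
  case True
  then have "{a \<in> carrier G. \<phi> a = 0} = carrier G" by auto
  then show ?thesis using f by auto
next
  case False
  have gG: "group G" by (rule is_group)
  then interpret p: group_hom G integer_group \<phi>
    using \<phi> by (simp add: group_hom_def group_hom_axioms_def)
  have pm: "\<phi> (a \<otimes> b) = \<phi> a + \<phi> b" if "a \<in> carrier G" "b \<in> carrier G" for a b
    using functional_mult[OF \<phi> that] .
  obtain a1 where a1: "a1 \<in> carrier G" "\<phi> a1 \<noteq> 0" using False by auto
  define P where "P k \<longleftrightarrow> k > 0 \<and> (\<exists>a\<in>carrier G. \<phi> a = int k)" for k :: nat
  have "\<exists>a\<in>carrier G. \<phi> a = \<bar>\<phi> a1\<bar>"
  proof (cases "\<phi> a1 > 0")
    case True then show ?thesis using a1 by (intro bexI[of _ a1]) simp_all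
  next
    case False
    then show ?thesis using a1 functional_inv[OF \<phi> gG a1(1)] by (intro bexI[of _ "inv a1"]) simp_all
  qed
  then have "P (nat \<bar>\<phi> a1\<bar>)" using a1(2) unfolding P_def by simp
  then have Pg: "P (LEAST k. P k)" by (rule LeastI)
  define g where "g = int (LEAST k. P k)"
  obtain a0 where a0: "a0 \<in> carrier G" "\<phi> a0 = g" and g: "g > 0" using Pg unfolding P_def g_def by auto
  define r where "r a = a \<otimes> a0 [^] (- (\<phi> a div g))" for a
  have rc: "r a \<in> carrier G" if "a \<in> carrier G" for a using that a0 by (simp add: r_def)
  have pr: "\<phi> (r a) = \<phi> a mod g" if "a \<in> carrier G" for a
  proof -
    have "\<phi> (r a) = \<phi> a + \<phi> (a0 [^] (- (\<phi> a div g)))"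
      unfolding r_def by (rule pm[OF that int_pow_closed[OF a0(1)]])
    also have "\<phi> (a0 [^] (- (\<phi> a div g))) = - (\<phi> a div g) * g"
      using p.hom_int_pow[OF a0(1)] a0(2) by simp
    finally show ?thesis using minus_div_mult_eq_mod[of "\<phi> a" g] by linarith
  qed
  have pr0: "\<phi> (r a) = 0" if a: "a \<in> carrier G" for a
  proof (rule ccontr)
    assume "\<phi> (r a) \<noteq> 0"
    then have "\<phi> a mod g > 0" using pr[OF a] pos_mod_sign[OF g, of "\<phi> a"] by linarith
    then have "P (nat (\<phi> a mod g))"
      unfolding P_def using pr[OF a] by (intro conjI bexI[OF _ rc[OF a]]) simp_all
    then have "(LEAST k. P k) \<le> nat (\<phi> a mod g)" by (rule Least_le)
    then have "g \<le> \<phi> a mod g" using \<open>\<phi> a mod g > 0\<close> by (simp add: g_def)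
    then show False using pos_mod_bound[OF g, of "\<phi> a"] by simp
  qed
  have dv: "g dvd \<phi> a" if a: "a \<in> carrier G" for a using pr[OF a] pr0[OF a] by (simp add: dvd_eq_mod_eq_0)
  have rm: "r (a \<otimes> b) = r a \<otimes> r b" if a: "a \<in> carrier G" and b: "b \<in> carrier G" for a b
  proof -
    have e: "- (\<phi> (a \<otimes> b) div g) = - (\<phi> a div g) + - (\<phi> b div g)"
      using div_add[OF dv[OF a] dv[OF b]] by (simp add: pm[OF a b])
    define s t where "s = a0 [^] (- (\<phi> a div g))" and "t = a0 [^] (- (\<phi> b div g))"
    have "a0 [^] (- (\<phi> (a \<otimes> b) div g)) = s \<otimes> t"
      unfolding e s_def t_def by (rule int_pow_mult[OF a0(1)])
    moreover have "s \<in> carrier G" "t \<in> carrier G" using a0 by (simp_all add: s_def t_def)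
    ultimately show ?thesis unfolding r_def s_def[symmetric] t_def[symmetric]
      using a b by (simp add: m_ac)
  qed
  have ra: "r a = a" if "a \<in> carrier G" "\<phi> a = 0" for a using that a0 by (simp add: r_def)
  show ?thesis
  proof (intro bexI[of _ "f \<circ> r"] ballI impI)
    show "f \<circ> r \<in> hom G G'"
      using f rc pr0 by (auto simp: hom_def rm)
  qed (simp add: ra)
qed

lemma (in comm_group) comm_group_subgroup:
  assumes "subgroup H G" shows "comm_group (G\<lparr>carrier := H\<rparr>)"
  by (rule group.group_comm_groupI[OF subgroup_imp_group[OF assms]])
    (use subgroup.mem_carrier[OF assms] in \<open>simp add: m_comm\<close>)

text \<open>
  Used with three targets: the integers, to extend functionals from \<open>\<Gamma>(M)\<^sub>n\<close> to a product; the kernel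
  itself, to split it off; and a second free group, to extend sections of a differential.
\<close>

lemma hom_extends_from_common_kernel:
  assumes "finite \<Phi>" and A: "comm_group A" and G: "comm_group G" and "\<Phi> \<subseteq> hom A integer_group"
    and "f \<in> hom (A\<lparr>carrier := {a \<in> carrier A. \<forall>\<phi>\<in>\<Phi>. \<phi> a = 0}\<rparr>) G"
  shows "\<exists>F\<in>hom A G. \<forall>a\<in>carrier A. (\<forall>\<phi>\<in>\<Phi>. \<phi> a = 0) \<longrightarrow> F a = f a"
  using assms(1,4,5)
proof (induction \<Phi> arbitrary: f)
  case empty
  then show ?case by auto
next
  case (insert \<phi> \<Phi>)
  interpret A: comm_group A by (rule A)
  let ?H = "{a \<in> carrier A. \<forall>\<phi>\<in>\<Phi>. \<phi> a = 0}"
  have sub: "subgroup ?H A"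
    using insert.prems(1) A.is_group
    by unfold_locales (auto simp: functional_mult functional_one functional_inv subset_iff)
  then have "comm_group (A\<lparr>carrier := ?H\<rparr>)" by (rule A.comm_group_subgroup)
  then interpret H: comm_group "A\<lparr>carrier := ?H\<rparr>" .
  have ph: "\<phi> \<in> hom (A\<lparr>carrier := ?H\<rparr>) integer_group"
    using insert.prems(1) by (auto simp: hom_def)
  have "{a \<in> ?H. \<phi> a = 0} = {a \<in> carrier A. \<forall>\<psi>\<in>insert \<phi> \<Phi>. \<psi> a = 0}" by auto
  then have f': "f \<in> hom (A\<lparr>carrier := ?H\<rparr>\<lparr>carrier := {a \<in> carrier (A\<lparr>carrier := ?H\<rparr>). \<phi> a = 0}\<rparr>) G"
    using insert.prems(2) by simp
  obtain F1 where F1: "F1 \<in> hom (A\<lparr>carrier := ?H\<rparr>) G" "\<forall>a\<in>?H. \<phi> a = 0 \<longrightarrow> F1 a = f a"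
    using H.hom_extends_from_functional_kernel[OF G ph f'] by auto
  obtain F where "F \<in> hom A G" "\<forall>a\<in>carrier A. (\<forall>\<phi>\<in>\<Phi>. \<phi> a = 0) \<longrightarrow> F a = F1 a"
    using insert.IH[OF _ F1(1)] insert.prems(1) by auto
  then show ?case using F1(2) by (intro bexI[of _ F]) auto
qed

abbreviation zfree :: "nat \<Rightarrow> zvec monoid" where
  "zfree m \<equiv> free_Abelian_group {..<m}"

abbreviation vecs :: "nat \<Rightarrow> zvec set" where
  "vecs m \<equiv> carrier (zfree m)"

lemma vecs_add: "u \<in> vecs m \<Longrightarrow> v \<in> vecs m \<Longrightarrow> u + v \<in> vecs m"
  using keys_add[of u v] by fastforce

lemma vecs_minus: "u \<in> vecs m \<Longrightarrow> - u \<in> vecs m"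
  by simp

lemma vecs_diff: "u \<in> vecs m \<Longrightarrow> v \<in> vecs m \<Longrightarrow> u - v \<in> vecs m"
  using keys_diff[of u v] by fastforce

lemma vecs_zero: "0 \<in> vecs m"
  by simp

lemma vecs_cmul: "u \<in> vecs m \<Longrightarrow> frag_cmul c u \<in> vecs m"
  using keys_cmul[of c u] by fastforce

lemma vecs_sum: "(\<And>i. i \<in> I \<Longrightarrow> u i \<in> vecs m) \<Longrightarrow> (\<Sum>i\<in>I. u i) \<in> vecs m"
  by (rule sum_closed_free_Abelian_group)

lemma zhom_closed: "f \<in> hom (zfree m) (zfree n) \<Longrightarrow> u \<in> vecs m \<Longrightarrow> f u \<in> vecs n"
  by (rule hom_in_carrier)

lemma zhom_add: "f \<in> hom (zfree m) (zfree n) \<Longrightarrow> u \<in> vecs m \<Longrightarrow> v \<in> vecs m \<Longrightarrow> f (u + v) = f u + f v"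
  by (rule hom_frag_add) simp_all

lemma zhom_diff: "f \<in> hom (zfree m) (zfree n) \<Longrightarrow> u \<in> vecs m \<Longrightarrow> v \<in> vecs m \<Longrightarrow> f (u - v) = f u - f v"
  by (rule hom_frag_diff) simp_all

lemma zhom_minus: "f \<in> hom (zfree m) (zfree n) \<Longrightarrow> u \<in> vecs m \<Longrightarrow> f (- u) = - f u"
  by (rule hom_frag_minus) simp_all

lemma zhom_zero: "f \<in> hom (zfree m) (zfree n) \<Longrightarrow> f 0 = 0"
  using zhom_diff[OF _ vecs_zero vecs_zero, of f m n] by simp

lemma zhom_sum:
  assumes "f \<in> hom (zfree m) (zfree n)" "\<And>i. i \<in> I \<Longrightarrow> u i \<in> vecs m"
  shows "f (\<Sum>i\<in>I. u i) = (\<Sum>i\<in>I. f (u i))"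
  using assms(2)
proof (induction I rule: infinite_finite_induct)
  case (insert i I)
  have "(\<Sum>i\<in>I. u i) \<in> vecs m" using insert.prems by (intro vecs_sum) auto
  then show ?case using insert zhom_add[OF assms(1), of "u i" "\<Sum>i\<in>I. u i"] by simp
qed (simp_all add: zhom_zero[OF assms(1)])

lemma zhom_sign:
  assumes "f \<in> hom (zfree m) (zfree n)" "u \<in> vecs m"
  shows "f (frag_cmul ((-1) ^ k) u) = frag_cmul ((-1) ^ k) (f u)"
  by (cases "even k") (use zhom_minus[OF assms] in simp_all)

lemma zhom_of_functions:
  assumes "\<And>u. u \<in> vecs m \<Longrightarrow> f u \<in> vecs n" "\<And>u v. u \<in> vecs m \<Longrightarrow> v \<in> vecs m \<Longrightarrow> f (u + v) = f u + f v"
  shows "f \<in> hom (zfree m) (zfree n)"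
  by (rule homI) (simp_all only: assms mult_free_Abelian_group)

lemma zhom_kernel_functionals:
  assumes "D \<in> hom (zfree m) (zfree n)"
  obtains \<Phi> where "finite \<Phi>" "\<Phi> \<subseteq> hom (zfree m) integer_group"
    "\<And>a. a \<in> vecs m \<Longrightarrow> (\<forall>\<phi>\<in>\<Phi>. \<phi> a = 0) \<longleftrightarrow> D a = 0"
proof
  let ?F = "(\<lambda>j a. Poly_Mapping.lookup (D a) j) ` {..<n}"
  show "finite ?F" by simp
  show "?F \<subseteq> hom (zfree m) integer_group"
    using hom_compose[OF assms lookup_hom] by (auto simp: o_def)
  fix a assume a: "a \<in> vecs m"
  have "Poly_Mapping.lookup (D a) j = 0" if "j \<ge> n" for j
    using zhom_closed[OF assms a] that by (auto simp: in_keys_iff subset_iff)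
  then have "D a = 0 \<longleftrightarrow> (\<forall>j<n. Poly_Mapping.lookup (D a) j = 0)"
    by (metis linorder_not_le lookup_zero poly_mapping_eqI)
  then show "(\<forall>\<phi>\<in>?F. \<phi> a = 0) \<longleftrightarrow> D a = 0" by auto
qed

lemma zhom_kernel_extension:
  assumes D: "D \<in> hom (zfree m) (zfree n)"
    and f: "\<And>u. u \<in> vecs m \<Longrightarrow> D u = 0 \<Longrightarrow> f u \<in> vecs k"
      "\<And>u v. u \<in> vecs m \<Longrightarrow> D u = 0 \<Longrightarrow> v \<in> vecs m \<Longrightarrow> D v = 0 \<Longrightarrow> f (u + v) = f u + f v"
  shows "\<exists>F\<in>hom (zfree m) (zfree k). \<forall>u\<in>vecs m. D u = 0 \<longrightarrow> F u = f u"
proof -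
  obtain \<Phi> where \<Phi>: "finite \<Phi>" "\<Phi> \<subseteq> hom (zfree m) integer_group"
    "\<And>a. a \<in> vecs m \<Longrightarrow> (\<forall>\<phi>\<in>\<Phi>. \<phi> a = 0) \<longleftrightarrow> D a = 0"
    using zhom_kernel_functionals[OF D] by metis
  have "{a \<in> vecs m. \<forall>\<phi>\<in>\<Phi>. \<phi> a = 0} = {a \<in> vecs m. D a = 0}" using \<Phi>(3) by blast
  then have "f \<in> hom (zfree m\<lparr>carrier := {a \<in> vecs m. \<forall>\<phi>\<in>\<Phi>. \<phi> a = 0}\<rparr>) (zfree k)"
    using f by (auto simp: hom_def simp del: carrier_free_Abelian_group_iff)
  from hom_extends_from_common_kernel[OF \<Phi>(1) abelian_free_Abelian_group abelian_free_Abelian_group \<Phi>(2) this]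
  show ?thesis using \<Phi>(3) by blast
qed

text \<open>
  The difference of the identity and a retraction onto the kernel; it picks preimages under \<open>D\<close>
  additively.
\<close>

lemma zhom_complement_projection:
  assumes D: "D \<in> hom (zfree m) (zfree n)"
  obtains \<pi> where "\<pi> \<in> hom (zfree m) (zfree m)"
    "\<And>a. a \<in> vecs m \<Longrightarrow> D a = 0 \<Longrightarrow> \<pi> a = 0" "\<And>a. a \<in> vecs m \<Longrightarrow> D (\<pi> a) = D a"
proof -
  obtain \<Phi> where \<Phi>: "finite \<Phi>" "\<Phi> \<subseteq> hom (zfree m) integer_group"
    "\<And>a. a \<in> vecs m \<Longrightarrow> (\<forall>\<phi>\<in>\<Phi>. \<phi> a = 0) \<longleftrightarrow> D a = 0"
    using zhom_kernel_functionals[OF D] by metis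
  have H: "{a \<in> vecs m. \<forall>\<phi>\<in>\<Phi>. \<phi> a = 0} = {a \<in> vecs m. D a = 0}" using \<Phi>(3) by blast
  let ?H = "zfree m\<lparr>carrier := {a \<in> vecs m. D a = 0}\<rparr>"
  have sub: "subgroup {a \<in> vecs m. D a = 0} (zfree m)"
    using vecs_add vecs_minus vecs_zero
    by unfold_locales
      (auto simp: zhom_add[OF D] zhom_zero[OF D] zhom_minus[OF D] vecs_zero simp del: carrier_free_Abelian_group_iff
        simp: inv_free_Abelian_group[unfolded carrier_free_Abelian_group_iff[symmetric]])
  then have "comm_group ?H" by (rule comm_group.comm_group_subgroup[OF abelian_free_Abelian_group])
  moreover have "(\<lambda>a. a) \<in> hom (zfree m\<lparr>carrier := {a \<in> vecs m. \<forall>\<phi>\<in>\<Phi>. \<phi> a = 0}\<rparr>) ?H"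
    unfolding H by (auto simp: hom_def)
  ultimately obtain \<kappa> where k: "\<kappa> \<in> hom (zfree m) ?H" "\<And>a. a \<in> vecs m \<Longrightarrow> D a = 0 \<Longrightarrow> \<kappa> a = a"
    using hom_extends_from_common_kernel[OF \<Phi>(1) abelian_free_Abelian_group _ \<Phi>(2), of ?H "\<lambda>a. a"] \<Phi>(3) by blast
  have kc: "\<kappa> a \<in> vecs m" "D (\<kappa> a) = 0" if "a \<in> vecs m" for a
    using k(1) that by (auto simp: hom_def Pi_iff simp del: carrier_free_Abelian_group_iff)
  have ka: "\<kappa> (a + b) = \<kappa> a + \<kappa> b" if "a \<in> vecs m" "b \<in> vecs m" for a b
    using k(1) that by (auto simp: hom_def simp del: carrier_free_Abelian_group_iff)
  show ?thesis
  proof (rule that[of "\<lambda>a. a - \<kappa> a"])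
    show "(\<lambda>a. a - \<kappa> a) \<in> hom (zfree m) (zfree m)"
      by (rule zhom_of_functions) (simp_all add: vecs_diff kc ka del: carrier_free_Abelian_group_iff)
    show "D (a - \<kappa> a) = D a" if "a \<in> vecs m" for a
      using zhom_diff[OF D that kc(1)[OF that]] kc(2)[OF that] by simp
  qed (simp add: k(2))
qed

lemma zhom_section:
  assumes D: "D \<in> hom (zfree m) (zfree n)" and D': "D' \<in> hom (zfree n) (zfree k)"
    and exact: "\<And>z. z \<in> vecs n \<Longrightarrow> D' z = 0 \<Longrightarrow> \<exists>a\<in>vecs m. D a = z"
  shows "\<exists>\<rho>\<in>hom (zfree n) (zfree m). \<forall>z\<in>vecs n. D' z = 0 \<longrightarrow> D (\<rho> z) = z"
proof -
  obtain \<pi> where \<pi>: "\<pi> \<in> hom (zfree m) (zfree m)"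
    "\<And>a. a \<in> vecs m \<Longrightarrow> D a = 0 \<Longrightarrow> \<pi> a = 0" "\<And>a. a \<in> vecs m \<Longrightarrow> D (\<pi> a) = D a"
    using zhom_complement_projection[OF D] by metis
  define c where "c z = (SOME a. a \<in> vecs m \<and> D a = z)" for z
  have c: "c z \<in> vecs m" "D (c z) = z" if "z \<in> vecs n" "D' z = 0" for z
    using someI_ex[of "\<lambda>a. a \<in> vecs m \<and> D a = z"] exact[OF that] unfolding c_def by blast+
  have ad: "\<pi> (c (u + v)) = \<pi> (c u) + \<pi> (c v)"
    if u: "u \<in> vecs n" "D' u = 0" and v: "v \<in> vecs n" "D' v = 0" for u v
  proof -
    have uv: "u + v \<in> vecs n" "D' (u + v) = 0"
      using u v zhom_add[OF D' u(1) v(1)] vecs_add by auto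
    have "D (c (u + v) - (c u + c v)) = 0"
      using c[OF u] c[OF v] c[OF uv] by (simp add: zhom_diff[OF D] zhom_add[OF D] vecs_add del: carrier_free_Abelian_group_iff)
    then have "\<pi> (c (u + v) - (c u + c v)) = 0"
      using c[OF u] c[OF v] c[OF uv] by (intro \<pi>(2)) (auto intro: vecs_diff vecs_add simp del: carrier_free_Abelian_group_iff)
    then show ?thesis
      using c[OF u] c[OF v] c[OF uv] by (simp add: zhom_diff[OF \<pi>(1)] zhom_add[OF \<pi>(1)] vecs_add del: carrier_free_Abelian_group_iff)
  qed
  have cl: "\<pi> (c u) \<in> vecs m" if "u \<in> vecs n" "D' u = 0" for u
    using zhom_closed[OF \<pi>(1) c(1)[OF that]] .
  obtain \<rho> where r: "\<rho> \<in> hom (zfree n) (zfree m)" "\<And>u. u \<in> vecs n \<Longrightarrow> D' u = 0 \<Longrightarrow> \<rho> u = \<pi> (c u)"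
    using zhom_kernel_extension[OF D' cl ad] by blast
  show ?thesis
  proof (intro bexI[OF _ r(1)] ballI impI)
    show "D (\<rho> z) = z" if "z \<in> vecs n" "D' z = 0" for z
      using r(2)[OF that] \<pi>(3)[OF c(1)[OF that]] c(2)[OF that] by simp
  qed
qed

section \<open>Relative cochains with regular values\<close>

lemma sset_face: "is_sset K \<Longrightarrow> i \<le> Suc n \<Longrightarrow> x \<in> simp K (Suc n) \<Longrightarrow> face K (Suc n) i x \<in> simp K n"
  by (rule funcset_mem[OF is_sset_def[THEN iffD1, THEN conjunct1, rule_format]])

lemma sset_degen: "is_sset K \<Longrightarrow> i \<le> n \<Longrightarrow> x \<in> simp K n \<Longrightarrow> degen K n i x \<in> simp K (Suc n)"
  by (rule funcset_mem[OF is_sset_def[THEN iffD1, THEN conjunct2, THEN conjunct1, rule_format]])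

lemma sset_face_face:
  "is_sset K \<Longrightarrow> x \<in> simp K (Suc (Suc n)) \<Longrightarrow> i < j \<Longrightarrow> j \<le> Suc (Suc n) \<Longrightarrow>
    face K (Suc n) i (face K (Suc (Suc n)) j x) = face K (Suc n) (j - 1) (face K (Suc (Suc n)) i x)"
  by (rule is_sset_def[THEN iffD1, THEN conjunct2, THEN conjunct2, THEN conjunct1, rule_format]) simp_all

lemma sset_degen_degen:
  "is_sset K \<Longrightarrow> x \<in> simp K n \<Longrightarrow> i \<le> j \<Longrightarrow> j \<le> n \<Longrightarrow>
    degen K (Suc n) i (degen K n j x) = degen K (Suc n) (Suc j) (degen K n i x)"
  by (rule is_sset_def[THEN iffD1, THEN conjunct2, THEN conjunct2, THEN conjunct2, THEN conjunct1, rule_format])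
    simp_all

lemma sset_face_degen:
  "is_sset K \<Longrightarrow> x \<in> simp K n \<Longrightarrow> i \<le> Suc n \<Longrightarrow> j \<le> n \<Longrightarrow>
    face K (Suc n) i (degen K n j x) =
          (if i < j then degen K (n - 1) (j - 1) (face K n i x)
           else if i = j \<or> i = Suc j then x
           else degen K (n - 1) j (face K n (i - 1) x))"
  by (rule is_sset_def[THEN iffD1, THEN conjunct2, THEN conjunct2, THEN conjunct2, THEN conjunct2, rule_format])
    simp_all

lemma sset_face_degen_same:
  "is_sset K \<Longrightarrow> x \<in> simp K n \<Longrightarrow> j \<le> n \<Longrightarrow> face K (Suc n) j (degen K n j x) = x"
  "is_sset K \<Longrightarrow> x \<in> simp K n \<Longrightarrow> j \<le> n \<Longrightarrow> face K (Suc n) (Suc j) (degen K n j x) = x"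
  by (simp_all add: sset_face_degen)

lemma sset_face_degen_less:
  "is_sset K \<Longrightarrow> x \<in> simp K (Suc n) \<Longrightarrow> i < j \<Longrightarrow> j \<le> Suc n \<Longrightarrow>
    face K (Suc (Suc n)) i (degen K (Suc n) j x) = degen K n (j - 1) (face K (Suc n) i x)"
  by (simp add: sset_face_degen)

lemma sset_face_degen_greater:
  "is_sset K \<Longrightarrow> x \<in> simp K (Suc n) \<Longrightarrow> Suc j < i \<Longrightarrow> i \<le> Suc (Suc n) \<Longrightarrow>
    face K (Suc (Suc n)) i (degen K (Suc n) j x) = degen K n j (face K (Suc n) (i - 1) x)"
  by (simp add: sset_face_degen)

text \<open>
  A ring of rational functions on the simplices of each degree, stable under the simplicial
  operators.  Cochains and maps are later required to be regular with respect to such a system;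
  on a product with an interval it can impose conditions on one end only.
\<close>

definition function_system :: "'k sset \<Rightarrow> (nat \<Rightarrow> ('k \<Rightarrow> rat) set) \<Rightarrow> bool" where
  "function_system K R \<longleftrightarrow> (\<forall>n. rat_algebra (simp K n) (R n)) \<and>
     (\<forall>n. \<forall>i\<le>Suc n. \<forall>F\<in>R n. (\<lambda>x. F (face K (Suc n) i x)) \<in> R (Suc n)) \<and>
     (\<forall>n. \<forall>i\<le>n. \<forall>F\<in>R (Suc n). (\<lambda>x. F (degen K n i x)) \<in> R n)"

lemma function_system_algebra: "function_system K R \<Longrightarrow> rat_algebra (simp K n) (R n)"
  by (simp add: function_system_def)

lemma function_system_face: "function_system K R \<Longrightarrow> i \<le> Suc n \<Longrightarrow> F \<in> R n \<Longrightarrow>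
    (\<lambda>x. F (face K (Suc n) i x)) \<in> R (Suc n)"
  by (simp add: function_system_def)

lemma function_system_degen: "function_system K R \<Longrightarrow> i \<le> n \<Longrightarrow> F \<in> R (Suc n) \<Longrightarrow>
    (\<lambda>x. F (degen K n i x)) \<in> R n"
  by (simp add: function_system_def)

lemma function_system_UNIV: "function_system K (\<lambda>_. UNIV)"
  by (simp add: function_system_def rat_algebra_UNIV)

definition subcomplex :: "'k sset \<Rightarrow> (nat \<Rightarrow> 'k set) \<Rightarrow> bool" where
  "subcomplex K L \<longleftrightarrow> (\<forall>n. L n \<subseteq> simp K n) \<and>
     (\<forall>n. \<forall>i\<le>Suc n. \<forall>x\<in>L (Suc n). face K (Suc n) i x \<in> L n) \<and>
     (\<forall>n. \<forall>i\<le>n. \<forall>x\<in>L n. degen K n i x \<in> L (Suc n))"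

lemma subcomplex_subset: "subcomplex K L \<Longrightarrow> x \<in> L n \<Longrightarrow> x \<in> simp K n"
  by (auto simp: subcomplex_def)

lemma subcomplex_face: "subcomplex K L \<Longrightarrow> i \<le> Suc n \<Longrightarrow> x \<in> L (Suc n) \<Longrightarrow> face K (Suc n) i x \<in> L n"
  by (simp add: subcomplex_def)

lemma subcomplex_degen: "subcomplex K L \<Longrightarrow> i \<le> n \<Longrightarrow> x \<in> L n \<Longrightarrow> degen K n i x \<in> L (Suc n)"
  by (simp add: subcomplex_def)

text \<open>
  Because of this, extending a normalised cochain on \<open>L\<close> by zero gives a normalised cochain.
\<close>

lemma subcomplex_degen_iff:
  assumes "is_sset K" "subcomplex K L" "i \<le> n" "x \<in> simp K n"
  shows "degen K n i x \<in> L (Suc n) \<longleftrightarrow> x \<in> L n"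
proof
  assume "degen K n i x \<in> L (Suc n)"
  then have "face K (Suc n) i (degen K n i x) \<in> L n"
    using assms(3) by (intro subcomplex_face[OF assms(2)]) auto
  then show "x \<in> L n" using assms by (simp add: sset_face_degen_same)
qed (rule subcomplex_degen[OF assms(2,3)])

text \<open>
  Here \<open>v\<close> is a cochain of degree \<open>n - 1\<close>.  The value 0 in degree 0 lets statements about primitives
  cover that degree, in which they assert that a cocycle vanishes.
\<close>

definition cob :: "'k sset \<Rightarrow> nat \<Rightarrow> ('k \<Rightarrow> int) \<Rightarrow> 'k \<Rightarrow> int" where
  "cob K n v x = (if n = 0 then 0 else \<Sum>i\<le>n. (-1) ^ i * v (face K n i x))"

lemma cob_Suc: "cob K (Suc n) v x = (\<Sum>i\<le>Suc n. (-1) ^ i * v (face K (Suc n) i x))"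
  by (simp add: cob_def)

lemma cob_add: "cob K n (\<lambda>x. u x + v x) x = cob K n u x + cob K n v x"
  and cob_diff: "cob K n (\<lambda>x. u x - v x) x = cob K n u x - cob K n v x"
  and cob_minus: "cob K n (\<lambda>x. - u x) x = - cob K n u x"
  and cob_zero: "cob K n (\<lambda>x. 0) x = 0"
  by (simp_all add: cob_def distrib_left right_diff_distrib sum.distrib sum_subtractf sum_negf)

lemma cob_cong:
  assumes "is_sset K" "x \<in> simp K n" "\<And>y. n > 0 \<Longrightarrow> y \<in> simp K (n - 1) \<Longrightarrow> u y = v y"
  shows "cob K n u x = cob K n v x"
proof (cases n)
  case (Suc m)
  then show ?thesis using assms sset_face[OF assms(1)]
    unfolding Suc cob_Suc by (intro sum.cong refl) simp
qed (simp add: cob_def)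

text \<open>
  The identity \<open>\<partial>\<^sub>i \<partial>\<^sub>j = \<partial>\<^sub>j\<^sub>-\<^sub>1 \<partial>\<^sub>i\<close> for \<open>i < j\<close> matches the terms with \<open>i < j\<close> with those with \<open>j \<le> i\<close>,
  with opposite signs.
\<close>

lemma cob_cob:
  assumes K: "is_sset K" and x: "x \<in> simp K (Suc (Suc n))"
  shows "cob K (Suc (Suc n)) (cob K (Suc n) u) x = 0"
proof -
  define t where "t j i = (-1) ^ (j + i) * u (face K (Suc n) i (face K (Suc (Suc n)) j x))" for j i
  let ?A1 = "{(j, i). j \<le> Suc (Suc n) \<and> i < j}" and ?A2 = "{(j, i). i \<le> Suc n \<and> j \<le> i}"
  have fin: "finite ?A1" "finite ?A2"
    by (rule finite_subset[of _ "{..Suc (Suc n)} \<times> {..Suc (Suc n)}"]; auto)+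
  have "cob K (Suc (Suc n)) (cob K (Suc n) u) x = (\<Sum>(j, i)\<in>{..Suc (Suc n)} \<times> {..Suc n}. t j i)"
    unfolding cob_Suc sum_distrib_left sum.cartesian_product
    by (intro sum.cong refl) (auto simp: power_add t_def)
  also have "{..Suc (Suc n)} \<times> {..Suc n} = ?A1 \<union> ?A2" by auto
  also have "(\<Sum>(j, i)\<in>?A1 \<union> ?A2. t j i) = (\<Sum>(j, i)\<in>?A1. t j i) + (\<Sum>(j, i)\<in>?A2. t j i)"
    by (rule sum.union_disjoint[OF fin]) auto
  also have "(\<Sum>(j, i)\<in>?A1. t j i) = (\<Sum>(j, i)\<in>?A2. - t j i)"
  proof (rule sum.reindex_bij_witness[of _ "\<lambda>(j, i). (Suc i, j)" "\<lambda>(j, i). (i, j - 1)"])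
    fix p assume p: "p \<in> ?A1"
    obtain j' i where p': "p = (j', i)" by (rule prod.exhaust)
    define j where "j = j' - 1"
    have ji: "j \<le> Suc n" "i \<le> j" "j' = Suc j" using p by (auto simp: p' j_def)
    have "t (Suc j) i = - t i j"
      using sset_face_face[OF K x, of i "Suc j"] ji unfolding t_def by (simp add: add.commute)
    then show "(case case p of (j, i) \<Rightarrow> (i, j - 1) of (j, i) \<Rightarrow> - t j i) = (case p of (j, i) \<Rightarrow> t j i)"
      by (simp add: p' ji(3))
  qed auto
  also have "\<dots> = - (\<Sum>(j, i)\<in>?A2. t j i)"
    unfolding split_def by (rule sum_negf)
  finally show ?thesis by simp
qed

definition rel_cochain ::
    "'k sset \<Rightarrow> (nat \<Rightarrow> 'k set) \<Rightarrow> (nat \<Rightarrow> ('k \<Rightarrow> rat) set) \<Rightarrow> nat \<Rightarrow> ('k \<Rightarrow> int) \<Rightarrow> bool" where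
  "rel_cochain K L R n u \<longleftrightarrow> (\<lambda>x. of_int (u x)) \<in> R n \<and> (\<forall>x\<in>L n. u x = 0) \<and>
     (\<forall>m i. n = Suc m \<and> i \<le> m \<longrightarrow> (\<forall>x\<in>simp K m. u (degen K m i x) = 0))"

lemma rel_cochainI:
  assumes "(\<lambda>x. of_int (u x)) \<in> R n" "\<And>x. x \<in> L n \<Longrightarrow> u x = 0"
    "\<And>m i x. n = Suc m \<Longrightarrow> i \<le> m \<Longrightarrow> x \<in> simp K m \<Longrightarrow> u (degen K m i x) = 0"
  shows "rel_cochain K L R n u"
  using assms by (simp add: rel_cochain_def)

lemma rel_cochain_regular: "rel_cochain K L R n u \<Longrightarrow> (\<lambda>x. of_int (u x)) \<in> R n"
  and rel_cochain_sub: "rel_cochain K L R n u \<Longrightarrow> x \<in> L n \<Longrightarrow> u x = 0"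
  and rel_cochain_degen: "rel_cochain K L R (Suc m) u \<Longrightarrow> i \<le> m \<Longrightarrow> x \<in> simp K m \<Longrightarrow> u (degen K m i x) = 0"
  by (simp_all add: rel_cochain_def)

lemma rel_cochain_UNIV: "rel_cochain K L R n u \<Longrightarrow> rel_cochain K L (\<lambda>_. UNIV) n u"
  by (simp add: rel_cochain_def)

lemma rel_cochain_add:
  assumes "function_system K R" "rel_cochain K L R n u" "rel_cochain K L R n v"
  shows "rel_cochain K L R n (\<lambda>x. u x + v x)"
  using assms(2,3) rat_algebra_add[OF function_system_algebra[OF assms(1)]]
  by (simp add: rel_cochain_def)

lemma rel_cochain_minus:
  assumes "function_system K R" "rel_cochain K L R n u"
  shows "rel_cochain K L R n (\<lambda>x. - u x)"
  using assms(2) rat_algebra_uminus[OF function_system_algebra[OF assms(1)]]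
  by (simp add: rel_cochain_def)

lemma rel_cochain_diff:
  assumes "function_system K R" "rel_cochain K L R n u" "rel_cochain K L R n v"
  shows "rel_cochain K L R n (\<lambda>x. u x - v x)"
  using rel_cochain_add[OF assms(1,2) rel_cochain_minus[OF assms(1,3)]] by simp

lemma rel_cochain_zero:
  assumes "function_system K R"
  shows "rel_cochain K L R n (\<lambda>x. 0)"
  using rat_algebra_const[OF function_system_algebra[OF assms(1)], of 0] by (simp add: rel_cochain_def)

lemma rel_cochain_sum_cmul:
  assumes "function_system K R" "\<And>i. i \<in> I \<Longrightarrow> rel_cochain K L R n (u i)"
  shows "rel_cochain K L R n (\<lambda>x. \<Sum>i\<in>I. u i x * c i)"
proof (rule rel_cochainI)
  note alg = function_system_algebra[OF assms(1)]
  have "(\<lambda>x. \<Sum>i\<in>I. of_int (c i) * of_int (u i x)) \<in> R n"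
    by (intro rat_algebra_sum[OF alg] rat_algebra_cmul[OF alg] rel_cochain_regular[OF assms(2)])
  then show "(\<lambda>x. of_int (\<Sum>i\<in>I. u i x * c i)) \<in> R n" by (simp add: mult.commute)
qed (use assms(2) in \<open>auto simp: rel_cochain_def intro!: sum.neutral\<close>)

lemma rel_cochain_cong:
  assumes K: "is_sset K" and R: "function_system K R" and L: "subcomplex K L" and u: "rel_cochain K L R n u"
    and uv: "\<And>x. x \<in> simp K n \<Longrightarrow> u x = v x"
  shows "rel_cochain K L R n v"
proof (rule rel_cochainI)
  show "(\<lambda>x. of_int (v x)) \<in> R n"
    by (rule rat_algebra_cong[OF function_system_algebra[OF R] rel_cochain_regular[OF u]]) (simp add: uv)
  show "v x = 0" if "x \<in> L n" for x
    using rel_cochain_sub[OF u that] uv[OF subcomplex_subset[OF L that]] by simp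
  show "v (degen K m i x) = 0" if "n = Suc m" "i \<le> m" "x \<in> simp K m" for m i x
    using rel_cochain_degen[of K L R m u i x] u that uv[of "degen K m i x"] sset_degen[OF K that(2,3)] by simp
qed

lemma rel_cochain_cob:
  assumes K: "is_sset K" and R: "function_system K R" and L: "subcomplex K L" and u: "rel_cochain K L R n u"
  shows "rel_cochain K L R (Suc n) (cob K (Suc n) u)"
proof (rule rel_cochainI)
  note alg = function_system_algebra[OF R]
  have "(\<lambda>x. \<Sum>i\<le>Suc n. (-1) ^ i * of_int (u (face K (Suc n) i x))) \<in> R (Suc n)"
    by (intro rat_algebra_sum[OF alg] rat_algebra_cmul[OF alg] function_system_face[OF R] rel_cochain_regular[OF u]) auto
  then show "(\<lambda>x. of_int (cob K (Suc n) u x)) \<in> R (Suc n)" by (simp add: cob_Suc)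
next
  fix x assume "x \<in> L (Suc n)"
  then show "cob K (Suc n) u x = 0"
    unfolding cob_Suc by (intro sum.neutral) (simp add: rel_cochain_sub[OF u] subcomplex_face[OF L])
next
  fix m i x assume "Suc n = Suc m" and i: "i \<le> m" and x: "x \<in> simp K m"
  then have m: "m = n" by simp
  let ?t = "\<lambda>k. (-1) ^ k * u (face K (Suc n) k (degen K n i x))"
  have z: "?t k = 0" if k: "k \<le> Suc n" "k \<noteq> i" "k \<noteq> Suc i" for k
  proof -
    obtain n' where n': "n = Suc n'" using k i m by (cases n) auto
    have x': "x \<in> simp K (Suc n')" using x m n' by simp
    note u' = u[unfolded n']
    show ?thesis
    proof (cases "k < i")
      case True
      then show ?thesis using i m sset_face_degen_less[OF K x' True] sset_face[OF K _ x', of k]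
          rel_cochain_degen[OF u', of "i - 1"] by (simp add: n')
    next
      case False
      then have "Suc i < k" using k by simp
      then show ?thesis using i m k sset_face_degen_greater[OF K x' \<open>Suc i < k\<close>] sset_face[OF K _ x', of "k - 1"]
          rel_cochain_degen[OF u', of "i"] by (simp add: n')
    qed
  qed
  have "cob K (Suc n) u (degen K n i x) = (\<Sum>k\<in>{i, Suc i}. ?t k)"
    unfolding cob_Suc using i m z by (intro sum.mono_neutral_right) auto
  also have "\<dots> = 0" using i x m by (simp add: sset_face_degen_same[OF K])
  finally show "cob K (Suc n) u (degen K m i x) = 0" by (simp add: m)
qed

definition acyclic_pair :: "'k sset \<Rightarrow> (nat \<Rightarrow> 'k set) \<Rightarrow> (nat \<Rightarrow> ('k \<Rightarrow> rat) set) \<Rightarrow> bool" where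
  "acyclic_pair K L R \<longleftrightarrow> (\<forall>n u. rel_cochain K L R n u \<and> (\<forall>x\<in>simp K (Suc n). cob K (Suc n) u x = 0) \<longrightarrow>
     (\<exists>v. rel_cochain K L R (n - 1) v \<and> (\<forall>x\<in>simp K n. u x = cob K n v x)))"

subsection \<open>Vector valued cochains\<close>

definition vcob :: "'k sset \<Rightarrow> nat \<Rightarrow> ('k \<Rightarrow> zvec) \<Rightarrow> 'k \<Rightarrow> zvec" where
  "vcob K n v x = (if n = 0 then 0 else \<Sum>i\<le>n. frag_cmul ((-1) ^ i) (v (face K n i x)))"

lemma lookup_vcob: "Poly_Mapping.lookup (vcob K n v x) k = cob K n (\<lambda>x. Poly_Mapping.lookup (v x) k) x"
  by (simp add: vcob_def cob_def lookup_sum)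

lemma vcob_Suc: "vcob K (Suc n) v x = (\<Sum>i\<le>Suc n. frag_cmul ((-1) ^ i) (v (face K (Suc n) i x)))"
  by (simp add: vcob_def)

lemma vcob_add: "vcob K n (\<lambda>x. u x + v x) x = vcob K n u x + vcob K n v x"
  and vcob_diff: "vcob K n (\<lambda>x. u x - v x) x = vcob K n u x - vcob K n v x"
  and vcob_minus: "vcob K n (\<lambda>x. - u x) x = - vcob K n u x"
  by (rule poly_mapping_eqI; simp add: lookup_vcob lookup_add lookup_minus cob_add cob_diff cob_minus)+

lemma vcob_cong:
  assumes "is_sset K" "x \<in> simp K n" "\<And>y. n > 0 \<Longrightarrow> y \<in> simp K (n - 1) \<Longrightarrow> u y = v y"
  shows "vcob K n u x = vcob K n v x"
  by (rule poly_mapping_eqI, unfold lookup_vcob, rule cob_cong[OF assms(1,2)]) (simp add: assms(3))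

lemma vcob_vcob:
  assumes "is_sset K" "x \<in> simp K (Suc (Suc n))"
  shows "vcob K (Suc (Suc n)) (vcob K (Suc n) u) x = 0"
  by (rule poly_mapping_eqI) (simp add: lookup_vcob cob_cob[OF assms])

lemma vcob_hom:
  assumes K: "is_sset K" and f: "f \<in> hom (zfree m) (zfree m')"
    and u: "\<And>y. n > 0 \<Longrightarrow> y \<in> simp K (n - 1) \<Longrightarrow> u y \<in> vecs m" and x: "x \<in> simp K n"
  shows "f (vcob K n u x) = vcob K n (\<lambda>y. f (u y)) x"
proof (cases n)
  case 0
  then show ?thesis by (simp add: vcob_def zhom_zero[OF f])
next
  case (Suc k)
  have uc: "u (face K (Suc k) i x) \<in> vecs m" if "i \<le> Suc k" for i
    using u sset_face[OF K that] x Suc by simp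
  have "f (vcob K n u x) = (\<Sum>i\<le>Suc k. f (frag_cmul ((-1) ^ i) (u (face K (Suc k) i x))))"
    unfolding Suc vcob_Suc by (rule zhom_sum[OF f]) (intro vecs_cmul uc, simp)
  also have "\<dots> = (\<Sum>i\<le>Suc k. frag_cmul ((-1) ^ i) (f (u (face K (Suc k) i x))))"
    by (intro sum.cong refl zhom_sign[OF f] uc) simp
  finally show ?thesis by (simp add: Suc vcob_Suc)
qed

definition vcochain ::
    "'k sset \<Rightarrow> (nat \<Rightarrow> 'k set) \<Rightarrow> (nat \<Rightarrow> ('k \<Rightarrow> rat) set) \<Rightarrow> nat \<Rightarrow> nat \<Rightarrow> ('k \<Rightarrow> zvec) \<Rightarrow> bool" where
  "vcochain K L R m n u \<longleftrightarrow> (\<forall>x\<in>simp K n. u x \<in> vecs m) \<and>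
     (\<forall>k. rel_cochain K L R n (\<lambda>x. Poly_Mapping.lookup (u x) k))"

lemma vcochain_vecs: "vcochain K L R m n u \<Longrightarrow> x \<in> simp K n \<Longrightarrow> u x \<in> vecs m"
  and vcochain_lookup: "vcochain K L R m n u \<Longrightarrow> rel_cochain K L R n (\<lambda>x. Poly_Mapping.lookup (u x) k)"
  unfolding vcochain_def by blast+

lemma vcochain_add:
  assumes "function_system K R" "vcochain K L R m n u" "vcochain K L R m n v"
  shows "vcochain K L R m n (\<lambda>x. u x + v x)"
  unfolding vcochain_def lookup_add
  by (intro conjI ballI allI vecs_add rel_cochain_add[OF assms(1)] vcochain_vecs[OF assms(2)]
      vcochain_vecs[OF assms(3)] vcochain_lookup[OF assms(2)] vcochain_lookup[OF assms(3)])

lemma vcochain_minus: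
  assumes "function_system K R" "vcochain K L R m n u"
  shows "vcochain K L R m n (\<lambda>x. - u x)"
  unfolding vcochain_def lookup_uminus
  by (intro conjI ballI allI vecs_minus rel_cochain_minus[OF assms(1)] vcochain_vecs[OF assms(2)]
      vcochain_lookup[OF assms(2)])

lemma vcochain_diff:
  assumes "function_system K R" "vcochain K L R m n u" "vcochain K L R m n v"
  shows "vcochain K L R m n (\<lambda>x. u x - v x)"
  using vcochain_add[OF assms(1,2) vcochain_minus[OF assms(1,3)]] by simp

lemma vcochain_cob:
  assumes K: "is_sset K" and R: "function_system K R" and L: "subcomplex K L" and u: "vcochain K L R m n u"
  shows "vcochain K L R m (Suc n) (vcob K (Suc n) u)"
  unfolding vcochain_def lookup_vcob
proof (intro conjI ballI allI)
  show "vcob K (Suc n) u x \<in> vecs m" if "x \<in> simp K (Suc n)" for x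
    unfolding vcob_Suc using sset_face[OF K _ that]
    by (intro vecs_sum vecs_cmul vcochain_vecs[OF u]) auto
qed (rule rel_cochain_cob[OF K R L vcochain_lookup[OF u]])

lemma vcochain_hom:
  assumes K: "is_sset K" and R: "function_system K R" and L: "subcomplex K L"
    and f: "f \<in> hom (zfree m) (zfree m')" and u: "vcochain K L R m n u"
  shows "vcochain K L R m' n (\<lambda>x. f (u x))"
  unfolding vcochain_def
proof (intro conjI ballI allI)
  show "f (u x) \<in> vecs m'" if "x \<in> simp K n" for x
    using zhom_closed[OF f vcochain_vecs[OF u that]] .
  fix k
  let ?l = "\<lambda>z. Poly_Mapping.lookup (f z) k"
  have l: "?l \<in> hom (zfree m) integer_group"
    using hom_compose[OF f lookup_hom] by (simp add: o_def)
  have "rel_cochain K L R n (\<lambda>x. \<Sum>j<m. Poly_Mapping.lookup (u x) j * ?l (frag_of j))"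
    by (rule rel_cochain_sum_cmul[OF R vcochain_lookup[OF u]])
  then show "rel_cochain K L R n (\<lambda>x. ?l (u x))"
    by (rule rel_cochain_cong[OF K R L])
      (use functional_expand[OF l] vcochain_vecs[OF u] in simp)
qed

text \<open>
  Acyclicity with integral coefficients suffices for coefficients in a free group, coordinate by
  coordinate.
\<close>

lemma vcochain_primitive:
  assumes K: "is_sset K" and R: "function_system K R" and L: "subcomplex K L" and ac: "acyclic_pair K L R"
    and u: "vcochain K L R m n u" and cocycle: "\<And>x. x \<in> simp K (Suc n) \<Longrightarrow> vcob K (Suc n) u x = 0"
  shows "\<exists>v. vcochain K L R m (n - 1) v \<and> (\<forall>x\<in>simp K n. u x = vcob K n v x)"
proof -
  have "\<exists>w. rel_cochain K L R (n - 1) w \<and> (\<forall>x\<in>simp K n. Poly_Mapping.lookup (u x) k = cob K n w x)" for k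
    using ac[unfolded acyclic_pair_def, rule_format, OF conjI[OF vcochain_lookup[OF u, of k]]]
      cocycle by (auto simp flip: lookup_vcob)
  then obtain w where w: "\<And>k. rel_cochain K L R (n - 1) (w k)"
    "\<And>k x. x \<in> simp K n \<Longrightarrow> Poly_Mapping.lookup (u x) k = cob K n (w k) x" by metis
  define v where "v x = (\<Sum>j<m. frag_cmul (w j x) (frag_of j))" for x
  have lv: "Poly_Mapping.lookup (v x) k = (if k < m then w k x else 0)" for x k
    by (simp add: v_def lookup_sum if_distrib cong: if_cong)
  show ?thesis
  proof (intro exI[of _ v] conjI ballI)
    show "vcochain K L R m (n - 1) v"
      unfolding vcochain_def lv
    proof (intro conjI ballI allI)
      show "v x \<in> vecs m" for x
        unfolding v_def by (intro vecs_sum vecs_cmul) simp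
      show "rel_cochain K L R (n - 1) (\<lambda>x. if k < m then w k x else 0)" for k
        using w(1)[of k] rel_cochain_zero[OF R] by (cases "k < m") simp_all
    qed
    fix x assume x: "x \<in> simp K n"
    show "u x = vcob K n v x"
    proof (rule poly_mapping_eqI)
      fix k
      have "k \<ge> m \<Longrightarrow> Poly_Mapping.lookup (u x) k = 0"
        using vcochain_vecs[OF u x] by (auto simp: in_keys_iff subset_iff)
      then show "Poly_Mapping.lookup (u x) k = Poly_Mapping.lookup (vcob K n v x) k"
        unfolding lookup_vcob lv using w(2)[OF x] by (cases "k < m") (simp_all add: cob_zero)
    qed
  qed
qed

subsection \<open>Solving the extension equation\<close>

text \<open>
  One asks for a primitive of the cocycle \<open>e\<close> in the complex of cochains with values in the chain
  complex \<open>(V, D)\<close>.  Above degree \<open>h\<close>, where \<open>D\<close> is exact, \<open>r (n + 1)\<close> is computed from \<open>r n\<close> by a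
  section of \<open>D\<close>; as a section is linear, it preserves regularity.  In low degrees \<open>r n\<close> is computed
  from \<open>r (n + 1)\<close> as a primitive with respect to the coboundary.  The two recursions start from
  \<open>r (h + 1)\<close>, which must make \<open>\<delta> (r (h + 1)) + e (h + 1)\<close> a cycle for \<open>D\<close>.
\<close>

lemma twisted_cochain_equation:
  assumes K: "is_sset K" and R: "function_system K R" and L: "subcomplex K L" and ac: "acyclic_pair K L R"
    and D: "\<And>q. D q \<in> hom (zfree (m (Suc q))) (zfree (m q))"
    and DD: "\<And>q a. a \<in> vecs (m (Suc (Suc q))) \<Longrightarrow> D q (D (Suc q) a) = 0"
    and exact: "\<And>q z. h \<le> q \<Longrightarrow> z \<in> vecs (m (Suc q)) \<Longrightarrow> D q z = 0 \<Longrightarrow>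
        \<exists>a\<in>vecs (m (Suc (Suc q))). D (Suc q) a = z"
    and e: "\<And>n. vcochain K L R (m n) (Suc n) (e n)"
    and De: "\<And>n x. x \<in> simp K (Suc (Suc n)) \<Longrightarrow> D n (e (Suc n) x) = - vcob K (Suc (Suc n)) (e n) x"
  obtains r where "\<And>n. vcochain K L R (m n) n (r n)"
    "\<And>n x. x \<in> simp K (Suc n) \<Longrightarrow> D n (r (Suc n) x) - vcob K (Suc n) (r n) x = e n x"
proof -
  define eqn where "eqn r n \<longleftrightarrow> (\<forall>x\<in>simp K (Suc n). D n (r (Suc n) x) - vcob K (Suc n) (r n) x = e n x)" for r n
  define killed where "killed r j \<longleftrightarrow>
      (\<forall>x\<in>simp K (Suc (Suc j)). D j (vcob K (Suc (Suc j)) (r (Suc j)) x + e (Suc j) x) = 0)" for r j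
  have ev: "e n x \<in> vecs (m n)" if "x \<in> simp K (Suc n)" for n x using vcochain_vecs[OF e that] .

  \<comment> \<open>Modulo the cycles the cochain e (h + 1) is a cocycle; pi selects a complement of the cycles.\<close>
  have start: "\<exists>r. vcochain K L R (m (Suc h)) (Suc h) (r (Suc h)) \<and> killed r h"
  proof -
    obtain \<pi> where \<pi>: "\<pi> \<in> hom (zfree (m (Suc h))) (zfree (m (Suc h)))"
      "\<And>a. a \<in> vecs (m (Suc h)) \<Longrightarrow> D h a = 0 \<Longrightarrow> \<pi> a = 0"
      "\<And>a. a \<in> vecs (m (Suc h)) \<Longrightarrow> D h (\<pi> a) = D h a"
      using zhom_complement_projection[OF D[of h]] by metis
    have c: "vcochain K L R (m (Suc h)) (Suc (Suc h)) (\<lambda>x. \<pi> (e (Suc h) x))"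
      by (rule vcochain_hom[OF K R L \<pi>(1) e])
    have cc: "vcob K (Suc (Suc (Suc h))) (\<lambda>x. \<pi> (e (Suc h) x)) x = 0"
      if x: "x \<in> simp K (Suc (Suc (Suc h)))" for x
    proof -
      have "vcob K (Suc (Suc (Suc h))) (\<lambda>x. \<pi> (e (Suc h) x)) x = \<pi> (vcob K (Suc (Suc (Suc h))) (e (Suc h)) x)"
        by (rule vcob_hom[OF K \<pi>(1) _ x, symmetric]) (simp add: ev del: carrier_free_Abelian_group_iff)
      also have "vcob K (Suc (Suc (Suc h))) (e (Suc h)) x = - D (Suc h) (e (Suc (Suc h)) x)"
        using De[OF x] by simp
      also have "\<pi> \<dots> = 0"
        using ev[OF x] zhom_closed[OF D ev[OF x]] DD[OF ev[OF x]]
        by (intro \<pi>(2)) (simp_all add: vecs_minus zhom_minus[OF D] del: carrier_free_Abelian_group_iff)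
      finally show ?thesis .
    qed
    obtain v where v: "vcochain K L R (m (Suc h)) (Suc (Suc h) - 1) v"
      "\<And>x. x \<in> simp K (Suc (Suc h)) \<Longrightarrow> \<pi> (e (Suc h) x) = vcob K (Suc (Suc h)) v x"
      using vcochain_primitive[OF K R L ac c cc] by blast
    have v': "vcochain K L R (m (Suc h)) (Suc h) v" using v(1) by simp
    have pv: "vcochain K L R (m (Suc h)) (Suc h) (\<lambda>x. \<pi> (v x))"
      by (rule vcochain_hom[OF K R L \<pi>(1) v'])
    have "killed (\<lambda>_ x. - \<pi> (v x)) h"
      unfolding killed_def
    proof
      fix x assume x: "x \<in> simp K (Suc (Suc h))"
      have "vcob K (Suc (Suc h)) (\<lambda>x. - \<pi> (v x)) x = - \<pi> (vcob K (Suc (Suc h)) v x)"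
        unfolding vcob_minus
        using vcob_hom[OF K \<pi>(1) _ x, of v] vcochain_vecs[OF v'] by simp
      also have "\<dots> = - \<pi> (\<pi> (e (Suc h) x))" using v(2)[OF x] by simp
      finally have eq: "vcob K (Suc (Suc h)) (\<lambda>x. - \<pi> (v x)) x = - \<pi> (\<pi> (e (Suc h) x))" .
      have pe: "\<pi> (e (Suc h) x) \<in> vecs (m (Suc h))" "\<pi> (\<pi> (e (Suc h) x)) \<in> vecs (m (Suc h))"
        using zhom_closed[OF \<pi>(1)] ev[OF x] by blast+
      show "D h (vcob K (Suc (Suc h)) (\<lambda>x. - \<pi> (v x)) x + e (Suc h) x) = 0"
        unfolding eq using pe ev[OF x]
        by (simp add: zhom_diff[OF D] \<pi>(3) del: carrier_free_Abelian_group_iff)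
    qed
    then show ?thesis using vcochain_minus[OF R pv] by (intro exI[of _ "\<lambda>_ x. - \<pi> (v x)"]) simp
  qed

  \<comment> \<open>The condition killed r j is what makes D (r (j + 1)) - e j a cocycle, and it is inherited by
    the next lower degree.\<close>
  have down: "k \<le> Suc h \<Longrightarrow> \<exists>r. (\<forall>i. k \<le> i \<and> i \<le> Suc h \<longrightarrow> vcochain K L R (m i) i (r i)) \<and>
      (\<forall>i. k \<le> i \<and> i \<le> h \<longrightarrow> eqn r i) \<and> killed r h \<and> (\<forall>j. k = Suc j \<longrightarrow> killed r j)" for k
  proof (induction k rule: inc_induct)
    case base
    obtain r where "vcochain K L R (m (Suc h)) (Suc h) (r (Suc h))" "killed r h" using start by auto
    moreover from this(1) have "\<forall>i. Suc h \<le> i \<and> i \<le> Suc h \<longrightarrow> vcochain K L R (m i) i (r i)"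
      by (metis le_antisym)
    ultimately show ?case by (intro exI[of _ r]) auto
  next
    case (step n)
    then obtain r where r: "\<And>i. Suc n \<le> i \<Longrightarrow> i \<le> Suc h \<Longrightarrow> vcochain K L R (m i) i (r i)"
      "\<And>i. Suc n \<le> i \<Longrightarrow> i \<le> h \<Longrightarrow> eqn r i" "killed r h" "killed r n" by auto
    have nh: "n \<le> h" using step by simp
    have rn: "vcochain K L R (m (Suc n)) (Suc n) (r (Suc n))" using r(1) nh by simp
    let ?w = "\<lambda>x. D n (r (Suc n) x) - e n x"
    have w: "vcochain K L R (m n) (Suc n) ?w"
      by (rule vcochain_diff[OF R vcochain_hom[OF K R L D rn] e])
    have cc: "vcob K (Suc (Suc n)) ?w x = 0" if x: "x \<in> simp K (Suc (Suc n))" for x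
    proof -
      have "vcob K (Suc (Suc n)) ?w x = D n (vcob K (Suc (Suc n)) (r (Suc n)) x) - vcob K (Suc (Suc n)) (e n) x"
        unfolding vcob_diff using vcob_hom[OF K D _ x, of "r (Suc n)"] vcochain_vecs[OF rn] by simp
      also have "\<dots> = D n (vcob K (Suc (Suc n)) (r (Suc n)) x) + D n (e (Suc n) x)"
        using De[OF x] by simp
      also have "\<dots> = D n (vcob K (Suc (Suc n)) (r (Suc n)) x + e (Suc n) x)"
        using zhom_add[OF D vcochain_vecs[OF vcochain_cob[OF K R L rn] x] ev[OF x]] by simp
      also have "\<dots> = 0" using r(4) x by (simp add: killed_def)
      finally show ?thesis .
    qed
    obtain v where "vcochain K L R (m n) (Suc n - 1) v"
      "\<And>x. x \<in> simp K (Suc n) \<Longrightarrow> ?w x = vcob K (Suc n) v x"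
      using vcochain_primitive[OF K R L ac w cc] by blast
    then have v: "vcochain K L R (m n) n v" "\<And>x. x \<in> simp K (Suc n) \<Longrightarrow> ?w x = vcob K (Suc n) v x"
      by simp_all
    let ?r = "r(n := v)"
    have eq: "eqn ?r n"
      unfolding eqn_def using v(2) by (simp add: algebra_simps)
    have k: "killed ?r j" if "n = Suc j" for j
      unfolding killed_def
    proof
      fix x assume x: "x \<in> simp K (Suc (Suc j))"
      have x': "x \<in> simp K (Suc n)" using x that by simp
      have "vcob K (Suc (Suc j)) (?r (Suc j)) x + e (Suc j) x = D (Suc j) (r (Suc (Suc j)) x)"
        using v(2)[OF x', symmetric] that by simp
      moreover have "r (Suc (Suc j)) x \<in> vecs (m (Suc (Suc j)))"
        using vcochain_vecs[OF rn x'] that by simp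
      ultimately show "D j (vcob K (Suc (Suc j)) (?r (Suc j)) x + e (Suc j) x) = 0"
        using DD by simp
    qed
    have "vcochain K L R (m i) i (?r i)" if "n \<le> i" "i \<le> Suc h" for i
      using that v(1) r(1)[of i] by (cases "i = n") auto
    moreover have "eqn ?r i" if "n \<le> i" "i \<le> h" for i
    proof (cases "i = n")
      case False
      then show ?thesis using that r(2)[of i] by (simp add: eqn_def)
    qed (simp add: eq)
    moreover have "killed ?r h" using r(3) nh by (simp add: killed_def)
    ultimately show ?case using k by (intro exI[of _ ?r]) blast
  qed
  obtain r where r: "\<And>i. i \<le> Suc h \<Longrightarrow> vcochain K L R (m i) i (r i)"
    "\<And>i. i \<le> h \<Longrightarrow> eqn r i" "killed r h"
    using down[of 0] by auto

  have "\<exists>\<rho>. \<rho> \<in> hom (zfree (m (Suc q))) (zfree (m (Suc (Suc q)))) \<and>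
      (\<forall>z\<in>vecs (m (Suc q)). D q z = 0 \<longrightarrow> D (Suc q) (\<rho> z) = z)" if "h \<le> q" for q
    using zhom_section[OF D[of "Suc q"] D[of q] exact[OF that]] by metis
  then obtain \<rho> where \<rho>: "\<And>q. h \<le> q \<Longrightarrow> \<rho> q \<in> hom (zfree (m (Suc q))) (zfree (m (Suc (Suc q))))"
    "\<And>q z. h \<le> q \<Longrightarrow> z \<in> vecs (m (Suc q)) \<Longrightarrow> D q z = 0 \<Longrightarrow> D (Suc q) (\<rho> q z) = z" by metis

  define s where "s = rec_nat (r (Suc h))
     (\<lambda>k s x. \<rho> (h + k) (e (Suc (h + k)) x + vcob K (Suc (Suc (h + k))) s x))"
  have s0: "s 0 = r (Suc h)"
    and sS: "s (Suc k) = (\<lambda>x. \<rho> (h + k) (e (Suc (h + k)) x + vcob K (Suc (Suc (h + k))) (s k) x))" for k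
    by (simp_all add: s_def)
  \<comment> \<open>The cochains s k are the r (h + 1 + k); the same condition now says that the section applies.\<close>
  have up: "vcochain K L R (m (Suc (h + k))) (Suc (h + k)) (s k) \<and>
      (\<forall>x\<in>simp K (Suc (Suc (h + k))). D (h + k) (vcob K (Suc (Suc (h + k))) (s k) x + e (Suc (h + k)) x) = 0)" for k
  proof (induction k)
    case 0
    then show ?case using r(1)[of "Suc h"] r(3) by (simp add: s0 killed_def)
  next
    case (Suc k)
    let ?n = "Suc (h + k)"
    have sk: "vcochain K L R (m ?n) ?n (s k)" using Suc by simp
    have k0: "D (h + k) (e ?n x + vcob K (Suc ?n) (s k) x) = 0" if "x \<in> simp K (Suc ?n)" for x
      using Suc that by (simp add: add.commute)
    let ?z = "\<lambda>x. e ?n x + vcob K (Suc ?n) (s k) x"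
    have z: "vcochain K L R (m ?n) (Suc ?n) ?z"
      by (rule vcochain_add[OF R e vcochain_cob[OF K R L sk]])
    have sk': "vcochain K L R (m (Suc ?n)) (Suc ?n) (s (Suc k))"
      unfolding sS by (rule vcochain_hom[OF K R L \<rho>(1) z]) simp
    have eqs: "D ?n (s (Suc k) x) = ?z x" if "x \<in> simp K (Suc ?n)" for x
      unfolding sS using \<rho>(2)[OF _ vcochain_vecs[OF z that] k0[OF that]] by simp
    have "D ?n (vcob K (Suc (Suc ?n)) (s (Suc k)) x + e (Suc ?n) x) = 0" if x: "x \<in> simp K (Suc (Suc ?n))" for x
    proof -
      have "D ?n (vcob K (Suc (Suc ?n)) (s (Suc k)) x) = vcob K (Suc (Suc ?n)) (\<lambda>y. D ?n (s (Suc k) y)) x"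
        by (rule vcob_hom[OF K D _ x]) (use vcochain_vecs[OF sk'] in simp)
      also have "\<dots> = vcob K (Suc (Suc ?n)) ?z x"
        by (rule vcob_cong[OF K x]) (simp add: eqs)
      also have "\<dots> = vcob K (Suc (Suc ?n)) (e ?n) x"
        using vcob_vcob[OF K x] by (simp add: vcob_add)
      also have "\<dots> = - D ?n (e (Suc ?n) x)" using De[OF x] by simp
      finally show ?thesis
        using zhom_add[OF D vcochain_vecs[OF vcochain_cob[OF K R L sk'] x] ev[OF x]] by simp
    qed
    then show ?case using sk' by simp
  qed
  define r' where "r' n = (if n \<le> Suc h then r n else s (n - Suc h))" for n
  have r's: "r' (Suc (h + k)) = s k" for k
    by (cases k) (simp_all add: r'_def s0)
  show ?thesis
  proof (rule that[of r'])
    fix n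
    show "vcochain K L R (m n) n (r' n)"
    proof (cases "n \<le> Suc h")
      case True
      then show ?thesis using r(1) by (simp add: r'_def)
    next
      case False
      then obtain k where "n = Suc (h + k)" by (metis add_Suc less_iff_Suc_add not_le add_Suc_right)
      then show ?thesis using up r's by simp
    qed
    fix x assume x: "x \<in> simp K (Suc n)"
    show "D n (r' (Suc n) x) - vcob K (Suc n) (r' n) x = e n x"
    proof (cases "n \<le> h")
      case True
      then show ?thesis using r(2) x by (simp add: eqn_def r'_def)
    next
      case False
      then obtain k where n: "n = Suc (h + k)" by (metis less_iff_Suc_add not_le)
      have c: "vcochain K L R (m n) (Suc n) (\<lambda>x. e n x + vcob K (Suc n) (s k) x)"
        by (rule vcochain_add[OF R e vcochain_cob[OF K R L]]) (use up n in simp)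
      have "D n (\<rho> (h + k) (e n x + vcob K (Suc n) (s k) x)) = e n x + vcob K (Suc n) (s k) x"
        unfolding n
      proof (rule \<rho>(2))
        show "e (Suc (h + k)) x + vcob K (Suc (Suc (h + k))) (s k) x \<in> vecs (m (Suc (h + k)))"
          using vcochain_vecs[OF c x] n by simp
        show "D (h + k) (e (Suc (h + k)) x + vcob K (Suc (Suc (h + k))) (s k) x) = 0"
          using up[of k] x n by (simp add: add.commute)
      qed simp
      then show ?thesis using r's[of k] r's[of "Suc k"] n by (simp add: sS)
    qed
  qed
qed

section \<open>The simplicial group of a chain complex\<close>

lemma std_faces_finite: "finite (std_faces n)" "S \<in> std_faces n \<Longrightarrow> finite S"
  by (auto simp: std_faces_def intro: finite_subset[of _ "{..n}"])

lemma coface_inj: "inj (coface i)"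
  by (auto simp: inj_def coface_def split: if_splits)

lemma coface_less_iff: "coface i s < coface i t \<longleftrightarrow> s < t"
  by (auto simp: coface_def)

lemma coface_image_card: "card (coface i ` S) = card S"
  by (rule card_image[OF inj_on_subset[OF coface_inj]]) simp

lemma coface_std_faces: "S \<in> std_faces n \<Longrightarrow> coface i ` S \<in> std_faces (Suc n)"
  by (auto simp: std_faces_def coface_def)

lemma codegen_coface: "codegen i (coface i s) = s"
  by (auto simp: codegen_def coface_def)

lemma coface_codegen: "s \<noteq> i \<Longrightarrow> coface i (codegen i s) = s"
  by (auto simp: codegen_def coface_def)

lemma codegen_coface_image: "codegen i ` coface i ` S = S"
  by (simp add: image_image codegen_coface)

lemma coface_codegen_image:
  assumes "i \<notin> S" shows "coface i ` codegen i ` S = S"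
proof -
  have "coface i (codegen i s) = s" if "s \<in> S" for s using assms that by (intro coface_codegen) auto
  then show ?thesis by (simp add: image_image)
qed

lemma coface_image_missing: "i \<notin> coface i ` S"
  by (auto simp: coface_def)

lemma std_faces_missing:
  assumes "S \<in> std_faces (Suc n)" "S \<noteq> {..Suc n}"
  obtains i S' where "i \<le> Suc n" "S' \<in> std_faces n" "S = coface i ` S'"
proof -
  obtain i where i: "i \<le> Suc n" "i \<notin> S" using assms by (auto simp: std_faces_def)
  have "codegen i s \<le> n" if "s \<in> S" for s
  proof -
    have "s \<le> Suc n" "s \<noteq> i" using that assms(1) i by (auto simp: std_faces_def)
    then show ?thesis using i(1) by (auto simp: codegen_def)
  qed
  then have "codegen i ` S \<in> std_faces n"
    using assms(1) by (auto simp: std_faces_def)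
  then show thesis using that[OF i(1)] coface_codegen_image[OF i(2)] by metis
qed

lemma coface_atMost: "s \<le> Suc n \<Longrightarrow> coface s ` {..n} = {..Suc n} - {s}"
proof
  assume s: "s \<le> Suc n"
  show "{..Suc n} - {s} \<subseteq> coface s ` {..n}"
  proof
    fix t assume "t \<in> {..Suc n} - {s}"
    then show "t \<in> coface s ` {..n}"
      using s by (intro image_eqI[of _ _ "codegen s t"]) (auto simp: codegen_def coface_def)
  qed
qed (auto simp: coface_def)

text \<open>
  The sign with which \<open>S - {s}\<close> occurs in the boundary of the simplex \<open>S\<close>.
\<close>

definition face_sign :: "nat set \<Rightarrow> nat \<Rightarrow> int" where
  "face_sign S s = (-1) ^ card {t\<in>S. t < s}"

lemma face_sign_coface: "face_sign (coface i ` S) (coface i s) = face_sign S s"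
proof -
  have "{t \<in> coface i ` S. t < coface i s} = coface i ` {t\<in>S. t < s}"
    by (auto simp: coface_less_iff)
  then show ?thesis by (simp add: face_sign_def coface_image_card)
qed

lemma face_sign_atMost: "s \<le> n \<Longrightarrow> face_sign {..n} s = (-1) ^ s"
proof -
  assume "s \<le> n"
  then have "{t \<in> {..n}. t < s} = {..<s}" by auto
  then show ?thesis by (simp add: face_sign_def)
qed

lemma iso_hom: "\<phi> \<in> iso A B \<Longrightarrow> \<phi> \<in> hom A B"
  by (simp add: iso_def)

text \<open>
  The groups of the complex are identified with \<open>zfree (m k)\<close> by \<open>e k\<close>, so that the chain conditions
  become equations between integral vectors; \<open>D\<close> below is the differential in these coordinates.
\<close>

locale framed_complex =
  fixes C :: "nat \<Rightarrow> zvec monoid" and d :: "nat \<Rightarrow> zvec \<Rightarrow> zvec"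
    and m :: "nat \<Rightarrow> nat" and e :: "nat \<Rightarrow> zvec \<Rightarrow> zvec"
  assumes complex: "fg_chain_complex C d"
    and frame: "e k \<in> iso (C k) (zfree (m k))"
begin

lemma C_free: "fg_free_abelian (C k)"
  and d_hom: "d k \<in> hom (C (Suc k)) (C k)"
  and dd: "x \<in> carrier (C (Suc (Suc k))) \<Longrightarrow> d k (d (Suc k) x) = \<one>\<^bsub>C k\<^esub>"
  using complex by (simp_all add: fg_chain_complex_def)

lemma C_comm: "comm_group (C k)" and C_group: "group (C k)"
  using fg_free_group[OF C_free] by blast+

definition e_inv :: "nat \<Rightarrow> zvec \<Rightarrow> zvec" where
  "e_inv k = inv_into (carrier (C k)) (e k)"

lemma e_inv_e: "a \<in> carrier (C k) \<Longrightarrow> e_inv k (e k a) = a"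
  and e_e_inv: "z \<in> vecs (m k) \<Longrightarrow> e k (e_inv k z) = z"
  and e_closed: "a \<in> carrier (C k) \<Longrightarrow> e k a \<in> vecs (m k)"
  and e_inv_closed: "z \<in> vecs (m k) \<Longrightarrow> e_inv k z \<in> carrier (C k)"
  unfolding e_inv_def by (rule iso_inv_cancel[OF frame]; assumption)+

lemma e_hom: "e k \<in> hom (C k) (zfree (m k))"
  by (rule iso_hom[OF frame])

lemma e_inv_hom: "e_inv k \<in> hom (zfree (m k)) (C k)"
  unfolding e_inv_def by (rule iso_hom[OF iso_inv_into[OF frame C_group]])

lemma e_group_hom: "group_hom (C k) (zfree (m k)) (e k)"
  using e_hom C_group by (simp add: group_hom_def group_hom_axioms_def)

lemma e_mult: "a \<in> carrier (C k) \<Longrightarrow> b \<in> carrier (C k) \<Longrightarrow> e k (a \<otimes>\<^bsub>C k\<^esub> b) = e k a + e k b"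
  using hom_mult[OF e_hom] by simp

lemma e_one: "e k \<one>\<^bsub>C k\<^esub> = 0"
  using group_hom.hom_one[OF e_group_hom] by simp

lemma e_pow: "a \<in> carrier (C k) \<Longrightarrow> e k (a [^]\<^bsub>C k\<^esub> (z::int)) = frag_cmul z (e k a)"
  using group_hom.hom_int_pow[OF e_group_hom] e_closed by simp

lemma e_eq_iff: "a \<in> carrier (C k) \<Longrightarrow> b \<in> carrier (C k) \<Longrightarrow> e k a = e k b \<longleftrightarrow> a = b"
  by (metis e_inv_e)

lemma e_finprod:
  assumes "finite A" "\<And>a. a \<in> A \<Longrightarrow> f a \<in> carrier (C k)"
  shows "e k (finprod (C k) f A) = (\<Sum>a\<in>A. e k (f a))"
  using assms
proof (induction A)
  interpret comm_group "C k" by (rule C_comm)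
  case empty
  then show ?case by (simp add: e_one)
next
  interpret comm_group "C k" by (rule C_comm)
  case (insert a A)
  show ?case using insert by (simp add: e_mult Pi_iff finprod_closed)
qed

definition D :: "nat \<Rightarrow> zvec \<Rightarrow> zvec" where
  "D q z = e q (d q (e_inv (Suc q) z))"

lemma D_hom: "D q \<in> hom (zfree (m (Suc q))) (zfree (m q))"
  using hom_compose[OF hom_compose[OF e_inv_hom d_hom] e_hom] by (simp add: D_def[abs_def] o_def)

lemma D_e: "a \<in> carrier (C (Suc q)) \<Longrightarrow> D q (e (Suc q) a) = e q (d q a)"
  by (simp add: D_def e_inv_e)

lemma DD: "z \<in> vecs (m (Suc (Suc q))) \<Longrightarrow> D q (D (Suc q) z) = 0"
proof -
  assume z: "z \<in> vecs (m (Suc (Suc q)))"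
  note c = e_inv_closed[OF z] 
  have "D q (D (Suc q) z) = D q (e (Suc q) (d (Suc q) (e_inv (Suc (Suc q)) z)))" by (simp add: D_def)
  also have "\<dots> = e q (d q (d (Suc q) (e_inv (Suc (Suc q)) z)))"
    by (rule D_e[OF hom_in_carrier[OF d_hom c]])
  finally show ?thesis by (simp add: dd[OF c] e_one)
qed

text \<open>
  Vanishing homology, which is a statement about cosets, in the form in which it is used.
\<close>

lemma D_exact:
  assumes "trivial_group (chain_homology C d (Suc q))" "z \<in> vecs (m (Suc q))" "D q z = 0"
  shows "\<exists>a\<in>vecs (m (Suc (Suc q))). D (Suc q) a = z"
proof -
  let ?c = "e_inv (Suc q) z"
  let ?Z = "kernel (C (Suc q)) (C q) (d q)" and ?B = "d (Suc q) ` carrier (C (Suc (Suc q)))"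
  let ?G = "C (Suc q)\<lparr>carrier := ?Z\<rparr>"
  have cc: "?c \<in> carrier (C (Suc q))" by (rule e_inv_closed[OF assms(2)])
  have "e q (d q ?c) = e q \<one>\<^bsub>C q\<^esub>" using assms(3) by (simp add: D_def e_one)
  then have "d q ?c = \<one>\<^bsub>C q\<^esub>"
    using e_eq_iff[OF hom_in_carrier[OF d_hom cc] monoid.one_closed[OF group.is_monoid[OF C_group]]] by simp
  then have ck: "?c \<in> ?Z" using cc by (simp add: kernel_def)
  have "carrier (?G Mod ?B) = {?B}"
    using assms(1) by (simp add: trivial_group_def chain_homology_def chain_cycles_def FactGroup_def)
  then have "r_coset ?G ?B ?c = ?B"
    using ck by (auto simp: FactGroup_def RCOSETS_def)
  moreover have "\<one>\<^bsub>C (Suc q)\<^esub> \<in> ?B"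
    using hom_one[OF d_hom C_group C_group, of "Suc q"] monoid.one_closed[OF group.is_monoid[OF C_group]]
    by (intro image_eqI[of _ _ "\<one>\<^bsub>C (Suc (Suc q))\<^esub>"]) simp_all
  then have "\<one>\<^bsub>C (Suc q)\<^esub> \<otimes>\<^bsub>C (Suc q)\<^esub> ?c \<in> r_coset ?G ?B ?c"
    unfolding r_coset_def by auto
  ultimately have "?c \<in> ?B" using cc C_group by (simp add: group.is_monoid monoid.l_one)
  then obtain a where a: "a \<in> carrier (C (Suc (Suc q)))" "?c = d (Suc q) a" by auto
  have "D (Suc q) (e (Suc (Suc q)) a) = z"
    using D_e[OF a(1)] a(2) e_e_inv[OF assms(2)] by simp
  then show ?thesis using e_closed[OF a(1)] by blast
qed

subsection \<open>Simplices as compatible families\<close>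

text \<open>
  All families of elements indexed by the faces of the standard simplex, without the chain
  condition; \<open>\<Gamma>(M)\<^sub>n\<close> is the subgroup on which \<open>defect\<close>, the deviation from being a chain map, vanishes.
\<close>

definition faces_group :: "nat \<Rightarrow> (nat set \<Rightarrow> zvec) monoid" where
  "faces_group n = product_group (std_faces n) (\<lambda>S. C (card S - 1))"

definition coord :: "nat set \<Rightarrow> (nat set \<Rightarrow> zvec) \<Rightarrow> zvec" where
  "coord S x = e (card S - 1) (x S)"

definition defect :: "nat set \<Rightarrow> (nat set \<Rightarrow> zvec) \<Rightarrow> zvec" where
  "defect S x = D (card S - 2) (coord S x) - (\<Sum>s\<in>S. frag_cmul (face_sign S s) (coord (S - {s}) x))"

lemma faces_group_closed: "x \<in> carrier (faces_group n) \<Longrightarrow> S \<in> std_faces n \<Longrightarrow> x S \<in> carrier (C (card S - 1))"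
  by (auto simp: faces_group_def PiE_iff)

lemma faces_group_comm: "comm_group (faces_group n)"
proof (rule group.group_comm_groupI)
  show "group (faces_group n)" unfolding faces_group_def by (rule product_group) (rule C_group)
  show "x \<otimes>\<^bsub>faces_group n\<^esub> y = y \<otimes>\<^bsub>faces_group n\<^esub> x"
    if "x \<in> carrier (faces_group n)" "y \<in> carrier (faces_group n)" for x y
    using faces_group_closed that comm_group.axioms(1)[OF C_comm] 
    by (auto simp: faces_group_def comm_monoid.m_comm intro!: restrict_ext)
qed

lemma std_faces_Diff:
  assumes "S \<in> std_faces n" "2 \<le> card S" "s \<in> S"
  shows "S - {s} \<in> std_faces n" "card (S - {s}) - 1 = card S - 2"
proof -
  have c: "card (S - {s}) = card S - 1" using assms std_faces_finite by simp
  then have "S - {s} \<noteq> {}" using assms(2) by (metis card.empty diff_is_0_eq not_less_eq_eq numeral_2_eq_2 One_nat_def)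
  then show "S - {s} \<in> std_faces n" using assms(1) by (auto simp: std_faces_def)
  show "card (S - {s}) - 1 = card S - 2" using c by simp
qed

lemma Gamma_mem:
  "x \<in> carrier (Gamma_obj C d n) \<longleftrightarrow> x \<in> carrier (faces_group n) \<and>
     (\<forall>S\<in>std_faces n. 2 \<le> card S \<longrightarrow> defect S x = 0)"
proof -
  let ?chain = "\<lambda>k S. d k (x S) = finprod (C k) (\<lambda>s. x (S - {s}) [^]\<^bsub>C k\<^esub> ((-1::int) ^ card {t\<in>S. t < s})) S"
  have pointwise: "(\<forall>k. card S = k + 2 \<longrightarrow>
          d k (x S) = finprod (C k) (\<lambda>s. x (S - {s}) [^]\<^bsub>C k\<^esub> ((-1::int) ^ card {t\<in>S. t < s})) S)
     \<longleftrightarrow> (2 \<le> card S \<longrightarrow> defect S x = 0)"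
    if x: "x \<in> carrier (faces_group n)" and S: "S \<in> std_faces n" for S
  proof (cases "2 \<le> card S")
    case True
    define k where "k = card S - 2"
    have cS: "card S - 1 = Suc k" "card S = k + 2" using True by (auto simp: k_def)
    have xS: "x S \<in> carrier (C (Suc k))" using faces_group_closed[OF x S] cS by simp
    have xs: "x (S - {s}) \<in> carrier (C k)" if "s \<in> S" for s
      using faces_group_closed[OF x std_faces_Diff(1)[OF S True that]] std_faces_Diff(2)[OF S True that]
      by (simp add: k_def)
    have pw: "x (S - {s}) [^]\<^bsub>C k\<^esub> (z::int) \<in> carrier (C k)" if "s \<in> S" for s z
      using group.int_pow_closed[OF C_group xs[OF that]] .
    let ?p = "finprod (C k) (\<lambda>s. x (S - {s}) [^]\<^bsub>C k\<^esub> ((-1::int) ^ card {t\<in>S. t < s})) S"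
    have "?p \<in> carrier (C k)"
      using pw by (intro comm_monoid.finprod_closed[OF comm_group.axioms(1)[OF C_comm]]) auto
    then have "d k (x S) = ?p \<longleftrightarrow> e k (d k (x S)) = e k ?p"
      using e_eq_iff[OF hom_in_carrier[OF d_hom xS]] by simp
    also have "e k ?p = (\<Sum>s\<in>S. frag_cmul (face_sign S s) (e k (x (S - {s}))))"
      using e_finprod[OF std_faces_finite(2)[OF S], where k = k] pw xs by (simp add: e_pow face_sign_def)
    also have "\<dots> = (\<Sum>s\<in>S. frag_cmul (face_sign S s) (coord (S - {s}) x))"
      using std_faces_Diff(2)[OF S True] by (intro sum.cong refl) (simp add: coord_def k_def)
    also have "e k (d k (x S)) = D k (coord S x)"
      unfolding coord_def cS(1) by (rule D_e[OF xS, symmetric])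
    finally show ?thesis by (simp add: defect_def cS(2))
  qed auto
  have swap: "(\<forall>k. \<forall>S\<in>A. Q k S) = (\<forall>S\<in>A. \<forall>k. Q k S)" for Q :: "nat \<Rightarrow> nat set \<Rightarrow> bool" and A
    by blast
  have "carrier (Gamma_obj C d n) = {x \<in> carrier (faces_group n).
      \<forall>k. \<forall>S\<in>std_faces n. card S = k + 2 \<longrightarrow>
          d k (x S) = finprod (C k) (\<lambda>s. x (S - {s}) [^]\<^bsub>C k\<^esub> ((-1::int) ^ card {t\<in>S. t < s})) S}"
    unfolding Gamma_obj_def faces_group_def carrier_product_group
    by (simp only: partial_object.update_convs product_group_def partial_object.select_convs)
  then have "x \<in> carrier (Gamma_obj C d n) \<longleftrightarrow> x \<in> carrier (faces_group n) \<and>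
      (\<forall>k. \<forall>S\<in>std_faces n. card S = k + 2 \<longrightarrow> ?chain k S)"
    by (simp only: mem_Collect_eq)
  also have "\<dots> \<longleftrightarrow> x \<in> carrier (faces_group n) \<and>
      (\<forall>S\<in>std_faces n. \<forall>k. card S = k + 2 \<longrightarrow> ?chain k S)"
    by (rule conj_cong[OF refl swap])
  also have "\<dots> \<longleftrightarrow> x \<in> carrier (faces_group n) \<and> (\<forall>S\<in>std_faces n. 2 \<le> card S \<longrightarrow> defect S x = 0)"
    by (intro conj_cong[OF refl] ball_cong[OF refl] pointwise)
  finally show ?thesis .
qed

lemma coord_vecs: "x \<in> carrier (faces_group n) \<Longrightarrow> S \<in> std_faces n \<Longrightarrow> coord S x \<in> vecs (m (card S - 1))"
  unfolding coord_def by (rule e_closed[OF faces_group_closed])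

lemma coord_mult:
  "x \<in> carrier (faces_group n) \<Longrightarrow> y \<in> carrier (faces_group n) \<Longrightarrow> S \<in> std_faces n \<Longrightarrow>
    coord S (x \<otimes>\<^bsub>faces_group n\<^esub> y) = coord S x + coord S y"
  using faces_group_closed by (simp add: coord_def faces_group_def e_mult)

lemma defect_mult:
  assumes x: "x \<in> carrier (faces_group n)" and y: "y \<in> carrier (faces_group n)"
    and S: "S \<in> std_faces n" "2 \<le> card S"
  shows "defect S (x \<otimes>\<^bsub>faces_group n\<^esub> y) = defect S x + defect S y"
proof -
  have c: "card S - 1 = Suc (card S - 2)" using S by simp
  have "coord S x \<in> vecs (m (Suc (card S - 2)))" "coord S y \<in> vecs (m (Suc (card S - 2)))"
    using coord_vecs[OF x S(1)] coord_vecs[OF y S(1)] c by simp_all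
  from zhom_add[OF D_hom this] show ?thesis
    using std_faces_Diff(1)[OF S] by (simp add: defect_def coord_mult[OF x y] S frag_cmul_distrib2 sum.distrib)
qed

text \<open>
  \<open>\<Gamma>(M)\<^sub>n\<close> is the common kernel of these finitely many homomorphisms to the integers.  Hence
  \<open>hom_extends_from_common_kernel\<close> applies to it.
\<close>

definition defect_functionals :: "nat \<Rightarrow> ((nat set \<Rightarrow> zvec) \<Rightarrow> int) set" where
  "defect_functionals n = (\<lambda>(S, j) x. Poly_Mapping.lookup (defect S x) j) `
     (SIGMA S:{S \<in> std_faces n. 2 \<le> card S}. {..<m (card S - 2)})"

lemma defect_functionals_finite: "finite (defect_functionals n)"
  unfolding defect_functionals_def by (intro finite_imageI finite_SigmaI) (auto simp: std_faces_finite)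

lemma defect_functionals_hom: "defect_functionals n \<subseteq> hom (faces_group n) integer_group"
  unfolding defect_functionals_def
  by (auto simp: hom_def defect_mult lookup_add)

lemma defect_vecs:
  assumes x: "x \<in> carrier (faces_group n)" and S: "S \<in> std_faces n" "2 \<le> card S"
  shows "defect S x \<in> vecs (m (card S - 2))"
proof -
  have c: "card S - 1 = Suc (card S - 2)" using S by simp
  have "coord S x \<in> vecs (m (Suc (card S - 2)))" using coord_vecs[OF x S(1)] c by simp
  moreover have "coord (S - {s}) x \<in> vecs (m (card S - 2))" if "s \<in> S" for s
    using coord_vecs[OF x std_faces_Diff(1)[OF S that]] std_faces_Diff(2)[OF S that] by simp
  ultimately show ?thesis unfolding defect_def
    by (intro vecs_diff vecs_sum vecs_cmul zhom_closed[OF D_hom])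
qed

lemma Gamma_carrier:
  "carrier (Gamma_obj C d n) = {x \<in> carrier (faces_group n). \<forall>\<phi>\<in>defect_functionals n. \<phi> x = 0}"
proof -
  have "defect S x = 0 \<longleftrightarrow> (\<forall>j<m (card S - 2). Poly_Mapping.lookup (defect S x) j = 0)"
    if x: "x \<in> carrier (faces_group n)" and S: "S \<in> std_faces n" "2 \<le> card S" for x S
  proof
    assume z: "\<forall>j<m (card S - 2). Poly_Mapping.lookup (defect S x) j = 0"
    show "defect S x = 0"
    proof (rule poly_mapping_eqI)
      fix j
      have "j \<ge> m (card S - 2) \<Longrightarrow> Poly_Mapping.lookup (defect S x) j = 0"
        using defect_vecs[OF x S] by (auto simp: in_keys_iff subset_iff)
      then show "Poly_Mapping.lookup (defect S x) j = Poly_Mapping.lookup 0 j" using z by (cases "j < m (card S - 2)") auto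
    qed
  qed simp
  then show ?thesis by (auto simp: Gamma_mem defect_functionals_def)
qed

lemma Gamma_obj_eq: "Gamma_obj C d n =
   faces_group n\<lparr>carrier := {x \<in> carrier (faces_group n). \<forall>\<phi>\<in>defect_functionals n. \<phi> x = 0}\<rparr>"
  unfolding Gamma_carrier[symmetric] by (simp add: Gamma_obj_def faces_group_def)

lemma Gamma_comm: "comm_group (Gamma_obj C d n)"
proof -
  interpret P: comm_group "faces_group n" by (rule faces_group_comm)
  have "subgroup {x \<in> carrier (faces_group n). \<forall>\<phi>\<in>defect_functionals n. \<phi> x = 0} (faces_group n)"
    using defect_functionals_hom[of n] P.is_group
    by unfold_locales (auto simp: functional_mult functional_one functional_inv subset_iff)
  then show ?thesis unfolding Gamma_obj_eq by (rule P.comm_group_subgroup)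
qed

lemma Gamma_group: "group (Gamma_obj C d n)"
  using Gamma_comm comm_group.axioms(2) by blast

lemma Gamma_faces_group: "x \<in> carrier (Gamma_obj C d n) \<Longrightarrow> x \<in> carrier (faces_group n)"
  by (simp add: Gamma_mem)

lemma Gamma_mult: "x \<otimes>\<^bsub>Gamma_obj C d n\<^esub> y = x \<otimes>\<^bsub>faces_group n\<^esub> y"
  by (simp add: Gamma_obj_def faces_group_def)


definition fc :: "nat \<Rightarrow> nat \<Rightarrow> (nat set \<Rightarrow> zvec) \<Rightarrow> nat set \<Rightarrow> zvec" where
  "fc n i x = (\<lambda>S\<in>std_faces n. x (coface i ` S))"

definition top :: "nat \<Rightarrow> (nat set \<Rightarrow> zvec) \<Rightarrow> zvec" where
  "top n x = coord {..n} x"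

lemma nface_Gamma: "nface (Gamma C d) (Suc n) i = fc n i"
  by (simp add: Gamma_def fc_def fun_eq_iff)

lemma full_face: "{..n} \<in> std_faces n" "card {..n} - 1 = n"
  by (auto simp: std_faces_def)

lemma fc_apply: "S \<in> std_faces n \<Longrightarrow> fc n i x S = x (coface i ` S)"
  by (simp add: fc_def)

lemma coord_fc: "S \<in> std_faces n \<Longrightarrow> coord S (fc n i x) = coord (coface i ` S) x"
  by (simp add: coord_def fc_apply coface_image_card)

text \<open>
  The increasing map \<open>coface i\<close> preserves the positions of the elements of \<open>S\<close>, hence the signs.
\<close>

lemma defect_fc:
  assumes S: "S \<in> std_faces n" "2 \<le> card S"
  shows "defect S (fc n i x) = defect (coface i ` S) x"
proof -
  have "coface i ` S - {coface i s} = coface i ` (S - {s})" if "s \<in> S" for s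
    using coface_inj by (auto simp: inj_def)
  then have "(\<Sum>s\<in>coface i ` S. frag_cmul (face_sign (coface i ` S) s) (coord (coface i ` S - {s}) x)) =
      (\<Sum>s\<in>S. frag_cmul (face_sign S s) (coord (coface i ` (S - {s})) x))"
    by (subst sum.reindex[OF inj_on_subset[OF coface_inj]]) (simp_all add: face_sign_coface)
  also have "\<dots> = (\<Sum>s\<in>S. frag_cmul (face_sign S s) (coord (S - {s}) (fc n i x)))"
    by (intro sum.cong refl) (simp add: coord_fc std_faces_Diff(1)[OF S])
  finally show ?thesis by (simp add: defect_def coord_fc S(1) coface_image_card)
qed

lemma fc_faces_group: "x \<in> carrier (faces_group (Suc n)) \<Longrightarrow> fc n i x \<in> carrier (faces_group n)"
  using faces_group_closed[OF _ coface_std_faces, of x n]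
  by (auto simp: faces_group_def fc_def coface_image_card)

lemma fc_closed:
  assumes x: "x \<in> carrier (Gamma_obj C d (Suc n))"
  shows "fc n i x \<in> carrier (Gamma_obj C d n)"
  unfolding Gamma_mem
proof (intro conjI ballI impI)
  show "fc n i x \<in> carrier (faces_group n)" by (rule fc_faces_group[OF Gamma_faces_group[OF x]])
  fix S assume S: "S \<in> std_faces n" "2 \<le> card S"
  then show "defect S (fc n i x) = 0"
    using x coface_std_faces[OF S(1)] by (simp add: defect_fc Gamma_mem coface_image_card)
qed

lemma fc_mult: "fc n i (x \<otimes>\<^bsub>faces_group (Suc n)\<^esub> y) = fc n i x \<otimes>\<^bsub>faces_group n\<^esub> fc n i y"
  by (simp add: fc_def faces_group_def coface_std_faces coface_image_card fun_eq_iff restrict_def)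

lemma fc_hom: "fc n i \<in> hom (Gamma_obj C d (Suc n)) (Gamma_obj C d n)"
  by (rule homI) (simp_all add: fc_closed Gamma_mult fc_mult)

lemma fc_group_hom: "group_hom (Gamma_obj C d (Suc n)) (Gamma_obj C d n) (fc n i)"
  using fc_hom Gamma_group by (simp add: group_hom_def group_hom_axioms_def)

lemma fc_m_inv: "x \<in> carrier (Gamma_obj C d (Suc n)) \<Longrightarrow>
    fc n i (inv\<^bsub>Gamma_obj C d (Suc n)\<^esub> x) = inv\<^bsub>Gamma_obj C d n\<^esub> fc n i x"
  by (rule group_hom.hom_inv[OF fc_group_hom])

lemma top_vecs: "x \<in> carrier (Gamma_obj C d n) \<Longrightarrow> top n x \<in> vecs (m n)"
  unfolding top_def using coord_vecs[OF Gamma_faces_group full_face(1)] by simp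

lemma top_mult: "x \<in> carrier (Gamma_obj C d n) \<Longrightarrow> y \<in> carrier (Gamma_obj C d n) \<Longrightarrow>
    top n (x \<otimes>\<^bsub>Gamma_obj C d n\<^esub> y) = top n x + top n y"
  unfolding top_def Gamma_mult by (intro coord_mult Gamma_faces_group full_face(1))

lemma top_hom: "top n \<in> hom (Gamma_obj C d n) (zfree (m n))"
  by (rule homI) (simp_all only: top_vecs top_mult mult_free_Abelian_group)

lemma defect_top:
  "defect {..Suc n} x = D n (top (Suc n) x) - (\<Sum>i\<le>Suc n. frag_cmul ((-1) ^ i) (top n (fc n i x)))"
proof -
  have "coord ({..Suc n} - {i}) x = top n (fc n i x)" if "i \<le> Suc n" for i
    using that by (simp add: top_def coord_fc full_face coface_atMost)
  then show ?thesis by (simp add: defect_def face_sign_atMost top_def)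
qed

text \<open>
  The chain condition on the top cell: the differential of the top component is the alternating sum
  of the top components of the faces.
\<close>

lemma top_boundary:
  assumes "x \<in> carrier (Gamma_obj C d (Suc n))"
  shows "D n (top (Suc n) x) = (\<Sum>i\<le>Suc n. frag_cmul ((-1) ^ i) (top n (fc n i x)))"
proof -
  have "defect {..Suc n} x = 0"
    using assms full_face(1)[of "Suc n"] unfolding Gamma_mem by simp
  then show ?thesis by (simp add: defect_top)
qed

lemma top_degen: "i \<le> n \<Longrightarrow> top (Suc n) (ndegen (Gamma C d) n i x) = 0"
proof -
  assume "i \<le> n"
  then have "\<not> inj_on (codegen i) {..Suc n}"
    using inj_onD[of "codegen i" "{..Suc n}" i "Suc i"] by (auto simp: codegen_def)
  then show ?thesis by (simp add: top_def coord_def Gamma_def full_face e_one)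
qed

lemma Gamma_extensional: "x \<in> carrier (Gamma_obj C d n) \<Longrightarrow> S \<notin> std_faces n \<Longrightarrow> x S = undefined"
  using Gamma_faces_group[of x n] by (auto simp: faces_group_def PiE_iff extensional_def)

lemma top_inject:
  assumes x: "x \<in> carrier (Gamma_obj C d n)" and y: "y \<in> carrier (Gamma_obj C d n)" and t: "top n x = top n y"
  shows "x {..n} = y {..n}"
proof -
  have "x {..n} \<in> carrier (C n)" "y {..n} \<in> carrier (C n)"
    using faces_group_closed[OF Gamma_faces_group[OF x] full_face(1)]
      faces_group_closed[OF Gamma_faces_group[OF y] full_face(1)] by simp_all
  moreover have "e n (x {..n}) = e n (y {..n})" using t by (simp add: top_def coord_def)
  ultimately show ?thesis using e_eq_iff by blast
qed

lemma Gamma_eqI: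
  assumes x: "x \<in> carrier (Gamma_obj C d (Suc n))" and y: "y \<in> carrier (Gamma_obj C d (Suc n))"
    and f: "\<And>i. i \<le> Suc n \<Longrightarrow> fc n i x = fc n i y" and t: "top (Suc n) x = top (Suc n) y"
  shows "x = y"
proof
  fix S
  show "x S = y S"
  proof (cases "S \<in> std_faces (Suc n)")
    case True
    show ?thesis
    proof (cases "S = {..Suc n}")
      case True then show ?thesis using top_inject[OF x y t] by simp
    next
      case False
      obtain i S' where iS: "i \<le> Suc n" "S' \<in> std_faces n" "S = coface i ` S'"
        by (rule std_faces_missing[OF True False])
      have "fc n i x S' = fc n i y S'" using f[OF iS(1)] by simp
      then show ?thesis using iS by (simp add: fc_apply)
    qed
  qed (simp add: Gamma_extensional[OF x] Gamma_extensional[OF y])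
qed

lemma std_faces_0: "std_faces 0 = {{..0}}"
  by (auto simp: std_faces_def)

lemma Gamma_eqI_0:
  assumes x: "x \<in> carrier (Gamma_obj C d 0)" and y: "y \<in> carrier (Gamma_obj C d 0)"
    and t: "top 0 x = top 0 y"
  shows "x = y"
proof
  fix S show "x S = y S"
    using top_inject[OF x y t] Gamma_extensional[OF x, of S] Gamma_extensional[OF y, of S]
    by (cases "S = {..0}") (simp_all add: std_faces_0)
qed

lemma Gamma_vertex:
  assumes "z \<in> vecs (m 0)"
  shows "\<exists>x\<in>carrier (Gamma_obj C d 0). top 0 x = z"
proof (rule bexI)
  let ?x = "\<lambda>S\<in>std_faces 0. e_inv 0 z"
  show "?x \<in> carrier (Gamma_obj C d 0)"
    unfolding Gamma_mem using e_inv_closed[OF assms] by (auto simp: faces_group_def std_faces_0)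
  show "top 0 ?x = z" using e_e_inv[OF assms] full_face(1)[of 0] by (simp add: top_def coord_def)
qed

text \<open>
  A proper face \<open>S\<close> of the standard simplex misses some vertex \<open>i\<close>, and then the value on \<open>S\<close> is read
  off from \<open>y i\<close>; the matching condition makes this independent of \<open>i\<close>.  The chain conditions on
  proper faces hold because they hold for the \<open>y i\<close>, and the one on the top cell is the condition on \<open>z\<close>.
\<close>

lemma Gamma_fill:
  assumes y: "\<And>i. i \<le> Suc n \<Longrightarrow> y i \<in> carrier (Gamma_obj C d n)"
    and match: "\<And>k i j. n = Suc k \<Longrightarrow> i < j \<Longrightarrow> j \<le> Suc n \<Longrightarrow> fc k i (y j) = fc k (j - 1) (y i)"
    and z: "z \<in> vecs (m (Suc n))" "D n z = (\<Sum>i\<le>Suc n. frag_cmul ((-1) ^ i) (top n (y i)))"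
  shows "\<exists>x\<in>carrier (Gamma_obj C d (Suc n)). (\<forall>i\<le>Suc n. fc n i x = y i) \<and> top (Suc n) x = z"
proof -
  have indep: "y i (codegen i ` S) = y j (codegen j ` S)"
    if ij: "i < j" "j \<le> Suc n" and iS: "i \<notin> S" "j \<notin> S" and S: "S \<in> std_faces (Suc n)" for i j S
  proof -
    let ?T = "codegen i ` codegen j ` S"
    obtain s where s: "s \<in> S" "s \<le> Suc n" using S by (auto simp: std_faces_def)
    have "s \<noteq> i" "s \<noteq> j" using s iS by auto
    then have "n \<noteq> 0" using ij s(2) by linarith
    then obtain k where n: "n = Suc k" by (cases n) auto
    have Tk: "?T \<in> std_faces k"
      unfolding std_faces_def
    proof (intro CollectI conjI)
      show "?T \<subseteq> {..k}"
      proof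
        fix a assume "a \<in> ?T"
        then obtain s where "s \<in> S" "a = codegen i (codegen j s)" by blast
        moreover from this(1) have "s \<le> Suc n" "s \<noteq> i" "s \<noteq> j" using S iS by (auto simp: std_faces_def)
        ultimately show "a \<in> {..k}" using ij n by (auto simp: codegen_def split: if_splits)
      qed
    qed (use S in \<open>auto simp: std_faces_def\<close>)
    have a1: "coface i ` ?T = codegen j ` S"
      unfolding image_image
    proof (intro image_cong refl)
      fix s assume "s \<in> S"
      then have "s \<noteq> i" "s \<noteq> j" using iS by auto
      then show "coface i (codegen i (codegen j s)) = codegen j s"
        using ij by (auto simp: codegen_def coface_def)
    qed
    have a2: "coface (j - 1) ` ?T = codegen i ` S"
      unfolding image_image
    proof (intro image_cong refl)
      fix s assume "s \<in> S"
      then have "s \<noteq> i" "s \<noteq> j" using iS by auto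
      then show "coface (j - 1) (codegen i (codegen j s)) = codegen i s"
        using ij by (auto simp: codegen_def coface_def)
    qed
    have "y j (codegen j ` S) = fc k i (y j) ?T" using Tk a1 by (simp add: fc_apply)
    also have "\<dots> = fc k (j - 1) (y i) ?T" using match[OF n ij] by simp
    also have "\<dots> = y i (codegen i ` S)" using Tk a2 by (simp add: fc_apply)
    finally show ?thesis by simp
  qed
  define x where "x = (\<lambda>S\<in>std_faces (Suc n). if S = {..Suc n} then e_inv (Suc n) z
     else let i = (LEAST i. i \<notin> S) in y i (codegen i ` S))"
  have x_missing: "x S = y i (codegen i ` S)"
    if S: "S \<in> std_faces (Suc n)" and i: "i \<le> Suc n" "i \<notin> S" for S i
  proof -
    define l where "l = (LEAST i. i \<notin> S)"
    have l: "l \<notin> S" "l \<le> i" unfolding l_def using i(2) by (rule LeastI, rule Least_le)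
    have "S \<noteq> {..Suc n}" using i by auto
    then have "x S = y l (codegen l ` S)" using S by (simp add: x_def l_def Let_def)
    also have "\<dots> = y i (codegen i ` S)"
      using indep[OF _ i(1) l(1) i(2) S] l(2) by (cases "l = i") auto
    finally show ?thesis .
  qed
  have xf: "x (coface i ` S) = y i S" if "S \<in> std_faces n" "i \<le> Suc n" for S i
    using x_missing[OF coface_std_faces[OF that(1)] that(2) coface_image_missing]
    by (simp add: codegen_coface_image)
  have fx: "fc n i x = y i" if i: "i \<le> Suc n" for i
  proof
    fix S show "fc n i x S = y i S"
    proof (cases "S \<in> std_faces n")
      case True then show ?thesis using xf[OF True i] by (simp add: fc_apply)
    next
      case False then show ?thesis using Gamma_extensional[OF y[OF i] False] by (simp add: fc_def)
    qed
  qed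
  have xt: "x {..Suc n} = e_inv (Suc n) z" using full_face(1)[of "Suc n"] by (simp add: x_def)
  then have tx: "top (Suc n) x = z" using e_e_inv[OF z(1)] by (simp add: top_def coord_def)
  have xP: "x \<in> carrier (faces_group (Suc n))"
    unfolding faces_group_def carrier_product_group
  proof (rule PiE_I)
    fix S assume S: "S \<in> std_faces (Suc n)"
    show "x S \<in> carrier (C (card S - 1))"
    proof (cases "S = {..Suc n}")
      case True then show ?thesis using xt e_inv_closed[OF z(1)] by simp
    next
      case False
      obtain i S' where iS: "i \<le> Suc n" "S' \<in> std_faces n" "S = coface i ` S'"
        by (rule std_faces_missing[OF S False])
      show ?thesis
        using faces_group_closed[OF Gamma_faces_group[OF y[OF iS(1)]] iS(2)] xf[OF iS(2,1)] iS(3)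
        by (simp add: coface_image_card)
    qed
  qed (simp add: x_def)
  have "x \<in> carrier (Gamma_obj C d (Suc n))"
    unfolding Gamma_mem
  proof (intro conjI ballI impI)
    fix S assume S: "S \<in> std_faces (Suc n)" "2 \<le> card S"
    show "defect S x = 0"
    proof (cases "S = {..Suc n}")
      case True then show ?thesis by (simp add: defect_top tx z(2) fx)
    next
      case False
      obtain i S' where iS: "i \<le> Suc n" "S' \<in> std_faces n" "S = coface i ` S'"
        by (rule std_faces_missing[OF S(1) False])
      have c: "2 \<le> card S'" using S(2) iS(3) by (simp add: coface_image_card)
      have "defect S x = defect S' (fc n i x)" using defect_fc[OF iS(2) c] iS(3) by simp
      also have "\<dots> = 0" using y[OF iS(1)] c iS(2) by (simp add: fx[OF iS(1)] Gamma_mem)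
      finally show ?thesis .
    qed
  qed (rule xP)
  then show ?thesis using fx tx by blast
qed

subsection \<open>Regular maps into the simplicial group\<close>

lemma faces_group_functional:
  assumes l: "l \<in> hom (faces_group n) integer_group" and x: "x \<in> carrier (faces_group n)"
  shows "l x = (\<Sum>S\<in>std_faces n. l (\<lambda>T\<in>std_faces n. if T = S then x S else \<one>\<^bsub>C (card T - 1)\<^esub>))"
proof -
  interpret P: comm_group "faces_group n" by (rule faces_group_comm)
  have one: "\<one>\<^bsub>C k\<^esub> \<in> carrier (C k)" for k
    using C_group by (simp add: group.is_monoid monoid.one_closed)
  define part where "part A = (\<lambda>T\<in>std_faces n. if T \<in> A then x T else \<one>\<^bsub>C (card T - 1)\<^esub>)" for A
  define single where "single S = (\<lambda>T\<in>std_faces n. if T = S then x S else \<one>\<^bsub>C (card T - 1)\<^esub>)" for S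
  have pc: "part A \<in> carrier (faces_group n)" for A
    using faces_group_closed[OF x] one by (auto simp: part_def faces_group_def)
  have sc: "single S \<in> carrier (faces_group n)" for S
    using faces_group_closed[OF x] one by (auto simp: single_def faces_group_def)
  have "l (part A) = (\<Sum>S\<in>A. l (single S))" if "finite A" for A
    using that
  proof (induction A)
    case empty
    have "part {} = \<one>\<^bsub>faces_group n\<^esub>" by (simp add: part_def faces_group_def)
    then show ?case using functional_one[OF l P.is_group] by simp
  next
    case (insert S A)
    have "part (insert S A) = single S \<otimes>\<^bsub>faces_group n\<^esub> part A"
      using insert.hyps faces_group_closed[OF x] C_group one
      by (auto simp: part_def single_def faces_group_def fun_eq_iff group.is_monoid monoid.l_one monoid.r_one)
    then show ?case using insert functional_mult[OF l sc pc] by simp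
  qed
  from this[OF std_faces_finite(1)[of n]] have "l (part (std_faces n)) = (\<Sum>S\<in>std_faces n. l (single S))" .
  moreover have "part (std_faces n) = x"
    using x by (auto simp: part_def faces_group_def fun_eq_iff PiE_iff extensional_def)
  ultimately show ?thesis by (simp add: single_def)
qed

text \<open>
  A functional on \<open>\<Gamma>(M)\<^sub>n\<close> extends to the product over all faces, where it is a sum of functionals of
  the components.
\<close>

lemma regular_Gamma:
  assumes R: "rat_algebra Z R" and u: "\<And>z. z \<in> Z \<Longrightarrow> u z \<in> carrier (Gamma_obj C d n)"
    and comp: "\<And>S. S \<in> std_faces n \<Longrightarrow> regular Z R (C (card S - 1)) (\<lambda>z. u z S)"
  shows "regular Z R (Gamma_obj C d n) u"
  unfolding regular_def
proof (intro conjI ballI)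
  show "u \<in> Z \<rightarrow> carrier (Gamma_obj C d n)" using u by blast
  fix l assume l: "l \<in> hom (Gamma_obj C d n) integer_group"
  obtain l' where l': "l' \<in> hom (faces_group n) integer_group"
    and ext: "\<And>x. x \<in> carrier (Gamma_obj C d n) \<Longrightarrow> l' x = l x"
    using hom_extends_from_common_kernel[OF defect_functionals_finite faces_group_comm
        abelian_integer_group defect_functionals_hom, of l n] l
    unfolding Gamma_carrier Gamma_obj_eq by auto
  let ?single = "\<lambda>S a. \<lambda>T\<in>std_faces n. if T = S then a else \<one>\<^bsub>C (card T - 1)\<^esub>"
  have "(\<lambda>a. l' (?single S a)) \<in> hom (C (card S - 1)) integer_group" if S: "S \<in> std_faces n" for S
  proof (rule homI)
    fix a b assume ab: "a \<in> carrier (C (card S - 1))" "b \<in> carrier (C (card S - 1))"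
    have one: "\<one>\<^bsub>C k\<^esub> \<in> carrier (C k)" for k
      using C_group by (simp add: group.is_monoid monoid.one_closed)
    have "?single S a \<in> carrier (faces_group n)" "?single S b \<in> carrier (faces_group n)"
      using ab one by (auto simp: faces_group_def)
    moreover have "?single S (a \<otimes>\<^bsub>C (card S - 1)\<^esub> b) = ?single S a \<otimes>\<^bsub>faces_group n\<^esub> ?single S b"
      using C_group one by (auto simp: faces_group_def fun_eq_iff group.is_monoid monoid.l_one)
    ultimately show "l' (?single S (a \<otimes>\<^bsub>C (card S - 1)\<^esub> b)) =
        l' (?single S a) \<otimes>\<^bsub>integer_group\<^esub> l' (?single S b)"
      using functional_mult[OF l'] by simp
  qed simp
  then have "(\<lambda>z. \<Sum>S\<in>std_faces n. of_int (l' (?single S (u z S)))) \<in> R"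
    by (intro rat_algebra_sum[OF R] regular_functional[OF comp])
  then show "(\<lambda>z. of_int (l (u z))) \<in> R"
    by (rule rat_algebra_cong[OF R])
      (simp add: ext[OF u, symmetric] faces_group_functional[OF l' Gamma_faces_group[OF u]])
qed

lemma eval_hom: "S \<in> std_faces n \<Longrightarrow> (\<lambda>x. x S) \<in> hom (Gamma_obj C d n) (C (card S - 1))"
  by (rule homI)
    (simp_all only: Gamma_mult faces_group_closed[OF Gamma_faces_group], simp add: faces_group_def)

end

section \<open>Extending maps over a principal twisted product\<close>

lemma forget_simps [simp]:
  "simp (forget X) n = carrier (obj X n)" "face (forget X) = nface X" "degen (forget X) = ndegen X"
  by (simp_all add: forget_def)

lemma snum_sset: "is_snum X \<Longrightarrow> is_sset (forget X)"
  by (simp add: is_snum_def)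

lemma snum_free: "is_snum X \<Longrightarrow> fg_free_abelian (obj X n)"
  by (simp add: is_snum_def)

lemma snum_group: "is_snum X \<Longrightarrow> group (obj X n)"
  by (rule fg_free_group(2)[OF snum_free])

lemma snum_face_numerical: "is_snum X \<Longrightarrow> i \<le> Suc n \<Longrightarrow> numerical (obj X (Suc n)) (obj X n) (nface X (Suc n) i)"
  by (simp add: is_snum_def)

lemma snum_degen_numerical: "is_snum X \<Longrightarrow> i \<le> n \<Longrightarrow> numerical (obj X n) (obj X (Suc n)) (ndegen X n i)"
  by (simp add: is_snum_def)

lemma snum_face: "is_snum X \<Longrightarrow> i \<le> Suc n \<Longrightarrow> x \<in> carrier (obj X (Suc n)) \<Longrightarrow> nface X (Suc n) i x \<in> carrier (obj X n)"
  using sset_face[OF snum_sset, of X i n x] by simp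

lemma snum_degen: "is_snum X \<Longrightarrow> i \<le> n \<Longrightarrow> x \<in> carrier (obj X n) \<Longrightarrow> ndegen X n i x \<in> carrier (obj X (Suc n))"
  using sset_degen[OF snum_sset, of X i n x] by simp

text \<open>
  Simplicial maps without the extensionality of \<open>smaps\<close>, so that they can be given by formulas.
\<close>

definition smap :: "'a sset \<Rightarrow> 'b sset \<Rightarrow> (nat \<Rightarrow> 'a \<Rightarrow> 'b) \<Rightarrow> bool" where
  "smap K L f \<longleftrightarrow> (\<forall>n. f n \<in> simp K n \<rightarrow> simp L n) \<and>
     (\<forall>n. \<forall>i\<le>Suc n. \<forall>x\<in>simp K (Suc n). f n (face K (Suc n) i x) = face L (Suc n) i (f (Suc n) x)) \<and>
     (\<forall>n. \<forall>i\<le>n. \<forall>x\<in>simp K n. f (Suc n) (degen K n i x) = degen L n i (f n x))"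

lemma smap_closed: "smap K L f \<Longrightarrow> x \<in> simp K n \<Longrightarrow> f n x \<in> simp L n"
  by (auto simp: smap_def)

lemma smap_face: "smap K L f \<Longrightarrow> i \<le> Suc n \<Longrightarrow> x \<in> simp K (Suc n) \<Longrightarrow>
    f n (face K (Suc n) i x) = face L (Suc n) i (f (Suc n) x)"
  by (simp add: smap_def)

lemma smap_degen: "smap K L f \<Longrightarrow> i \<le> n \<Longrightarrow> x \<in> simp K n \<Longrightarrow>
    f (Suc n) (degen K n i x) = degen L n i (f n x)"
  by (simp add: smap_def)

lemma smaps_smap: "f \<in> smaps K L \<Longrightarrow> smap K L f"
  by (auto simp: smaps_def smap_def PiE_def)

lemma nmaps_smap: "f \<in> nmaps X Y \<Longrightarrow> smap (forget X) (forget Y) f"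
  by (simp add: nmaps_def smaps_smap)

lemma nmaps_numerical: "f \<in> nmaps X Y \<Longrightarrow> numerical (obj X n) (obj Y n) (f n)"
  by (simp add: nmaps_def)

lemma nmaps_closed: "f \<in> nmaps X Y \<Longrightarrow> x \<in> carrier (obj X n) \<Longrightarrow> f n x \<in> carrier (obj Y n)"
  using smap_closed[OF nmaps_smap, of f X Y x n] by simp

lemma nmaps_face: "f \<in> nmaps X Y \<Longrightarrow> i \<le> Suc n \<Longrightarrow> x \<in> carrier (obj X (Suc n)) \<Longrightarrow>
    f n (nface X (Suc n) i x) = nface Y (Suc n) i (f (Suc n) x)"
  using smap_face[OF nmaps_smap, of f X Y i n x] by simp

lemma nmaps_degen: "f \<in> nmaps X Y \<Longrightarrow> i \<le> n \<Longrightarrow> x \<in> carrier (obj X n) \<Longrightarrow>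
    f (Suc n) (ndegen X n i x) = ndegen Y n i (f n x)"
  using smap_degen[OF nmaps_smap, of f X Y i n x] by simp

lemma regular_DirProd:
  assumes R: "rat_algebra Z R" and A: "group A" and B: "group B"
    and u: "regular Z R A u" and v: "regular Z R B v"
  shows "regular Z R (A \<times>\<times> B) (\<lambda>z. (u z, v z))"
  unfolding regular_def
proof (intro conjI ballI)
  have oneA: "\<one>\<^bsub>A\<^esub> \<in> carrier A" and oneB: "\<one>\<^bsub>B\<^esub> \<in> carrier B"
    using A B by (simp_all add: group.is_monoid monoid.one_closed)
  show "(\<lambda>z. (u z, v z)) \<in> Z \<rightarrow> carrier (A \<times>\<times> B)"
    using regularD[OF u] regularD[OF v] by (simp add: DirProd_def)
  fix l assume l: "l \<in> hom (A \<times>\<times> B) integer_group"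
  have split: "l (a, b) = l (a, \<one>\<^bsub>B\<^esub>) + l (\<one>\<^bsub>A\<^esub>, b)" if "a \<in> carrier A" "b \<in> carrier B" for a b
    using functional_mult[OF l, of "(a, \<one>\<^bsub>B\<^esub>)" "(\<one>\<^bsub>A\<^esub>, b)"] that oneA oneB A B
    by (simp add: DirProd_def group.is_monoid monoid.l_one monoid.r_one)
  have "(\<lambda>a. l (a, \<one>\<^bsub>B\<^esub>)) \<in> hom A integer_group"
  proof (rule homI)
    show "l (a \<otimes>\<^bsub>A\<^esub> a', \<one>\<^bsub>B\<^esub>) = l (a, \<one>\<^bsub>B\<^esub>) \<otimes>\<^bsub>integer_group\<^esub> l (a', \<one>\<^bsub>B\<^esub>)"
      if "a \<in> carrier A" "a' \<in> carrier A" for a a'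
      using functional_mult[OF l, of "(a, \<one>\<^bsub>B\<^esub>)" "(a', \<one>\<^bsub>B\<^esub>)"] that oneB B
      by (simp add: DirProd_def group.is_monoid monoid.l_one)
  qed simp
  moreover have "(\<lambda>b. l (\<one>\<^bsub>A\<^esub>, b)) \<in> hom B integer_group"
  proof (rule homI)
    show "l (\<one>\<^bsub>A\<^esub>, b \<otimes>\<^bsub>B\<^esub> b') = l (\<one>\<^bsub>A\<^esub>, b) \<otimes>\<^bsub>integer_group\<^esub> l (\<one>\<^bsub>A\<^esub>, b')"
      if "b \<in> carrier B" "b' \<in> carrier B" for b b'
      using functional_mult[OF l, of "(\<one>\<^bsub>A\<^esub>, b)" "(\<one>\<^bsub>A\<^esub>, b')"] that oneA A
      by (simp add: DirProd_def group.is_monoid monoid.l_one)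
  qed simp
  ultimately have "(\<lambda>z. of_int (l (u z, \<one>\<^bsub>B\<^esub>)) + of_int (l (\<one>\<^bsub>A\<^esub>, v z))) \<in> R"
    using regular_functional[OF u] regular_functional[OF v] by (intro rat_algebra_add[OF R])
  then show "(\<lambda>z. of_int (l (u z, v z))) \<in> R"
    by (rule rat_algebra_cong[OF R]) (simp add: split[OF regularD[OF u] regularD[OF v]])
qed

text \<open>
  A principal twisted cartesian product \<open>p : E \<rightarrow> B\<close> with fibre \<open>\<Gamma>(C)\<close>, the isomorphism \<open>\<phi>\<close> with the
  standard model and its inverse \<open>\<psi>\<close> being chosen.
\<close>

locale ptcp_stage = framed_complex C d m e
  for C :: "nat \<Rightarrow> zvec monoid" and d m e +
  fixes E B :: "zvec snum" and p \<tau> \<phi> \<psi>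
  assumes snE: "is_snum E" and snB: "is_snum B" and p: "p \<in> nmaps E B"
    and tw: "twisting_function B (Gamma C d) \<tau>"
    and \<phi>: "\<phi> \<in> nmaps E (twisted_product B (Gamma C d) \<tau>)"
    and \<psi>: "\<psi> \<in> nmaps (twisted_product B (Gamma C d) \<tau>) E"
    and \<psi>\<phi>: "x \<in> carrier (obj E n) \<Longrightarrow> \<psi> n (\<phi> n x) = x"
    and \<phi>\<psi>: "w \<in> carrier (obj (twisted_product B (Gamma C d) \<tau>) n) \<Longrightarrow> \<phi> n (\<psi> n w) = w"
    and snd_\<phi>: "x \<in> carrier (obj E n) \<Longrightarrow> snd (\<phi> n x) = p n x"
begin

abbreviation Gm where "Gm n \<equiv> Gamma_obj C d n"

text \<open>
  The simplices of \<open>E\<close> are recorded by the cochain \<open>c\<close>, and the twisting function by \<open>t\<close>, whose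
  index is shifted so that \<open>t n\<close> has values in degree \<open>n\<close>.
\<close>

definition fib :: "nat \<Rightarrow> zvec \<Rightarrow> nat set \<Rightarrow> zvec" where
  "fib n x = fst (\<phi> n x)"

definition c :: "nat \<Rightarrow> zvec \<Rightarrow> zvec" where
  "c n x = top n (fib n x)"

definition t :: "nat \<Rightarrow> zvec \<Rightarrow> zvec" where
  "t n b = top n (\<tau> (Suc n) b)"

lemma obj_tw: "obj (twisted_product B (Gamma C d) \<tau>) n = Gm n \<times>\<times> obj B n"
  by (simp add: twisted_product_def Gamma_def)

lemma obj_Gamma: "obj (Gamma C d) n = Gm n"
  by (simp add: Gamma_def)

lemma \<phi>_pair: "x \<in> carrier (obj E n) \<Longrightarrow> \<phi> n x = (fib n x, p n x)"
  by (simp add: fib_def snd_\<phi>[symmetric])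

lemma fib_closed: "x \<in> carrier (obj E n) \<Longrightarrow> fib n x \<in> carrier (Gm n)"
  using nmaps_closed[OF \<phi>, of x n] by (simp add: \<phi>_pair obj_tw DirProd_def)

lemma p_closed: "x \<in> carrier (obj E n) \<Longrightarrow> p n x \<in> carrier (obj B n)"
  by (rule nmaps_closed[OF p])

lemma tau_numerical: "numerical (obj B (Suc n)) (Gm n) (\<tau> (Suc n))"
  using tw by (simp add: twisting_function_def obj_Gamma)

lemma tau_closed: "b \<in> carrier (obj B (Suc n)) \<Longrightarrow> \<tau> (Suc n) b \<in> carrier (Gm n)"
  using tau_numerical[of n] by (auto simp: numerical_def)

lemma tau_face: "b \<in> carrier (obj B (Suc (Suc n))) \<Longrightarrow> 0 < i \<Longrightarrow> i \<le> Suc n \<Longrightarrow>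
    fc n i (\<tau> (Suc (Suc n)) b) = \<tau> (Suc n) (nface B (Suc (Suc n)) (Suc i) b)"
  using tw by (simp add: twisting_function_def nface_Gamma)

lemma tau_face_0: "b \<in> carrier (obj B (Suc (Suc n))) \<Longrightarrow>
    fc n 0 (\<tau> (Suc (Suc n)) b) = inv\<^bsub>Gm n\<^esub> \<tau> (Suc n) (nface B (Suc (Suc n)) 0 b)
      \<otimes>\<^bsub>Gm n\<^esub> \<tau> (Suc n) (nface B (Suc (Suc n)) 1 b)"
  using tw by (simp add: twisting_function_def nface_Gamma obj_Gamma)

lemma fib_face: "x \<in> carrier (obj E (Suc n)) \<Longrightarrow> 0 < i \<Longrightarrow> i \<le> Suc n \<Longrightarrow>
    fib n (nface E (Suc n) i x) = fc n i (fib (Suc n) x)"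
  using nmaps_face[OF \<phi>, of i n x] \<phi>_pair[of x "Suc n"] \<phi>_pair[OF snum_face[OF snE, of i n x]]
  by (simp add: twisted_product_def nface_Gamma)

lemma fib_face_0: "x \<in> carrier (obj E (Suc n)) \<Longrightarrow>
    fib n (nface E (Suc n) 0 x) = \<tau> (Suc n) (p (Suc n) x) \<otimes>\<^bsub>Gm n\<^esub> fc n 0 (fib (Suc n) x)"
  using nmaps_face[OF \<phi>, of 0 n x] \<phi>_pair[of x "Suc n"] \<phi>_pair[OF snum_face[OF snE, of 0 n x]]
  by (simp add: twisted_product_def nface_Gamma obj_Gamma)

lemma fib_degen: "x \<in> carrier (obj E n) \<Longrightarrow> i \<le> n \<Longrightarrow>
    fib (Suc n) (ndegen E n i x) = ndegen (Gamma C d) n i (fib n x)"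
  using nmaps_degen[OF \<phi>, of i n x] \<phi>_pair[of x n] \<phi>_pair[OF snum_degen[OF snE, of i n x]]
  by (simp add: twisted_product_def)

lemma E_eqI: "x \<in> carrier (obj E n) \<Longrightarrow> x' \<in> carrier (obj E n) \<Longrightarrow> fib n x = fib n x' \<Longrightarrow>
    p n x = p n x' \<Longrightarrow> x = x'"
  using \<phi>_pair[of x n] \<phi>_pair[of x' n] \<psi>\<phi>[of x n] \<psi>\<phi>[of x' n] by simp

lemma E_exists:
  assumes "g \<in> carrier (Gm n)" "b \<in> carrier (obj B n)"
  shows "\<exists>x\<in>carrier (obj E n). fib n x = g \<and> p n x = b"
proof (rule bexI)
  have w: "(g, b) \<in> carrier (obj (twisted_product B (Gamma C d) \<tau>) n)"
    using assms by (simp add: obj_tw DirProd_def)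
  show x: "\<psi> n (g, b) \<in> carrier (obj E n)" by (rule nmaps_closed[OF \<psi> w])
  show "fib n (\<psi> n (g, b)) = g \<and> p n (\<psi> n (g, b)) = b"
    using \<phi>_pair[OF x] \<phi>\<psi>[OF w] by simp
qed

lemma c_vecs: "x \<in> carrier (obj E n) \<Longrightarrow> c n x \<in> vecs (m n)"
  unfolding c_def by (rule top_vecs[OF fib_closed])

lemma c_degen: "x \<in> carrier (obj E n) \<Longrightarrow> i \<le> n \<Longrightarrow> c (Suc n) (ndegen E n i x) = 0"
  by (simp add: c_def fib_degen top_degen)

lemma t_vecs: "b \<in> carrier (obj B (Suc n)) \<Longrightarrow> t n b \<in> vecs (m n)"
  unfolding t_def by (rule top_vecs[OF tau_closed])

lemma t_degen:
  assumes "b \<in> carrier (obj B n)" "i \<le> n"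
  shows "t n (ndegen B n i b) = 0"
proof (cases i)
  case 0
  then show ?thesis using tw assms hom_one[OF top_hom Gamma_group, of n]
    by (simp add: twisting_function_def t_def obj_Gamma)
next
  case (Suc j)
  then obtain q where q: "n = Suc q" using assms(2) by (cases n) auto
  have "\<tau> (Suc (Suc q)) (ndegen B (Suc q) (Suc j) b) = ndegen (Gamma C d) q j (\<tau> (Suc q) b)"
    using tw assms Suc q by (simp add: twisting_function_def)
  then show ?thesis using assms Suc q by (simp add: t_def top_degen)
qed

lemma fib_regular:
  assumes R: "rat_algebra Z R" and u: "regular Z R (obj E n) u"
  shows "regular Z R (Gm n) (\<lambda>z. fib n (u z))"
proof -
  have g: "group (obj (twisted_product B (Gamma C d) \<tau>) n)"
    unfolding obj_tw by (intro DirProd_group Gamma_group snum_group[OF snB])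
  have "regular Z R (Gm n \<times>\<times> obj B n) (\<lambda>z. \<phi> n (u z))"
    using numerical_regular[OF nmaps_numerical[OF \<phi>] R u g] by (simp add: obj_tw)
  moreover have "fst \<in> hom (Gm n \<times>\<times> obj B n) (Gm n)"
    by (rule homI) (auto simp: DirProd_def)
  ultimately show ?thesis unfolding fib_def by (rule regular_hom)
qed

lemma c_regular: "rat_algebra Z R \<Longrightarrow> regular Z R (obj E n) u \<Longrightarrow> regular Z R (zfree (m n)) (\<lambda>z. c n (u z))"
  unfolding c_def by (rule regular_hom[OF fib_regular top_hom])

lemma tau_regular: "rat_algebra Z R \<Longrightarrow> regular Z R (obj B (Suc n)) u \<Longrightarrow> regular Z R (Gm n) (\<lambda>z. \<tau> (Suc n) (u z))"
  by (rule numerical_regular[OF tau_numerical _ _ Gamma_group])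

lemma t_regular: "rat_algebra Z R \<Longrightarrow> regular Z R (obj B (Suc n)) u \<Longrightarrow> regular Z R (zfree (m n)) (\<lambda>z. t n (u z))"
  unfolding t_def by (rule regular_hom[OF tau_regular top_hom])

lemma zero_th_sum: "(\<Sum>i\<le>(n::nat). if i = 0 then a else 0) = (a :: zvec)"
  by (induction n) simp_all

text \<open>
  The chain condition on the top cell in \<open>\<Gamma>(C)\<close>, except that the zeroth face of the fibre coordinate
  differs from the fibre coordinate of the zeroth face by the twisting function.
\<close>

lemma c_boundary:
  assumes x: "x \<in> carrier (obj E (Suc n))"
  shows "D n (c (Suc n) x) = vcob (forget E) (Suc n) (c n) x - t n (p (Suc n) x)"
proof -
  let ?g = "fib (Suc n) x" and ?b = "p (Suc n) x"
  have g: "fc n i ?g \<in> carrier (Gm n)" for i by (rule fc_closed[OF fib_closed[OF x]])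
  have "frag_cmul ((-1) ^ i) (top n (fc n i ?g)) =
      frag_cmul ((-1) ^ i) (c n (nface E (Suc n) i x)) - (if i = 0 then t n ?b else 0)" if "i \<le> Suc n" for i
    using that x fib_face[OF x, of i] fib_face_0[OF x]
      top_mult[OF tau_closed[OF p_closed[OF x]] g] by (cases "i = 0") (simp_all add: c_def t_def)
  then have "(\<Sum>i\<le>Suc n. frag_cmul ((-1) ^ i) (top n (fc n i ?g))) =
      (\<Sum>i\<le>Suc n. frag_cmul ((-1) ^ i) (c n (nface E (Suc n) i x)) - (if i = 0 then t n ?b else 0))"
    by (intro sum.cong refl) simp
  then show ?thesis
    unfolding sum_subtractf zero_th_sum
    using top_boundary[OF fib_closed[OF x]] by (simp add: vcob_def c_def)
qed

text \<open>
  The identity \<open>\<partial>\<^sub>0 \<tau>(b) = \<tau>(\<partial>\<^sub>0 b)\<^sup>-\<^sup>1 \<tau>(\<partial>\<^sub>1 b)\<close> accounts for two faces of \<open>b\<close>, the other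
  identities for one each.
\<close>

lemma t_boundary:
  assumes b: "b \<in> carrier (obj B (Suc (Suc n)))"
  shows "D n (t (Suc n) b) = - vcob (forget B) (Suc (Suc n)) (t n) b"
proof -
  let ?f = "\<lambda>i. t n (nface B (Suc (Suc n)) i b)"
  let ?y = "\<lambda>i. \<tau> (Suc n) (nface B (Suc (Suc n)) i b)"
  have y: "?y i \<in> carrier (Gm n)" if "i \<le> Suc (Suc n)" for i
    using tau_closed[OF snum_face[OF snB that b]] .
  have th: "top n (inv\<^bsub>Gm n\<^esub> ?y 0 \<otimes>\<^bsub>Gm n\<^esub> ?y 1) = - ?f 0 + ?f 1"
  proof -
    interpret group_hom "Gm n" "zfree (m n)" "top n"
      using top_hom Gamma_group by (simp add: group_hom_def group_hom_axioms_def)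
    have "top n (inv\<^bsub>Gm n\<^esub> ?y 0) = - ?f 0"
      using hom_inv[OF y[of 0]] top_vecs[OF y[of 0]] by (simp add: t_def)
    then show ?thesis using y[of 0] y[of 1] by (simp add: t_def)
  qed
  have "frag_cmul ((-1) ^ i) (top n (fc n i (\<tau> (Suc (Suc n)) b))) =
      frag_cmul ((-1) ^ i) (?f (Suc i)) - (if i = 0 then ?f 0 else 0)" if "i \<le> Suc n" for i
    using that tau_face[OF b, of i] tau_face_0[OF b] th by (cases "i = 0") (simp_all add: t_def)
  then have "(\<Sum>i\<le>Suc n. frag_cmul ((-1) ^ i) (top n (fc n i (\<tau> (Suc (Suc n)) b)))) =
      (\<Sum>i\<le>Suc n. frag_cmul ((-1) ^ i) (?f (Suc i)) - (if i = 0 then ?f 0 else 0))"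
    by (intro sum.cong refl) simp
  also have "\<dots> = (\<Sum>i\<le>Suc n. frag_cmul ((-1) ^ i) (?f (Suc i))) - ?f 0"
    unfolding sum_subtractf zero_th_sum ..
  also have "\<dots> = - (\<Sum>i\<le>Suc (Suc n). frag_cmul ((-1) ^ i) (?f i))"
    unfolding sum.atMost_Suc_shift[of _ "Suc n"] by (simp flip: sum_negf del: sum.atMost_Suc)
  finally show ?thesis
    using top_boundary[OF tau_closed[OF b]] by (simp add: t_def vcob_def)
qed

text \<open>
  With \<open>stage_fill\<close> this says that lifting a simplex over \<open>b\<close>, the lift being given on the boundary,
  amounts to choosing \<open>c\<close> subject to the linear condition of \<open>c_boundary\<close>.
\<close>

lemma stage_unique:
  assumes x: "x \<in> carrier (obj E (Suc n))" "x' \<in> carrier (obj E (Suc n))"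
    and px: "p (Suc n) x = p (Suc n) x'" and cx: "c (Suc n) x = c (Suc n) x'"
    and fx: "\<And>i. i \<le> Suc n \<Longrightarrow> nface E (Suc n) i x = nface E (Suc n) i x'"
  shows "x = x'"
proof (rule E_eqI[OF x _ px])
  show "fib (Suc n) x = fib (Suc n) x'"
  proof (rule Gamma_eqI[OF fib_closed[OF x(1)] fib_closed[OF x(2)]])
    show "top (Suc n) (fib (Suc n) x) = top (Suc n) (fib (Suc n) x')" using cx by (simp add: c_def)
    fix i assume i: "i \<le> Suc n"
    show "fc n i (fib (Suc n) x) = fc n i (fib (Suc n) x')"
    proof (cases "i = 0")
      case True
      interpret G: group "Gm n" by (rule Gamma_group)
      have "\<tau> (Suc n) (p (Suc n) x) \<otimes>\<^bsub>Gm n\<^esub> fc n 0 (fib (Suc n) x) =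
          \<tau> (Suc n) (p (Suc n) x) \<otimes>\<^bsub>Gm n\<^esub> fc n 0 (fib (Suc n) x')"
        using fib_face_0[OF x(1)] fib_face_0[OF x(2)] fx[of 0] px by simp
      then show ?thesis
        using True G.Units_l_cancel[of "\<tau> (Suc n) (p (Suc n) x)"] tau_closed[OF p_closed[OF x(1)]] fc_closed[OF fib_closed[OF x(1)]]
          fc_closed[OF fib_closed[OF x(2)]] by simp
    next
      case False
      then show ?thesis using fib_face[OF x(1), of i] fib_face[OF x(2), of i] fx[OF i] i by simp
    qed
  qed
qed

lemma stage_unique_0:
  assumes x: "x \<in> carrier (obj E 0)" "x' \<in> carrier (obj E 0)"
    and px: "p 0 x = p 0 x'" and cx: "c 0 x = c 0 x'"
  shows "x = x'"
  using E_eqI[OF x Gamma_eqI_0[OF fib_closed[OF x(1)] fib_closed[OF x(2)]] px] cx by (simp add: c_def)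

lemma stage_vertex:
  assumes "b \<in> carrier (obj B 0)" "z \<in> vecs (m 0)"
  shows "\<exists>x\<in>carrier (obj E 0). p 0 x = b \<and> c 0 x = z"
proof -
  obtain g where g: "g \<in> carrier (Gm 0)" "top 0 g = z" using Gamma_vertex[OF assms(2)] by blast
  show ?thesis using E_exists[OF g(1) assms(1)] g(2) by (auto simp: c_def)
qed

lemma stage_fill:
  assumes b: "b \<in> carrier (obj B (Suc n))"
    and y: "\<And>i. i \<le> Suc n \<Longrightarrow> y i \<in> carrier (obj E n)"
    and py: "\<And>i. i \<le> Suc n \<Longrightarrow> p n (y i) = nface B (Suc n) i b"
    and match: "\<And>k i j. n = Suc k \<Longrightarrow> i < j \<Longrightarrow> j \<le> Suc n \<Longrightarrow> nface E (Suc k) i (y j) = nface E (Suc k) (j - 1) (y i)"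
    and z: "z \<in> vecs (m (Suc n))" "D n z = (\<Sum>i\<le>Suc n. frag_cmul ((-1) ^ i) (c n (y i))) - t n b"
  shows "\<exists>x\<in>carrier (obj E (Suc n)). p (Suc n) x = b \<and> (\<forall>i\<le>Suc n. nface E (Suc n) i x = y i) \<and> c (Suc n) x = z"
proof -
  interpret G: comm_group "Gm n" by (rule Gamma_comm)
  have tb: "\<tau> (Suc n) b \<in> carrier (Gm n)" by (rule tau_closed[OF b])
  \<comment> \<open>The faces that the fibre coordinate has to have; the zeroth one is untwisted.\<close>
  define w where "w i = (if i = 0 then inv\<^bsub>Gm n\<^esub> \<tau> (Suc n) b \<otimes>\<^bsub>Gm n\<^esub> fib n (y 0) else fib n (y i))" for i
  have wc: "w i \<in> carrier (Gm n)" if "i \<le> Suc n" for i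
    using fib_closed[OF y[OF that]] fib_closed[OF y[of 0]] tb by (simp add: w_def)
  have "top n (w 0) = c n (y 0) - t n b"
  proof -
    have i: "inv\<^bsub>Gm n\<^esub> \<tau> (Suc n) b \<in> carrier (Gm n)" using tb by simp
    have "top n (inv\<^bsub>Gm n\<^esub> \<tau> (Suc n) b) + t n b = 0"
      using top_mult[OF i tb] tb hom_one[OF top_hom Gamma_group, of n] by (simp add: t_def)
    then have "top n (inv\<^bsub>Gm n\<^esub> \<tau> (Suc n) b) = - t n b" by (simp add: eq_neg_iff_add_eq_0)
    then show ?thesis using top_mult[OF i fib_closed[OF y[of 0]]] by (simp add: w_def c_def)
  qed
  then have "frag_cmul ((-1) ^ i) (top n (w i)) =
      frag_cmul ((-1) ^ i) (c n (y i)) - (if i = 0 then t n b else 0)" for i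
    by (cases "i = 0") (simp_all add: w_def c_def)
  then have "(\<Sum>i\<le>Suc n. frag_cmul ((-1) ^ i) (top n (w i))) = (\<Sum>i\<le>Suc n. frag_cmul ((-1) ^ i) (c n (y i))) - t n b"
    by (simp only: sum_subtractf zero_th_sum)
  then have zw: "D n z = (\<Sum>i\<le>Suc n. frag_cmul ((-1) ^ i) (top n (w i)))" using z(2) by simp
  have wm: "fc k i (w j) = fc k (j - 1) (w i)" if n: "n = Suc k" and ij: "i < j" "j \<le> Suc n" for k i j
  proof -
    interpret H: comm_group "Gm k" by (rule Gamma_comm)
    have yi: "y i \<in> carrier (obj E (Suc k))" and yj: "y j \<in> carrier (obj E (Suc k))"
      using y n ij by auto
    have b': "b \<in> carrier (obj B (Suc (Suc k)))" using b n by simp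
    have m: "nface E (Suc k) i (y j) = nface E (Suc k) (j - 1) (y i)" by (rule match[OF n ij])
    show ?thesis
    proof (cases "i = 0")
      case False
      then have "fc k i (w j) = fib k (nface E (Suc k) i (y j))"
        using fib_face[OF yj, of i] ij n by (simp add: w_def)
      moreover have "fc k (j - 1) (w i) = fib k (nface E (Suc k) (j - 1) (y i))"
        using fib_face[OF yi, of "j - 1"] ij n False by (simp add: w_def)
      ultimately show ?thesis using m by simp
    next
      case True
      let ?X = "fib k (nface E (Suc k) 0 (y j))"
      let ?T = "\<lambda>i. \<tau> (Suc k) (nface B (Suc (Suc k)) i b)"
      have Tc: "?T i \<in> carrier (Gm k)" if "i \<le> Suc (Suc k)" for i
        by (rule tau_closed[OF snum_face[OF snB that b']])
      have Xc: "?X \<in> carrier (Gm k)" using fib_closed[OF snum_face[OF snE _ yj, of 0]] by simp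
      have fj: "fc k 0 (fib (Suc k) (y j)) \<in> carrier (Gm k)" by (rule fc_closed[OF fib_closed[OF yj]])
      have "?X = ?T j \<otimes>\<^bsub>Gm k\<^esub> fc k 0 (fib (Suc k) (y j))"
        using fib_face_0[OF yj] py[OF ij(2)] n by simp
      then have l: "fc k 0 (w j) = inv\<^bsub>Gm k\<^esub> ?T j \<otimes>\<^bsub>Gm k\<^esub> ?X"
        using ij n Tc[of j] fj by (simp add: w_def H.m_assoc[symmetric])
      have f0: "fib (Suc k) (y 0) \<in> carrier (Gm (Suc k))" using fib_closed[OF yi] True by simp
      have tb': "\<tau> (Suc (Suc k)) b \<in> carrier (Gm (Suc k))" using tb n by simp
      have r: "fc k (j - 1) (w 0) = inv\<^bsub>Gm k\<^esub> fc k (j - 1) (\<tau> (Suc (Suc k)) b) \<otimes>\<^bsub>Gm k\<^esub> fc k (j - 1) (fib (Suc k) (y 0))"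
      proof -
        interpret GS: group "Gm (Suc k)" by (rule Gamma_group)
        have "inv\<^bsub>Gm (Suc k)\<^esub> \<tau> (Suc (Suc k)) b \<in> carrier (Gm (Suc k))" using tb' by simp
        from hom_mult[OF fc_hom this f0] show ?thesis
          by (simp add: w_def n fc_m_inv[OF tb'])
      qed
      \<comment> \<open>For j > 1 the twisting function commutes with the face operators that occur; for j = 1 its
        zeroth face enters.\<close>
      show ?thesis
      proof (cases "j = 1")
        case False
        then have "fc k (j - 1) (\<tau> (Suc (Suc k)) b) = ?T j"
          using tau_face[OF b', of "j - 1"] ij n by simp
        moreover have "fc k (j - 1) (fib (Suc k) (y 0)) = ?X"
          using fib_face[OF yi, of "j - 1"] False ij n m True by simp
        ultimately show ?thesis using l r True by simp
      next
        case j: True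
        have y0: "y 0 \<in> carrier (obj E (Suc k))" using yi True by simp
        have f00: "fc k 0 (fib (Suc k) (y 0)) \<in> carrier (Gm k)" by (rule fc_closed[OF f0])
        have "?X = ?T 0 \<otimes>\<^bsub>Gm k\<^esub> fc k 0 (fib (Suc k) (y 0))"
          using fib_face_0[OF y0] py[of 0] n m True j by simp
        then have "fc k 0 (fib (Suc k) (y 0)) = inv\<^bsub>Gm k\<^esub> ?T 0 \<otimes>\<^bsub>Gm k\<^esub> ?X"
          using Tc[of 0] f00 by (simp add: H.m_assoc[symmetric])
        then have "fc k 0 (w 0) = inv\<^bsub>Gm k\<^esub> (inv\<^bsub>Gm k\<^esub> ?T 0 \<otimes>\<^bsub>Gm k\<^esub> ?T 1) \<otimes>\<^bsub>Gm k\<^esub> (inv\<^bsub>Gm k\<^esub> ?T 0 \<otimes>\<^bsub>Gm k\<^esub> ?X)"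
          using r j tau_face_0[OF b'] by simp
        also have "\<dots> = inv\<^bsub>Gm k\<^esub> ?T 1 \<otimes>\<^bsub>Gm k\<^esub> ?X"
        proof -
          have "inv\<^bsub>Gm k\<^esub> (inv\<^bsub>Gm k\<^esub> P \<otimes>\<^bsub>Gm k\<^esub> Q) \<otimes>\<^bsub>Gm k\<^esub> (inv\<^bsub>Gm k\<^esub> P \<otimes>\<^bsub>Gm k\<^esub> S) = inv\<^bsub>Gm k\<^esub> Q \<otimes>\<^bsub>Gm k\<^esub> S"
            if P: "P \<in> carrier (Gm k)" and Q: "Q \<in> carrier (Gm k)" and S: "S \<in> carrier (Gm k)" for P Q S
          proof -
            have "inv\<^bsub>Gm k\<^esub> (inv\<^bsub>Gm k\<^esub> P \<otimes>\<^bsub>Gm k\<^esub> Q) = inv\<^bsub>Gm k\<^esub> Q \<otimes>\<^bsub>Gm k\<^esub> P"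
              using P Q by (simp add: H.inv_mult_group)
            then have "inv\<^bsub>Gm k\<^esub> (inv\<^bsub>Gm k\<^esub> P \<otimes>\<^bsub>Gm k\<^esub> Q) \<otimes>\<^bsub>Gm k\<^esub> (inv\<^bsub>Gm k\<^esub> P \<otimes>\<^bsub>Gm k\<^esub> S)
                = inv\<^bsub>Gm k\<^esub> Q \<otimes>\<^bsub>Gm k\<^esub> (P \<otimes>\<^bsub>Gm k\<^esub> (inv\<^bsub>Gm k\<^esub> P \<otimes>\<^bsub>Gm k\<^esub> S))"
              using P Q S by (simp add: H.m_assoc)
            also have "P \<otimes>\<^bsub>Gm k\<^esub> (inv\<^bsub>Gm k\<^esub> P \<otimes>\<^bsub>Gm k\<^esub> S) = S"
              using P S by (simp add: H.m_assoc[symmetric])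
            finally show ?thesis .
          qed
          from this[OF Tc[of 0] Tc[of 1] Xc] show ?thesis by simp
        qed
        finally show ?thesis using l True j by simp
      qed
    qed
  qed
  obtain g where g: "g \<in> carrier (Gm (Suc n))" "\<forall>i\<le>Suc n. fc n i g = w i" "top (Suc n) g = z"
    using Gamma_fill[OF wc wm z(1) zw] by blast
  obtain x where x: "x \<in> carrier (obj E (Suc n))" "fib (Suc n) x = g" "p (Suc n) x = b"
    using E_exists[OF g(1) b] by blast
  have "nface E (Suc n) i x = y i" if i: "i \<le> Suc n" for i
  proof (rule E_eqI[OF snum_face[OF snE i x(1)] y[OF i]])
    show "p n (nface E (Suc n) i x) = p n (y i)"
      using nmaps_face[OF p i x(1)] py[OF i] x(3) by simp
    show "fib n (nface E (Suc n) i x) = fib n (y i)"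
    proof (cases "i = 0")
      case True
      have "fib n (nface E (Suc n) 0 x) = \<tau> (Suc n) b \<otimes>\<^bsub>Gm n\<^esub> w 0"
        using fib_face_0[OF x(1)] x(2,3) g(2) by simp
      then show ?thesis using True tb fib_closed[OF y[of 0]] by (simp add: w_def G.m_assoc[symmetric])
    next
      case False
      then show ?thesis using fib_face[OF x(1), of i] x(2) g(2) i by (simp add: w_def)
    qed
  qed
  then show ?thesis using x g(3) by (auto simp: c_def)
qed

lemma stage_regular_aux:
  assumes R: "rat_algebra Z R" and u: "\<And>z. z \<in> Z \<Longrightarrow> u z \<in> carrier (obj E n)"
    and pu: "regular Z R (obj B n) (\<lambda>z. p n (u z))" and gu: "regular Z R (Gm n) (\<lambda>z. fib n (u z))"
  shows "regular Z R (obj E n) u"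
proof -
  have "regular Z R (obj (twisted_product B (Gamma C d) \<tau>) n) (\<lambda>z. (fib n (u z), p n (u z)))"
    unfolding obj_tw by (rule regular_DirProd[OF R Gamma_group snum_group[OF snB] gu pu])
  from numerical_regular[OF nmaps_numerical[OF \<psi>] R this snum_group[OF snE]] show ?thesis
    by (rule regular_cong[OF R]) (simp add: \<phi>_pair[OF u, symmetric] \<psi>\<phi>[OF u])
qed

lemma full_component_regular:
  assumes R: "rat_algebra Z R" and g: "\<And>z. z \<in> Z \<Longrightarrow> g z \<in> carrier (Gm n)"
    and t: "regular Z R (zfree (m n)) (\<lambda>z. top n (g z))"
  shows "regular Z R (C n) (\<lambda>z. g z {..n})"
proof (rule regular_cong[OF R regular_hom[OF t e_inv_hom]])
  fix z assume "z \<in> Z"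
  then show "e_inv n (top n (g z)) = g z {..n}"
    using faces_group_closed[OF Gamma_faces_group[OF g] full_face(1)] by (simp add: top_def coord_def e_inv_e)
qed

lemma stage_regular_0:
  assumes R: "rat_algebra Z R" and u: "\<And>z. z \<in> Z \<Longrightarrow> u z \<in> carrier (obj E 0)"
    and pu: "regular Z R (obj B 0) (\<lambda>z. p 0 (u z))" and cu: "regular Z R (zfree (m 0)) (\<lambda>z. c 0 (u z))"
  shows "regular Z R (obj E 0) u"
proof (rule stage_regular_aux[OF R u pu])
  show "regular Z R (Gm 0) (\<lambda>z. fib 0 (u z))"
    using full_component_regular[OF R fib_closed[OF u] cu[unfolded c_def]]
    by (intro regular_Gamma[OF R fib_closed[OF u]]) (simp_all add: std_faces_0)
qed

lemma stage_regular:
  assumes R: "rat_algebra Z R" and u: "\<And>z. z \<in> Z \<Longrightarrow> u z \<in> carrier (obj E (Suc n))"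
    and pu: "regular Z R (obj B (Suc n)) (\<lambda>z. p (Suc n) (u z))"
    and cu: "regular Z R (zfree (m (Suc n))) (\<lambda>z. c (Suc n) (u z))"
    and fu: "\<And>i. i \<le> Suc n \<Longrightarrow> regular Z R (obj E n) (\<lambda>z. nface E (Suc n) i (u z))"
  shows "regular Z R (obj E (Suc n)) u"
proof (rule stage_regular_aux[OF R u pu])
  note g = fib_closed[OF u]
  have fcr: "regular Z R (Gm n) (\<lambda>z. fc n i (fib (Suc n) (u z)))" if i: "i \<le> Suc n" for i
  proof (cases "i = 0")
    case True
    interpret G: group "Gm n" by (rule Gamma_group)
    have "regular Z R (Gm n) (\<lambda>z. inv\<^bsub>Gm n\<^esub> \<tau> (Suc n) (p (Suc n) (u z)) \<otimes>\<^bsub>Gm n\<^esub> fib n (nface E (Suc n) 0 (u z)))"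
      by (intro regular_mult[OF R Gamma_group] regular_inv[OF R Gamma_group] tau_regular[OF R pu]
          fib_regular[OF R fu]) simp
    then show ?thesis
    proof (rule regular_cong[OF R])
      fix z assume z: "z \<in> Z"
      have "fc n 0 (fib (Suc n) (u z)) \<in> carrier (Gm n)" "\<tau> (Suc n) (p (Suc n) (u z)) \<in> carrier (Gm n)"
        using fc_closed[OF g[OF z]] tau_closed[OF p_closed[OF u[OF z]]] by simp_all
      then show "inv\<^bsub>Gm n\<^esub> \<tau> (Suc n) (p (Suc n) (u z)) \<otimes>\<^bsub>Gm n\<^esub> fib n (nface E (Suc n) 0 (u z)) =
          fc n i (fib (Suc n) (u z))"
        using True fib_face_0[OF u[OF z]] by (simp add: G.m_assoc[symmetric])
    qed
  next
    case False
    show ?thesis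
      by (rule regular_cong[OF R fib_regular[OF R fu[OF i]]]) (use False i fib_face[OF u] in simp)
  qed
  show "regular Z R (Gm (Suc n)) (\<lambda>z. fib (Suc n) (u z))"
  proof (rule regular_Gamma[OF R g])
    fix S assume S: "S \<in> std_faces (Suc n)"
    show "regular Z R (C (card S - 1)) (\<lambda>z. fib (Suc n) (u z) S)"
    proof (cases "S = {..Suc n}")
      case True
      then show ?thesis using full_component_regular[OF R g cu[unfolded c_def]] by simp
    next
      case False
      obtain i S' where iS: "i \<le> Suc n" "S' \<in> std_faces n" "S = coface i ` S'"
        by (rule std_faces_missing[OF S False])
      from regular_hom[OF fcr[OF iS(1)] eval_hom[OF iS(2)]] show ?thesis
        using iS(2,3) by (simp add: fc_apply coface_image_card)
    qed
  qed
qed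

end

subsection \<open>Extension to one stage\<close>

lemma smap_vcob:
  assumes f: "smap K L f" and K: "is_sset K" and x: "x \<in> simp K n"
  shows "vcob L n v (f n x) = vcob K n (\<lambda>y. v (f (n - 1) y)) x"
proof (cases n)
  case (Suc k)
  then show ?thesis using smap_face[OF f, of _ k x] x
    unfolding Suc vcob_Suc by (intro sum.cong refl) simp
qed (simp add: vcob_def)

lemma regular_lookup:
  "regular S R (zfree m) u \<Longrightarrow> (\<lambda>x. of_int (Poly_Mapping.lookup (u x) k)) \<in> R"
  using regular_functional[OF _ lookup_hom] .

lemma vcochain_regular:
  assumes "function_system K R" "vcochain K L R m n u"
  shows "regular (simp K n) (R n) (zfree m) u"
proof (rule regular_free[OF function_system_algebra[OF assms(1)]])
  show "Poly_Mapping.keys (u x) \<subseteq> {..<m}" if "x \<in> simp K n" for x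
    using vcochain_vecs[OF assms(2) that] by simp
  show "(\<lambda>x. of_int (Poly_Mapping.lookup (u x) j)) \<in> R n" for j
    by (rule rel_cochain_regular[OF vcochain_lookup[OF assms(2)]])
qed

lemma vcochainI:
  assumes "\<And>x. x \<in> simp K n \<Longrightarrow> u x \<in> vecs m" "\<And>k. (\<lambda>x. of_int (Poly_Mapping.lookup (u x) k)) \<in> R n"
    "\<And>x. x \<in> L n \<Longrightarrow> u x = 0"
    "\<And>l i x. n = Suc l \<Longrightarrow> i \<le> l \<Longrightarrow> x \<in> simp K l \<Longrightarrow> u (degen K l i x) = 0"
  shows "vcochain K L R m n u"
  unfolding vcochain_def
proof (intro conjI ballI allI)
  show "u x \<in> vecs m" if "x \<in> simp K n" for x by (rule assms(1)[OF that])
  show "rel_cochain K L R n (\<lambda>x. Poly_Mapping.lookup (u x) k)" for k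
    using assms(2-4) by (intro rel_cochainI) simp_all
qed

lemma vcochain_sub:
  assumes "vcochain K L R m n u" "x \<in> L n"
  shows "u x = 0"
  by (rule poly_mapping_eqI) (simp add: rel_cochain_sub[OF vcochain_lookup[OF assms(1)] assms(2)])

lemma vcochain_degen:
  assumes "vcochain K L R m (Suc n) u" "i \<le> n" "x \<in> simp K n"
  shows "u (degen K n i x) = 0"
  by (rule poly_mapping_eqI) (simp add: rel_cochain_degen[OF vcochain_lookup[OF assms(1)] assms(2,3)])

lemma vcochain_relative:
  assumes "vcochain K (\<lambda>_. {}) R m n u" "\<And>x. x \<in> L n \<Longrightarrow> u x = 0"
  shows "vcochain K L R m n u"
proof (rule vcochainI)
  show "(\<lambda>x. of_int (Poly_Mapping.lookup (u x) k)) \<in> R n" for k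
    by (rule rel_cochain_regular[OF vcochain_lookup[OF assms(1)]])
  show "u (degen K l i x) = 0" if "n = Suc l" "i \<le> l" "x \<in> simp K l" for l i x
    using vcochain_degen[of K "\<lambda>_. {}" R m l u i x] assms(1) that by simp
qed (use vcochain_vecs[OF assms(1)] assms(2) in blast)+

lemma vcochain_absolute:
  assumes "vcochain K L R m n u"
  shows "vcochain K (\<lambda>_. {}) R m n u"
proof (rule vcochainI)
  show "(\<lambda>x. of_int (Poly_Mapping.lookup (u x) k)) \<in> R n" for k
    by (rule rel_cochain_regular[OF vcochain_lookup[OF assms(1)]])
  show "u (degen K l i x) = 0" if "n = Suc l" "i \<le> l" "x \<in> simp K l" for l i x
    using vcochain_degen[of K L R m l u i x] assms(1) that by simp
qed (use vcochain_vecs[OF assms(1)] in blast)+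

lemma subcomplex_empty: "subcomplex K (\<lambda>_. {})"
  by (simp add: subcomplex_def)

text \<open>
  In \<open>smap_on\<close> the map is defined on a subcomplex only.  Regularity
  there is expressed by the extension by zero of cochains pulled back along the map.
\<close>

definition regular_map :: "'k sset \<Rightarrow> (nat \<Rightarrow> ('k \<Rightarrow> rat) set) \<Rightarrow> 'b snum \<Rightarrow> (nat \<Rightarrow> 'k \<Rightarrow> 'b) \<Rightarrow> bool" where
  "regular_map K R Y f \<longleftrightarrow> smap K (forget Y) f \<and> (\<forall>n. regular (simp K n) (R n) (obj Y n) (f n))"

definition smap_on :: "'k sset \<Rightarrow> (nat \<Rightarrow> 'k set) \<Rightarrow> 'b snum \<Rightarrow> (nat \<Rightarrow> 'k \<Rightarrow> 'b) \<Rightarrow> bool" where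
  "smap_on K L Y g \<longleftrightarrow> (\<forall>n. \<forall>x\<in>L n. g n x \<in> carrier (obj Y n)) \<and>
     (\<forall>n. \<forall>i\<le>Suc n. \<forall>x\<in>L (Suc n). g n (face K (Suc n) i x) = nface Y (Suc n) i (g (Suc n) x)) \<and>
     (\<forall>n. \<forall>i\<le>n. \<forall>x\<in>L n. g (Suc n) (degen K n i x) = ndegen Y n i (g n x))"

lemma smap_on_closed: "smap_on K L Y g \<Longrightarrow> x \<in> L n \<Longrightarrow> g n x \<in> carrier (obj Y n)"
  by (simp add: smap_on_def)

lemma smap_on_face: "smap_on K L Y g \<Longrightarrow> i \<le> Suc n \<Longrightarrow> x \<in> L (Suc n) \<Longrightarrow>
    g n (face K (Suc n) i x) = nface Y (Suc n) i (g (Suc n) x)"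
  by (simp add: smap_on_def)

lemma smap_on_degen: "smap_on K L Y g \<Longrightarrow> i \<le> n \<Longrightarrow> x \<in> L n \<Longrightarrow>
    g (Suc n) (degen K n i x) = ndegen Y n i (g n x)"
  by (simp add: smap_on_def)

context ptcp_stage
begin

text \<open>
  The top component of a lift is a cochain whose twisted coboundary is given by the twisting
  function, and conversely such a cochain determines a lift.  So the cochain given on \<open>L\<close> is first
  extended by zero and then corrected by a solution of the cochain equation relative to \<open>L\<close>.
\<close>

lemma stage_extension:
  fixes h :: nat
  assumes K: "is_sset K" and R: "function_system K R" and L: "subcomplex K L" and ac: "acyclic_pair K L R"
    and exact: "\<And>q. h \<le> q \<Longrightarrow> trivial_group (chain_homology C d (Suc q))"
    and f: "regular_map K R B f" and g: "smap_on K L E g"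
    and gf: "\<And>n x. x \<in> L n \<Longrightarrow> p n (g n x) = f n x"
    and g_reg: "\<And>n k. (\<lambda>x. of_int (if x \<in> L n then Poly_Mapping.lookup (c n (g n x)) k else 0)) \<in> R n"
  shows "\<exists>F. regular_map K R E F \<and> (\<forall>n. \<forall>x\<in>simp K n. p n (F n x) = f n x) \<and> (\<forall>n. \<forall>x\<in>L n. F n x = g n x)"
proof -
  note alg = function_system_algebra[OF R]
  have fm: "smap K (forget B) f" and fr: "regular (simp K n) (R n) (obj B n) (f n)" for n
    using f by (simp_all add: regular_map_def)
  have fB: "f n x \<in> carrier (obj B n)" if "x \<in> simp K n" for n x
    using smap_closed[OF fm that] by simp
  have ff: "f n (face K (Suc n) i x) = nface B (Suc n) i (f (Suc n) x)" if "i \<le> Suc n" "x \<in> simp K (Suc n)" for n i x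
    using smap_face[OF fm that] by simp
  have fd: "f (Suc n) (degen K n i x) = ndegen B n i (f n x)" if "i \<le> n" "x \<in> simp K n" for n i x
    using smap_degen[OF fm that] by simp
  note gE = smap_on_closed[OF g] and gface = smap_on_face[OF g] and gdeg = smap_on_degen[OF g]
  let ?O = "\<lambda>_. {}"
  \<comment> \<open>The cochain of the lift is s = s0 + r, where r vanishes on L and corrects the error e of s0.\<close>
  define s0 where "s0 n x = (if x \<in> L n then c n (g n x) else 0)" for n x
  have s0c: "vcochain K ?O R (m n) n (s0 n)" for n
  proof (rule vcochainI)
    show "s0 n x \<in> vecs (m n)" for x
      using c_vecs[OF gE] by (simp add: s0_def vecs_zero)
    show "(\<lambda>x. of_int (Poly_Mapping.lookup (s0 n x) k)) \<in> R n" for k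
      using g_reg[of n k] by (simp add: s0_def if_distrib[of "\<lambda>z. Poly_Mapping.lookup z k"] cong: if_cong)
    fix l i x assume n: "n = Suc l" and i: "i \<le> l" and x: "x \<in> simp K l"
    show "s0 n (degen K l i x) = 0"
      using subcomplex_degen_iff[OF K L i x] gdeg[OF i] c_degen[OF gE _ ] i by (simp add: s0_def n)
  qed simp
  define tf where "tf n x = t n (f (Suc n) x)" for n x
  have tfc: "vcochain K ?O R (m n) (Suc n) (tf n)" for n
  proof (rule vcochainI)
    show "tf n x \<in> vecs (m n)" if "x \<in> simp K (Suc n)" for x
      unfolding tf_def by (rule t_vecs[OF fB[OF that]])
    show "(\<lambda>x. of_int (Poly_Mapping.lookup (tf n x) k)) \<in> R (Suc n)" for k
      unfolding tf_def by (rule regular_lookup[OF t_regular[OF alg fr]])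
    show "tf n (degen K l i x) = 0" if "Suc n = Suc l" "i \<le> l" "x \<in> simp K l" for l i x
      using that by (simp add: tf_def fd t_degen[OF fB])
  qed simp
  have Dh: "D q \<in> hom (zfree (m (Suc q))) (zfree (m q))" for q by (rule D_hom)
  have tD: "D n (tf (Suc n) x) = - vcob K (Suc (Suc n)) (tf n) x" if x: "x \<in> simp K (Suc (Suc n))" for n x
    using t_boundary[OF fB[OF x]] smap_vcob[OF fm K x, of "t n"] by (simp add: tf_def[abs_def])
  define e where "e n x = vcob K (Suc n) (s0 n) x - tf n x - D n (s0 (Suc n) x)" for n x
  have ec0: "vcochain K ?O R (m n) (Suc n) (e n)" for n
    unfolding e_def by (intro vcochain_diff[OF R] vcochain_cob[OF K R subcomplex_empty] s0c tfc
      vcochain_hom[OF K R subcomplex_empty Dh])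
  have s0L: "D n (s0 (Suc n) x) = vcob K (Suc n) (s0 n) x - tf n x" if x: "x \<in> L (Suc n)" for n x
  proof -
    have "vcob K (Suc n) (s0 n) x = vcob (forget E) (Suc n) (c n) (g (Suc n) x)"
      unfolding vcob_Suc using gface[OF _ x] subcomplex_face[OF L _ x]
      by (intro sum.cong refl) (simp add: s0_def)
    then show ?thesis
      using c_boundary[OF gE[OF x]] x by (simp add: s0_def tf_def gf)
  qed
  have ec: "vcochain K L R (m n) (Suc n) (e n)" for n
    by (rule vcochain_relative[OF ec0]) (simp add: e_def s0L)
  have De: "D n (e (Suc n) x) = - vcob K (Suc (Suc n)) (e n) x" if x: "x \<in> simp K (Suc (Suc n))" for n x
  proof -
    have sv: "s0 k y \<in> vecs (m k)" if "y \<in> simp K k" for k y using vcochain_vecs[OF s0c that] .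
    have v1: "vcob K (Suc (Suc n)) (s0 (Suc n)) x \<in> vecs (m (Suc n))"
      using vcochain_vecs[OF vcochain_cob[OF K R subcomplex_empty s0c] x] .
    have v2: "tf (Suc n) x \<in> vecs (m (Suc n))" using vcochain_vecs[OF tfc x] .
    have v3: "D (Suc n) (s0 (Suc (Suc n)) x) \<in> vecs (m (Suc n))" by (rule zhom_closed[OF Dh sv[OF x]])
    have "D n (e (Suc n) x) = D n (vcob K (Suc (Suc n)) (s0 (Suc n)) x) - D n (tf (Suc n) x)
        - D n (D (Suc n) (s0 (Suc (Suc n)) x))"
      unfolding e_def using zhom_diff[OF Dh vecs_diff[OF v1 v2] v3] zhom_diff[OF Dh v1 v2] by simp
    also have "\<dots> = vcob K (Suc (Suc n)) (\<lambda>y. D n (s0 (Suc n) y)) x + vcob K (Suc (Suc n)) (tf n) x"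
      using vcob_hom[OF K Dh _ x, of "s0 (Suc n)"] sv tD[OF x] DD[OF sv[OF x]] by simp
    also have "\<dots> = - vcob K (Suc (Suc n)) (e n) x"
      unfolding e_def vcob_diff using vcob_vcob[OF K x] by simp
    finally show ?thesis .
  qed
  have ex: "\<exists>a\<in>vecs (m (Suc (Suc q))). D (Suc q) a = z"
    if "h \<le> q" "z \<in> vecs (m (Suc q))" "D q z = 0" for q z
    by (rule D_exact[OF exact[OF that(1)] that(2,3)])
  obtain r where rc: "\<And>n. vcochain K L R (m n) n (r n)"
    and r: "\<And>n x. x \<in> simp K (Suc n) \<Longrightarrow> D n (r (Suc n) x) - vcob K (Suc n) (r n) x = e n x"
    by (rule twisted_cochain_equation[where h = h and m = m, OF K R L ac Dh DD ex ec De]) blast+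
  define s where "s n x = s0 n x + r n x" for n x
  have sc: "vcochain K ?O R (m n) n (s n)" for n
    unfolding s_def by (rule vcochain_add[OF R s0c vcochain_absolute[OF rc]])
  have seq: "D n (s (Suc n) x) = vcob K (Suc n) (s n) x - t n (f (Suc n) x)" if x: "x \<in> simp K (Suc n)" for n x
  proof -
    have "D n (s (Suc n) x) = D n (s0 (Suc n) x) + D n (r (Suc n) x)"
      unfolding s_def by (rule zhom_add[OF Dh vcochain_vecs[OF s0c x] vcochain_vecs[OF rc x]])
    also have "D n (r (Suc n) x) = vcob K (Suc n) (r n) x + e n x" using r[OF x] by (simp add: algebra_simps)
    finally show ?thesis by (simp add: e_def s_def[abs_def] vcob_add tf_def)
  qed
  have sL: "s n x = c n (g n x)" if "x \<in> L n" for n x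
    using that vcochain_sub[OF rc that] by (simp add: s_def s0_def)

  \<comment> \<open>The lift of a simplex is filled in over its boundary, where the lift is already defined.\<close>
  define F where "F = rec_nat (\<lambda>x. SOME y. y \<in> carrier (obj E 0) \<and> p 0 y = f 0 x \<and> c 0 y = s 0 x)
    (\<lambda>n F x. SOME y. y \<in> carrier (obj E (Suc n)) \<and> p (Suc n) y = f (Suc n) x \<and>
        (\<forall>i\<le>Suc n. nface E (Suc n) i y = F (face K (Suc n) i x)) \<and> c (Suc n) y = s (Suc n) x)"
  have F0: "F 0 x = (SOME y. y \<in> carrier (obj E 0) \<and> p 0 y = f 0 x \<and> c 0 y = s 0 x)" for x
    by (simp add: F_def)
  have FS: "F (Suc n) x = (SOME y. y \<in> carrier (obj E (Suc n)) \<and> p (Suc n) y = f (Suc n) x \<and>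
        (\<forall>i\<le>Suc n. nface E (Suc n) i y = F n (face K (Suc n) i x)) \<and> c (Suc n) y = s (Suc n) x)" for n x
    by (simp add: F_def)
  have inv: "\<forall>x\<in>simp K n. F n x \<in> carrier (obj E n) \<and> p n (F n x) = f n x \<and> c n (F n x) = s n x \<and>
      (\<forall>k i. n = Suc k \<and> i \<le> n \<longrightarrow> nface E n i (F n x) = F k (face K n i x))" for n
  proof (induction n)
    case 0
    show ?case
    proof
      fix x assume x: "x \<in> simp K 0"
      have "\<exists>y. y \<in> carrier (obj E 0) \<and> p 0 y = f 0 x \<and> c 0 y = s 0 x"
        using stage_vertex[OF fB[OF x] vcochain_vecs[OF sc x]] by blast
      from someI_ex[OF this] show "F 0 x \<in> carrier (obj E 0) \<and> p 0 (F 0 x) = f 0 x \<and> c 0 (F 0 x) = s 0 x \<and>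
          (\<forall>k i. 0 = Suc k \<and> i \<le> 0 \<longrightarrow> nface E 0 i (F 0 x) = F k (face K 0 i x))"
        unfolding F0 by simp
    qed
  next
    case (Suc n)
    show ?case
    proof
      fix x assume x: "x \<in> simp K (Suc n)"
      have fx: "face K (Suc n) i x \<in> simp K n" if "i \<le> Suc n" for i by (rule sset_face[OF K that x])
      let ?y = "\<lambda>i. F n (face K (Suc n) i x)"
      have "\<exists>y\<in>carrier (obj E (Suc n)). p (Suc n) y = f (Suc n) x \<and>
          (\<forall>i\<le>Suc n. nface E (Suc n) i y = ?y i) \<and> c (Suc n) y = s (Suc n) x"
      proof (rule stage_fill[OF fB[OF x]])
        show "?y i \<in> carrier (obj E n)" if "i \<le> Suc n" for i using Suc fx[OF that] by blast
        show "p n (?y i) = nface B (Suc n) i (f (Suc n) x)" if "i \<le> Suc n" for i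
          using Suc fx[OF that] ff[OF that x] by simp
        show "nface E (Suc k) i (?y j) = nface E (Suc k) (j - 1) (?y i)"
          if n: "n = Suc k" and ij: "i < j" "j \<le> Suc n" for k i j
        proof -
          have x': "x \<in> simp K (Suc (Suc k))" using x n by simp
          have "nface E (Suc k) i (?y j) = F k (face K (Suc k) i (face K (Suc n) j x))"
            using Suc fx[OF ij(2)] n ij by simp
          moreover have "nface E (Suc k) (j - 1) (?y i) = F k (face K (Suc k) (j - 1) (face K (Suc n) i x))"
            using Suc fx[of i] n ij by simp
          ultimately show ?thesis using sset_face_face[OF K x' ij(1)] ij(2) n by simp
        qed
        show "s (Suc n) x \<in> vecs (m (Suc n))" by (rule vcochain_vecs[OF sc x])
        show "D n (s (Suc n) x) = (\<Sum>i\<le>Suc n. frag_cmul ((-1) ^ i) (c n (?y i))) - t n (f (Suc n) x)"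
          unfolding seq[OF x] vcob_Suc using Suc fx by simp
      qed
      then have "\<exists>y. y \<in> carrier (obj E (Suc n)) \<and> p (Suc n) y = f (Suc n) x \<and>
          (\<forall>i\<le>Suc n. nface E (Suc n) i y = ?y i) \<and> c (Suc n) y = s (Suc n) x" by blast
      from someI_ex[OF this] show "F (Suc n) x \<in> carrier (obj E (Suc n)) \<and> p (Suc n) (F (Suc n) x) = f (Suc n) x \<and>
          c (Suc n) (F (Suc n) x) = s (Suc n) x \<and>
          (\<forall>k i. Suc n = Suc k \<and> i \<le> Suc n \<longrightarrow> nface E (Suc n) i (F (Suc n) x) = F k (face K (Suc n) i x))"
        unfolding FS[symmetric] by simp
    qed
  qed
  have FE: "F n x \<in> carrier (obj E n)" and Fp: "p n (F n x) = f n x" and Fc: "c n (F n x) = s n x"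
    if "x \<in> simp K n" for n x using inv[of n] that by blast+
  have Ff: "F n (face K (Suc n) i x) = nface E (Suc n) i (F (Suc n) x)" if "i \<le> Suc n" "x \<in> simp K (Suc n)" for n i x
    using inv[of "Suc n"] that by simp
  have Fd: "F (Suc n) (degen K n i x) = ndegen E n i (F n x)" if i: "i \<le> n" and x: "x \<in> simp K n" for n i x
    using i x
  proof (induction n arbitrary: i x rule: less_induct)
    case (less n)
    note i = less.prems(1) and x = less.prems(2)
    have sx: "degen K n i x \<in> simp K (Suc n)" by (rule sset_degen[OF K i x])
    have sF: "ndegen E n i (F n x) \<in> carrier (obj E (Suc n))" by (rule snum_degen[OF snE i FE[OF x]])
    note sE = snum_sset[OF snE]
    have FE': "F n x \<in> simp (forget E) n" using FE[OF x] by simp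
    show ?case
    proof (rule stage_unique[OF FE[OF sx] sF])
      show "p (Suc n) (F (Suc n) (degen K n i x)) = p (Suc n) (ndegen E n i (F n x))"
        using Fp[OF sx] fd[OF i x] nmaps_degen[OF p i FE[OF x]] Fp[OF x] by simp
      show "c (Suc n) (F (Suc n) (degen K n i x)) = c (Suc n) (ndegen E n i (F n x))"
        using Fc[OF sx] vcochain_degen[OF sc i x] c_degen[OF FE[OF x] i] by simp
      fix k assume k: "k \<le> Suc n"
      have l: "nface E (Suc n) k (F (Suc n) (degen K n i x)) = F n (face K (Suc n) k (degen K n i x))"
        using Ff[OF k sx] by simp
      show "nface E (Suc n) k (F (Suc n) (degen K n i x)) = nface E (Suc n) k (ndegen E n i (F n x))"
      proof (cases "k = i \<or> k = Suc i")
        case True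
        then show ?thesis
          using l sset_face_degen_same[OF K x i] sset_face_degen_same[OF sE FE' i] by auto
      next
        case False
        then obtain n' where n: "n = Suc n'" using i k by (cases n) auto
        have x': "x \<in> simp K (Suc n')" and FE'': "F n x \<in> simp (forget E) (Suc n')" using x FE' n by simp_all
        show ?thesis
        proof (cases "k < i")
          case True
          have kn: "k \<le> Suc n'" "i - 1 \<le> n'" using True i n by auto
          have "F n (face K (Suc n) k (degen K n i x)) = F (Suc n') (degen K n' (i - 1) (face K (Suc n') k x))"
            using sset_face_degen_less[OF K x' True] i n by simp
          also have "\<dots> = ndegen E n' (i - 1) (F n' (face K (Suc n') k x))"
            using less.IH[of n' "i - 1"] kn sset_face[OF K kn(1) x'] n by simp
          also have "\<dots> = ndegen E n' (i - 1) (nface E (Suc n') k (F n x))"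
            using Ff[OF kn(1) x'] n by simp
          also have "\<dots> = nface E (Suc n) k (ndegen E n i (F n x))"
            using sset_face_degen_less[OF sE FE'' True] i n by simp
          finally show ?thesis using l by simp
        next
          case notless: False
          then have ki: "Suc i < k" using False by simp
          have kn: "k - 1 \<le> Suc n'" "i \<le> n'" using ki k n by auto
          have "F n (face K (Suc n) k (degen K n i x)) = F (Suc n') (degen K n' i (face K (Suc n') (k - 1) x))"
            using sset_face_degen_greater[OF K x' ki] k n by simp
          also have "\<dots> = ndegen E n' i (F n' (face K (Suc n') (k - 1) x))"
            using less.IH[of n' i] kn sset_face[OF K kn(1) x'] n by simp
          also have "\<dots> = ndegen E n' i (nface E (Suc n') (k - 1) (F n x))"
            using Ff[OF kn(1) x'] n by simp
          also have "\<dots> = nface E (Suc n) k (ndegen E n i (F n x))"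
            using sset_face_degen_greater[OF sE FE'' ki] k n by simp
          finally show ?thesis using l by simp
        qed
      qed
    qed
  qed
  have FL: "F n x = g n x" if "x \<in> L n" for n x
    using that
  proof (induction n arbitrary: x)
    case 0
    note x = subcomplex_subset[OF L 0]
    show ?case
      by (rule stage_unique_0[OF FE[OF x] gE[OF 0]]) (simp_all add: Fp[OF x] Fc[OF x] gf[OF 0] sL[OF 0])
  next
    case (Suc n)
    note x = subcomplex_subset[OF L Suc.prems]
    show ?case
    proof (rule stage_unique[OF FE[OF x] gE[OF Suc.prems]])
      show "nface E (Suc n) i (F (Suc n) x) = nface E (Suc n) i (g (Suc n) x)" if i: "i \<le> Suc n" for i
        using Ff[OF i x] gface[OF i Suc.prems] Suc.IH[OF subcomplex_face[OF L i Suc.prems]] by simp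
    qed (simp_all add: Fp[OF x] Fc[OF x] gf[OF Suc.prems] sL[OF Suc.prems])
  qed
  have Fr: "regular (simp K n) (R n) (obj E n) (F n)" for n
  proof (induction n)
    case 0
    show ?case
    proof (rule stage_regular_0[OF alg FE])
      show "regular (simp K 0) (R 0) (obj B 0) (\<lambda>z. p 0 (F 0 z))"
        by (rule regular_cong[OF alg fr]) (simp add: Fp)
      show "regular (simp K 0) (R 0) (zfree (m 0)) (\<lambda>z. c 0 (F 0 z))"
        by (rule regular_cong[OF alg vcochain_regular[OF R sc]]) (simp add: Fc)
    qed
  next
    case (Suc n)
    show ?case
    proof (rule stage_regular[OF alg FE])
      show "regular (simp K (Suc n)) (R (Suc n)) (obj B (Suc n)) (\<lambda>z. p (Suc n) (F (Suc n) z))"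
        by (rule regular_cong[OF alg fr]) (simp add: Fp)
      show "regular (simp K (Suc n)) (R (Suc n)) (zfree (m (Suc n))) (\<lambda>z. c (Suc n) (F (Suc n) z))"
        by (rule regular_cong[OF alg vcochain_regular[OF R sc]]) (simp add: Fc)
      fix i assume i: "i \<le> Suc n"
      have "regular (simp K (Suc n)) (R (Suc n)) (obj E n) (\<lambda>z. F n (face K (Suc n) i z))"
        by (rule regular_pullback[OF Suc]) (use sset_face[OF K i] function_system_face[OF R i] in auto)
      then show "regular (simp K (Suc n)) (R (Suc n)) (obj E n) (\<lambda>z. nface E (Suc n) i (F (Suc n) z))"
        by (rule regular_cong[OF alg]) (simp add: Ff[OF i])
    qed
  qed
  have "smap K (forget E) F"
    unfolding smap_def using FE Ff Fd by auto
  then show ?thesis using Fr Fp FL by (intro exI[of _ F]) (simp add: regular_map_def)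
qed

end

section \<open>Towers and their inverse limits\<close>

lemma ptcp_stage_exists:
  assumes E: "is_snum E" and B: "is_snum B" and p: "p \<in> nmaps E B" and C: "fg_chain_complex C d"
    and pt: "is_ptcp E B p (Gamma C d)"
  shows "\<exists>m e \<tau> \<phi> \<psi>. ptcp_stage C d m e E B p \<tau> \<phi> \<psi>"
proof -
  have "\<exists>m \<epsilon>. \<epsilon> \<in> iso (C k) (zfree m)" for k
    using C by (simp add: fg_chain_complex_def fg_free_abelian_def is_iso_def ex_in_conv)
  then have "\<exists>m. \<forall>k. \<exists>\<epsilon>. \<epsilon> \<in> iso (C k) (zfree (m k))" by (intro choice allI)
  then obtain m where m: "\<forall>k. \<exists>\<epsilon>. \<epsilon> \<in> iso (C k) (zfree (m k))" by (elim exE)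
  obtain e where me: "\<And>k. e k \<in> iso (C k) (zfree (m k))" using choice[OF m] by auto
  obtain \<tau> \<phi> where tw: "twisting_function B (Gamma C d) \<tau>"
    and iso: "snum_iso E (twisted_product B (Gamma C d) \<tau>) \<phi>"
    and snd: "\<forall>q. \<forall>x\<in>carrier (obj E q). snd (\<phi> q x) = p q x"
    using pt unfolding is_ptcp_def by blast
  let ?W = "twisted_product B (Gamma C d) \<tau>"
  obtain \<psi> where phi: "\<phi> \<in> nmaps E ?W" and psi: "\<psi> \<in> nmaps ?W E"
    and i1: "nmap_comp E \<psi> \<phi> = nmap_id E" and i2: "nmap_comp ?W \<phi> \<psi> = nmap_id ?W"
    using iso unfolding snum_iso_def by blast
  have "\<psi> n (\<phi> n x) = x" if "x \<in> carrier (obj E n)" for n x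
    using fun_cong[OF fun_cong[OF i1], of n x] that by (simp add: nmap_comp_def nmap_id_def compose_def)
  moreover have "\<phi> n (\<psi> n w) = w" if "w \<in> carrier (obj ?W n)" for n w
    using fun_cong[OF fun_cong[OF i2], of n w] that by (simp add: nmap_comp_def nmap_id_def compose_def)
  ultimately have "ptcp_stage C d m e E B p \<tau> \<phi> \<psi>"
    using C me E B p tw phi psi snd by unfold_locales auto
  then show ?thesis by blast
qed

text \<open>
  Numerical normalised cochains of \<open>Y\<close> that vanish in degree 0.  All of them vanish at a
  base point, which is degenerate in positive degrees.
\<close>

definition null_cochain :: "'b snum \<Rightarrow> nat \<Rightarrow> ('b \<Rightarrow> int) \<Rightarrow> bool" where
  "null_cochain Y n N \<longleftrightarrow> numerical (obj Y n) integer_group N \<and>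
     (n = 0 \<longrightarrow> (\<forall>x\<in>carrier (obj Y 0). N x = 0)) \<and>
     (\<forall>k i. n = Suc k \<and> i \<le> k \<longrightarrow> (\<forall>x\<in>carrier (obj Y k). N (ndegen Y k i x) = 0))"

lemma tower_cone_maps: "tower_cone Y T p r \<Longrightarrow> r n \<in> nmaps Y (T n)"
  by (simp add: tower_cone_def)

lemma tower_cone_comp: "tower_cone Y T p r \<Longrightarrow> x \<in> carrier (obj Y j) \<Longrightarrow> p n j (r (Suc n) j x) = r n j x"
proof -
  assume r: "tower_cone Y T p r" and x: "x \<in> carrier (obj Y j)"
  have "nmap_comp Y (p n) (r (Suc n)) = r n" using r by (simp add: tower_cone_def)
  from fun_cong[OF fun_cong[OF this], of j x] show ?thesis
    using x by (simp add: nmap_comp_def compose_def)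
qed

text \<open>
  Stage by stage, by \<open>stage_extension\<close>.  In degree 0 all terms of the tower are points, so the top
  components vanish there and define null cochains on \<open>Y\<close>.
\<close>

lemma tower_extension:
  fixes K :: "'k sset" and Y :: "'b snum" and T :: "nat \<Rightarrow> zvec snum" and p :: "nat \<Rightarrow> nat \<Rightarrow> zvec \<Rightarrow> zvec"
    and C :: "nat \<Rightarrow> nat \<Rightarrow> zvec monoid" and d :: "nat \<Rightarrow> nat \<Rightarrow> zvec \<Rightarrow> zvec"
  assumes K: "is_sset K" and R: "function_system K R" and L: "subcomplex K L" and ac: "acyclic_pair K L R"
    and T: "\<And>n. is_snum (T n)" and p: "\<And>n. p n \<in> nmaps (T (Suc n)) (T n)"
    and T0: "\<And>j. \<exists>x. carrier (obj (T 0) j) = {x}" and v: "\<And>n. \<exists>x. carrier (obj (T n) 0) = {x}"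
    and C: "\<And>n. fg_chain_complex (C n) (d n)"
    and pt: "\<And>n. is_ptcp (T (Suc n)) (T n) (p n) (Gamma (C n) (d n))"
    and exact: "\<And>n. \<exists>h. \<forall>q\<ge>h. trivial_group (chain_homology (C n) (d n) (Suc q))"
    and Y: "is_snum Y" and r: "tower_cone Y T p r"
    and g: "smap_on K L Y g"
    and g_reg: "\<And>n N. null_cochain Y n N \<Longrightarrow> (\<lambda>x. of_int (if x \<in> L n then N (g n x) else 0)) \<in> R n"
  shows "\<exists>f. \<forall>n. regular_map K R (T n) (f n) \<and> (\<forall>j. \<forall>x\<in>L j. f n j x = r n j (g j x)) \<and>
      (\<forall>j. \<forall>x\<in>simp K j. p n j (f (Suc n) j x) = f n j x)"
proof -
  define P where "P n f \<longleftrightarrow> regular_map K R (T n) f \<and> (\<forall>j. \<forall>x\<in>L j. f j x = r n j (g j x))" for n f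
  define Q where "Q n f f' \<longleftrightarrow> (\<forall>j. \<forall>x\<in>simp K j. p n j (f' j x) = f j x)" for n and f f' :: "nat \<Rightarrow> 'k \<Rightarrow> zvec"
  have rm: "r n \<in> nmaps Y (T n)" for n by (rule tower_cone_maps[OF r])
  have gY: "g j x \<in> carrier (obj Y j)" if "x \<in> L j" for j x by (rule smap_on_closed[OF g that])
  have rg: "smap_on K L (T n) (\<lambda>j x. r n j (g j x))" for n
    unfolding smap_on_def
    using nmaps_closed[OF rm gY] smap_on_face[OF g] nmaps_face[OF rm] smap_on_degen[OF g] nmaps_degen[OF rm] gY
    by simp
  have "\<exists>f. P 0 f"
  proof -
    obtain pt where pt: "\<And>j. carrier (obj (T 0) j) = {pt j}" using T0 by metis
    have "regular (simp K n) (R n) (obj (T 0) n) (\<lambda>x. pt n)" for n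
      by (rule regular_const[OF function_system_algebra[OF R]]) (simp add: pt)
    then have "regular_map K R (T 0) (\<lambda>j x. pt j)"
      unfolding regular_map_def smap_def
      using pt snum_face[OF T, of _ _ _ 0] snum_degen[OF T, of _ _ _ 0] by simp
    moreover have "pt j = r 0 j (g j x)" if "x \<in> L j" for j x
      using nmaps_closed[OF rm gY[OF that], of 0] pt by simp
    ultimately show ?thesis by (auto simp: P_def)
  qed
  moreover have "\<exists>f'. P (Suc n) f' \<and> Q n f f'" if Pf: "P n f" for n f
  proof -
    obtain m e \<tau> \<phi> \<psi> where "ptcp_stage (C n) (d n) m e (T (Suc n)) (T n) (p n) \<tau> \<phi> \<psi>"
      using ptcp_stage_exists[OF T T p C pt] by blast
    then interpret S: ptcp_stage "C n" "d n" m e "T (Suc n)" "T n" "p n" \<tau> \<phi> \<psi> .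
    obtain h where h: "\<And>q. h \<le> q \<Longrightarrow> trivial_group (chain_homology (C n) (d n) (Suc q))" using exact by blast
    let ?g = "\<lambda>j x. r (Suc n) j (g j x)"
    have c0: "S.c 0 x = 0" if x: "x \<in> carrier (obj (T (Suc n)) 0)" for x
    proof -
      obtain x' where "x' \<in> carrier (obj (T (Suc n)) 0)" "S.c 0 x' = 0"
        using S.stage_vertex[OF S.p_closed[OF x] vecs_zero] by blast
      then show ?thesis using v[of "Suc n"] x by auto
    qed
    have reg: "(\<lambda>x. of_int (if x \<in> L j then Poly_Mapping.lookup (S.c j (?g j x)) k else 0)) \<in> R j" for j k
    proof (rule g_reg)
      let ?N = "\<lambda>x. Poly_Mapping.lookup (S.c j (r (Suc n) j x)) k"
      show "null_cochain Y j ?N"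
        unfolding null_cochain_def
      proof (intro conjI impI allI ballI)
        have "regular (carrier (obj Y j)) (polyfuns (obj Y j)) (obj (T (Suc n)) j) (r (Suc n) j)"
          by (rule numerical_regularD[OF nmaps_numerical[OF rm] snum_group[OF T]])
        then have "regular (carrier (obj Y j)) (polyfuns (obj Y j)) integer_group ?N"
          unfolding regular_integer[OF rat_algebra_polyfuns]
          by (intro regular_lookup[OF S.c_regular[OF rat_algebra_polyfuns]])
        then show "numerical (obj Y j) integer_group ?N"
          by (rule regular_numerical[OF snum_free[OF Y] fg_free_integer_group])
        show "?N x = 0" if "j = 0" "x \<in> carrier (obj Y 0)" for x
          using c0[OF nmaps_closed[OF rm that(2)]] that(1) by simp
        show "?N (ndegen Y l i x) = 0" if "j = Suc l \<and> i \<le> l" "x \<in> carrier (obj Y l)" for l i x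
          using that nmaps_degen[OF rm, of i l x] S.c_degen[OF nmaps_closed[OF rm that(2)]] by simp
      qed
    qed
    have "\<exists>F. regular_map K R (T (Suc n)) F \<and> (\<forall>j. \<forall>x\<in>simp K j. p n j (F j x) = f j x) \<and> (\<forall>j. \<forall>x\<in>L j. F j x = ?g j x)"
    proof (rule S.stage_extension[where h = h, OF K R L ac h _ rg _ reg])
      show "regular_map K R (T n) f" using Pf by (simp add: P_def)
      show "p n j (?g j x) = f j x" if "x \<in> L j" for j x
        using tower_cone_comp[OF r gY[OF that]] Pf that by (simp add: P_def)
    qed
    then show ?thesis unfolding P_def Q_def by blast
  qed
  ultimately obtain f where f: "\<And>n. P n (f n) \<and> Q n (f n) (f (Suc n))"
    using dependent_nat_choice[of P Q] by blast
  show ?thesis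
  proof (intro exI[of _ f] allI)
    show "regular_map K R (T n) (f n) \<and> (\<forall>j. \<forall>x\<in>L j. f n j x = r n j (g j x)) \<and>
      (\<forall>j. \<forall>x\<in>simp K j. p n j (f (Suc n) j x) = f n j x)" for n
      using f[of n] by (simp add: P_def Q_def)
  qed
qed

subsection \<open>Simplicial objects with separating maps\<close>

lemma numerical_comp:
  assumes "numerical A B f" "numerical B C g" "fg_free_abelian A" "fg_free_abelian B" "fg_free_abelian C"
  shows "numerical A C (\<lambda>x. g (f x))"
  by (rule regular_numerical[OF assms(3,5) numerical_regular[OF assms(2) rat_algebra_polyfuns
        numerical_regularD[OF assms(1) fg_free_group(2)[OF assms(4)]] fg_free_group(2)[OF assms(5)]]])

lemma numerical_cong:
  assumes "numerical A B f" "fg_free_abelian A" "fg_free_abelian B" "\<And>x. x \<in> carrier A \<Longrightarrow> f x = g x"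
  shows "numerical A B g"
  by (rule regular_numerical[OF assms(2,3) regular_cong[OF rat_algebra_polyfuns
        numerical_regularD[OF assms(1) fg_free_group(2)[OF assms(3)]] assms(4)]])

lemma numerical_closed: "numerical A B f \<Longrightarrow> x \<in> carrier A \<Longrightarrow> f x \<in> carrier B"
  by (auto simp: numerical_def)

lemma numerical_hom:
  assumes "f \<in> hom A B" "fg_free_abelian A" "fg_free_abelian B"
  shows "numerical A B f"
  by (rule regular_numerical[OF assms(2,3) regular_hom[OF regular_polyfuns assms(1)]])

text \<open>
  The simplicial identities hold in \<open>Z\<close> because they hold after applying the separating maps.  The
  lemma yields the two auxiliary objects needed for the universal property of the inverse limit.
\<close>

lemma snum_separated:
  fixes Z :: "'z snum" and T :: "nat \<Rightarrow> 't snum" and \<theta> :: "nat \<Rightarrow> nat \<Rightarrow> 'z \<Rightarrow> 't"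
  assumes free: "\<And>j. fg_free_abelian (obj Z j)"
    and face: "\<And>j i. i \<le> Suc j \<Longrightarrow> numerical (obj Z (Suc j)) (obj Z j) (nface Z (Suc j) i)"
    and degen: "\<And>j i. i \<le> j \<Longrightarrow> numerical (obj Z j) (obj Z (Suc j)) (ndegen Z j i)"
    and T: "\<And>n. is_sset (forget (T n))"
    and \<theta>: "\<And>n j x. x \<in> carrier (obj Z j) \<Longrightarrow> \<theta> n j x \<in> carrier (obj (T n) j)"
    and \<theta>_face: "\<And>n j i x. i \<le> Suc j \<Longrightarrow> x \<in> carrier (obj Z (Suc j)) \<Longrightarrow>
        \<theta> n j (nface Z (Suc j) i x) = nface (T n) (Suc j) i (\<theta> n (Suc j) x)"
    and \<theta>_degen: "\<And>n j i x. i \<le> j \<Longrightarrow> x \<in> carrier (obj Z j) \<Longrightarrow>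
        \<theta> n (Suc j) (ndegen Z j i x) = ndegen (T n) j i (\<theta> n j x)"
    and sep: "\<And>j x y. x \<in> carrier (obj Z j) \<Longrightarrow> y \<in> carrier (obj Z j) \<Longrightarrow> (\<And>n. \<theta> n j x = \<theta> n j y) \<Longrightarrow> x = y"
  shows "is_snum Z"
proof -
  note fc = numerical_closed[OF face] and dc = numerical_closed[OF degen]
  have sT: "\<theta> n j x \<in> simp (forget (T n)) j" if "x \<in> carrier (obj Z j)" for n j x
    using \<theta>[OF that] by simp
  have ff: "nface Z (Suc j) i (nface Z (Suc (Suc j)) k x) = nface Z (Suc j) (k - 1) (nface Z (Suc (Suc j)) i x)"
    if x: "x \<in> carrier (obj Z (Suc (Suc j)))" and ik: "i < k" "k \<le> Suc (Suc j)" for j x i k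
  proof -
    have le: "i \<le> Suc j" "i \<le> Suc (Suc j)" "k - 1 \<le> Suc j" using ik by auto
    show ?thesis
    proof (rule sep)
      show "\<theta> n j (nface Z (Suc j) i (nface Z (Suc (Suc j)) k x)) =
          \<theta> n j (nface Z (Suc j) (k - 1) (nface Z (Suc (Suc j)) i x))" for n
        using sset_face_face[OF T[of n] sT[OF x] ik]
        by (simp add: \<theta>_face le ik fc[OF ik(2) x] fc[OF le(2) x] x del: One_nat_def)
    qed (rule fc[OF le(1) fc[OF ik(2) x]], rule fc[OF le(3) fc[OF le(2) x]])
  qed
  have dd: "ndegen Z (Suc j) i (ndegen Z j k x) = ndegen Z (Suc j) (Suc k) (ndegen Z j i x)"
    if x: "x \<in> carrier (obj Z j)" and ik: "i \<le> k" "k \<le> j" for j x i k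
  proof -
    have le: "i \<le> Suc j" "i \<le> j" "Suc k \<le> Suc j" using ik by auto
    show ?thesis
    proof (rule sep)
      show "\<theta> n (Suc (Suc j)) (ndegen Z (Suc j) i (ndegen Z j k x)) =
          \<theta> n (Suc (Suc j)) (ndegen Z (Suc j) (Suc k) (ndegen Z j i x))" for n
        using sset_degen_degen[OF T[of n] sT[OF x] ik]
        by (simp add: \<theta>_degen le ik dc[OF ik(2) x] dc[OF le(2) x] x)
    qed (rule dc[OF le(1) dc[OF ik(2) x]], rule dc[OF le(3) dc[OF le(2) x]])
  qed
  have fd_same: "nface Z (Suc j) i (ndegen Z j k x) = x"
    if x: "x \<in> carrier (obj Z j)" and k: "k \<le> j" and i: "i = k \<or> i = Suc k" for j x i k
  proof -
    have le: "i \<le> Suc j" using k i by auto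
    show ?thesis
    proof (rule sep)
      show "\<theta> n j (nface Z (Suc j) i (ndegen Z j k x)) = \<theta> n j x" for n
        using sset_face_degen_same[OF T[of n] sT[OF x] k] i
        by (auto simp: \<theta>_face \<theta>_degen le k dc[OF k x] x)
    qed (rule fc[OF le dc[OF k x]], rule x)
  qed
  have fd_less: "nface Z (Suc (Suc j)) i (ndegen Z (Suc j) k x) = ndegen Z j (k - 1) (nface Z (Suc j) i x)"
    if x: "x \<in> carrier (obj Z (Suc j))" and ik: "i < k" "k \<le> Suc j" for j x i k
  proof -
    have le: "i \<le> Suc (Suc j)" "i \<le> Suc j" "k - 1 \<le> j" using ik by auto
    show ?thesis
    proof (rule sep)
      show "\<theta> n (Suc j) (nface Z (Suc (Suc j)) i (ndegen Z (Suc j) k x)) =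
          \<theta> n (Suc j) (ndegen Z j (k - 1) (nface Z (Suc j) i x))" for n
        using sset_face_degen_less[OF T[of n] sT[OF x] ik]
        by (simp add: \<theta>_face \<theta>_degen le ik dc[OF ik(2) x] fc[OF le(2) x] x del: One_nat_def)
    qed (rule fc[OF le(1) dc[OF ik(2) x]], rule dc[OF le(3) fc[OF le(2) x]])
  qed
  have fd_greater: "nface Z (Suc (Suc j)) i (ndegen Z (Suc j) k x) = ndegen Z j k (nface Z (Suc j) (i - 1) x)"
    if x: "x \<in> carrier (obj Z (Suc j))" and ik: "Suc k < i" "i \<le> Suc (Suc j)" for j x i k
  proof -
    have le: "i - 1 \<le> Suc j" "k \<le> j" "k \<le> Suc j" using ik by auto
    show ?thesis
    proof (rule sep)
      show "\<theta> n (Suc j) (nface Z (Suc (Suc j)) i (ndegen Z (Suc j) k x)) =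
          \<theta> n (Suc j) (ndegen Z j k (nface Z (Suc j) (i - 1) x))" for n
        using sset_face_degen_greater[OF T[of n] sT[OF x] ik]
        by (simp add: \<theta>_face \<theta>_degen le ik dc[OF le(3) x] fc[OF le(1) x] x del: One_nat_def)
    qed (rule fc[OF ik(2) dc[OF le(3) x]], rule dc[OF le(2) fc[OF le(1) x]])
  qed
  have fd: "nface Z (Suc j) i (ndegen Z j k x) =
          (if i < k then ndegen Z (j - 1) (k - 1) (nface Z j i x)
           else if i = k \<or> i = Suc k then x
           else ndegen Z (j - 1) k (nface Z j (i - 1) x))"
    if x: "x \<in> carrier (obj Z j)" and ik: "i \<le> Suc j" "k \<le> j" for j x i k
  proof (cases "i = k \<or> i = Suc k")
    case True
    then show ?thesis using fd_same[OF x ik(2) True] by auto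
  next
    case False
    then obtain j' where j: "j = Suc j'" using ik by (cases j) auto
    show ?thesis
      using False fd_less[of x j' i k] fd_greater[of x j' k i] x ik j by auto
  qed
  have "is_sset (forget Z)"
    unfolding is_sset_def forget_simps
    using fc dc ff dd fd by (intro conjI allI impI ballI funcsetI) (simp_all only: simp_thms)
  then show ?thesis unfolding is_snum_def using free face degen by blast
qed

text \<open>
  The universal property of an inverse limit only speaks of test objects with integral vectors as
  elements; this provides a copy of \<open>Y\<close> among them.
\<close>

lemma snum_transport:
  fixes Y :: "'b snum"
  assumes Y: "is_snum Y"
  shows "\<exists>(Y' :: zvec snum) \<eta>. is_snum Y' \<and> \<eta> \<in> nmaps Y' Y \<and>
     (\<forall>j. \<forall>y\<in>carrier (obj Y j). \<exists>x\<in>carrier (obj Y' j). \<eta> j x = y)"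
proof -
  have "\<exists>m \<epsilon>. \<epsilon> \<in> iso (obj Y j) (zfree m)" for j
    using snum_free[OF Y] by (simp add: fg_free_abelian_def is_iso_def ex_in_conv)
  then have "\<exists>m. \<forall>j. \<exists>\<epsilon>. \<epsilon> \<in> iso (obj Y j) (zfree (m j))" by (intro choice allI)
  then obtain m where m: "\<forall>j. \<exists>\<epsilon>. \<epsilon> \<in> iso (obj Y j) (zfree (m j))" by (elim exE)
  obtain a where a: "\<And>j. a j \<in> iso (obj Y j) (zfree (m j))" using choice[OF m] by auto
  define b where "b j = inv_into (carrier (obj Y j)) (a j)" for j
  have b: "b j \<in> iso (zfree (m j)) (obj Y j)" for j
    unfolding b_def by (rule iso_inv_into[OF a snum_group[OF Y]])
  have ba: "b j (a j y) = y" if "y \<in> carrier (obj Y j)" for j y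
    unfolding b_def by (rule iso_inv_cancel(1)[OF a that])
  have ab: "a j (b j x) = x" if "x \<in> vecs (m j)" for j x
    unfolding b_def by (rule iso_inv_cancel(2)[OF a that])
  have ac: "a j y \<in> vecs (m j)" if "y \<in> carrier (obj Y j)" for j y by (rule iso_inv_cancel(3)[OF a that])
  have bc: "b j x \<in> carrier (obj Y j)" if "x \<in> vecs (m j)" for j x
    unfolding b_def by (rule iso_inv_cancel(4)[OF a that])
  have free: "fg_free_abelian (zfree k)" for k
    unfolding fg_free_abelian_def using abelian_free_Abelian_group iso_set_refl by (auto simp: is_iso_def)
  have an: "numerical (obj Y j) (zfree (m j)) (a j)" for j
    by (rule numerical_hom[OF iso_hom[OF a] snum_free[OF Y] free])
  have bn: "numerical (zfree (m j)) (obj Y j) (b j)" for j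
    by (rule numerical_hom[OF iso_hom[OF b] free snum_free[OF Y]])
  define Y' where "Y' = \<lparr>obj = (\<lambda>j. zfree (m j)), nface = (\<lambda>n i x. a (n - 1) (nface Y n i (b n x))),
      ndegen = (\<lambda>n i x. a (Suc n) (ndegen Y n i (b n x)))\<rparr>"
  have obj': "obj Y' j = zfree (m j)" for j by (simp add: Y'_def)
  have face': "nface Y' (Suc j) i x = a j (nface Y (Suc j) i (b (Suc j) x))" for j i x by (simp add: Y'_def)
  have degen': "ndegen Y' j i x = a (Suc j) (ndegen Y j i (b j x))" for j i x by (simp add: Y'_def)
  have bface: "b j (nface Y' (Suc j) i x) = nface Y (Suc j) i (b (Suc j) x)"
    if "i \<le> Suc j" "x \<in> vecs (m (Suc j))" for i j x
    unfolding face' by (rule ba[OF snum_face[OF Y that(1) bc[OF that(2)]]])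
  have bdegen: "b (Suc j) (ndegen Y' j i x) = ndegen Y j i (b j x)"
    if "i \<le> j" "x \<in> vecs (m j)" for i j x
    unfolding degen' by (rule ba[OF snum_degen[OF Y that(1) bc[OF that(2)]]])
  have Y': "is_snum Y'"
  proof (rule snum_separated[where T = "\<lambda>_. Y" and \<theta> = "\<lambda>_. b"])
    show "fg_free_abelian (obj Y' j)" for j unfolding obj' by (rule free)
    show "numerical (obj Y' (Suc j)) (obj Y' j) (nface Y' (Suc j) i)" if "i \<le> Suc j" for j i
      unfolding obj' face'[abs_def]
      by (intro numerical_comp[OF _ an] numerical_comp[OF bn] snum_face_numerical[OF Y that] free snum_free[OF Y])
    show "numerical (obj Y' j) (obj Y' (Suc j)) (ndegen Y' j i)" if "i \<le> j" for j i
      unfolding obj' degen'[abs_def]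
      by (intro numerical_comp[OF _ an] numerical_comp[OF bn] snum_degen_numerical[OF Y that] free snum_free[OF Y])
    show "is_sset (forget Y)" by (rule snum_sset[OF Y])
    show "b j x \<in> carrier (obj Y j)" if "x \<in> carrier (obj Y' j)" for j x
      using bc that unfolding obj' .
    show "b j (nface Y' (Suc j) i x) = nface Y (Suc j) i (b (Suc j) x)"
      if "i \<le> Suc j" "x \<in> carrier (obj Y' (Suc j))" for i j x
      using bface that unfolding obj' .
    show "b (Suc j) (ndegen Y' j i x) = ndegen Y j i (b j x)" if "i \<le> j" "x \<in> carrier (obj Y' j)" for i j x
      using bdegen that unfolding obj' .
    show "x = y" if "x \<in> carrier (obj Y' j)" "y \<in> carrier (obj Y' j)" "\<And>n::nat. b j x = b j y" for j x y
    proof -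
      have "x \<in> vecs (m j)" "y \<in> vecs (m j)" using that(1,2) unfolding obj' .
      then show ?thesis using ab[of x j] ab[of y j] that(3) by metis
    qed
  qed
  define \<eta> where "\<eta> j = restrict (b j) (vecs (m j))" for j
  have "\<eta> \<in> nmaps Y' Y"
  proof -
    have "numerical (obj Y' j) (obj Y j) (\<eta> j)" for j
      unfolding obj' by (rule numerical_cong[OF bn free snum_free[OF Y]]) (simp add: \<eta>_def)
    moreover have "\<eta> \<in> smaps (forget Y') (forget Y)"
      unfolding smaps_def forget_simps obj'
    proof (intro CollectI conjI allI impI ballI)
      show "\<eta> j \<in> vecs (m j) \<rightarrow>\<^sub>E carrier (obj Y j)" for j using bc by (auto simp: \<eta>_def simp del: carrier_free_Abelian_group_iff)
      show "\<eta> j (nface Y' (Suc j) i x) = nface Y (Suc j) i (\<eta> (Suc j) x)"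
        if "i \<le> Suc j" "x \<in> vecs (m (Suc j))" for j i x
        using bface[OF that] snum_face[OF Y' that(1)] that unfolding obj' \<eta>_def by simp
      show "\<eta> (Suc j) (ndegen Y' j i x) = ndegen Y j i (\<eta> j x)" if "i \<le> j" "x \<in> vecs (m j)" for j i x
        using bdegen[OF that] snum_degen[OF Y' that(1)] that unfolding obj' \<eta>_def by simp
    qed
    ultimately show ?thesis by (simp add: nmaps_def)
  qed
  moreover have "\<exists>x\<in>carrier (obj Y' j). \<eta> j x = y" if "y \<in> carrier (obj Y j)" for j y
    using ac[OF that] ba[OF that] unfolding obj' by (intro bexI[of _ "a j y"]) (simp_all add: \<eta>_def)
  ultimately show ?thesis using Y' by blast
qed

lemma num_iso_inj: "num_iso A B f \<Longrightarrow> x \<in> carrier A \<Longrightarrow> y \<in> carrier A \<Longrightarrow> f x = f y \<Longrightarrow> x = y"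
  unfolding num_iso_def by metis

lemma compatible_eq:
  fixes A :: "nat \<Rightarrow> 'a monoid"
  assumes inj: "\<And>n x y. N \<le> n \<Longrightarrow> x \<in> carrier (A (Suc n)) \<Longrightarrow> y \<in> carrier (A (Suc n)) \<Longrightarrow> p n x = p n y \<Longrightarrow> x = y"
    and a: "\<And>n. a n \<in> carrier (A n)" "\<And>n. p n (a (Suc n)) = a n"
    and b: "\<And>n. b n \<in> carrier (A n)" "\<And>n. p n (b (Suc n)) = b n"
    and N: "a N = b N"
  shows "a n = b n"
proof (cases "n \<le> N")
  case True
  then show ?thesis
  proof (induction n rule: inc_induct)
    case (step n)
    then show ?case using a(2)[of n] b(2)[of n] by simp
  qed (rule N)
next
  case False
  then have "N \<le> n" by simp
  then show ?thesis
  proof (induction n rule: dec_induct)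
    case (step n)
    then show ?case using inj[OF step(1) a(1) b(1)] a(2)[of n] b(2)[of n] by simp
  qed (rule N)
qed

lemma compatible_threads:
  fixes A :: "nat \<Rightarrow> 'a monoid"
  assumes A: "\<And>n. fg_free_abelian (A n)" and p: "\<And>n. numerical (A (Suc n)) (A n) (p n)"
    and iso: "\<And>n. N \<le> n \<Longrightarrow> num_iso (A (Suc n)) (A n) (p n)"
  shows "\<exists>\<theta>. (\<forall>n. numerical (A N) (A n) (\<theta> n)) \<and>
     (\<forall>n. \<forall>x\<in>carrier (A N). p n (\<theta> (Suc n) x) = \<theta> n x) \<and> (\<forall>x\<in>carrier (A N). \<theta> N x = x)"
proof -
  define Q where "Q n q \<longleftrightarrow> numerical (A n) (A (Suc n)) q \<and> (\<forall>y\<in>carrier (A n). p n (q y) = y)" for n q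
  have "\<exists>q. N \<le> n \<longrightarrow> Q n q" for n
  proof (cases "N \<le> n")
    case True
    then show ?thesis using iso[OF True] unfolding num_iso_def Q_def by (elim conjE exE) (rule exI, simp)
  qed simp
  then have "\<forall>n. \<exists>q. N \<le> n \<longrightarrow> Q n q" by (rule allI)
  from choice[OF this] obtain q where q0: "\<forall>n. N \<le> n \<longrightarrow> Q n (q n)" ..
  have q': "Q n (q n)" if "N \<le> n" for n using q0 that by simp
  have q: "numerical (A n) (A (Suc n)) (q n)" "\<And>y. y \<in> carrier (A n) \<Longrightarrow> p n (q n y) = y" if "N \<le> n" for n
    using q'[OF that] by (simp_all add: Q_def)
  define up where "up = rec_nat (\<lambda>x. x) (\<lambda>k u x. q (N + k) (u x))"
  define dn where "dn = rec_nat (\<lambda>x. x) (\<lambda>k u x. p (N - Suc k) (u x))"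
  have up: "up 0 = (\<lambda>x. x)" "up (Suc k) = (\<lambda>x. q (N + k) (up k x))" for k by (simp_all add: up_def)
  have dn: "dn 0 = (\<lambda>x. x)" "dn (Suc k) = (\<lambda>x. p (N - Suc k) (dn k x))" for k by (simp_all add: dn_def)
  have id: "numerical (A N) (A N) (\<lambda>x. x)"
    by (rule numerical_hom[OF _ A A]) (simp add: hom_def)
  have upn: "numerical (A N) (A (N + k)) (up k)" for k
  proof (induction k)
    case 0 then show ?case using id by (simp add: up)
  next
    case (Suc k)
    have "numerical (A N) (A (Suc (N + k))) (\<lambda>x. q (N + k) (up k x))"
      by (rule numerical_comp[OF Suc q(1) A A A]) simp
    then show ?case by (simp add: up)
  qed
  have dnn: "k \<le> N \<Longrightarrow> numerical (A N) (A (N - k)) (dn k)" for k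
  proof (induction k)
    case 0 then show ?case using id by (simp add: dn)
  next
    case (Suc k)
    have e: "Suc (N - Suc k) = N - k" using Suc.prems by simp
    have a: "numerical (A (N - k)) (A (N - Suc k)) (p (N - Suc k))" using p[of "N - Suc k"] unfolding e .
    have b: "numerical (A N) (A (N - k)) (dn k)" using Suc by simp
    show ?case unfolding dn by (rule numerical_comp[OF b a A A A])
  qed
  define \<theta> where "\<theta> n = (if n \<le> N then dn (N - n) else up (n - N))" for n
  have th_up: "\<theta> (N + k) = up k" for k
    by (cases k) (simp_all add: \<theta>_def up dn)
  show ?thesis
  proof (intro exI[of _ \<theta>] conjI allI ballI)
    show "numerical (A N) (A n) (\<theta> n)" for n
    proof (cases "n \<le> N")
      case True then show ?thesis using dnn[of "N - n"] by (simp add: \<theta>_def)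
    next
      case False then show ?thesis using upn[of "n - N"] by (simp add: \<theta>_def)
    qed
    fix n x assume x: "x \<in> carrier (A N)"
    show "p n (\<theta> (Suc n) x) = \<theta> n x"
    proof (cases "n < N")
      case True
      then have "\<theta> n = dn (Suc (N - Suc n))" by (simp add: \<theta>_def Suc_diff_Suc)
      then show ?thesis using True by (simp add: dn \<theta>_def)
    next
      case False
      then obtain k where n: "n = N + k" using le_Suc_ex[of N n] by (auto simp: not_less)
      show ?thesis
        using th_up[of k] th_up[of "Suc k"] q(2)[OF _ numerical_closed[OF upn x]] by (simp add: n up)
    qed
  next
    show "\<theta> N x = x" for x by (simp add: \<theta>_def dn)
  qed
qed

text \<open>
  In each degree the inverse limit is one of the terms of the tower.  The limit can be constructed
  degreewise from these terms, and the universal property identifies the given one with it.  That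
  the identification is injective is seen by testing with a copy of the limit itself.
\<close>

lemma inverse_limit_degreewise:
  fixes Y :: "'b snum" and T :: "nat \<Rightarrow> zvec snum" and p :: "nat \<Rightarrow> nat \<Rightarrow> zvec \<Rightarrow> zvec"
  assumes Y: "is_snum Y" and T: "\<And>n. is_snum (T n)" and p: "\<And>n. p n \<in> nmaps (T (Suc n)) (T n)"
    and lim: "is_inverse_limit Y T p"
    and iso: "\<And>j. \<exists>N. \<forall>n\<ge>N. num_iso (obj (T (Suc n)) j) (obj (T n) j) (p n j)"
  shows "\<exists>r N u. tower_cone Y T p r \<and> (\<forall>j. numerical (obj (T (N j)) j) (obj Y j) (u j)) \<and>
     (\<forall>j. \<forall>x\<in>carrier (obj (T (N j)) j). r (N j) j (u j x) = x) \<and>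
     (\<forall>j. \<forall>y\<in>carrier (obj Y j). u j (r (N j) j y) = y) \<and>
     (\<forall>j n. \<forall>x\<in>carrier (obj (T (Suc n)) j). \<forall>y\<in>carrier (obj (T (Suc n)) j).
        N j \<le> n \<longrightarrow> p n j x = p n j y \<longrightarrow> x = y)"
proof -
  obtain r where r: "tower_cone Y T p r"
    and univ: "\<And>(Z :: zvec snum) r'. is_snum Z \<Longrightarrow> tower_cone Z T p r' \<Longrightarrow>
           \<exists>!u. u \<in> nmaps Z Y \<and> (\<forall>n. nmap_comp Z (r n) u = r' n)"
    using lim unfolding is_inverse_limit_def by auto
  have rm: "r n \<in> nmaps Y (T n)" for n by (rule tower_cone_maps[OF r])
  have rc: "p n j (r (Suc n) j y) = r n j y" if "y \<in> carrier (obj Y j)" for n j y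
    by (rule tower_cone_comp[OF r that])
  have "\<forall>j. \<exists>N. \<forall>n\<ge>N. num_iso (obj (T (Suc n)) j) (obj (T n) j) (p n j)" using iso by simp
  from choice[OF this] obtain N where N: "\<And>j n. N j \<le> n \<Longrightarrow> num_iso (obj (T (Suc n)) j) (obj (T n) j) (p n j)" by auto
  have inj: "x = y" if "N j \<le> n" "x \<in> carrier (obj (T (Suc n)) j)" "y \<in> carrier (obj (T (Suc n)) j)" "p n j x = p n j y"
    for j n x y using num_iso_inj[OF N[OF that(1)] that(2-4)] .
  let ?A = "\<lambda>j n. obj (T n) j"
  have "\<forall>j. \<exists>\<theta>. (\<forall>n. numerical (?A j (N j)) (?A j n) (\<theta> n)) \<and>
     (\<forall>n. \<forall>x\<in>carrier (?A j (N j)). p n j (\<theta> (Suc n) x) = \<theta> n x) \<and> (\<forall>x\<in>carrier (?A j (N j)). \<theta> (N j) x = x)"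
    using compatible_threads[of "\<lambda>n. obj (T n) _" "\<lambda>n. p n _", OF snum_free[OF T] nmaps_numerical[OF p] N] by simp
  from choice[OF this] obtain \<theta> where th: "\<forall>j. (\<forall>n. numerical (?A j (N j)) (?A j n) (\<theta> j n)) \<and>
     (\<forall>n. \<forall>x\<in>carrier (?A j (N j)). p n j (\<theta> j (Suc n) x) = \<theta> j n x) \<and>
     (\<forall>x\<in>carrier (?A j (N j)). \<theta> j (N j) x = x)" ..
  note \<theta> = th[THEN spec, THEN conjunct1, THEN spec] th[THEN spec, THEN conjunct2, THEN conjunct1, THEN spec, THEN bspec]
    th[THEN spec, THEN conjunct2, THEN conjunct2, THEN bspec]
  have thc: "\<theta> j n x \<in> carrier (?A j n)" if "x \<in> carrier (?A j (N j))" for j n x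
    by (rule numerical_closed[OF \<theta>(1) that])
  \<comment> \<open>Two compatible families in the same degree agree as soon as they agree at \<open>N j\<close>.\<close>
  have uniq: "a n = b n" if "\<And>n. a n \<in> carrier (?A j n)" "\<And>n. p n j (a (Suc n)) = a n"
    "\<And>n. b n \<in> carrier (?A j n)" "\<And>n. p n j (b (Suc n)) = b n" "a (N j) = b (N j)" for j n a b
    using compatible_eq[where A = "?A j" and p = "\<lambda>n. p n j" and N = "N j" and a = a and b = b, OF inj that] by simp
  \<comment> \<open>The limit constructed degreewise.  A simplicial operator changes the degree, and with it the
    term of the tower that represents the limit; theta moves an element to the required term.\<close>
  define Z where "Z = \<lparr>obj = (\<lambda>j. ?A j (N j)),
     nface = (\<lambda>k i x. nface (T (N (k - 1))) k i (\<theta> k (N (k - 1)) x)),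
     ndegen = (\<lambda>k i x. ndegen (T (N (Suc k))) k i (\<theta> k (N (Suc k)) x))\<rparr>"
  have objZ: "obj Z j = ?A j (N j)" for j by (simp add: Z_def)
  have faceZ: "nface Z (Suc k) i x = nface (T (N k)) (Suc k) i (\<theta> (Suc k) (N k) x)" for k i x by (simp add: Z_def)
  have degenZ: "ndegen Z k i x = ndegen (T (N (Suc k))) k i (\<theta> k (N (Suc k)) x)" for k i x by (simp add: Z_def)
  have face_num: "numerical (obj Z (Suc k)) (obj Z k) (nface Z (Suc k) i)" if "i \<le> Suc k" for k i
    unfolding objZ faceZ[abs_def]
    by (rule numerical_comp[OF \<theta>(1) snum_face_numerical[OF T that] snum_free[OF T] snum_free[OF T] snum_free[OF T]])
  have degen_num: "numerical (obj Z k) (obj Z (Suc k)) (ndegen Z k i)" if "i \<le> k" for k i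
    unfolding objZ degenZ[abs_def]
    by (rule numerical_comp[OF \<theta>(1) snum_degen_numerical[OF T that] snum_free[OF T] snum_free[OF T] snum_free[OF T]])
  have faceZc: "nface Z (Suc k) i x \<in> carrier (?A k (N k))" if "i \<le> Suc k" "x \<in> carrier (?A (Suc k) (N (Suc k)))" for k i x
    using numerical_closed[OF face_num[OF that(1)]] that(2) unfolding objZ by blast
  have degenZc: "ndegen Z k i x \<in> carrier (?A (Suc k) (N (Suc k)))" if "i \<le> k" "x \<in> carrier (?A k (N k))" for k i x
    using numerical_closed[OF degen_num[OF that(1)]] that(2) unfolding objZ by blast
  have th_face: "\<theta> k n (nface Z (Suc k) i x) = nface (T n) (Suc k) i (\<theta> (Suc k) n x)"
    if i: "i \<le> Suc k" and x: "x \<in> carrier (?A (Suc k) (N (Suc k)))" for k n i x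
  proof (rule uniq[where a = "\<lambda>n. \<theta> k n (nface Z (Suc k) i x)" and b = "\<lambda>n. nface (T n) (Suc k) i (\<theta> (Suc k) n x)"])
    show "p n k (nface (T (Suc n)) (Suc k) i (\<theta> (Suc k) (Suc n) x)) = nface (T n) (Suc k) i (\<theta> (Suc k) n x)" for n
      using nmaps_face[OF p i thc[OF x]] \<theta>(2)[OF x] by simp
    show "\<theta> k (N k) (nface Z (Suc k) i x) = nface (T (N k)) (Suc k) i (\<theta> (Suc k) (N k) x)"
      using \<theta>(3)[OF faceZc[OF i x]] by (simp add: faceZ)
  qed (use thc[OF faceZc[OF i x]] \<theta>(2)[OF faceZc[OF i x]] snum_face[OF T i thc[OF x]] in auto)
  have th_degen: "\<theta> (Suc k) n (ndegen Z k i x) = ndegen (T n) k i (\<theta> k n x)"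
    if i: "i \<le> k" and x: "x \<in> carrier (?A k (N k))" for k n i x
  proof (rule uniq[where a = "\<lambda>n. \<theta> (Suc k) n (ndegen Z k i x)" and b = "\<lambda>n. ndegen (T n) k i (\<theta> k n x)"])
    show "p n (Suc k) (ndegen (T (Suc n)) k i (\<theta> k (Suc n) x)) = ndegen (T n) k i (\<theta> k n x)" for n
      using nmaps_degen[OF p i thc[OF x]] \<theta>(2)[OF x] by simp
    show "\<theta> (Suc k) (N (Suc k)) (ndegen Z k i x) = ndegen (T (N (Suc k))) k i (\<theta> k (N (Suc k)) x)"
      using \<theta>(3)[OF degenZc[OF i x]] by (simp add: degenZ)
  qed (use thc[OF degenZc[OF i x]] \<theta>(2)[OF degenZc[OF i x]] snum_degen[OF T i thc[OF x]] in auto)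
  have Z: "is_snum Z"
  proof (rule snum_separated[where T = T and \<theta> = "\<lambda>n j. \<theta> j n", OF _ face_num degen_num snum_sset[OF T]])
    show "fg_free_abelian (obj Z j)" for j unfolding objZ by (rule snum_free[OF T])
    show "\<theta> j n x \<in> carrier (?A j n)" if "x \<in> carrier (obj Z j)" for j n x using thc that unfolding objZ .
    show "\<theta> j n (nface Z (Suc j) i x) = nface (T n) (Suc j) i (\<theta> (Suc j) n x)"
      if "i \<le> Suc j" "x \<in> carrier (obj Z (Suc j))" for j n i x using th_face that unfolding objZ .
    show "\<theta> (Suc j) n (ndegen Z j i x) = ndegen (T n) j i (\<theta> j n x)"
      if "i \<le> j" "x \<in> carrier (obj Z j)" for j n i x using th_degen that unfolding objZ .
    show "x = y" if "x \<in> carrier (obj Z j)" "y \<in> carrier (obj Z j)" "\<And>n. \<theta> j n x = \<theta> j n y" for j x y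
    proof -
      have "x \<in> carrier (?A j (N j))" "y \<in> carrier (?A j (N j))" using that(1,2) unfolding objZ .
      then show ?thesis using trans[OF trans[OF \<theta>(3)[symmetric] that(3)] \<theta>(3)] by blast
    qed
  qed
  define r' where "r' n j = restrict (\<theta> j n) (carrier (obj Z j))" for n j
  have r'm: "r' n \<in> nmaps Z (T n)" for n
    unfolding nmaps_def smaps_def forget_simps
  proof (intro CollectI conjI allI impI ballI)
    show "r' n j \<in> carrier (obj Z j) \<rightarrow>\<^sub>E carrier (?A j n)" for j using thc by (auto simp: r'_def objZ)
    show "r' n j (nface Z (Suc j) i x) = nface (T n) (Suc j) i (r' n (Suc j) x)"
      if "i \<le> Suc j" "x \<in> carrier (obj Z (Suc j))" for i j x
      using th_face[OF that(1)] snum_face[OF Z that] that by (simp add: r'_def objZ)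
    show "r' n (Suc j) (ndegen Z j i x) = ndegen (T n) j i (r' n j x)"
      if "i \<le> j" "x \<in> carrier (obj Z j)" for i j x
      using th_degen[OF that(1)] snum_degen[OF Z that] that by (simp add: r'_def objZ)
    show "numerical (obj Z j) (?A j n) (r' n j)" for j
      unfolding objZ by (rule numerical_cong[OF \<theta>(1) snum_free[OF T] snum_free[OF T]]) (simp add: r'_def objZ)
  qed
  have r'c: "tower_cone Z T p r'"
    unfolding tower_cone_def
  proof (intro conjI allI r'm)
    show "nmap_comp Z (p n) (r' (Suc n)) = r' n" for n
      using \<theta>(2) by (auto simp: fun_eq_iff nmap_comp_def compose_def r'_def objZ)
  qed
  obtain u where u: "u \<in> nmaps Z Y" "\<And>n. nmap_comp Z (r n) u = r' n" using univ[OF Z r'c] by blast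
  have ru: "r n j (u j x) = \<theta> j n x" if "x \<in> carrier (obj Z j)" for n j x
    using fun_cong[OF fun_cong[OF u(2)[of n]], of j x] that by (simp add: nmap_comp_def compose_def r'_def)
  have th_r: "\<theta> j n (r (N j) j y) = r n j y" if y: "y \<in> carrier (obj Y j)" for j n y
  proof (rule uniq[where a = "\<lambda>n. \<theta> j n (r (N j) j y)" and b = "\<lambda>n. r n j y"])
    have y': "r (N j) j y \<in> carrier (?A j (N j))" by (rule nmaps_closed[OF rm y])
    show "\<theta> j n (r (N j) j y) \<in> carrier (?A j n)" for n by (rule thc[OF y'])
    show "p n j (\<theta> j (Suc n) (r (N j) j y)) = \<theta> j n (r (N j) j y)" for n by (rule \<theta>(2)[OF y'])
    show "\<theta> j (N j) (r (N j) j y) = r (N j) j y" by (rule \<theta>(3)[OF y'])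
  qed (rule nmaps_closed[OF rm y] rc[OF y])+
  have ur: "u j (r (N j) j y) = y" if y: "y \<in> carrier (obj Y j)" for j y
  proof -
    obtain Y' :: "zvec snum" and \<eta> where Y': "is_snum Y'" and \<eta>: "\<eta> \<in> nmaps Y' Y"
      and surj: "\<And>j y. y \<in> carrier (obj Y j) \<Longrightarrow> \<exists>x\<in>carrier (obj Y' j). \<eta> j x = y"
      using snum_transport[OF Y] by blast
    \<comment> \<open>Both eta and w, its composite with the round trip through Z, are maps from Y' to Y that induce
      the cone rho.\<close>
    define \<rho> where "\<rho> n = nmap_comp Y' (r n) \<eta>" for n
    define w where "w = nmap_comp Y' (\<lambda>j y. u j (r (N j) j y)) \<eta>"
    have \<rho>: "\<rho> n j x = r n j (\<eta> j x)" if "x \<in> carrier (obj Y' j)" for n j x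
      using that by (simp add: \<rho>_def nmap_comp_def compose_def)
    have w: "w j x = u j (r (N j) j (\<eta> j x))" if "x \<in> carrier (obj Y' j)" for j x
      using that by (simp add: w_def nmap_comp_def compose_def)
    note \<eta>c = nmaps_closed[OF \<eta>]
    have rZ: "r (N j) j y \<in> carrier (obj Z j)" if "y \<in> carrier (obj Y j)" for j y
      using nmaps_closed[OF rm that] unfolding objZ .
    have rZ_face: "r (N j) j (nface Y (Suc j) i y) = nface Z (Suc j) i (r (N (Suc j)) (Suc j) y)"
      if "i \<le> Suc j" "y \<in> carrier (obj Y (Suc j))" for i j y
      using nmaps_face[OF rm that] th_r[OF that(2)] by (simp add: faceZ)
    have rZ_degen: "r (N (Suc j)) (Suc j) (ndegen Y j i y) = ndegen Z j i (r (N j) j y)"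
      if "i \<le> j" "y \<in> carrier (obj Y j)" for i j y
      using nmaps_degen[OF rm that] th_r[OF that(2)] by (simp add: degenZ)
    have \<rho>m: "\<rho> n \<in> nmaps Y' (T n)" for n
      unfolding nmaps_def smaps_def forget_simps
    proof (intro CollectI conjI allI impI ballI)
      show "\<rho> n j \<in> carrier (obj Y' j) \<rightarrow>\<^sub>E carrier (?A j n)" for j
        using nmaps_closed[OF rm \<eta>c] by (auto simp: \<rho>_def nmap_comp_def compose_def)
      show "\<rho> n j (nface Y' (Suc j) i x) = nface (T n) (Suc j) i (\<rho> n (Suc j) x)"
        if "i \<le> Suc j" "x \<in> carrier (obj Y' (Suc j))" for i j x
        using \<rho>[OF snum_face[OF Y' that]] \<rho>[OF that(2)] nmaps_face[OF \<eta> that] nmaps_face[OF rm that(1) \<eta>c[OF that(2)]] by simp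
      show "\<rho> n (Suc j) (ndegen Y' j i x) = ndegen (T n) j i (\<rho> n j x)"
        if "i \<le> j" "x \<in> carrier (obj Y' j)" for i j x
        using \<rho>[OF snum_degen[OF Y' that]] \<rho>[OF that(2)] nmaps_degen[OF \<eta> that] nmaps_degen[OF rm that(1) \<eta>c[OF that(2)]] by simp
      show "numerical (obj Y' j) (?A j n) (\<rho> n j)" for j
        by (rule numerical_cong[OF numerical_comp[OF nmaps_numerical[OF \<eta>] nmaps_numerical[OF rm]
              snum_free[OF Y'] snum_free[OF Y] snum_free[OF T]] snum_free[OF Y'] snum_free[OF T]]) (simp add: \<rho>)
    qed
    have cone: "tower_cone Y' T p \<rho>"
      unfolding tower_cone_def
    proof (intro conjI allI \<rho>m)
      show "nmap_comp Y' (p n) (\<rho> (Suc n)) = \<rho> n" for n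
        using rc[OF \<eta>c] by (auto simp: fun_eq_iff nmap_comp_def compose_def \<rho>_def)
    qed
    have wm: "w \<in> nmaps Y' Y"
      unfolding nmaps_def smaps_def forget_simps
    proof (intro CollectI conjI allI impI ballI)
      show "w j \<in> carrier (obj Y' j) \<rightarrow>\<^sub>E carrier (obj Y j)" for j
        using nmaps_closed[OF u(1) rZ[OF \<eta>c]] by (auto simp: w_def nmap_comp_def compose_def)
      show "w j (nface Y' (Suc j) i x) = nface Y (Suc j) i (w (Suc j) x)"
        if "i \<le> Suc j" "x \<in> carrier (obj Y' (Suc j))" for i j x
        using w[OF snum_face[OF Y' that]] w[OF that(2)] nmaps_face[OF \<eta> that] rZ_face[OF that(1) \<eta>c[OF that(2)]]
          nmaps_face[OF u(1) that(1) rZ[OF \<eta>c[OF that(2)]]] by simp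
      show "w (Suc j) (ndegen Y' j i x) = ndegen Y j i (w j x)"
        if "i \<le> j" "x \<in> carrier (obj Y' j)" for i j x
        using w[OF snum_degen[OF Y' that]] w[OF that(2)] nmaps_degen[OF \<eta> that] rZ_degen[OF that(1) \<eta>c[OF that(2)]]
          nmaps_degen[OF u(1) that(1) rZ[OF \<eta>c[OF that(2)]]] by simp
      have n1: "numerical (obj Y' j) (obj Z j) (\<lambda>x. r (N j) j (\<eta> j x))" for j
        unfolding objZ by (rule numerical_comp[OF nmaps_numerical[OF \<eta>] nmaps_numerical[OF rm]
              snum_free[OF Y'] snum_free[OF Y] snum_free[OF T]])
      show "numerical (obj Y' j) (obj Y j) (w j)" for j
        by (rule numerical_cong[OF numerical_comp[OF n1 nmaps_numerical[OF u(1)]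
              snum_free[OF Y'] snum_free[OF Z] snum_free[OF Y]] snum_free[OF Y'] snum_free[OF Y]]) (simp add: w)
    qed
    have wr: "nmap_comp Y' (r n) w = \<rho> n" for n
    proof (intro ext)
      fix j x
      show "nmap_comp Y' (r n) w j x = \<rho> n j x"
      proof (cases "x \<in> carrier (obj Y' j)")
        case True
        then show ?thesis using w[OF True] \<rho>[OF True] ru[OF rZ[OF \<eta>c[OF True]]] th_r[OF \<eta>c[OF True]]
          by (simp add: nmap_comp_def compose_def)
      qed (simp add: nmap_comp_def compose_def \<rho>_def)
    qed
    have "w = \<eta>" using univ[OF Y' cone] wm wr \<eta> by (auto simp: \<rho>_def)
    obtain x where x: "x \<in> carrier (obj Y' j)" "\<eta> j x = y" using surj[OF y] by blast
    show ?thesis using w[OF x(1)] x(2) \<open>w = \<eta>\<close> by simp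
  qed
  show ?thesis
  proof (intro exI[of _ r] exI[of _ N] exI[of _ u] conjI allI ballI impI r)
    show "numerical (?A j (N j)) (obj Y j) (u j)" for j using nmaps_numerical[OF u(1), of j] unfolding objZ .
    show "r (N j) j (u j x) = x" if "x \<in> carrier (?A j (N j))" for j x
      using ru[of x j "N j"] \<theta>(3)[OF that] that by (simp add: objZ)
  qed (use ur inj in blast)+
qed

text \<open>
  The maps to the terms of the tower supplied by \<open>tower_extension\<close> are combined by means of the
  identification of \<open>Y\<close>, in degree \<open>j\<close>, with the term \<open>N j\<close>.
\<close>

theorem fibred_extension:
  fixes Y :: "'b snum"
  assumes K: "is_sset K" and R: "function_system K R" and L: "subcomplex K L" and ac: "acyclic_pair K L R"
    and Y: "is_snum Y" and fib: "fibred_structure Y T p C d"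
    and exact: "\<And>n. \<exists>h. \<forall>q\<ge>h. trivial_group (chain_homology (C n) (d n) (Suc q))"
    and g: "smap_on K L Y g"
    and g_reg: "\<And>n N. null_cochain Y n N \<Longrightarrow> (\<lambda>x. of_int (if x \<in> L n then N (g n x) else 0)) \<in> R n"
  shows "\<exists>F. regular_map K R Y F \<and> (\<forall>n. \<forall>x\<in>L n. F n x = g n x)"
proof -
  have T: "is_snum (T n)" and p: "p n \<in> nmaps (T (Suc n)) (T n)" and lim: "is_inverse_limit Y T p"
    and T0: "\<exists>x. carrier (obj (T 0) j) = {x}" and v: "\<exists>x. carrier (obj (T n) 0) = {x}"
    and iso: "\<exists>N. \<forall>n\<ge>N. num_iso (obj (T (Suc n)) j) (obj (T n) j) (p n j)"
    and C: "fg_chain_complex (C n) (d n)" and pt: "is_ptcp (T (Suc n)) (T n) (p n) (Gamma (C n) (d n))" for n j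
    using fib by (simp_all add: fibred_structure_def)
  obtain r N u where r: "tower_cone Y T p r" and u_num: "\<forall>j. numerical (obj (T (N j)) j) (obj Y j) (u j)"
    and ru: "\<forall>j. \<forall>x\<in>carrier (obj (T (N j)) j). r (N j) j (u j x) = x"
    and ur: "\<forall>j. \<forall>y\<in>carrier (obj Y j). u j (r (N j) j y) = y"
    and inj: "\<forall>j n. \<forall>x\<in>carrier (obj (T (Suc n)) j). \<forall>y\<in>carrier (obj (T (Suc n)) j).
        N j \<le> n \<longrightarrow> p n j x = p n j y \<longrightarrow> x = y"
    using inverse_limit_degreewise[OF Y T p lim iso] by (elim exE conjE)
  have rm: "r n \<in> nmaps Y (T n)" for n by (rule tower_cone_maps[OF r])
  have "\<exists>f. \<forall>n. regular_map K R (T n) (f n) \<and> (\<forall>j. \<forall>x\<in>L j. f n j x = r n j (g j x)) \<and>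
      (\<forall>j. \<forall>x\<in>simp K j. p n j (f (Suc n) j x) = f n j x)"
    by (rule tower_extension[OF K R L ac T p T0 v C pt exact Y r g]) (rule g_reg)
  then obtain f where f: "\<forall>n. regular_map K R (T n) (f n) \<and> (\<forall>j. \<forall>x\<in>L j. f n j x = r n j (g j x)) \<and>
      (\<forall>j. \<forall>x\<in>simp K j. p n j (f (Suc n) j x) = f n j x)" ..
  have fm: "smap K (forget (T n)) (f n)" and fr: "regular (simp K j) (R j) (obj (T n) j) (f n j)" for n j
    using f by (simp_all add: regular_map_def)
  have fc: "f n j x \<in> carrier (obj (T n) j)" if "x \<in> simp K j" for n j x
    using smap_closed[OF fm that] by simp
  define F where "F j x = u j (f (N j) j x)" for j x
  have FY: "F j x \<in> carrier (obj Y j)" if "x \<in> simp K j" for j x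
    unfolding F_def using numerical_closed[OF u_num[rule_format] fc[OF that]] .
  have rF: "r n j (F j x) = f n j x" if x: "x \<in> simp K j" for n j x
  proof (rule compatible_eq[where A = "\<lambda>n. obj (T n) j" and p = "\<lambda>n. p n j" and N = "N j"
        and a = "\<lambda>n. r n j (F j x)" and b = "\<lambda>n. f n j x"])
    show "a = b" if "N j \<le> n" "a \<in> carrier (obj (T (Suc n)) j)" "b \<in> carrier (obj (T (Suc n)) j)" "p n j a = p n j b"
      for n a b using inj that by simp
    show "p n j (r (Suc n) j (F j x)) = r n j (F j x)" for n by (rule tower_cone_comp[OF r FY[OF x]])
    show "p n j (f (Suc n) j x) = f n j x" for n using f x by simp
    show "r (N j) j (F j x) = f (N j) j x" unfolding F_def using ru fc[OF x] by simp
  qed (rule nmaps_closed[OF rm FY[OF x]], rule fc[OF x])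
  have Y_eqI: "a = b" if "a \<in> carrier (obj Y j)" "b \<in> carrier (obj Y j)" "r (N j) j a = r (N j) j b" for a b j
  proof -
    have "a = u j (r (N j) j a)" using ur that(1) by simp
    also have "\<dots> = b" using ur that(2,3) by simp
    finally show ?thesis .
  qed
  have "smap K (forget Y) F"
    unfolding smap_def forget_simps
  proof (intro conjI allI impI ballI funcsetI FY)
    fix j i x assume i: "i \<le> Suc j" and x: "x \<in> simp K (Suc j)"
    note fx = sset_face[OF K i x]
    show "F j (face K (Suc j) i x) = nface Y (Suc j) i (F (Suc j) x)"
      by (rule Y_eqI[OF FY[OF fx] snum_face[OF Y i FY[OF x]]])
        (simp add: rF[OF fx] nmaps_face[OF rm i FY[OF x]] rF[OF x] smap_face[OF fm i x])
  next
    fix j i x assume i: "i \<le> j" and x: "x \<in> simp K j"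
    note dx = sset_degen[OF K i x]
    show "F (Suc j) (degen K j i x) = ndegen Y j i (F j x)"
      by (rule Y_eqI[OF FY[OF dx] snum_degen[OF Y i FY[OF x]]])
        (simp add: rF[OF dx] nmaps_degen[OF rm i FY[OF x]] rF[OF x] smap_degen[OF fm i x])
  qed
  moreover have "regular (simp K j) (R j) (obj Y j) (F j)" for j
    unfolding F_def[abs_def]
    by (rule numerical_regular[OF u_num[rule_format] function_system_algebra[OF R] fr snum_group[OF Y]])
  moreover have "F j x = g j x" if x: "x \<in> L j" for j x
    using f ur smap_on_closed[OF g x] x by (simp add: F_def)
  ultimately show ?thesis by (intro exI[of _ F]) (simp add: regular_map_def)
qed

section \<open>Cylinders\<close>

text \<open>
  A simplex of the interval is encoded by the number of its vertices that lie at the initial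
  vertex; so 0 stands for the constant simplices at the terminal vertex and \<open>n + 1\<close>, in degree
  \<open>n\<close>, for those at the initial vertex.
\<close>

definition cyl :: "'k sset \<Rightarrow> ('k \<times> nat) sset" where
  "cyl K = \<lparr>simp = (\<lambda>n. simp K n \<times> {..Suc n}),
     face = (\<lambda>n i (x, j). (face K n i x, if i < j then j - 1 else j)),
     degen = (\<lambda>n i (x, j). (degen K n i x, if i < j then Suc j else j))\<rparr>"

lemma cyl_simps [simp]:
  "(x, j) \<in> simp (cyl K) n \<longleftrightarrow> x \<in> simp K n \<and> j \<le> Suc n"
  "face (cyl K) n i (x, j) = (face K n i x, if i < j then j - 1 else j)"
  "degen (cyl K) n i (x, j) = (degen K n i x, if i < j then Suc j else j)"
  by (simp_all add: cyl_def)

lemma cyl_simpE: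
  assumes "z \<in> simp (cyl K) n"
  obtains x j where "z = (x, j)" "x \<in> simp K n" "j \<le> Suc n"
  using assms by (cases z) simp

lemma cyl_sset:
  assumes K: "is_sset K" shows "is_sset (cyl K)"
  unfolding is_sset_def
proof (intro conjI allI impI ballI funcsetI)
  fix n i z assume i: "i \<le> Suc n" and z: "z \<in> simp (cyl K) (Suc n)"
  then show "face (cyl K) (Suc n) i z \<in> simp (cyl K) n"
    using sset_face[OF K i] by (elim cyl_simpE) auto
next
  fix n i z assume i: "i \<le> n" and z: "z \<in> simp (cyl K) n"
  then show "degen (cyl K) n i z \<in> simp (cyl K) (Suc n)"
    using sset_degen[OF K i] by (elim cyl_simpE) auto
next
  fix n z i k assume z: "z \<in> simp (cyl K) (Suc (Suc n))" and ik: "i < k \<and> k \<le> Suc (Suc n)"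
  obtain x j where x: "z = (x, j)" "x \<in> simp K (Suc (Suc n))" by (rule cyl_simpE[OF z])
  show "face (cyl K) (Suc n) i (face (cyl K) (Suc (Suc n)) k z) =
        face (cyl K) (Suc n) (k - 1) (face (cyl K) (Suc (Suc n)) i z)"
    using sset_face_face[OF K x(2), of i k] ik by (auto simp: x(1))
next
  fix n z i k assume z: "z \<in> simp (cyl K) n" and ik: "i \<le> k \<and> k \<le> n"
  obtain x j where x: "z = (x, j)" "x \<in> simp K n" by (rule cyl_simpE[OF z])
  show "degen (cyl K) (Suc n) i (degen (cyl K) n k z) = degen (cyl K) (Suc n) (Suc k) (degen (cyl K) n i z)"
    using sset_degen_degen[OF K x(2), of i k] ik by (auto simp: x(1))
next
  fix n z i k assume z: "z \<in> simp (cyl K) n" and ik: "i \<le> Suc n \<and> k \<le> n"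
  obtain x j where x: "z = (x, j)" "x \<in> simp K n" by (rule cyl_simpE[OF z])
  show "face (cyl K) (Suc n) i (degen (cyl K) n k z) =
          (if i < k then degen (cyl K) (n - 1) (k - 1) (face (cyl K) n i z)
           else if i = k \<or> i = Suc k then z
           else degen (cyl K) (n - 1) k (face (cyl K) n (i - 1) z))"
    using sset_face_degen[OF K x(2), of i k] ik by (auto simp: x(1))
qed

text \<open>
  Two conditions on functions on a cylinder: regularity on the copy of \<open>K\<close> belonging to each simplex
  of the interval, and regularity on the far end alone, which is the copy over \<open>n + 1\<close>.
\<close>

definition slices_regular :: "(nat \<Rightarrow> ('k \<Rightarrow> rat) set) \<Rightarrow> nat \<Rightarrow> ('k \<times> nat \<Rightarrow> rat) set" where
  "slices_regular R n = {F. \<forall>j\<le>Suc n. (\<lambda>x. F (x, j)) \<in> R n}"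

definition end_regular :: "(nat \<Rightarrow> ('k \<Rightarrow> rat) set) \<Rightarrow> nat \<Rightarrow> ('k \<times> nat \<Rightarrow> rat) set" where
  "end_regular R n = {F. (\<lambda>x. F (x, Suc n)) \<in> R n}"

lemma rat_algebraI:
  assumes "\<And>c. (\<lambda>_. c) \<in> R" "\<And>F G. F \<in> R \<Longrightarrow> G \<in> R \<Longrightarrow> (\<lambda>x. F x + G x) \<in> R"
    "\<And>F G. F \<in> R \<Longrightarrow> G \<in> R \<Longrightarrow> (\<lambda>x. F x * G x) \<in> R"
    "\<And>F G. F \<in> R \<Longrightarrow> (\<And>x. x \<in> S \<Longrightarrow> F x = G x) \<Longrightarrow> G \<in> R"
  shows "rat_algebra S R"
  unfolding rat_algebra_def using assms by simp

lemma slices_regular_system: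
  assumes R: "function_system K R" shows "function_system (cyl K) (slices_regular R)"
proof -
  note alg = function_system_algebra[OF R]
  have "rat_algebra (simp (cyl K) n) (slices_regular R n)" for n
  proof (rule rat_algebraI)
    fix F G assume FG: "F \<in> slices_regular R n" "\<And>z. z \<in> simp (cyl K) n \<Longrightarrow> F z = G z"
    have "(\<lambda>x. G (x, j)) \<in> R n" if "j \<le> Suc n" for j
      by (rule rat_algebra_cong[OF alg, of "\<lambda>x. F (x, j)"]) (use FG that in \<open>simp_all add: slices_regular_def\<close>)
    then show "G \<in> slices_regular R n" by (simp add: slices_regular_def)
  qed (simp_all add: slices_regular_def rat_algebra_const[OF alg] rat_algebra_add[OF alg] rat_algebra_mult[OF alg])
  moreover have "(\<lambda>z. F (face (cyl K) (Suc n) i z)) \<in> slices_regular R (Suc n)"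
    if i: "i \<le> Suc n" and F: "F \<in> slices_regular R n" for F n i
    unfolding slices_regular_def
  proof (intro CollectI allI impI)
    fix j assume "j \<le> Suc (Suc n)"
    then have "(if i < j then j - 1 else j) \<le> Suc n" using i by auto
    then have "(\<lambda>x. F (x, if i < j then j - 1 else j)) \<in> R n" using F by (simp add: slices_regular_def)
    from function_system_face[OF R i this] show "(\<lambda>x. F (face (cyl K) (Suc n) i (x, j))) \<in> R (Suc n)" by simp
  qed
  moreover have "(\<lambda>z. F (degen (cyl K) n i z)) \<in> slices_regular R n"
    if i: "i \<le> n" and F: "F \<in> slices_regular R (Suc n)" for F n i
    unfolding slices_regular_def
  proof (intro CollectI allI impI)
    fix j assume "j \<le> Suc n"
    then have "(if i < j then Suc j else j) \<le> Suc (Suc n)" by auto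
    then have "(\<lambda>x. F (x, if i < j then Suc j else j)) \<in> R (Suc n)" using F by (simp add: slices_regular_def)
    from function_system_degen[OF R i this] show "(\<lambda>x. F (degen (cyl K) n i (x, j))) \<in> R n" by simp
  qed
  ultimately show ?thesis unfolding function_system_def by simp
qed

lemma end_regular_system:
  assumes R: "function_system K R" shows "function_system (cyl K) (end_regular R)"
proof -
  note alg = function_system_algebra[OF R]
  have "rat_algebra (simp (cyl K) n) (end_regular R n)" for n
  proof (rule rat_algebraI)
    fix F G assume FG: "F \<in> end_regular R n" "\<And>z. z \<in> simp (cyl K) n \<Longrightarrow> F z = G z"
    show "G \<in> end_regular R n"
      unfolding end_regular_def mem_Collect_eq
      by (rule rat_algebra_cong[OF alg, of "\<lambda>x. F (x, Suc n)"]) (use FG in \<open>simp_all add: end_regular_def\<close>)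
  qed (simp_all add: end_regular_def rat_algebra_const[OF alg] rat_algebra_add[OF alg] rat_algebra_mult[OF alg])
  moreover have "(\<lambda>z. F (face (cyl K) (Suc n) i z)) \<in> end_regular R (Suc n)"
    if i: "i \<le> Suc n" and F: "F \<in> end_regular R n" for F n i
    using function_system_face[OF R i, of "\<lambda>x. F (x, Suc n)"] F i by (simp add: end_regular_def)
  moreover have "(\<lambda>z. F (degen (cyl K) n i z)) \<in> end_regular R n"
    if i: "i \<le> n" and F: "F \<in> end_regular R (Suc n)" for F n i
    using function_system_degen[OF R i, of "\<lambda>x. F (x, Suc (Suc n))"] F i by (simp add: end_regular_def)
  ultimately show ?thesis unfolding function_system_def by simp
qed

lemma slices_regular_UNIV: "slices_regular (\<lambda>_. UNIV) = (\<lambda>_. UNIV)"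
  by (simp add: slices_regular_def fun_eq_iff)

definition cyl_start :: "'k sset \<Rightarrow> (nat \<Rightarrow> 'k set) \<Rightarrow> nat \<Rightarrow> ('k \<times> nat) set" where
  "cyl_start K L n = {(x, j). x \<in> simp K n \<and> j \<le> Suc n \<and> (j = 0 \<or> x \<in> L n)}"

definition cyl_ends :: "'k sset \<Rightarrow> (nat \<Rightarrow> 'k set) \<Rightarrow> nat \<Rightarrow> ('k \<times> nat) set" where
  "cyl_ends K L n = {(x, j). x \<in> simp K n \<and> j \<le> Suc n \<and> (j = 0 \<or> j = Suc n \<or> x \<in> L n)}"

lemma cyl_start_subcomplex:
  assumes K: "is_sset K" and L: "subcomplex K L" shows "subcomplex (cyl K) (cyl_start K L)"
  unfolding subcomplex_def cyl_start_def
  using subcomplex_face[OF L] subcomplex_degen[OF L] sset_face[OF K] sset_degen[OF K] by auto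

lemma cyl_ends_subcomplex:
  assumes K: "is_sset K" and L: "subcomplex K L" shows "subcomplex (cyl K) (cyl_ends K L)"
  unfolding subcomplex_def cyl_ends_def
  using subcomplex_face[OF L] subcomplex_degen[OF L] sset_face[OF K] sset_degen[OF K] by auto

subsection \<open>The prism operator\<close>

text \<open>
  Integration over the prisms of the contraction of the interval to its terminal vertex.  On the
  \<open>i\<close>-th simplex of the prism over \<open>(x, j)\<close> the number of vertices at the initial vertex is the
  minimum of \<open>i + 1\<close> and that of \<open>s\<^sub>i (x, j)\<close>; for \<open>i \<ge> j\<close> it is degenerate and contributes
  nothing to normalised cochains.
\<close>

definition prism :: "'k sset \<Rightarrow> nat \<Rightarrow> ('k \<times> nat \<Rightarrow> int) \<Rightarrow> 'k \<times> nat \<Rightarrow> int" where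
  "prism K n u z = (\<Sum>i<snd z. (-1) ^ i * u (degen K n i (fst z), Suc i))"

text \<open>
  In the double sum for \<open>prism (\<delta> u)\<close> the faces \<open>k = i\<close> and \<open>k = i + 1\<close> of the \<open>i\<close>-th prism simplex
  telescope to the difference on the right.  The faces with \<open>k < i\<close> and those with \<open>k > i + 1\<close>
  are prism simplices over the faces of \<open>x\<close> and cancel against \<open>\<delta> (prism u)\<close>.
\<close>

lemma prism_homotopy:
  assumes K: "is_sset K" and x: "x \<in> simp K n" and j: "j \<le> Suc n"
  shows "prism K n (cob (cyl K) (Suc n) u) (x, j) + cob (cyl K) n (prism K (n - 1) u) (x, j) = u (x, 0) - u (x, j)"
proof -
  define t where "t i k = (-1) ^ (i + k) * u (face (cyl K) (Suc n) k (degen K n i x, Suc i))" for i k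
  let ?A = "{..<j} \<times> {..Suc n}"
  let ?D = "{(i, k). i < j \<and> (k = i \<or> k = Suc i)}"
  let ?A1 = "{(i, k). i < j \<and> k < i}" and ?A2 = "{(i, k). i < j \<and> Suc i < k \<and> k \<le> Suc n}"
  have fin: "finite ?D" "finite ?A1" "finite ?A2"
    by (rule finite_subset[of _ "{..<j} \<times> {..Suc j + Suc n}"]; auto)+
  have "prism K n (cob (cyl K) (Suc n) u) (x, j) = (\<Sum>(i, k)\<in>?A. t i k)"
    unfolding prism_def cob_Suc sum_distrib_left sum.cartesian_product[symmetric] fst_conv snd_conv
    by (intro sum.cong refl) (simp add: t_def power_add)
  also have "?A = ?D \<union> (?A1 \<union> ?A2)" using j by auto
  also have "(\<Sum>(i, k)\<in>?D \<union> (?A1 \<union> ?A2). t i k) = (\<Sum>(i, k)\<in>?D. t i k) + (\<Sum>(i, k)\<in>?A1 \<union> ?A2. t i k)"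
    by (rule sum.union_disjoint[OF fin(1) finite_UnI[OF fin(2,3)]]) auto
  also have "(\<Sum>(i, k)\<in>?A1 \<union> ?A2. t i k) = (\<Sum>(i, k)\<in>?A1. t i k) + (\<Sum>(i, k)\<in>?A2. t i k)"
    by (rule sum.union_disjoint[OF fin(2,3)]) auto
  also have "(\<Sum>(i, k)\<in>?D. t i k) = (\<Sum>(i, k)\<in>(SIGMA i:{..<j}. {i, Suc i}). t i k)"
  proof -
    have "?D = (SIGMA i:{..<j}. {i, Suc i})" by auto
    then show ?thesis by simp
  qed
  also have "\<dots> = (\<Sum>i<j. \<Sum>k\<in>{i, Suc i}. t i k)"
    by (rule sum.Sigma[symmetric]) auto
  also have "\<dots> = (\<Sum>i<j. u (x, i) - u (x, Suc i))"
  proof (rule sum.cong[OF refl])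
    fix i assume "i \<in> {..<j}"
    then have i: "i \<le> n" using j by simp
    show "(\<Sum>k\<in>{i, Suc i}. t i k) = u (x, i) - u (x, Suc i)"
      using sset_face_degen_same[OF K x i] by (simp add: t_def)
  qed
  also have "\<dots> = u (x, 0) - u (x, j)" by (rule sum_lessThan_telescope')
  finally have main: "prism K n (cob (cyl K) (Suc n) u) (x, j) =
      u (x, 0) - u (x, j) + ((\<Sum>(i, k)\<in>?A1. t i k) + (\<Sum>(i, k)\<in>?A2. t i k))" .
  show ?thesis
  proof (cases n)
    case 0
    have e: "?A1 = {}" "?A2 = {}" using j 0 by auto
    show ?thesis using main unfolding e by (simp add: cob_def 0)
  next
    case (Suc n')
    have x': "x \<in> simp K (Suc n')" using x Suc by simp
    define b where "b i k = (-1) ^ (i + k) * u (degen K n' i (face K n k x), Suc i)" for i k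
    let ?B1 = "{(i, k). Suc i < j \<and> k \<le> i}" and ?B2 = "{(i, k). i < j \<and> i < k \<and> k \<le> n}"
    have "(\<Sum>(i, k)\<in>?A1. t i k) = (\<Sum>(i, k)\<in>?B1. - b i k)"
    proof (rule sum.reindex_bij_witness[of _ "\<lambda>(i, k). (Suc i, k)" "\<lambda>(i, k). (i - 1, k)"])
      fix q assume q: "q \<in> ?A1"
      obtain i' k where q': "q = (i', k)" by (rule prod.exhaust)
      define i where "i = i' - 1"
      have ik: "i' = Suc i" "k \<le> i" "Suc i < j" using q by (auto simp: q' i_def)
      have "face K (Suc n) k (degen K n (Suc i) x) = degen K n' i (face K n k x)"
        using sset_face_degen_less[OF K x', of k "Suc i"] ik j Suc by simp
      then have "t (Suc i) k = - b i k" using ik by (simp add: t_def b_def)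
      then show "(case case q of (i, k) \<Rightarrow> (i - 1, k) of (i, k) \<Rightarrow> - b i k) = (case q of (i, k) \<Rightarrow> t i k)"
        by (simp add: q' ik(1))
    qed auto
    moreover have "(\<Sum>(i, k)\<in>?A2. t i k) = (\<Sum>(i, k)\<in>?B2. - b i k)"
    proof (rule sum.reindex_bij_witness[of _ "\<lambda>(i, k). (i, Suc k)" "\<lambda>(i, k). (i, k - 1)"])
      fix q assume q: "q \<in> ?A2"
      obtain i k' where q': "q = (i, k')" by (rule prod.exhaust)
      define k where "k = k' - 1"
      have ik: "k' = Suc k" "i < k" "i < j" "k \<le> n" using q by (auto simp: q' k_def)
      have "face K (Suc n) (Suc k) (degen K n i x) = degen K n' i (face K n k x)"
        using sset_face_degen_greater[OF K x', of i "Suc k"] ik j Suc by simp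
      then have "t i (Suc k) = - b i k" using ik by (simp add: t_def b_def)
      then show "(case case q of (i, k) \<Rightarrow> (i, k - 1) of (i, k) \<Rightarrow> - b i k) = (case q of (i, k) \<Rightarrow> t i k)"
        by (simp add: q' ik(1))
    qed auto
    moreover have "cob (cyl K) n (prism K (n - 1) u) (x, j) = (\<Sum>(i, k)\<in>?B1. b i k) + (\<Sum>(i, k)\<in>?B2. b i k)"
    proof -
      have "cob (cyl K) n (prism K (n - 1) u) (x, j) =
          (\<Sum>k\<le>n. \<Sum>i<(if k < j then j - 1 else j). b i k)"
        unfolding Suc cob_Suc prism_def
        by (intro sum.cong refl) (simp add: b_def sum_distrib_left power_add Suc mult.left_commute mult.assoc)
      also have "\<dots> = (\<Sum>(k, i)\<in>(SIGMA k:{..n}. {..<(if k < j then j - 1 else j)}). b i k)"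
        by (rule sum.Sigma) auto
      also have "\<dots> = (\<Sum>(i, k)\<in>?B1 \<union> ?B2. b i k)"
        by (rule sum.reindex_bij_witness[of _ "\<lambda>(i, k). (k, i)" "\<lambda>(k, i). (i, k)"])
          (use j in \<open>auto split: if_splits\<close>)
      also have "\<dots> = (\<Sum>(i, k)\<in>?B1. b i k) + (\<Sum>(i, k)\<in>?B2. b i k)"
      proof (rule sum.union_disjoint)
        show "finite ?B1" by (rule finite_subset[of _ "{..j} \<times> {..j}"]) auto
        show "finite ?B2" by (rule finite_subset[of _ "{..j} \<times> {..n}"]) auto
      qed auto
      finally show ?thesis .
    qed
    ultimately show ?thesis using main by (simp add: split_def sum_negf)
  qed
qed

lemma prism_rel_cochain:
  assumes K: "is_sset K" and L: "subcomplex K L" and R: "function_system K R"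
    and u: "rel_cochain (cyl K) (cyl_start K L) (slices_regular R) (Suc n) u"
  shows "rel_cochain (cyl K) (cyl_start K L) (slices_regular R) n (prism K n u)"
proof (rule rel_cochainI)
  note alg = function_system_algebra[OF R]
  show "(\<lambda>z. of_int (prism K n u z)) \<in> slices_regular R n"
    unfolding slices_regular_def
  proof (intro CollectI allI impI)
    fix j assume j: "j \<le> Suc n"
    have "(\<lambda>x. \<Sum>i<j. (-1) ^ i * of_int (u (degen K n i x, Suc i))) \<in> R n"
    proof (intro rat_algebra_sum[OF alg] rat_algebra_cmul[OF alg])
      fix i assume "i \<in> {..<j}"
      then have i: "i \<le> n" using j by simp
      have "(\<lambda>x. of_int (u (x, Suc i))) \<in> R (Suc n)"
        using rel_cochain_regular[OF u] i by (simp add: slices_regular_def)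
      from function_system_degen[OF R i this] show "(\<lambda>x. of_int (u (degen K n i x, Suc i))) \<in> R n" .
    qed
    then show "(\<lambda>x. of_int (prism K n u (x, j))) \<in> R n" by (simp add: prism_def)
  qed
  show "prism K n u z = 0" if "z \<in> cyl_start K L n" for z
  proof -
    obtain x j where z: "z = (x, j)" by (rule prod.exhaust)
    have "u (degen K n i x, Suc i) = 0" if "i < j" for i
      using \<open>z \<in> cyl_start K L n\<close> that z subcomplex_degen[OF L, of i n x] sset_degen[OF K, of i n x]
      by (intro rel_cochain_sub[OF u]) (auto simp: cyl_start_def)
    then show ?thesis by (simp add: prism_def z)
  qed
  fix m k z assume n: "n = Suc m" and k: "k \<le> m" and z: "z \<in> simp (cyl K) m"
  obtain x j where x: "z = (x, j)" "x \<in> simp K m" "j \<le> Suc m" by (rule cyl_simpE[OF z])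
  have "u (degen K n i (degen K m k x), Suc i) = 0" if i: "i \<le> Suc m" for i
  proof (cases "i \<le> k")
    case True
    have "(degen K n i (degen K m k x), Suc i) = degen (cyl K) (Suc m) (Suc k) (degen K m i x, Suc i)"
      using sset_degen_degen[OF K x(2) True k] True n by simp
    then show ?thesis
      using rel_cochain_degen[OF u, of "Suc k" "(degen K m i x, Suc i)"] sset_degen[OF K _ x(2), of i] True k n by simp
  next
    case False
    have "degen K (Suc m) k (degen K m (i - 1) x) = degen K (Suc m) i (degen K m k x)"
      using sset_degen_degen[OF K x(2), of k "i - 1"] False i by simp
    then have "(degen K n i (degen K m k x), Suc i) = degen (cyl K) (Suc m) k (degen K m (i - 1) x, i)"
      using False n by simp
    then show ?thesis
      using rel_cochain_degen[OF u, of k "(degen K m (i - 1) x, i)"] sset_degen[OF K _ x(2), of "i - 1"] False i k n by simp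
  qed
  then show "prism K n u (degen (cyl K) m k z) = 0"
    using x(3) by (auto simp: prism_def x(1) intro!: sum.neutral)
qed

subsection \<open>Comparison of regular with arbitrary cochains\<close>

text \<open>
  The inclusion of the regular relative cochains into all relative cochains induces injections and
  surjections in cohomology.
\<close>

definition comparable :: "'k sset \<Rightarrow> (nat \<Rightarrow> 'k set) \<Rightarrow> (nat \<Rightarrow> ('k \<Rightarrow> rat) set) \<Rightarrow> bool" where
  "comparable K L R \<longleftrightarrow>
     (\<forall>n u v. rel_cochain K L R n u \<and> rel_cochain K L (\<lambda>_. UNIV) (n - 1) v \<and> (\<forall>x\<in>simp K n. u x = cob K n v x) \<longrightarrow>
        (\<exists>w. rel_cochain K L R (n - 1) w \<and> (\<forall>x\<in>simp K n. u x = cob K n w x))) \<and>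
     (\<forall>n u. rel_cochain K L (\<lambda>_. UNIV) n u \<and> (\<forall>x\<in>simp K (Suc n). cob K (Suc n) u x = 0) \<longrightarrow>
        (\<exists>w v. rel_cochain K L R n w \<and> rel_cochain K L (\<lambda>_. UNIV) (n - 1) v \<and>
           (\<forall>x\<in>simp K n. u x = w x + cob K n v x)))"

lemma comparable_injective:
  assumes "comparable K L R" "rel_cochain K L R n u" "rel_cochain K L (\<lambda>_. UNIV) (n - 1) v"
    "\<And>x. x \<in> simp K n \<Longrightarrow> u x = cob K n v x"
  shows "\<exists>w. rel_cochain K L R (n - 1) w \<and> (\<forall>x\<in>simp K n. u x = cob K n w x)"
  using assms(1)[unfolded comparable_def, THEN conjunct1, rule_format, OF conjI[OF assms(2) conjI[OF assms(3)]]]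
    assms(4) by simp

lemma comparable_surjective:
  assumes "comparable K L R" "rel_cochain K L (\<lambda>_. UNIV) n u"
    "\<And>x. x \<in> simp K (Suc n) \<Longrightarrow> cob K (Suc n) u x = 0"
  shows "\<exists>w v. rel_cochain K L R n w \<and> rel_cochain K L (\<lambda>_. UNIV) (n - 1) v \<and>
           (\<forall>x\<in>simp K n. u x = w x + cob K n v x)"
  using assms(1)[unfolded comparable_def, THEN conjunct2, rule_format, OF conjI[OF assms(2)]]
    assms(3) by simp

lemma rel_cochain_cob':
  assumes K: "is_sset K" and R: "function_system K R" and L: "subcomplex K L"
    and u: "rel_cochain K L R (n - 1) u"
  shows "rel_cochain K L R n (cob K n u)"
proof (cases n)
  case 0
  then show ?thesis using rel_cochain_zero[OF R, of L 0] by (simp add: cob_def[abs_def])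
next
  case (Suc m)
  then show ?thesis using rel_cochain_cob[OF K R L, of m u] u by simp
qed

lemma cob_cob':
  assumes K: "is_sset K" and x: "x \<in> simp K (Suc n)"
  shows "cob K (Suc n) (cob K n u) x = 0"
proof (cases n)
  case 0
  then show ?thesis by (simp add: cob_def)
next
  case (Suc m)
  then show ?thesis using cob_cob[OF K, of x m u] x by simp
qed

lemma cob_eqI:
  assumes "is_sset K" "x \<in> simp K (Suc n)" "\<And>y. y \<in> simp K n \<Longrightarrow> u y = v y"
  shows "cob K (Suc n) u x = cob K (Suc n) v x"
  by (rule cob_cong[OF assms(1,2)]) (simp add: assms(3))

definition at_end :: "nat \<Rightarrow> ('k \<times> nat \<Rightarrow> int) \<Rightarrow> 'k \<Rightarrow> int" where
  "at_end n u x = u (x, Suc n)"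

definition extend_end :: "nat \<Rightarrow> ('k \<Rightarrow> int) \<Rightarrow> 'k \<times> nat \<Rightarrow> int" where
  "extend_end n v z = (if snd z = Suc n then v (fst z) else 0)"

lemma at_end_extend_end: "at_end n (extend_end n v) = v"
  by (simp add: at_end_def extend_end_def fun_eq_iff)

lemma at_end_cob: "x \<in> simp K n \<Longrightarrow> at_end n (cob (cyl K) n u) x = cob K n (at_end (n - 1) u) x"
  by (cases n) (simp_all add: at_end_def cob_def)

lemma at_end_rel_cochain:
  assumes "rel_cochain (cyl K) (cyl_start K L) (end_regular R) n u" and L: "subcomplex K L"
  shows "rel_cochain K L R n (at_end n u)"
proof (rule rel_cochainI)
  show "(\<lambda>x. of_int (at_end n u x)) \<in> R n"
    using rel_cochain_regular[OF assms(1)] by (simp add: at_end_def end_regular_def)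
  show "at_end n u x = 0" if "x \<in> L n" for x
    using rel_cochain_sub[OF assms(1), of "(x, Suc n)"] that subcomplex_subset[OF L that]
    by (simp add: at_end_def cyl_start_def)
  show "at_end n u (degen K m i x) = 0" if "n = Suc m" "i \<le> m" "x \<in> simp K m" for m i x
    using rel_cochain_degen[of "cyl K" "cyl_start K L" "end_regular R" m u i "(x, Suc m)"] assms(1) that
    by (simp add: at_end_def)
qed

lemma slices_imp_end: "F \<in> slices_regular R n \<Longrightarrow> F \<in> end_regular R n"
  by (simp add: slices_regular_def end_regular_def)

lemma rel_cochain_mono:
  assumes "rel_cochain K L R n u" "\<And>F. F \<in> R n \<Longrightarrow> F \<in> R' n"
  shows "rel_cochain K L R' n u"
  using assms by (simp add: rel_cochain_def)

lemma extend_end_rel_cochain: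
  assumes R: "function_system K R" and v: "rel_cochain K L R n v"
  shows "rel_cochain (cyl K) (cyl_start K L) (slices_regular R) n (extend_end n v)"
proof (rule rel_cochainI)
  note alg = function_system_algebra[OF R]
  show "(\<lambda>z. of_int (extend_end n v z)) \<in> slices_regular R n"
    unfolding slices_regular_def
  proof (intro CollectI allI impI)
    fix j
    show "(\<lambda>x. of_int (extend_end n v (x, j))) \<in> R n"
      using rel_cochain_regular[OF v] rat_algebra_const[OF alg, of 0]
      by (cases "j = Suc n") (simp_all add: extend_end_def)
  qed
  show "extend_end n v z = 0" if "z \<in> cyl_start K L n" for z
    using that rel_cochain_sub[OF v] by (auto simp: extend_end_def cyl_start_def)
  fix m i z assume n: "n = Suc m" and i: "i \<le> m" and z: "z \<in> simp (cyl K) m"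
  obtain x j where x: "z = (x, j)" "x \<in> simp K m" "j \<le> Suc m" by (rule cyl_simpE[OF z])
  have "v (degen K m i x) = 0" using rel_cochain_degen[of K L R m v i x] v n i x(2) by simp
  then show "extend_end n v (degen (cyl K) m i z) = 0" by (simp add: extend_end_def x(1))
qed

text \<open>
  A cochain that vanishes at the near end is, by \<open>prism_homotopy\<close>, up to sign the sum of \<open>prism (\<delta> u)\<close>
  and \<open>\<delta> (prism u)\<close>.
\<close>

lemma start_contraction:
  assumes K: "is_sset K" and L: "subcomplex K L" and R: "function_system K R"
    and u: "rel_cochain (cyl K) (cyl_start K L) (slices_regular R) n u"
    and cocycle: "\<And>z. z \<in> simp (cyl K) (Suc n) \<Longrightarrow> cob (cyl K) (Suc n) u z = 0"
  shows "\<exists>P. rel_cochain (cyl K) (cyl_start K L) (slices_regular R) (n - 1) P \<and>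
     (\<forall>z\<in>simp (cyl K) n. u z = cob (cyl K) n P z)"
proof -
  let ?P = "\<lambda>z. - prism K (n - 1) u z"
  have eq: "u z = cob (cyl K) n ?P z" if z: "z \<in> simp (cyl K) n" for z
  proof -
    obtain x j where x: "z = (x, j)" "x \<in> simp K n" "j \<le> Suc n" by (rule cyl_simpE[OF z])
    have "cob (cyl K) (Suc n) u (degen K n i x, Suc i) = 0" if "i < j" for i
      using that x(2,3) sset_degen[OF K _ x(2), of i] by (intro cocycle) simp
    then have "prism K n (cob (cyl K) (Suc n) u) (x, j) = 0"
      by (auto simp: prism_def intro!: sum.neutral)
    moreover have "u (x, 0) = 0"
      using rel_cochain_sub[OF u, of "(x, 0)"] x(2) by (simp add: cyl_start_def)
    ultimately show ?thesis
      using prism_homotopy[OF K x(2,3), of u] by (simp add: x(1) cob_minus)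
  qed
  show ?thesis
  proof (cases n)
    case 0
    then show ?thesis
      using eq rel_cochain_zero[OF slices_regular_system[OF R], of "cyl_start K L" 0]
      by (intro exI[of _ "\<lambda>z. 0"]) (simp add: cob_def)
  next
    case (Suc m)
    have "rel_cochain (cyl K) (cyl_start K L) (slices_regular R) m (prism K m u)"
      by (rule prism_rel_cochain[OF K L R]) (use u Suc in simp)
    then show ?thesis
      using eq rel_cochain_minus[OF slices_regular_system[OF R]] Suc by (intro exI[of _ ?P]) simp
  qed
qed

lemma start_contraction_UNIV:
  assumes K: "is_sset K" and L: "subcomplex K L"
    and u: "rel_cochain (cyl K) (cyl_start K L) (\<lambda>_. UNIV) n u"
    and cocycle: "\<And>z. z \<in> simp (cyl K) (Suc n) \<Longrightarrow> cob (cyl K) (Suc n) u z = 0"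
  shows "\<exists>P. rel_cochain (cyl K) (cyl_start K L) (\<lambda>_. UNIV) (n - 1) P \<and>
     (\<forall>z\<in>simp (cyl K) n. u z = cob (cyl K) n P z)"
  using start_contraction[OF K L function_system_UNIV[of K], of n u] u cocycle
  by (simp add: slices_regular_UNIV)

lemma at_end_rel_cochain_UNIV:
  assumes "rel_cochain (cyl K) (cyl_start K L) (\<lambda>_. UNIV) n u" and L: "subcomplex K L"
  shows "rel_cochain K L (\<lambda>_. UNIV) n (at_end n u)"
  by (rule at_end_rel_cochain[OF _ L]) (rule rel_cochain_mono[OF assms(1)], simp add: end_regular_def)

lemma extend_end_rel_cochain_UNIV:
  assumes v: "rel_cochain K L (\<lambda>_. UNIV) n v"
  shows "rel_cochain (cyl K) (cyl_start K L) (\<lambda>_. UNIV) n (extend_end n v)"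
  using extend_end_rel_cochain[OF function_system_UNIV v] by (simp add: slices_regular_UNIV)

text \<open>
  A primitive of a cocycle regular at the end is supplied by the contraction; its restriction to
  the end is a primitive of a regular cocycle, hence regular up to a coboundary, which is removed
  by subtracting an extension of it.
\<close>

lemma cylinder_acyclic:
  assumes K: "is_sset K" and L: "subcomplex K L" and R: "function_system K R" and cmp: "comparable K L R"
  shows "acyclic_pair (cyl K) (cyl_start K L) (end_regular R)"
  unfolding acyclic_pair_def
proof (intro allI impI)
  note cK = cyl_sset[OF K] and cL = cyl_start_subcomplex[OF K L] and cR = end_regular_system[OF R]
  note U = function_system_UNIV
  fix n u
  assume A: "rel_cochain (cyl K) (cyl_start K L) (end_regular R) n u \<and>
    (\<forall>z\<in>simp (cyl K) (Suc n). cob (cyl K) (Suc n) u z = 0)"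
  then have u: "rel_cochain (cyl K) (cyl_start K L) (end_regular R) n u" by blast
  obtain P where P: "rel_cochain (cyl K) (cyl_start K L) (\<lambda>_. UNIV) (n - 1) P"
    "\<And>z. z \<in> simp (cyl K) n \<Longrightarrow> u z = cob (cyl K) n P z"
    using start_contraction_UNIV[OF K L rel_cochain_UNIV[OF u]] A by auto
  show "\<exists>v. rel_cochain (cyl K) (cyl_start K L) (end_regular R) (n - 1) v \<and>
     (\<forall>z\<in>simp (cyl K) n. u z = cob (cyl K) n v z)"
  proof (cases n)
    case 0
    then show ?thesis using P(2) rel_cochain_zero[OF cR, of "cyl_start K L" 0]
      by (intro exI[of _ "\<lambda>z. 0"]) (simp add: cob_def)
  next
    case (Suc m)
    have P': "rel_cochain (cyl K) (cyl_start K L) (\<lambda>_. UNIV) m P" using P(1) Suc by simp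
    let ?v = "at_end m P"
    have v: "rel_cochain K L (\<lambda>_. UNIV) m ?v" by (rule at_end_rel_cochain_UNIV[OF P' L])
    have ue: "at_end n u x = cob K n ?v x" if x: "x \<in> simp K n" for x
    proof -
      have "at_end n u x = at_end n (cob (cyl K) n P) x" using P(2)[of "(x, Suc n)"] x by (simp add: at_end_def)
      then show ?thesis using at_end_cob[OF x, of P] Suc by simp
    qed
    obtain w where w: "rel_cochain K L R m w" "\<forall>x\<in>simp K n. at_end n u x = cob K n w x"
      using comparable_injective[OF cmp at_end_rel_cochain[OF u L], of ?v] v ue Suc by auto
    have vw: "rel_cochain K L (\<lambda>_. UNIV) m (\<lambda>x. ?v x - w x)"
      by (rule rel_cochain_diff[OF U v rel_cochain_UNIV[OF w(1)]])
    have "cob K (Suc m) (\<lambda>x. ?v x - w x) x = 0" if "x \<in> simp K (Suc m)" for x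
      using ue[of x] w(2) that Suc by (simp add: cob_diff)
    then obtain w' y where w': "rel_cochain K L R m w'" "rel_cochain K L (\<lambda>_. UNIV) (m - 1) y"
      "\<forall>x\<in>simp K m. ?v x - w x = w' x + cob K m y x"
      using comparable_surjective[OF cmp vw] by auto
    let ?q = "cob (cyl K) m (extend_end (m - 1) y)"
    have q: "rel_cochain (cyl K) (cyl_start K L) (\<lambda>_. UNIV) m ?q"
      by (rule rel_cochain_cob'[OF cK U cL extend_end_rel_cochain_UNIV[OF w'(2)]])
    let ?P = "\<lambda>z. P z - ?q z"
    have Pq: "rel_cochain (cyl K) (cyl_start K L) (\<lambda>_. UNIV) m ?P" by (rule rel_cochain_diff[OF U P' q])
    have pe: "at_end m ?P x = w x + w' x" if x: "x \<in> simp K m" for x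
    proof -
      have "at_end m ?q x = cob K m y x" using at_end_cob[OF x] by (simp add: at_end_extend_end)
      then show ?thesis using bspec[OF w'(3) x] by (simp add: at_end_def)
    qed
    have ww: "(\<lambda>x. of_int (w x + w' x)) \<in> R m"
      by (rule rel_cochain_regular[OF rel_cochain_add[OF R w(1) w'(1)]])
    have "(\<lambda>x. of_int (at_end m ?P x)) \<in> R m"
      by (rule rat_algebra_cong[OF function_system_algebra[OF R] ww]) (simp only: pe)
    then have "(\<lambda>z. of_int (?P z)) \<in> end_regular R m"
      by (simp only: end_regular_def mem_Collect_eq at_end_def)
    then have "rel_cochain (cyl K) (cyl_start K L) (end_regular R) m ?P"
      using Pq unfolding rel_cochain_def by (elim conjE) (intro conjI)
    moreover have "u z = cob (cyl K) n ?P z" if z: "z \<in> simp (cyl K) n" for z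
    proof -
      have "cob (cyl K) n ?q z = 0" unfolding Suc by (rule cob_cob'[OF cK]) (use z Suc in simp)
      then show ?thesis using P(2)[OF z] by (simp add: cob_diff)
    qed
    ultimately show ?thesis using Suc by (intro exI[of _ ?P]) simp
  qed
qed

lemma ends_imp_start:
  assumes "rel_cochain (cyl K) (cyl_ends K L) R n u" shows "rel_cochain (cyl K) (cyl_start K L) R n u"
  using assms unfolding rel_cochain_def cyl_ends_def cyl_start_def by auto

lemma at_end_of_ends:
  assumes "rel_cochain (cyl K) (cyl_ends K L) R n u" "x \<in> simp K n" shows "at_end n u x = 0"
  using rel_cochain_sub[OF assms(1), of "(x, Suc n)"] assms(2) by (simp add: at_end_def cyl_ends_def)

lemma start_imp_ends:
  assumes "rel_cochain (cyl K) (cyl_start K L) R n u" "\<And>x. x \<in> simp K n \<Longrightarrow> at_end n u x = 0"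
  shows "rel_cochain (cyl K) (cyl_ends K L) R n u"
proof (rule rel_cochainI)
  show "u z = 0" if "z \<in> cyl_ends K L n" for z
    using that rel_cochain_sub[OF assms(1)] assms(2)
    by (cases z) (auto simp: cyl_ends_def cyl_start_def at_end_def)
qed (use rel_cochain_regular[OF assms(1)] rel_cochain_degen[of "cyl K" "cyl_start K L" R _ u] assms(1) in auto)

text \<open>
  Suspension: the pair of the cylinder and its two ends has the cohomology of the base shifted by
  one degree, the connecting map being restriction to the end of a primitive.
\<close>

lemma cylinder_comparable:
  assumes K: "is_sset K" and L: "subcomplex K L" and R: "function_system K R" and cmp: "comparable K L R"
  shows "comparable (cyl K) (cyl_ends K L) (slices_regular R)"
  unfolding comparable_def
proof (intro conjI allI impI)
  note cK = cyl_sset[OF K] and cS = cyl_start_subcomplex[OF K L] and cR = slices_regular_system[OF R]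
  note U = function_system_UNIV and alg = function_system_algebra[OF R]
  fix n u y
  assume A: "rel_cochain (cyl K) (cyl_ends K L) (slices_regular R) n u \<and>
    rel_cochain (cyl K) (cyl_ends K L) (\<lambda>_. UNIV) (n - 1) y \<and> (\<forall>z\<in>simp (cyl K) n. u z = cob (cyl K) n y z)"
  then have u: "rel_cochain (cyl K) (cyl_ends K L) (slices_regular R) n u"
    and y: "rel_cochain (cyl K) (cyl_ends K L) (\<lambda>_. UNIV) (n - 1) y"
    and uy: "\<And>z. z \<in> simp (cyl K) n \<Longrightarrow> u z = cob (cyl K) n y z" by blast+
  show "\<exists>w. rel_cochain (cyl K) (cyl_ends K L) (slices_regular R) (n - 1) w \<and>
      (\<forall>z\<in>simp (cyl K) n. u z = cob (cyl K) n w z)"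
  proof (cases n)
    case 0
    then show ?thesis using uy rel_cochain_zero[OF cR, of "cyl_ends K L" 0]
      by (intro exI[of _ "\<lambda>z. 0"]) (simp add: cob_def)
  next
    case (Suc m)
    have y': "rel_cochain (cyl K) (cyl_ends K L) (\<lambda>_. UNIV) m y" using y Suc by simp
    have "cob (cyl K) (Suc n) u z = 0" if z: "z \<in> simp (cyl K) (Suc n)" for z
      using cob_eqI[OF cK z uy] cob_cob'[OF cK z] by simp
    then obtain P where P: "rel_cochain (cyl K) (cyl_start K L) (slices_regular R) m P"
      "\<forall>z\<in>simp (cyl K) n. u z = cob (cyl K) n P z"
      using start_contraction[OF K L R ends_imp_start[OF u]] Suc by auto
    have Py: "rel_cochain (cyl K) (cyl_start K L) (\<lambda>_. UNIV) m (\<lambda>z. P z - y z)"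
      by (rule rel_cochain_diff[OF U rel_cochain_UNIV[OF P(1)] ends_imp_start[OF y']])
    have "cob (cyl K) (Suc m) (\<lambda>z. P z - y z) z = 0" if "z \<in> simp (cyl K) (Suc m)" for z
      using P(2) uy that Suc by (simp add: cob_diff)
    then obtain q where q: "rel_cochain (cyl K) (cyl_start K L) (\<lambda>_. UNIV) (m - 1) q"
      "\<forall>z\<in>simp (cyl K) m. P z - y z = cob (cyl K) m q z"
      using start_contraction_UNIV[OF K L Py] by auto
    have Pe: "at_end m P x = cob K m (at_end (m - 1) q) x" if x: "x \<in> simp K m" for x
    proof -
      have "at_end m P x = at_end m (cob (cyl K) m q) x"
        using bspec[OF q(2), of "(x, Suc m)"] at_end_of_ends[OF y' x] x by (simp add: at_end_def)
      then show ?thesis using at_end_cob[OF x] by simp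
    qed
    have Pr: "rel_cochain K L R m (at_end m P)"
      by (rule at_end_rel_cochain[OF rel_cochain_mono[OF P(1) slices_imp_end] L])
    obtain w where w: "rel_cochain K L R (m - 1) w" "\<forall>x\<in>simp K m. at_end m P x = cob K m w x"
      using comparable_injective[OF cmp Pr at_end_rel_cochain_UNIV[OF q(1) L] Pe] by auto
    let ?q = "cob (cyl K) m (extend_end (m - 1) w)"
    have qr: "rel_cochain (cyl K) (cyl_start K L) (slices_regular R) m ?q"
      by (rule rel_cochain_cob'[OF cK cR cS extend_end_rel_cochain[OF R w(1)]])
    have "rel_cochain (cyl K) (cyl_ends K L) (slices_regular R) m (\<lambda>z. P z - ?q z)"
    proof (rule start_imp_ends[OF rel_cochain_diff[OF cR P(1) qr]])
      fix x assume x: "x \<in> simp K m"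
      have "at_end m ?q x = cob K m w x" using at_end_cob[OF x] by (simp add: at_end_extend_end)
      then show "at_end m (\<lambda>z. P z - ?q z) x = 0" using bspec[OF w(2) x] by (simp add: at_end_def)
    qed
    moreover have "u z = cob (cyl K) n (\<lambda>z. P z - ?q z) z" if z: "z \<in> simp (cyl K) n" for z
    proof -
      have "cob (cyl K) n ?q z = 0" unfolding Suc by (rule cob_cob'[OF cK]) (use z Suc in simp)
      then show ?thesis using bspec[OF P(2) z] by (simp add: cob_diff)
    qed
    ultimately show ?thesis using Suc by (intro exI[of _ "\<lambda>z. P z - ?q z"]) simp
  qed
next
  note cK = cyl_sset[OF K] and cS = cyl_start_subcomplex[OF K L] and cR = slices_regular_system[OF R]
  note U = function_system_UNIV and alg = function_system_algebra[OF R]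
  fix n u
  assume A: "rel_cochain (cyl K) (cyl_ends K L) (\<lambda>_. UNIV) n u \<and>
    (\<forall>z\<in>simp (cyl K) (Suc n). cob (cyl K) (Suc n) u z = 0)"
  then have u: "rel_cochain (cyl K) (cyl_ends K L) (\<lambda>_. UNIV) n u" by blast
  obtain P where P: "rel_cochain (cyl K) (cyl_start K L) (\<lambda>_. UNIV) (n - 1) P"
    "\<forall>z\<in>simp (cyl K) n. u z = cob (cyl K) n P z"
    using start_contraction_UNIV[OF K L ends_imp_start[OF u]] A by auto
  show "\<exists>w v. rel_cochain (cyl K) (cyl_ends K L) (slices_regular R) n w \<and>
      rel_cochain (cyl K) (cyl_ends K L) (\<lambda>_. UNIV) (n - 1) v \<and>
      (\<forall>z\<in>simp (cyl K) n. u z = w z + cob (cyl K) n v z)"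
  proof (cases n)
    case 0
    then show ?thesis using P(2) rel_cochain_zero[OF cR, of "cyl_ends K L" 0] rel_cochain_zero[OF U, of "cyl K" "cyl_ends K L" 0]
      by (intro exI[of _ "\<lambda>z. 0"]) (simp add: cob_def)
  next
    case (Suc m)
    have P': "rel_cochain (cyl K) (cyl_start K L) (\<lambda>_. UNIV) m P" using P(1) Suc by simp
    let ?v = "at_end m P"
    have v: "rel_cochain K L (\<lambda>_. UNIV) m ?v" by (rule at_end_rel_cochain_UNIV[OF P' L])
    have "cob K (Suc m) ?v x = 0" if x: "x \<in> simp K (Suc m)" for x
    proof -
      have "at_end n (cob (cyl K) n P) x = 0"
        using bspec[OF P(2), of "(x, Suc n)"] at_end_of_ends[OF u, of x] x Suc by (simp add: at_end_def)
      then show ?thesis using at_end_cob[of x K n P] x Suc by simp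
    qed
    then obtain w y where w: "rel_cochain K L R m w" and y: "rel_cochain K L (\<lambda>_. UNIV) (m - 1) y"
      and wy: "\<forall>x\<in>simp K m. ?v x = w x + cob K m y x"
      using comparable_surjective[OF cmp v] by auto
    let ?e = "extend_end m w" and ?q = "cob (cyl K) m (extend_end (m - 1) y)"
    let ?w = "cob (cyl K) n ?e" and ?v2 = "\<lambda>z. P z - ?e z - ?q z"
    have er: "rel_cochain (cyl K) (cyl_start K L) (slices_regular R) m ?e" by (rule extend_end_rel_cochain[OF R w])
    have cw: "cob K n w x = 0" if x: "x \<in> simp K n" for x
    proof -
      have x': "x \<in> simp K (Suc m)" using x Suc by simp
      have "cob K (Suc m) ?v x = cob K (Suc m) (\<lambda>x. w x + cob K m y x) x"
        by (rule cob_eqI[OF K x']) (use wy in blast)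
      then show ?thesis
        using \<open>\<And>x. x \<in> simp K (Suc m) \<Longrightarrow> cob K (Suc m) ?v x = 0\<close>[OF x'] cob_cob'[OF K x', of y] Suc
        by (simp add: cob_add)
    qed
    have "rel_cochain (cyl K) (cyl_start K L) (slices_regular R) n ?w"
      unfolding Suc by (rule rel_cochain_cob[OF cK cR cS er])
    then have w_rel: "rel_cochain (cyl K) (cyl_ends K L) (slices_regular R) n ?w"
      by (rule start_imp_ends) (use cw Suc in \<open>simp add: at_end_cob at_end_extend_end\<close>)
    have q: "rel_cochain (cyl K) (cyl_start K L) (\<lambda>_. UNIV) m ?q"
      by (rule rel_cochain_cob'[OF cK U cS extend_end_rel_cochain_UNIV[OF y]])
    have v2: "rel_cochain (cyl K) (cyl_ends K L) (\<lambda>_. UNIV) m ?v2"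
    proof (rule start_imp_ends[OF rel_cochain_diff[OF U rel_cochain_diff[OF U P' rel_cochain_UNIV[OF er]] q]])
      fix x assume x: "x \<in> simp K m"
      have "at_end m ?q x = cob K m y x" using at_end_cob[OF x] by (simp add: at_end_extend_end)
      moreover have "at_end m ?e x = w x" by (simp add: at_end_extend_end)
      ultimately show "at_end m ?v2 x = 0" using bspec[OF wy x] by (simp add: at_end_def)
    qed
    have "u z = ?w z + cob (cyl K) n ?v2 z" if z: "z \<in> simp (cyl K) n" for z
    proof -
      have "cob (cyl K) n ?q z = 0" unfolding Suc by (rule cob_cob'[OF cK]) (use z Suc in simp)
      then show ?thesis using bspec[OF P(2) z] by (simp add: cob_diff)
    qed
    then show ?thesis using w_rel v2 Suc by (intro exI[of _ ?w] exI[of _ ?v2]) simp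
  qed
qed

section \<open>Numerical spaces\<close>

text \<open>
  By this lemma the polynomial functions on the terms of a simplicial object are stable under its
  simplicial operators, which are numerical.
\<close>

lemma polyfuns_pullback:
  assumes F: "F \<in> polyfuns A" and R: "rat_algebra S R" and u: "regular S R A u"
  shows "(\<lambda>z. F (u z)) \<in> R"
  using F
proof induction
  case (const c) show ?case by (rule rat_algebra_const[OF R])
next
  case (linear l) then show ?case by (rule regular_functional[OF u])
next
  case (add F G) then show ?case using rat_algebra_add[OF R] by blast
next
  case (mult F G) then show ?case using rat_algebra_mult[OF R] by blast
next
  case (cong F G)
  show ?case by (rule rat_algebra_cong[OF R cong.IH]) (simp add: cong.hyps regularD[OF u])
qed

abbreviation numfuns :: "'a snum \<Rightarrow> nat \<Rightarrow> ('a \<Rightarrow> rat) set" where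
  "numfuns X n \<equiv> polyfuns (obj X n)"

lemma numfuns_system:
  assumes X: "is_snum X" shows "function_system (forget X) (numfuns X)"
  unfolding function_system_def forget_simps
proof (intro conjI allI impI ballI)
  show "rat_algebra (carrier (obj X n)) (numfuns X n)" for n by (rule rat_algebra_polyfuns)
  show "(\<lambda>x. F (nface X (Suc n) i x)) \<in> numfuns X (Suc n)" if "i \<le> Suc n" "F \<in> numfuns X n" for n i F
    by (rule polyfuns_pullback[OF that(2) rat_algebra_polyfuns
          numerical_regularD[OF snum_face_numerical[OF X that(1)] snum_group[OF X]]])
  show "(\<lambda>x. F (ndegen X n i x)) \<in> numfuns X n" if "i \<le> n" "F \<in> numfuns X (Suc n)" for n i F
    by (rule polyfuns_pullback[OF that(2) rat_algebra_polyfuns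
          numerical_regularD[OF snum_degen_numerical[OF X that(1)] snum_group[OF X]]])
qed

lemma numerical_integer_iff:
  assumes "fg_free_abelian A"
  shows "numerical A integer_group u \<longleftrightarrow> (\<lambda>x. of_int (u x)) \<in> polyfuns A"
proof
  assume "numerical A integer_group u"
  from numerical_regularD[OF this] show "(\<lambda>x. of_int (u x)) \<in> polyfuns A"
    by (simp add: regular_integer[OF rat_algebra_polyfuns])
next
  assume "(\<lambda>x. of_int (u x)) \<in> polyfuns A"
  then show "numerical A integer_group u"
    by (intro regular_numerical[OF assms fg_free_integer_group]) (simp add: regular_integer[OF rat_algebra_polyfuns])
qed

text \<open>
  Both cochain groups of a numerical space consist of normalised cochains without condition on a
  subcomplex; only the predicate differs, and only its stability under the group operations and
  under the coboundary matters for the translation of the comparison isomorphism.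
\<close>

lemma norm_cochains_mem:
  "c \<in> carrier (norm_cochains K P n) \<longleftrightarrow> c \<in> simp K n \<rightarrow>\<^sub>E UNIV \<and> P n c \<and>
     (\<forall>m i. n = Suc m \<and> i \<le> m \<longrightarrow> (\<forall>x\<in>simp K m. c (degen K m i x) = 0))"
  by (simp add: norm_cochains_def)

lemma norm_cochains_mult: "a \<otimes>\<^bsub>norm_cochains K P n\<^esub> b = (\<lambda>x\<in>simp K n. a x + b x)"
  by (simp add: norm_cochains_def)

lemma norm_cochains_one: "\<one>\<^bsub>norm_cochains K P n\<^esub> = (\<lambda>x\<in>simp K n. 0)"
  by (simp add: norm_cochains_def)

lemma sset_coboundary_cob: "sset_coboundary K n c = restrict (cob K (Suc n) c) (simp K (Suc n))"
  by (simp add: sset_coboundary_def cob_Suc fun_eq_iff restrict_def)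

locale num_space =
  fixes X :: "'a snum"
  assumes num: "numerical_space X"
begin

lemma snX: "is_snum X" using num by (simp add: numerical_space_def)

abbreviation K where "K \<equiv> forget X"
abbreviation Em where "Em \<equiv> \<lambda>_::nat. {} :: 'a set"

lemma KS: "is_sset K" by (rule snum_sset[OF snX])

definition cochain :: "bool \<Rightarrow> nat \<Rightarrow> ('a \<Rightarrow> int) set" where
  "cochain b n = (if b then carrier (num_cochains X n) else carrier (set_cochains K n))"

definition system :: "bool \<Rightarrow> nat \<Rightarrow> ('a \<Rightarrow> rat) set" where
  "system b = (if b then numfuns X else (\<lambda>_. UNIV))"

lemma system: "function_system K (system b)"
  using numfuns_system[OF snX] function_system_UNIV[of K] by (simp add: system_def)

lemma cochain_rel: "c \<in> cochain b n \<longleftrightarrow> c \<in> extensional (simp K n) \<and> rel_cochain K Em (system b) n c"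
  using numerical_integer_iff[OF snum_free[OF snX], of n c]
  by (auto simp: cochain_def num_cochains_def set_cochains_def norm_cochains_mem rel_cochain_def system_def PiE_def)

lemma restrict_cochain:
  assumes "rel_cochain K Em (system b) n c"
  shows "restrict c (simp K n) \<in> cochain b n"
proof -
  have "rel_cochain K Em (system b) n (restrict c (simp K n))"
    by (rule rel_cochain_cong[OF KS system subcomplex_empty assms]) simp
  then show ?thesis by (simp add: cochain_rel)
qed

lemma cob_restrict: "x \<in> simp K (Suc n) \<Longrightarrow> cob K (Suc n) (restrict c (simp K n)) x = cob K (Suc n) c x"
  by (rule cob_eqI[OF KS]) simp_all

text \<open>
  The cohomology groups are quotients of groups of extensional functions.  Their elements are
  translated into statements on cochains whose values outside the simplices do not matter.
\<close>

definition bounds :: "bool \<Rightarrow> nat \<Rightarrow> ('a \<Rightarrow> int) set" where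
  "bounds b n = coboundaries (if b then num_cochains X else set_cochains K) (sset_coboundary K) n"

definition cocycles :: "bool \<Rightarrow> nat \<Rightarrow> ('a \<Rightarrow> int) set" where
  "cocycles b n = {c \<in> cochain b n. \<forall>x\<in>simp K (Suc n). cob K (Suc n) c x = 0}"

definition plus :: "nat \<Rightarrow> ('a \<Rightarrow> int) \<Rightarrow> ('a \<Rightarrow> int) \<Rightarrow> 'a \<Rightarrow> int" where
  "plus n a c = (\<lambda>x\<in>simp K n. a x + c x)"

lemma bounds_mem: "c \<in> bounds b n \<longleftrightarrow> c \<in> extensional (simp K n) \<and>
    (\<exists>v. rel_cochain K Em (system b) (n - 1) v \<and> (\<forall>x\<in>simp K n. c x = cob K n v x))"
proof (cases n)
  case 0
  have "rel_cochain K Em (system b) 0 (\<lambda>_. 0)" by (rule rel_cochain_zero[OF system])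
  moreover have "c = (\<lambda>x\<in>simp K 0. 0) \<longleftrightarrow> c \<in> extensional (simp K 0) \<and> (\<forall>x\<in>simp K 0. c x = 0)"
    by (auto simp: fun_eq_iff extensional_def restrict_def)
  ultimately show ?thesis
    unfolding 0 bounds_def coboundaries_def num_cochains_def set_cochains_def
    by (auto simp: norm_cochains_one cob_def)
next
  case (Suc m)
  have b: "bounds b n = sset_coboundary K m ` cochain b m"
    by (simp add: Suc bounds_def coboundaries_def cochain_def)
  show ?thesis
  proof
    assume "c \<in> bounds b n"
    then obtain v where v: "v \<in> cochain b m" "c = restrict (cob K (Suc m) v) (simp K (Suc m))"
      unfolding b sset_coboundary_cob by blast
    then show "c \<in> extensional (simp K n) \<and> (\<exists>v. rel_cochain K Em (system b) (n - 1) v \<and> (\<forall>x\<in>simp K n. c x = cob K n v x))"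
      using Suc by (intro conjI exI[of _ v]) (simp_all add: cochain_rel)
  next
    assume "c \<in> extensional (simp K n) \<and> (\<exists>v. rel_cochain K Em (system b) (n - 1) v \<and> (\<forall>x\<in>simp K n. c x = cob K n v x))"
    then obtain v where c: "c \<in> extensional (simp K n)" and v: "rel_cochain K Em (system b) m v"
      and cv: "\<forall>x\<in>simp K n. c x = cob K n v x" using Suc by auto
    have "c = sset_coboundary K m (restrict v (simp K m))"
      unfolding sset_coboundary_cob
    proof
      fix x show "c x = restrict (cob K (Suc m) (restrict v (simp K m))) (simp K (Suc m)) x"
        using c cv Suc cob_restrict[of x m v] extensional_arb[OF c, of x] by (cases "x \<in> simp K n") simp_all
    qed
    then show "c \<in> bounds b n" unfolding b using restrict_cochain[OF v] by blast
  qed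
qed

lemma bounds_zero: "(\<lambda>x\<in>simp K n. 0) \<in> bounds b n"
  unfolding bounds_mem
  using rel_cochain_zero[OF system] by (intro conjI exI[of _ "\<lambda>_. 0"]) (simp_all add: cob_zero)

lemma bounds_plus: "a \<in> bounds b n \<Longrightarrow> c \<in> bounds b n \<Longrightarrow> plus n a c \<in> bounds b n"
proof -
  assume "a \<in> bounds b n" "c \<in> bounds b n"
  then obtain v w where "rel_cochain K Em (system b) (n - 1) v" "\<forall>x\<in>simp K n. a x = cob K n v x"
    "rel_cochain K Em (system b) (n - 1) w" "\<forall>x\<in>simp K n. c x = cob K n w x"
    unfolding bounds_mem by blast
  then show ?thesis
    unfolding bounds_mem
    by (intro conjI exI[of _ "\<lambda>x. v x + w x"]) (simp_all add: plus_def cob_add rel_cochain_add[OF system])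
qed

lemma bounds_minus: "a \<in> bounds b n \<Longrightarrow> (\<lambda>x\<in>simp K n. - a x) \<in> bounds b n"
proof -
  assume "a \<in> bounds b n"
  then obtain v where "rel_cochain K Em (system b) (n - 1) v" "\<forall>x\<in>simp K n. a x = cob K n v x"
    unfolding bounds_mem by blast
  then show ?thesis
    unfolding bounds_mem
    by (intro conjI exI[of _ "\<lambda>x. - v x"]) (simp_all add: cob_minus rel_cochain_minus[OF system])
qed

lemma bounds_mono: "a \<in> bounds True n \<Longrightarrow> a \<in> bounds False n"
proof -
  assume "a \<in> bounds True n"
  then obtain v where "a \<in> extensional (simp K n)" "rel_cochain K Em (system True) (n - 1) v"
    "\<forall>x\<in>simp K n. a x = cob K n v x"
    unfolding bounds_mem by blast
  then show ?thesis
    unfolding bounds_mem by (intro conjI exI[of _ v]) (simp_all add: system_def rel_cochain_UNIV)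
qed

lemma extensional_zero_plus: "a \<in> extensional (simp K n) \<Longrightarrow> plus n (\<lambda>x\<in>simp K n. 0) a = a"
  by (auto simp: plus_def fun_eq_iff extensional_def)

definition coset :: "bool \<Rightarrow> nat \<Rightarrow> ('a \<Rightarrow> int) \<Rightarrow> ('a \<Rightarrow> int) set" where
  "coset b n c = (\<lambda>a. plus n a c) ` bounds b n"

lemma kernel_cocycles:
  "kernel (if b then num_cochains X n else set_cochains K n) (if b then num_cochains X (Suc n) else set_cochains K (Suc n))
     (sset_coboundary K n) = cocycles b n"
  by (auto simp: kernel_def cocycles_def cochain_def num_cochains_def set_cochains_def norm_cochains_one
      sset_coboundary_cob fun_eq_iff restrict_def)

lemma cohomology_carrier:
  "carrier (if b then num_cohomology X n else sset_cohomology K n) = coset b n ` cocycles b n"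
proof -
  have "carrier (if b then num_cohomology X n else sset_cohomology K n) =
      (\<Union>c\<in>cocycles b n. {r_coset (norm_cochains K (if b then (\<lambda>n. numerical (obj X n) integer_group) else (\<lambda>_ _. True)) n) (bounds b n) c})"
    using kernel_cocycles[of b n]
    by (auto simp: num_cohomology_def sset_cohomology_def cochain_cohomology_def FactGroup_def RCOSETS_def
        bounds_def num_cochains_def set_cochains_def r_coset_def)
  then show ?thesis
    by (auto simp: r_coset_def norm_cochains_mult coset_def plus_def)
qed

lemma comparison_coset:
  "cohomology_comparison X n (coset True n c) = {plus n a (plus n a' c) | a a'. a \<in> bounds False n \<and> a' \<in> bounds True n}"
  unfolding cohomology_comparison_def set_mult_def coset_def
  by (auto simp: set_cochains_def norm_cochains_mult plus_def bounds_def)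

lemma comparison_iso: "cohomology_comparison X n \<in> iso (num_cohomology X n) (sset_cohomology K n)"
  using num by (simp add: numerical_space_def)

lemma zero_cocycle: "(\<lambda>x\<in>simp K n. 0) \<in> cocycles b n"
proof -
  have "(\<lambda>x\<in>simp K n. 0) \<in> cochain b n" by (rule restrict_cochain[OF rel_cochain_zero[OF system]])
  then show ?thesis by (simp add: cocycles_def cob_restrict cob_zero del: forget_simps)
qed

text \<open>
  If \<open>u\<close> is a coboundary, then the comparison map sends its class and the class of 0 to the same
  coset, namely the group of all coboundaries.
\<close>

lemma absolute_injective:
  assumes u: "rel_cochain K Em (numfuns X) n u" and v: "rel_cochain K Em (\<lambda>_. UNIV) (n - 1) v"
    and uv: "\<And>x. x \<in> simp K n \<Longrightarrow> u x = cob K n v x"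
  shows "\<exists>w. rel_cochain K Em (numfuns X) (n - 1) w \<and> (\<forall>x\<in>simp K n. u x = cob K n w x)"
proof -
  let ?u = "restrict u (simp K n)" and ?z = "\<lambda>x\<in>simp K n. 0"
  have ut: "?u \<in> cochain True n" by (rule restrict_cochain) (simp add: system_def u)
  have "cob K (Suc n) ?u x = 0" if x: "x \<in> simp K (Suc n)" for x
    using cob_restrict[OF x, of u] cob_eqI[OF KS x uv] cob_cob'[OF KS x] by simp
  then have uc: "?u \<in> cocycles True n" using ut by (simp add: cocycles_def)
  have ub: "?u \<in> bounds False n"
    unfolding bounds_mem using v uv by (intro conjI exI[of _ v]) (simp_all add: system_def)
  have all: "cohomology_comparison X n (coset True n c) = bounds False n" if c: "c \<in> bounds False n" for c
  proof
    show "cohomology_comparison X n (coset True n c) \<subseteq> bounds False n"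
      unfolding comparison_coset using bounds_plus bounds_mono c by blast
    show "bounds False n \<subseteq> cohomology_comparison X n (coset True n c)"
    proof
      fix y assume y: "y \<in> bounds False n"
      have ext: "y \<in> extensional (simp K n)" "c \<in> extensional (simp K n)" using y c by (simp_all add: bounds_mem)
      have "plus n y (\<lambda>x\<in>simp K n. - c x) \<in> bounds False n" by (rule bounds_plus[OF y bounds_minus[OF c]])
      moreover have "y = plus n (plus n y (\<lambda>x\<in>simp K n. - c x)) (plus n ?z c)"
        using ext by (auto simp: plus_def fun_eq_iff extensional_def)
      ultimately show "y \<in> cohomology_comparison X n (coset True n c)"
        unfolding comparison_coset using bounds_zero[of n True] by blast
    qed
  qed
  have "inj_on (cohomology_comparison X n) (coset True n ` cocycles True n)"
    using comparison_iso[of n] cohomology_carrier[of True n] by (simp add: iso_def bij_betw_def)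
  then have "coset True n ?u = coset True n ?z"
    by (rule inj_onD) (simp_all only: all[OF ub] all[OF bounds_zero], intro imageI uc, intro imageI zero_cocycle)
  moreover have "?u \<in> coset True n ?u"
    unfolding coset_def using extensional_zero_plus[of ?u n] bounds_zero[of n True] by (intro image_eqI[of _ _ ?z]) simp_all
  ultimately obtain a where "a \<in> bounds True n" "?u = plus n a ?z" unfolding coset_def by blast
  moreover from this(1) have "plus n a ?z = a" by (auto simp: bounds_mem plus_def fun_eq_iff extensional_def)
  ultimately have "?u \<in> bounds True n" by simp
  then obtain w where "rel_cochain K Em (numfuns X) (n - 1) w" "\<forall>x\<in>simp K n. ?u x = cob K n w x"
    unfolding bounds_mem system_def by auto
  then show ?thesis by (intro exI[of _ w]) simp
qed

text \<open>
  A numerical cocycle whose class is sent to the class of \<open>u\<close> lies in that class, as the group of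
  coboundaries contains 0.
\<close>

lemma absolute_surjective:
  assumes u: "rel_cochain K Em (\<lambda>_. UNIV) n u" and cocycle: "\<And>x. x \<in> simp K (Suc n) \<Longrightarrow> cob K (Suc n) u x = 0"
  shows "\<exists>w v. rel_cochain K Em (numfuns X) n w \<and> rel_cochain K Em (\<lambda>_. UNIV) (n - 1) v \<and>
     (\<forall>x\<in>simp K n. u x = w x + cob K n v x)"
proof -
  let ?u = "restrict u (simp K n)" and ?z = "\<lambda>x\<in>simp K n. 0"
  have "?u \<in> cochain False n" by (rule restrict_cochain) (simp add: system_def u)
  then have uc: "?u \<in> cocycles False n" by (simp add: cocycles_def cob_restrict cocycle del: forget_simps)
  have "cohomology_comparison X n ` (coset True n ` cocycles True n) = coset False n ` cocycles False n"
    using comparison_iso[of n] cohomology_carrier[of True n] cohomology_carrier[of False n]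
    by (simp add: iso_def bij_betw_def)
  then have "coset False n ?u \<in> cohomology_comparison X n ` (coset True n ` cocycles True n)" using uc by blast
  then obtain w where w: "w \<in> cocycles True n" "cohomology_comparison X n (coset True n w) = coset False n ?u" by auto
  have we: "w \<in> extensional (simp K n)" and wr: "rel_cochain K Em (numfuns X) n w"
    using w(1) by (simp_all add: cocycles_def cochain_rel system_def)
  have "w = plus n ?z (plus n ?z w)" by (simp only: extensional_zero_plus[OF we])
  then have "w \<in> coset False n ?u"
    unfolding w(2)[symmetric] comparison_coset using bounds_zero by blast
  then obtain a where a: "a \<in> bounds False n" "w = plus n a ?u" unfolding coset_def by blast
  then obtain v where v: "rel_cochain K Em (\<lambda>_. UNIV) (n - 1) v" "\<forall>x\<in>simp K n. a x = cob K n v x"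
    unfolding bounds_mem system_def by auto
  have "u x = w x + cob K n (\<lambda>x. - v x) x" if "x \<in> simp K n" for x
    using a(2) v(2) that by (simp add: plus_def cob_minus)
  then show ?thesis
    using wr rel_cochain_minus[OF function_system_UNIV v(1)] by (intro exI[of _ w] exI[of _ "\<lambda>x. - v x"]) simp
qed

end

subsection \<open>Cochains vanishing at the base point\<close>

lemma base_point_subcomplex: "base_point K b \<Longrightarrow> subcomplex K (\<lambda>n. {b n})"
  by (simp add: base_point_def subcomplex_def)

lemma base_point_mem: "base_point K b \<Longrightarrow> b n \<in> simp K n"
  by (simp add: base_point_def)

lemma base_point_degen: "base_point K b \<Longrightarrow> b (Suc n) = degen K n 0 (b n)"
  by (simp add: base_point_def)

lemma rel_cochain_base_positive:
  assumes "base_point K b" "rel_cochain K (\<lambda>_. {}) R (Suc n) u"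
  shows "rel_cochain K (\<lambda>n. {b n}) R (Suc n) u"
proof (rule rel_cochainI)
  show "u z = 0" if "z \<in> {b (Suc n)}" for z
    using that rel_cochain_degen[OF assms(2), of 0 "b n"] base_point_mem[OF assms(1)] base_point_degen[OF assms(1)] by simp
qed (use rel_cochain_regular[OF assms(2)] rel_cochain_degen[of K "\<lambda>_. {}" R _ u] assms(2) in auto)

lemma rel_cochain_empty: "rel_cochain K L R n u \<Longrightarrow> rel_cochain K (\<lambda>_. {}) R n u"
  by (simp add: rel_cochain_def)

text \<open>
  Normalised cochains of positive degree vanish at the base point, which is degenerate; in degree 0
  one subtracts a constant, which does not change the coboundary.
\<close>

lemma rel_cochain_base_adjust:
  assumes K: "is_sset K" and R: "function_system K R" and b: "base_point K b"
    and u: "rel_cochain K (\<lambda>_. {}) R (n - 1) u"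
  shows "\<exists>v. rel_cochain K (\<lambda>n. {b n}) R (n - 1) v \<and> (\<forall>x\<in>simp K n. cob K n v x = cob K n u x)"
proof (cases "n - 1")
  case (Suc m)
  then show ?thesis using rel_cochain_base_positive[OF b, of R m u] u by auto
next
  case 0
  let ?v = "\<lambda>x. u x - u (b 0)"
  note alg = function_system_algebra[OF R]
  have "rel_cochain K (\<lambda>n. {b n}) R 0 ?v"
  proof (rule rel_cochainI)
    have "(\<lambda>x. of_int (u x) - of_int (u (b 0))) \<in> R 0"
      using rel_cochain_regular[OF u] 0 by (intro rat_algebra_diff[OF alg] rat_algebra_const[OF alg]) simp
    then show "(\<lambda>x. of_int (?v x)) \<in> R 0" by simp
  qed simp_all
  moreover have "cob K n ?v x = cob K n u x" for x
  proof (cases n)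
    case (Suc k)
    then have "k = 0" using 0 by simp
    then show ?thesis using Suc by (simp add: cob_def)
  qed (simp add: cob_def)
  ultimately show ?thesis using 0 by (intro exI[of _ ?v]) simp
qed

lemma numerical_space_comparable:
  assumes X: "numerical_space X" and b: "base_point (forget X) b"
  shows "comparable (forget X) (\<lambda>n. {b n}) (numfuns X)"
  unfolding comparable_def
proof (intro conjI allI impI)
  interpret num_space X by unfold_locales (rule X)
  note R = numfuns_system[OF snX]
  {
    fix n u v
    assume A: "rel_cochain K (\<lambda>n. {b n}) (numfuns X) n u \<and> rel_cochain K (\<lambda>n. {b n}) (\<lambda>_. UNIV) (n - 1) v \<and>
      (\<forall>x\<in>simp K n. u x = cob K n v x)"
    obtain w where w: "rel_cochain K Em (numfuns X) (n - 1) w" "\<forall>x\<in>simp K n. u x = cob K n w x"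
      using absolute_injective[of n u v] A rel_cochain_empty[of K "\<lambda>n. {b n}"] by blast
    obtain w' where "rel_cochain K (\<lambda>n. {b n}) (numfuns X) (n - 1) w'" "\<forall>x\<in>simp K n. cob K n w' x = cob K n w x"
      using rel_cochain_base_adjust[OF KS R b w(1)] by blast
    then show "\<exists>w. rel_cochain K (\<lambda>n. {b n}) (numfuns X) (n - 1) w \<and> (\<forall>x\<in>simp K n. u x = cob K n w x)"
      using w(2) by (intro exI[of _ w']) simp
  next
    fix n u
    assume A: "rel_cochain K (\<lambda>n. {b n}) (\<lambda>_. UNIV) n u \<and> (\<forall>x\<in>simp K (Suc n). cob K (Suc n) u x = 0)"
    then have ur: "rel_cochain K (\<lambda>n. {b n}) (\<lambda>_. UNIV) n u" by blast
    obtain w v where w: "rel_cochain K Em (numfuns X) n w" and v: "rel_cochain K Em (\<lambda>_. UNIV) (n - 1) v"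
      and uw: "\<forall>x\<in>simp K n. u x = w x + cob K n v x"
      using absolute_surjective[OF rel_cochain_empty[OF ur]] A by blast
    obtain v' where v': "rel_cochain K (\<lambda>n. {b n}) (\<lambda>_. UNIV) (n - 1) v'" "\<forall>x\<in>simp K n. cob K n v' x = cob K n v x"
      using rel_cochain_base_adjust[OF KS function_system_UNIV b v] by blast
    have "rel_cochain K (\<lambda>n. {b n}) (numfuns X) n w"
    proof (cases n)
      case 0
      have "w (b 0) = 0"
        using bspec[OF uw, of "b n"] rel_cochain_sub[OF ur, of "b n"] base_point_mem[OF b, of n] 0
        by (simp add: cob_def)
      then show ?thesis using w 0 unfolding rel_cochain_def by simp
    next
      case (Suc m)
      then show ?thesis using rel_cochain_base_positive[OF b, of "numfuns X" m w] w by simp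
    qed
    then show "\<exists>w v. rel_cochain K (\<lambda>n. {b n}) (numfuns X) n w \<and> rel_cochain K (\<lambda>n. {b n}) (\<lambda>_. UNIV) (n - 1) v \<and>
        (\<forall>x\<in>simp K n. u x = w x + cob K n v x)"
      using v' uw by (intro exI[of _ w] exI[of _ v']) simp
  }
qed

section \<open>Homotopies as maps from a cylinder\<close>

text \<open>
  The face \<open>\<partial>\<^sub>j h\<^sub>j\<close> is the simplex of the cylinder over the simplex of the interval with \<open>j\<close> vertices
  at the initial vertex.  It equals \<open>\<partial>\<^sub>j h\<^sub>j\<^sub>-\<^sub>1\<close>, which accounts for the case distinctions.
\<close>

lemma cylinder_of_homotopy:
  assumes K: "is_sset K" and L: "is_sset L" and f: "smap K L f" and g: "smap K L g"
    and h: "simplicial_homotopy K L f g h"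
  defines "H \<equiv> \<lambda>n (x, j). if j \<le> n then face L (Suc n) j (h n j x) else g n x"
  shows "smap (cyl K) L H" and "\<And>n x. x \<in> simp K n \<Longrightarrow> H n (x, 0) = f n x"
    and "\<And>n x. x \<in> simp K n \<Longrightarrow> H n (x, Suc n) = g n x"
proof -
  have hc: "h q i x \<in> simp L (Suc q)" if "i \<le> q" "x \<in> simp K q" for q i x
    using h that by (auto simp: simplicial_homotopy_def)
  have h0: "face L (Suc q) 0 (h q 0 x) = f q x" and h1: "face L (Suc q) (Suc q) (h q q x) = g q x"
    if "x \<in> simp K q" for q x
    using h that by (simp_all add: simplicial_homotopy_def)
  have hlt: "face L (Suc q) i (h q j x) = h (q - 1) (j - 1) (face K q i x)"
    if "x \<in> simp K q" "i < j" "j \<le> q" for q i j x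
    using h that by (simp add: simplicial_homotopy_def)
  have heq: "face L (Suc q) (Suc j) (h q (Suc j) x) = face L (Suc q) (Suc j) (h q j x)"
    if "x \<in> simp K q" "j < q" for q j x
    using h that by (simp add: simplicial_homotopy_def)
  have hgt: "face L (Suc q) i (h q j x) = h (q - 1) j (face K q (i - 1) x)"
    if "x \<in> simp K q" "Suc j < i" "i \<le> Suc q" for q i j x
    using h that by (simp add: simplicial_homotopy_def)
  have sle: "degen L (Suc q) i (h q j x) = h (Suc q) (Suc j) (degen K q i x)"
    if "x \<in> simp K q" "i \<le> j" "j \<le> q" for q i j x
    using h that by (simp add: simplicial_homotopy_def)
  have sgt: "degen L (Suc q) i (h q j x) = h (Suc q) j (degen K q (i - 1) x)"
    if "x \<in> simp K q" "j < i" "i \<le> Suc q" for q i j x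
    using h that by (simp add: simplicial_homotopy_def)
  have Hle: "H n (x, j) = face L (Suc n) j (h n j x)" if "j \<le> n" for n x j using that by (simp add: H_def)
  have Hend: "H n (x, Suc n) = g n x" for n x by (simp add: H_def)
  show "H n (x, Suc n) = g n x" if "x \<in> simp K n" for n x by (rule Hend)
  show "H n (x, 0) = f n x" if "x \<in> simp K n" for n x using h0[OF that] by (simp add: Hle)
  show "smap (cyl K) L H"
    unfolding smap_def
  proof (intro conjI allI impI ballI funcsetI)
    fix n z assume "z \<in> simp (cyl K) n"
    then obtain x j where z: "z = (x, j)" "x \<in> simp K n" "j \<le> Suc n" by (rule cyl_simpE)
    show "H n z \<in> simp L n"
    proof (cases "j \<le> n")
      case True
      then show ?thesis using sset_face[OF L _ hc[OF True z(2)], of j] by (simp add: z(1) Hle)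
    next
      case False
      then show ?thesis using smap_closed[OF g z(2)] by (simp add: z(1) H_def)
    qed
  next
    fix q i z assume i: "i \<le> Suc q" and "z \<in> simp (cyl K) (Suc q)"
    then obtain x j where z: "z = (x, j)" and x: "x \<in> simp K (Suc q)" and j: "j \<le> Suc (Suc q)" by (elim cyl_simpE)
    let ?w = "h (Suc q) j x"
    consider "j = Suc (Suc q)" | "j \<le> Suc q" "i < j" | "j \<le> Suc q" "j < i" | "j \<le> q" "i = j" | "j = Suc q" "i = j"
      using j by linarith
    then show "H q (face (cyl K) (Suc q) i z) = face L (Suc q) i (H (Suc q) z)"
    proof cases
      case 1
      then show ?thesis using i smap_face[OF g i x] by (simp add: z Hend)
    next
      case 2
      have w: "?w \<in> simp L (Suc (Suc q))" by (rule hc[OF 2(1) x])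
      have "face L (Suc q) i (face L (Suc (Suc q)) j ?w) = face L (Suc q) (j - 1) (face L (Suc (Suc q)) i ?w)"
        by (rule sset_face_face[OF L w 2(2) j])
      also have "face L (Suc (Suc q)) i ?w = h q (j - 1) (face K (Suc q) i x)" using hlt[OF x 2(2,1)] by simp
      finally show ?thesis using 2 by (simp add: z Hle)
    next
      case 3
      have w: "?w \<in> simp L (Suc (Suc q))" by (rule hc[OF 3(1) x])
      have "face L (Suc q) j (face L (Suc (Suc q)) (Suc i) ?w) = face L (Suc q) i (face L (Suc (Suc q)) j ?w)"
        using sset_face_face[OF L w, of j "Suc i"] 3 i by simp
      moreover have "face L (Suc (Suc q)) (Suc i) ?w = h q j (face K (Suc q) i x)"
        using hgt[OF x, of j "Suc i"] 3 i by simp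
      ultimately show ?thesis using 3 i by (simp add: z Hle)
    next
      case 4
      have w: "?w \<in> simp L (Suc (Suc q))" using hc[OF _ x] 4 by simp
      have w': "h (Suc q) (Suc j) x \<in> simp L (Suc (Suc q))" using hc[OF _ x] 4 by simp
      have "face L (Suc q) j (face L (Suc (Suc q)) j ?w) = face L (Suc q) j (face L (Suc (Suc q)) (Suc j) ?w)"
        using sset_face_face[OF L w, of j "Suc j"] 4 by simp
      also have "face L (Suc (Suc q)) (Suc j) ?w = face L (Suc (Suc q)) (Suc j) (h (Suc q) (Suc j) x)"
        using heq[OF x, of j] 4 by simp
      also have "face L (Suc q) j \<dots> = face L (Suc q) j (face L (Suc (Suc q)) j (h (Suc q) (Suc j) x))"
        using sset_face_face[OF L w', of j "Suc j"] 4 by simp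
      also have "face L (Suc (Suc q)) j (h (Suc q) (Suc j) x) = h q j (face K (Suc q) j x)"
        using hlt[OF x, of j "Suc j"] 4 by simp
      finally show ?thesis using 4 by (simp add: z Hle)
    next
      case 5
      have w: "?w \<in> simp L (Suc (Suc q))" using hc[OF _ x] 5 by simp
      have "face L (Suc q) j (face L (Suc (Suc q)) j ?w) = face L (Suc q) j (face L (Suc (Suc q)) (Suc j) ?w)"
        using sset_face_face[OF L w, of j "Suc j"] 5 by simp
      also have "face L (Suc (Suc q)) (Suc j) ?w = g (Suc q) x" using h1[OF x] 5 by simp
      also have "face L (Suc q) j (g (Suc q) x) = g q (face K (Suc q) j x)" using smap_face[OF g _ x, of j] 5 by simp
      finally show ?thesis using 5 by (simp add: z Hle Hend)
    qed
  next
    fix q i z assume i: "i \<le> q" and "z \<in> simp (cyl K) q"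
    then obtain x j where z: "z = (x, j)" and x: "x \<in> simp K q" and j: "j \<le> Suc q" by (elim cyl_simpE)
    let ?w = "h q j x"
    consider "j = Suc q" | "j \<le> q" "i < j" | "j \<le> q" "j \<le> i" using j by linarith
    then show "H (Suc q) (degen (cyl K) q i z) = degen L q i (H q z)"
    proof cases
      case 1
      then show ?thesis using i smap_degen[OF g i x] by (simp add: z Hend)
    next
      case 2
      have "face L (Suc (Suc q)) (Suc j) (degen L (Suc q) i ?w) = degen L q i (face L (Suc q) j ?w)"
        using sset_face_degen_greater[OF L hc[OF 2(1) x], of i "Suc j"] 2 by simp
      moreover have "degen L (Suc q) i ?w = h (Suc q) (Suc j) (degen K q i x)" using sle[OF x, of i j] 2 by simp
      ultimately show ?thesis using 2 by (simp add: z Hle)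
    next
      case 3
      have "face L (Suc (Suc q)) j (degen L (Suc q) (Suc i) ?w) = degen L q i (face L (Suc q) j ?w)"
        using sset_face_degen_less[OF L hc[OF 3(1) x], of j "Suc i"] 3 i by simp
      moreover have "degen L (Suc q) (Suc i) ?w = h (Suc q) j (degen K q i x)" using sgt[OF x, of j "Suc i"] 3 i by simp
      ultimately show ?thesis using 3 by (simp add: z Hle)
    qed
  qed
qed

text \<open>
  The \<open>i\<close>-th simplex of the prism over \<open>x\<close> lies over \<open>s\<^sub>i x\<close> and has \<open>i + 1\<close> vertices at the initial
  vertex of the interval.
\<close>

lemma homotopy_of_cylinder:
  assumes K: "is_sset K" and H: "smap (cyl K) L H"
    and f: "\<And>n x. x \<in> simp K n \<Longrightarrow> H n (x, 0) = f n x" and g: "\<And>n x. x \<in> simp K n \<Longrightarrow> H n (x, Suc n) = g n x"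
  shows "simplicial_homotopy K L f g (\<lambda>q i x. H (Suc q) (degen K q i x, Suc i))"
proof -
  have hc: "(degen K q i x, Suc i) \<in> simp (cyl K) (Suc q)" if "i \<le> q" "x \<in> simp K q" for q i x
    using sset_degen[OF K that] that by simp
  have fh: "face L (Suc q) k (H (Suc q) (degen K q i x, Suc i)) =
      H q (face K (Suc q) k (degen K q i x), if k \<le> i then i else Suc i)"
    if "i \<le> q" "x \<in> simp K q" "k \<le> Suc q" for q i x k
    using smap_face[OF H that(3) hc[OF that(1,2)]] by (cases "k \<le> i") (simp_all add: less_Suc_eq_le)
  have dh: "degen L (Suc q) k (H (Suc q) (degen K q i x, Suc i)) =
      H (Suc (Suc q)) (degen K (Suc q) k (degen K q i x), if k \<le> i then Suc (Suc i) else Suc i)"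
    if "i \<le> q" "x \<in> simp K q" "k \<le> Suc q" for q i x k
    using smap_degen[OF H that(3) hc[OF that(1,2)]] by (cases "k \<le> i") (simp_all add: less_Suc_eq_le)
  show ?thesis
    unfolding simplicial_homotopy_def
  proof (intro conjI allI impI ballI funcsetI)
    show "H (Suc q) (degen K q i x, Suc i) \<in> simp L (Suc q)" if "i \<le> q" "x \<in> simp K q" for q i x
      by (rule smap_closed[OF H hc[OF that]])
  next
    fix q x assume x: "x \<in> simp K q"
    show "face L (Suc q) 0 (H (Suc q) (degen K q 0 x, Suc 0)) = f q x"
      using fh[OF _ x, of 0 0] sset_face_degen_same[OF K x, of 0] f[OF x] by simp
    show "face L (Suc q) (Suc q) (H (Suc q) (degen K q q x, Suc q)) = g q x"
      using fh[OF _ x, of q "Suc q"] sset_face_degen_same[OF K x, of q] g[OF x] by simp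
  next
    fix q x i j assume x: "x \<in> simp K q" and ij: "i < j \<and> j \<le> q"
    then obtain q' where q: "q = Suc q'" by (cases q) auto
    have x': "x \<in> simp K (Suc q')" using x q by simp
    have "face K (Suc q) i (degen K q j x) = degen K q' (j - 1) (face K q i x)"
      using sset_face_degen_less[OF K x', of i j] ij q by simp
    then show "face L (Suc q) i (H (Suc q) (degen K q j x, Suc j)) =
        H (Suc (q - 1)) (degen K (q - 1) (j - 1) (face K q i x), Suc (j - 1))"
      using fh[OF _ x, of j i] ij q by simp
  next
    fix q x j assume x: "x \<in> simp K q" and j: "j < q"
    show "face L (Suc q) (Suc j) (H (Suc q) (degen K q (Suc j) x, Suc (Suc j))) =
        face L (Suc q) (Suc j) (H (Suc q) (degen K q j x, Suc j))"
      using fh[OF _ x, of "Suc j" "Suc j"] fh[OF _ x, of j "Suc j"] j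
        sset_face_degen_same(1)[OF K x, of "Suc j"] sset_face_degen_same(2)[OF K x, of j] by simp
  next
    fix q x i j assume x: "x \<in> simp K q" and ij: "Suc j < i \<and> i \<le> Suc q"
    then obtain q' where q: "q = Suc q'" by (cases q) auto
    have x': "x \<in> simp K (Suc q')" using x q by simp
    have "face K (Suc q) i (degen K q j x) = degen K q' j (face K q (i - 1) x)"
      using sset_face_degen_greater[OF K x', of j i] ij q by simp
    then show "face L (Suc q) i (H (Suc q) (degen K q j x, Suc j)) =
        H (Suc (q - 1)) (degen K (q - 1) j (face K q (i - 1) x), Suc j)"
      using fh[OF _ x, of j i] ij q by simp
  next
    fix q x i j assume x: "x \<in> simp K q" and ij: "i \<le> j \<and> j \<le> q"
    show "degen L (Suc q) i (H (Suc q) (degen K q j x, Suc j)) =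
        H (Suc (Suc q)) (degen K (Suc q) (Suc j) (degen K q i x), Suc (Suc j))"
      using dh[OF _ x, of j i] sset_degen_degen[OF K x, of i j] ij by simp
  next
    fix q x i j assume x: "x \<in> simp K q" and ij: "j < i \<and> i \<le> Suc q"
    have "degen K (Suc q) i (degen K q j x) = degen K (Suc q) j (degen K q (i - 1) x)"
    proof -
      have "j \<le> i - 1" "i - 1 \<le> q" "Suc (i - 1) = i" using ij by auto
      then show ?thesis using sset_degen_degen[OF K x, of j "i - 1"] by simp
    qed
    then show "degen L (Suc q) i (H (Suc q) (degen K q j x, Suc j)) =
        H (Suc (Suc q)) (degen K (Suc q) j (degen K q (i - 1) x), Suc j)"
      using dh[OF _ x, of j i] ij by simp
  qed
qed

lemma smap_restrict:
  assumes K: "is_sset K" and F: "smap K L F"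
  shows "(\<lambda>n. restrict (F n) (simp K n)) \<in> smaps K L"
  unfolding smaps_def
  using smap_closed[OF F] smap_face[OF F] smap_degen[OF F] sset_face[OF K] sset_degen[OF K] by auto

lemma smap_end:
  assumes "smap (cyl K) L H" shows "smap K L (\<lambda>n x. H n (x, Suc n))"
  unfolding smap_def
proof (intro conjI allI impI ballI funcsetI)
  show "H n (x, Suc n) \<in> simp L n" if "x \<in> simp K n" for n x
    using smap_closed[OF assms, of "(x, Suc n)" n] that by simp
  show "H n (face K (Suc n) i x, Suc n) = face L (Suc n) i (H (Suc n) (x, Suc (Suc n)))"
    if "i \<le> Suc n" "x \<in> simp K (Suc n)" for n i x
    using smap_face[OF assms that(1), of "(x, Suc (Suc n))"] that by simp
  show "H (Suc n) (degen K n i x, Suc (Suc n)) = degen L n i (H n (x, Suc n))"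
    if "i \<le> n" "x \<in> simp K n" for n i x
    using smap_degen[OF assms that(1), of "(x, Suc n)"] that by simp
qed

section \<open>Comparison of homotopy classes\<close>

locale special_target = num_space X for X :: "'a snum" +
  fixes x :: "nat \<Rightarrow> 'a" and Y :: "'b snum" and y :: "nat \<Rightarrow> 'b"
  assumes bx: "base_point (forget X) x" and bY: "base_point (forget Y) y"
    and special: "special_numerical_space Y y"
begin

lemma snY: "is_snum Y"
  using special by (simp add: special_numerical_space_def fibred_numerical_space_def)

lemma LS: "is_sset (forget Y)" by (rule snum_sset[OF snY])

lemma regular_extension:
  assumes K: "is_sset Q" and R: "function_system Q R" and L: "subcomplex Q L" and ac: "acyclic_pair Q L R"
    and g: "smap_on Q L Y g"
    and g_reg: "\<And>n N. null_cochain Y n N \<Longrightarrow> (\<lambda>z. of_int (if z \<in> L n then N (g n z) else 0)) \<in> R n"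
  shows "\<exists>F. regular_map Q R Y F \<and> (\<forall>n. \<forall>z\<in>L n. F n z = g n z)"
proof -
  obtain T p C d where fib: "fibred_structure Y T p C d"
    and conc: "\<forall>n. \<exists>h i. 1 \<le> h \<and> (\<forall>k. k \<noteq> h \<longrightarrow> trivial_group (chain_homology (C n) (d n) k)) \<and>
           chain_homology (C n) (d n) h \<cong> pi_quotient (forget Y) y h i"
    using special unfolding special_numerical_space_def by (elim conjE exE)
  have exact: "\<exists>h. \<forall>q\<ge>h. trivial_group (chain_homology (C n) (d n) (Suc q))" for n
  proof -
    obtain h where "\<forall>k. k \<noteq> h \<longrightarrow> trivial_group (chain_homology (C n) (d n) k)" using conc by blast
    then show ?thesis by (intro exI[of _ h]) simp
  qed
  show ?thesis by (rule fibred_extension[OF K R L ac snY fib exact g]) (rule g_reg)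
qed

lemma null_at_base: "null_cochain Y n N \<Longrightarrow> N (y n) = 0"
  using base_point_mem[OF bY] base_point_degen[OF bY] by (cases n) (simp_all add: null_cochain_def)

lemma y_mem: "y n \<in> carrier (obj Y n)" using base_point_mem[OF bY] by simp
lemma x_mem: "x n \<in> carrier (obj X n)" using base_point_mem[OF bx] by simp

lemma y_face: "i \<le> Suc n \<Longrightarrow> nface Y (Suc n) i (y (Suc n)) = y n"
  and y_degen: "i \<le> n \<Longrightarrow> ndegen Y n i (y n) = y (Suc n)"
  and x_face: "i \<le> Suc n \<Longrightarrow> nface X (Suc n) i (x (Suc n)) = x n"
  and x_degen: "i \<le> n \<Longrightarrow> ndegen X n i (x n) = x (Suc n)"
  using bx bY by (simp_all add: base_point_def)

abbreviation A where "A \<equiv> numfuns X"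

lemmas A_system = numfuns_system[OF snX]
lemmas base_sub = base_point_subcomplex[OF bx]
lemmas base_comparable = numerical_space_comparable[OF num bx]

abbreviation S where "S \<equiv> based_smaps (forget X) x (forget Y) y"
abbreviation NM where "NM \<equiv> based_nmaps X x Y y"
abbreviation hom_s where "hom_s \<equiv> based_homotopic (forget X) x (forget Y) y"
abbreviation hom_n where "hom_n \<equiv> based_num_homotopic X x Y y"

lemma S_smap: "f \<in> S \<Longrightarrow> smap K (forget Y) f" and S_base: "f \<in> S \<Longrightarrow> f n (x n) = y n"
  by (simp_all add: based_smaps_def smaps_smap)

lemma NM_S: "f \<in> NM \<Longrightarrow> f \<in> S"
  by (simp add: based_nmaps_def based_smaps_def nmaps_def)

lemma NM_numerical: "f \<in> NM \<Longrightarrow> numerical (obj X n) (obj Y n) (f n)"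
  by (simp add: based_nmaps_def nmaps_def)

lemma NM_I: "f \<in> S \<Longrightarrow> (\<And>n. numerical (obj X n) (obj Y n) (f n)) \<Longrightarrow> f \<in> NM"
  by (simp add: based_nmaps_def based_smaps_def nmaps_def)

lemma null_numerical:
  assumes "null_cochain Y n N" "numerical (obj X n) (obj Y n) f"
  shows "(\<lambda>z. of_int (N (f z))) \<in> A n"
proof -
  have "numerical (obj Y n) integer_group N" using assms(1) by (simp add: null_cochain_def)
  from numerical_comp[OF assms(2) this snum_free[OF snX] snum_free[OF snY] fg_free_integer_group]
  show ?thesis by (simp add: numerical_integer_iff[OF snum_free[OF snX]])
qed

lemma homotopic_cylinder:
  assumes "hom_s f g"
  shows "\<exists>H. smap (cyl K) (forget Y) H \<and> (\<forall>n. \<forall>z\<in>carrier (obj X n). H n (z, 0) = f n z \<and> H n (z, Suc n) = g n z) \<and>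
     (\<forall>n j. j \<le> Suc n \<longrightarrow> H n (x n, j) = y n)"
proof -
  obtain h where f: "f \<in> S" and g: "g \<in> S" and h: "simplicial_homotopy K (forget Y) f g h"
    and hb: "\<forall>q. \<forall>i\<le>q. h q i (x q) = y (Suc q)"
    using assms unfolding based_homotopic_def by blast
  let ?H = "\<lambda>n (z, j). if j \<le> n then face (forget Y) (Suc n) j (h n j z) else g n z"
  note H = cylinder_of_homotopy[OF KS LS S_smap[OF f] S_smap[OF g] h]
  have "?H n (x n, j) = y n" if "j \<le> Suc n" for n j
    using that hb S_base[OF g] y_face[of j n] by simp
  then show ?thesis using H by (intro exI[of _ ?H]) simp
qed

lemma cylinder_homotopic:
  assumes f: "f \<in> S" and g: "g \<in> S" and H: "smap (cyl K) (forget Y) H"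
    and e: "\<And>n z. z \<in> carrier (obj X n) \<Longrightarrow> H n (z, 0) = f n z" "\<And>n z. z \<in> carrier (obj X n) \<Longrightarrow> H n (z, Suc n) = g n z"
    and b: "\<And>n j. j \<le> Suc n \<Longrightarrow> H n (x n, j) = y n"
  shows "hom_s f g"
proof -
  have "simplicial_homotopy K (forget Y) f g (\<lambda>q i z. H (Suc q) (degen K q i z, Suc i))"
    by (rule homotopy_of_cylinder[OF KS H]) (simp_all add: e)
  moreover have "H (Suc q) (degen K q i (x q), Suc i) = y (Suc q)" if "i \<le> q" for q i
    using b[of "Suc i" "Suc q"] that by (simp add: x_degen)
  ultimately show ?thesis unfolding based_homotopic_def using f g
    by (intro conjI exI[of _ "\<lambda>q i z. H (Suc q) (degen K q i z, Suc i)"]) simp_all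
qed

lemma homotopic_refl: "f \<in> S \<Longrightarrow> hom_s f f"
proof -
  assume f: "f \<in> S"
  have "smap (cyl K) (forget Y) (\<lambda>n z. f n (fst z))"
    unfolding smap_def using smap_closed[OF S_smap[OF f]] smap_face[OF S_smap[OF f]] smap_degen[OF S_smap[OF f]]
    by (auto elim!: cyl_simpE)
  then show ?thesis by (rule cylinder_homotopic[OF f f]) (simp_all add: S_base[OF f])
qed

text \<open>
  On the near end the map to be extended is \<open>f\<close>, so nothing has to be regular there; at the far end
  it is prescribed only at the base point, where null cochains vanish.
\<close>

lemma numerical_approximation:
  assumes f: "f \<in> S"
  shows "\<exists>f'\<in>NM. hom_s f f'"
proof -
  let ?Q = "cyl K" and ?L = "cyl_start K (\<lambda>n. {x n})" and ?R = "end_regular A"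
  define g where "g n z = (if snd z = 0 then f n (fst z) else y n)" for n and z :: "'a \<times> nat"
  have g0: "g n (z, 0) = f n z" for n z by (simp add: g_def)
  have gb: "g n (x n, j) = y n" for n j by (simp add: g_def S_base[OF f])
  have gL: "\<exists>z j. w = (z, j) \<and> z \<in> carrier (obj X n) \<and> j \<le> Suc n \<and> (j = 0 \<or> z = x n)" if "w \<in> ?L n" for n w
    using that by (auto simp: cyl_start_def)
  have g: "smap_on ?Q ?L Y g"
    unfolding smap_on_def
  proof (intro conjI allI impI ballI)
    fix n w assume "w \<in> ?L n"
    then obtain z j where "w = (z, j)" "z \<in> carrier (obj X n)" "j = 0 \<or> z = x n" using gL by blast
    then show "g n w \<in> carrier (obj Y n)"
      using smap_closed[OF S_smap[OF f], of z n] y_mem by (auto simp: g0 gb)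
  next
    fix n i w assume i: "i \<le> Suc n" and "w \<in> ?L (Suc n)"
    then obtain z j where "w = (z, j)" "z \<in> carrier (obj X (Suc n))" "j = 0 \<or> z = x (Suc n)" using gL by blast
    then show "g n (face ?Q (Suc n) i w) = nface Y (Suc n) i (g (Suc n) w)"
      using smap_face[OF S_smap[OF f] i, of z] i by (auto simp: g0 gb x_face y_face)
  next
    fix n i w assume i: "i \<le> n" and "w \<in> ?L n"
    then obtain z j where "w = (z, j)" "z \<in> carrier (obj X n)" "j = 0 \<or> z = x n" using gL by blast
    then show "g (Suc n) (degen ?Q n i w) = ndegen Y n i (g n w)"
      using smap_degen[OF S_smap[OF f] i, of z] i by (auto simp: g0 gb x_degen y_degen)
  qed
  have reg: "(\<lambda>w. of_int (if w \<in> ?L n then N (g n w) else 0)) \<in> ?R n" if N: "null_cochain Y n N" for n N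
  proof -
    have "(\<lambda>z. of_int (if (z, Suc n) \<in> ?L n then N (g n (z, Suc n)) else 0)) = (\<lambda>z. 0 :: rat)"
      using null_at_base[OF N] by (auto simp: fun_eq_iff cyl_start_def gb)
    then show ?thesis
      using rat_algebra_const[OF rat_algebra_polyfuns, of 0 "obj X n"] by (simp only: end_regular_def mem_Collect_eq)
  qed
  obtain F where F: "regular_map ?Q ?R Y F" and FL: "\<forall>n. \<forall>w\<in>?L n. F n w = g n w"
    using regular_extension[OF cyl_sset[OF KS] end_regular_system[OF A_system] cyl_start_subcomplex[OF KS base_sub]
        cylinder_acyclic[OF KS base_sub A_system base_comparable] g reg] by blast
  have Fm: "smap ?Q (forget Y) F" and Fr: "regular (simp ?Q n) (?R n) (obj Y n) (F n)" for n
    using F by (simp_all add: regular_map_def)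
  have F0: "F n (z, 0) = f n z" if "z \<in> carrier (obj X n)" for n z
    using bspec[OF spec[OF FL], of "(z, 0)" n] that by (simp add: cyl_start_def g0)
  have Fb: "F n (x n, j) = y n" if "j \<le> Suc n" for n j
    using bspec[OF spec[OF FL], of "(x n, j)" n] that x_mem by (simp add: cyl_start_def gb)
  define f' where "f' n = restrict (\<lambda>z. F n (z, Suc n)) (carrier (obj X n))" for n
  have "(\<lambda>n. restrict (\<lambda>z. F n (z, Suc n)) (simp K n)) \<in> smaps K (forget Y)"
    by (rule smap_restrict[OF KS smap_end[OF Fm]])
  then have f'S: "f' \<in> S" using Fb x_mem by (simp add: based_smaps_def f'_def[abs_def])
  have "numerical (obj X n) (obj Y n) (f' n)" for n
  proof (rule regular_numerical[OF snum_free[OF snX] snum_free[OF snY]])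
    have "regular (carrier (obj X n)) (A n) (obj Y n) (\<lambda>z. F n (z, Suc n))"
      by (rule regular_pullback[OF Fr]) (auto simp: end_regular_def)
    then show "regular (carrier (obj X n)) (A n) (obj Y n) (f' n)"
      by (rule regular_cong[OF rat_algebra_polyfuns]) (simp add: f'_def)
  qed
  then have "f' \<in> NM" by (rule NM_I[OF f'S])
  moreover have "hom_s f f'"
    by (rule cylinder_homotopic[OF f f'S Fm]) (simp_all add: F0 Fb f'_def)
  ultimately show ?thesis by blast
qed

text \<open>
  The bottom of the square is the given homotopy, its sides are the homotopies to the numerical
  maps, and the extension is numerical on the top.
\<close>

lemma numerical_square:
  assumes fg: "hom_s f0 f1" and ff: "hom_s f0 g0" and gg: "hom_s f1 g1" and num0: "g0 \<in> NM" and num1: "g1 \<in> NM"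
  shows "hom_n g0 g1"
proof -
  obtain H where H: "smap (cyl K) (forget Y) H"
    and He: "\<forall>n. \<forall>z\<in>carrier (obj X n). H n (z, 0) = f0 n z \<and> H n (z, Suc n) = f1 n z"
    and Hb: "\<forall>n j. j \<le> Suc n \<longrightarrow> H n (x n, j) = y n"
    using homotopic_cylinder[OF fg] by (elim exE conjE)
  obtain U where U: "smap (cyl K) (forget Y) U"
    and Ue: "\<forall>n. \<forall>z\<in>carrier (obj X n). U n (z, 0) = f0 n z \<and> U n (z, Suc n) = g0 n z"
    and Ub: "\<forall>n j. j \<le> Suc n \<longrightarrow> U n (x n, j) = y n"
    using homotopic_cylinder[OF ff] by (elim exE conjE)
  obtain V where V: "smap (cyl K) (forget Y) V"
    and Ve: "\<forall>n. \<forall>z\<in>carrier (obj X n). V n (z, 0) = f1 n z \<and> V n (z, Suc n) = g1 n z"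
    and Vb: "\<forall>n j. j \<le> Suc n \<longrightarrow> V n (x n, j) = y n"
    using homotopic_cylinder[OF gg] by (elim exE conjE)
  let ?W = "cyl K" and ?E = "cyl_ends K (\<lambda>n. {x n})"
  let ?Q = "cyl ?W" and ?L = "cyl_start ?W ?E" and ?R = "end_regular (slices_regular A)"
  define g where "g n w = (case w of ((z, s), t) \<Rightarrow>
      if t = 0 then H n (z, s) else if s = 0 then U n (z, t) else if s = Suc n then V n (z, t) else y n)"
    for n and w :: "('a \<times> nat) \<times> nat"
  have gH: "g n ((z, s), 0) = H n (z, s)" for n z s by (simp add: g_def)
  have gU: "g n ((z, 0), t) = U n (z, t)" if "z \<in> carrier (obj X n)" for n z t
    using that He Ue by (simp add: g_def)
  have gV: "g n ((z, Suc n), t) = V n (z, t)" if "z \<in> carrier (obj X n)" for n z t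
    using that He Ve by (simp add: g_def)
  have gy: "g n ((x n, s), t) = y n" if "s \<le> Suc n" "t \<le> Suc n" for n s t
    using that Hb Ub Vb by (simp add: g_def)
  have gL: "\<exists>z s t. w = ((z, s), t) \<and> z \<in> carrier (obj X n) \<and> s \<le> Suc n \<and> t \<le> Suc n \<and>
      (t = 0 \<or> s = 0 \<or> s = Suc n \<or> z = x n)" if "w \<in> ?L n" for n w
    using that by (auto simp: cyl_start_def cyl_ends_def)
  have Xf: "nface X (Suc n) i z \<in> carrier (obj X n)" if "i \<le> Suc n" "z \<in> carrier (obj X (Suc n))" for n i z
    by (rule snum_face[OF snX that])
  have Xd: "ndegen X n i z \<in> carrier (obj X (Suc n))" if "i \<le> n" "z \<in> carrier (obj X n)" for n i z
    by (rule snum_degen[OF snX that])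
  have g: "smap_on ?Q ?L Y g"
    unfolding smap_on_def
  proof (intro conjI allI impI ballI)
    fix n w assume "w \<in> ?L n"
    then obtain z s t where w: "w = ((z, s), t)" and z: "z \<in> carrier (obj X n)" and st: "s \<le> Suc n" "t \<le> Suc n"
      and c: "t = 0 \<or> s = 0 \<or> s = Suc n \<or> z = x n" using gL by blast
    from c show "g n w \<in> carrier (obj Y n)"
    proof (elim disjE)
      assume "t = 0" then show ?thesis using smap_closed[OF H, of "(z, s)" n] z st by (simp add: w gH)
    next
      assume "s = 0" then show ?thesis using smap_closed[OF U, of "(z, t)" n] z st by (simp add: w gU)
    next
      assume "s = Suc n" then show ?thesis using smap_closed[OF V, of "(z, t)" n] z st by (simp add: w gV)
    next
      assume "z = x n" then show ?thesis using y_mem st by (simp add: w gy)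
    qed
  next
    fix n i w assume i: "i \<le> Suc n" and "w \<in> ?L (Suc n)"
    then obtain z s t where w: "w = ((z, s), t)" and z: "z \<in> carrier (obj X (Suc n))"
      and st: "s \<le> Suc (Suc n)" "t \<le> Suc (Suc n)"
      and c: "t = 0 \<or> s = 0 \<or> s = Suc (Suc n) \<or> z = x (Suc n)" using gL by blast
    have st': "(if i < s then s - 1 else s) \<le> Suc n" "(if i < t then t - 1 else t) \<le> Suc n" using st i by auto
    from c show "g n (face ?Q (Suc n) i w) = nface Y (Suc n) i (g (Suc n) w)"
    proof (elim disjE)
      assume "t = 0" then show ?thesis using smap_face[OF H i, of "(z, s)"] z st by (simp add: w gH)
    next
      assume "s = 0" then show ?thesis using smap_face[OF U i, of "(z, t)"] z st by (simp add: w gU Xf[OF i z])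
    next
      assume "s = Suc (Suc n)"
      then show ?thesis using smap_face[OF V i, of "(z, t)"] z st i by (simp add: w gV Xf[OF i z])
    next
      assume "z = x (Suc n)" then show ?thesis using st st' i by (simp add: w gy x_face y_face del: if_split)
    qed
  next
    fix n i w assume i: "i \<le> n" and "w \<in> ?L n"
    then obtain z s t where w: "w = ((z, s), t)" and z: "z \<in> carrier (obj X n)" and st: "s \<le> Suc n" "t \<le> Suc n"
      and c: "t = 0 \<or> s = 0 \<or> s = Suc n \<or> z = x n" using gL by blast
    have st': "(if i < s then Suc s else s) \<le> Suc (Suc n)" "(if i < t then Suc t else t) \<le> Suc (Suc n)" using st by auto
    from c show "g (Suc n) (degen ?Q n i w) = ndegen Y n i (g n w)"
    proof (elim disjE)
      assume "t = 0" then show ?thesis using smap_degen[OF H i, of "(z, s)"] z st by (simp add: w gH)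
    next
      assume "s = 0" then show ?thesis using smap_degen[OF U i, of "(z, t)"] z st by (simp add: w gU Xd[OF i z])
    next
      assume "s = Suc n"
      then show ?thesis using smap_degen[OF V i, of "(z, t)"] z st i by (simp add: w gV Xd[OF i z])
    next
      assume "z = x n" then show ?thesis using st st' i by (simp add: w gy x_degen y_degen del: if_split)
    qed
  qed
  have reg: "(\<lambda>w. of_int (if w \<in> ?L n then N (g n w) else 0)) \<in> ?R n" if N: "null_cochain Y n N" for n N
    unfolding end_regular_def slices_regular_def mem_Collect_eq
  proof (intro allI impI)
    fix s assume s: "s \<le> Suc n"
    note alg = rat_algebra_polyfuns[of "obj X n"]
    let ?F = "\<lambda>z. of_int (if ((z, s), Suc n) \<in> ?L n then N (g n ((z, s), Suc n)) else 0) :: rat"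
    have mem: "((z, s), Suc n) \<in> ?L n \<longleftrightarrow> z \<in> carrier (obj X n) \<and> (s = 0 \<or> s = Suc n \<or> z = x n)" for z
      using s by (auto simp: cyl_start_def cyl_ends_def)
    consider "s = 0" | "s = Suc n" | "s \<noteq> 0" "s \<noteq> Suc n" by blast
    then show "?F \<in> A n"
    proof cases
      case 1
      show ?thesis
        by (rule rat_algebra_cong[OF alg null_numerical[OF N NM_numerical[OF num0]]]) (use Ue in \<open>simp add: mem[unfolded 1] gU 1\<close>)
    next
      case 2
      show ?thesis
        by (rule rat_algebra_cong[OF alg null_numerical[OF N NM_numerical[OF num1]]]) (use Ve in \<open>simp add: mem[unfolded 2] gV 2\<close>)
    next
      case 3
      show ?thesis
        by (rule rat_algebra_cong[OF alg rat_algebra_const[OF alg, of 0]])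
          (use 3 s null_at_base[OF N] in \<open>simp add: mem gy\<close>)
    qed
  qed
  note WS = cyl_sset[OF KS] and W0 = cyl_ends_subcomplex[OF KS base_sub] and WR = slices_regular_system[OF A_system]
  obtain F where F: "regular_map ?Q ?R Y F" and FL: "\<forall>n. \<forall>w\<in>?L n. F n w = g n w"
    using regular_extension[OF cyl_sset[OF WS] end_regular_system[OF WR] cyl_start_subcomplex[OF WS W0]
        cylinder_acyclic[OF WS W0 WR cylinder_comparable[OF KS base_sub A_system base_comparable]] g reg] by blast
  have Fm: "smap ?Q (forget Y) F" and Fr: "regular (simp ?Q n) (?R n) (obj Y n) (F n)" for n
    using F by (simp_all add: regular_map_def)
  let ?G = "\<lambda>n w. F n (w, Suc n)"
  have G: "smap ?W (forget Y) ?G" by (rule smap_end[OF Fm])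
  have G0: "?G n (z, 0) = g0 n z" and G1: "?G n (z, Suc n) = g1 n z" if "z \<in> carrier (obj X n)" for n z
    using bspec[OF spec[OF FL], of "((z, 0), Suc n)" n] bspec[OF spec[OF FL], of "((z, Suc n), Suc n)" n] that Ue Ve
    by (simp_all add: cyl_start_def cyl_ends_def gU gV)
  have Gb: "?G n (x n, j) = y n" if "j \<le> Suc n" for n j
    using bspec[OF spec[OF FL], of "((x n, j), Suc n)" n] that x_mem by (simp add: cyl_start_def cyl_ends_def gy)
  have Gn: "numerical (obj X n) (obj Y n) (\<lambda>z. ?G n (z, j))" if j: "j \<le> Suc n" for n j
  proof (rule regular_numerical[OF snum_free[OF snX] snum_free[OF snY]])
    show "regular (carrier (obj X n)) (A n) (obj Y n) (\<lambda>z. ?G n (z, j))"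
      by (rule regular_pullback[OF Fr]) (use j in \<open>auto simp: end_regular_def slices_regular_def\<close>)
  qed
  let ?h = "\<lambda>q i z. ?G (Suc q) (degen K q i z, Suc i)"
  have "simplicial_homotopy K (forget Y) g0 g1 ?h"
    by (rule homotopy_of_cylinder[OF KS G]) (simp_all add: G0 G1)
  moreover have "numerical (obj X q) (obj Y (Suc q)) (?h q i)" if "i \<le> q" for q i
    using numerical_comp[OF snum_degen_numerical[OF snX that] Gn[of "Suc i" "Suc q"]
        snum_free[OF snX] snum_free[OF snX] snum_free[OF snY]] that by simp
  moreover have "?h q i (x q) = y (Suc q)" if "i \<le> q" for q i
    using Gb[of "Suc i" "Suc q"] that by (simp add: x_degen)
  ultimately show ?thesis
    unfolding based_num_homotopic_def using num0 num1 by (intro conjI exI[of _ ?h]) simp_all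
qed

lemma numerical_homotopic_homotopic: "hom_n f g \<Longrightarrow> hom_s f g"
  unfolding based_num_homotopic_def based_homotopic_def using NM_S by blast

lemma equivclp_forget: "equivclp hom_n f g \<Longrightarrow> equivclp hom_s f g"
proof (induction rule: equivclp_induct)
  case (step g k)
  then show ?case
    using numerical_homotopic_homotopic[of g k] numerical_homotopic_homotopic[of k g]
      equivclp_into_equivclp[of hom_s f g k] by blast
qed simp

text \<open>
  Along a chain of homotopies every member is replaced by a numerical map homotopic to it, the two
  ends being left as they are.
\<close>

lemma equivclp_reflect:
  assumes "equivclp hom_s f g" and f: "f \<in> NM"
  shows "\<forall>g'\<in>NM. hom_s g g' \<longrightarrow> equivclp hom_n f g'"
  using assms(1)
proof (induction rule: equivclp_induct)
  case base
  then show ?case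
    using numerical_square[OF homotopic_refl[OF NM_S[OF f]] homotopic_refl[OF NM_S[OF f]] _ f] by blast
next
  case (step g k)
  have "g \<in> S" using step.hyps(2) by (auto simp: based_homotopic_def)
  then obtain g' where g': "g' \<in> NM" "hom_s g g'" using numerical_approximation by blast
  then have fg': "equivclp hom_n f g'" using step.IH by blast
  show ?case
  proof (intro ballI impI)
    fix k' assume k': "k' \<in> NM" "hom_s k k'"
    from step.hyps(2) have "hom_n g' k' \<or> hom_n k' g'"
    proof
      assume "hom_s g k" then show ?thesis using numerical_square[OF _ g'(2) k'(2) g'(1) k'(1)] by blast
    next
      assume "hom_s k g" then show ?thesis using numerical_square[OF _ k'(2) g'(2) k'(1) g'(1)] by blast
    qed
    then show "equivclp hom_n f k'" by (rule equivclp_into_equivclp[OF fg'])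
  qed
qed

abbreviation Rs where "Rs \<equiv> htpy_rel (forget X) x (forget Y) y"
abbreviation Rn where "Rn \<equiv> num_htpy_rel X x Y y"

lemma Rs_equiv: "equiv S Rs"
  by (rule equivI)
    (auto simp: htpy_rel_def refl_on_def sym_def trans_def intro: equivclp_sym equivclp_trans)

lemma Rn_equiv: "equiv NM Rn"
  by (rule equivI)
    (auto simp: num_htpy_rel_def refl_on_def sym_def trans_def intro: equivclp_sym equivclp_trans)

lemma Rn_iff: "f \<in> NM \<Longrightarrow> g \<in> NM \<Longrightarrow> (f, g) \<in> Rn \<longleftrightarrow> (f, g) \<in> Rs"
proof
  assume f: "f \<in> NM" and g: "g \<in> NM" and "(f, g) \<in> Rs"
  then have "equivclp hom_s f g" by (simp add: htpy_rel_def)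
  from equivclp_reflect[OF this f] have "equivclp hom_n f g" using g homotopic_refl[OF NM_S[OF g]] by blast
  then show "(f, g) \<in> Rn" using f g by (simp add: num_htpy_rel_def)
qed (simp add: num_htpy_rel_def htpy_rel_def NM_S equivclp_forget)

text \<open>
  The class of a numerical map may be computed from any representative, since numerically homotopic
  maps are homotopic.
\<close>

lemma class_image:
  assumes f: "f \<in> NM"
  shows "Rs `` (forget_map ` (Rn `` {f})) = Rs `` {f}"
proof
  have *: "Rs `` {g} = Rs `` {f}" if "(f, g) \<in> Rn" for g
  proof -
    have "g \<in> NM" using that by (simp add: num_htpy_rel_def)
    then have "(f, g) \<in> Rs" using that Rn_iff[OF f] by simp
    then show ?thesis using equiv_class_eq[OF Rs_equiv] by blast
  qed
  show "Rs `` (forget_map ` (Rn `` {f})) \<subseteq> Rs `` {f}"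
  proof
    fix k assume "k \<in> Rs `` (forget_map ` (Rn `` {f}))"
    then obtain g where "(f, g) \<in> Rn" "(g, k) \<in> Rs" by (auto simp: forget_map_def)
    then show "k \<in> Rs `` {f}" using *[of g] by auto
  qed
  have "f \<in> Rn `` {f}" using f by (simp add: num_htpy_rel_def)
  then show "Rs `` {f} \<subseteq> Rs `` (forget_map ` (Rn `` {f}))" by (auto simp: forget_map_def)
qed

lemma classes_bijective:
  "bij_betw (\<lambda>c. Rs `` (forget_map ` c)) (NM // Rn) (S // Rs)"
proof (rule bij_betw_imageI)
  show "inj_on (\<lambda>c. Rs `` (forget_map ` c)) (NM // Rn)"
  proof (rule inj_onI)
    fix c c' assume c: "c \<in> NM // Rn" and c': "c' \<in> NM // Rn"
      and eq: "Rs `` (forget_map ` c) = Rs `` (forget_map ` c')"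
    obtain f where f: "f \<in> NM" "c = Rn `` {f}" using c by (rule quotientE)
    obtain g where g: "g \<in> NM" "c' = Rn `` {g}" using c' by (rule quotientE)
    have "Rs `` {f} = Rs `` {g}" using eq class_image[OF f(1)] class_image[OF g(1)] by (simp add: f(2) g(2))
    then have "(f, g) \<in> Rs" using eq_equiv_class[OF _ Rs_equiv NM_S[OF g(1)]] by blast
    then have "(f, g) \<in> Rn" using Rn_iff[OF f(1) g(1)] by simp
    then show "c = c'" unfolding f(2) g(2) by (rule equiv_class_eq[OF Rn_equiv])
  qed
  show "(\<lambda>c. Rs `` (forget_map ` c)) ` (NM // Rn) = S // Rs"
  proof
    show "(\<lambda>c. Rs `` (forget_map ` c)) ` (NM // Rn) \<subseteq> S // Rs"
    proof
      fix D assume "D \<in> (\<lambda>c. Rs `` (forget_map ` c)) ` (NM // Rn)"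
      then obtain c where c: "c \<in> NM // Rn" "D = Rs `` (forget_map ` c)" by blast
      obtain f where f: "f \<in> NM" "c = Rn `` {f}" using c(1) by (rule quotientE)
      show "D \<in> S // Rs" unfolding c(2) f(2) class_image[OF f(1)] by (rule quotientI[OF NM_S[OF f(1)]])
    qed
    show "S // Rs \<subseteq> (\<lambda>c. Rs `` (forget_map ` c)) ` (NM // Rn)"
    proof
      fix D assume "D \<in> S // Rs"
      then obtain k where k: "k \<in> S" "D = Rs `` {k}" by (rule quotientE)
      obtain f where f: "f \<in> NM" "hom_s k f" using numerical_approximation[OF k(1)] by blast
      have "(k, f) \<in> Rs" using k(1) NM_S[OF f(1)] f(2) by (auto simp: htpy_rel_def)
      then have "D = Rs `` {f}" unfolding k(2) by (rule equiv_class_eq[OF Rs_equiv])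
      also have "\<dots> = Rs `` (forget_map ` (Rn `` {f}))" using class_image[OF f(1)] by simp
      finally show "D \<in> (\<lambda>c. Rs `` (forget_map ` c)) ` (NM // Rn)" using quotientI[OF f(1), of Rn] by blast
    qed
  qed
qed

end

theorem lemma2p6:
  fixes X :: "'a snum" and Y :: "'b snum"
    and x :: "nat \<Rightarrow> 'a" and y :: "nat \<Rightarrow> 'b"
  assumes "numerical_space X" and "base_point (forget X) x"
    and "base_point (forget Y) y" and "special_numerical_space Y y"
  shows "(\<forall>(f, g) \<in> num_htpy_rel X x Y y.
            (forget_map f, forget_map g) \<in> htpy_rel (forget X) x (forget Y) y) \<and>
         bij_betw (\<lambda>c. htpy_rel (forget X) x (forget Y) y `` (forget_map ` c))
           (based_nmaps X x Y y // num_htpy_rel X x Y y)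
           (based_smaps (forget X) x (forget Y) y // htpy_rel (forget X) x (forget Y) y)"
proof -
  interpret special_target X x Y y using assms by unfold_locales
  have "(forget_map f, forget_map g) \<in> Rs" if "(f, g) \<in> Rn" for f g
  proof -
    have "f \<in> NM" "g \<in> NM" using that by (simp_all add: num_htpy_rel_def)
    then show ?thesis using Rn_iff that by (simp add: forget_map_def)
  qed
  then show ?thesis using classes_bijective by auto
qed

end
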